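(* Let $C$ be the plane curve $F(X,Y,Z)=0$ in $\mathbb{P}^2$ over $\mathbb{C}$, with $$F(X,Y,Z)=X(Y^5+Z^5)+(XYZ)^2-X^4YZ-2(YZ)^3,$$ and affine coordinates $(x,y)=(X/Z,Y/Z)$. The map $$U:(x,y)\mapsto\left(-\frac{y^5+x^3y-3xy^2+1}{(y-x^2)(y^3-x)},\ -\frac{y^2x-1}{y^3-x}\right)$$ is an automorphism of $C$ (i.e. a birational self-map of $C$, equivalently an automorphism of its smooth model), and $U$ together with the collineations $R$ and $S$ (defined in the context) generates the entire automorphism group, which is isomorphic to $S_5$.
   Context: The curve $C$ is the Hulek-Craig (HC) plane model of Bring's curve, the smooth genus-$4$ curve $\mathcal{B}=\{\sum x_i=\sum x_i^2=\sum x_i^3=0\}\subset\mathbb{P}^4$, whose automorphism group is $\mathrm{Aut}(\mathcal{B})\cong S_5$. Let $\zeta=\exp(2\pi i/5)$. $R$ and $S$ act on $C$ by left multiplication on $(X,Y,Z)^T$ by $$R=\frac1{\sqrt5}\begin{pmatrix}1&2&2\\1&\zeta^2+\zeta^{-2}&\zeta+\zeta^{-1}\\1&\zeta+\zeta^{-1}&\zeta^2+\zeta^{-2}\end{pmatrix},\qquad S=\begin{pmatrix}1&0&0\\0&\zeta&0\\0&0&\zeta^{-1}\end{pmatrix}.$$ Automorphisms of $C$ are understood as birational self-maps of $C$, i.e. automorphisms of the associated compact Riemann surface. *)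

theory Defs
  imports "HOL-Analysis.Analysis" "HOL-Algebra.Sym_Groups" "HOL-Algebra.Generated_Groups"
begin

section \<open>Birational self-maps of a plane projective curve\<close>

text \<open>
  A point of the complex projective plane is given by homogeneous coordinates: a nonzero vector
  of \<^typ>\<open>complex^3\<close>, up to the relation \<open>proj_eq\<close>.  Over the infinite field of complex numbers
  polynomials are identified with polynomial functions.
\<close>

definition proj_eq :: "complex^3 \<Rightarrow> complex^3 \<Rightarrow> bool" where
  "proj_eq v w \<longleftrightarrow> (\<exists>c. c \<noteq> 0 \<and> w = c *s v)"

definition is_form :: "nat \<Rightarrow> (complex^3 \<Rightarrow> complex) \<Rightarrow> bool" where
  "is_form d P \<longleftrightarrow>
     (\<exists>a :: nat \<Rightarrow> nat \<Rightarrow> complex.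
        \<forall>v. P v = (\<Sum>i\<le>d. \<Sum>j\<le>d - i. a i j * (v $ 1) ^ i * (v $ 2) ^ j * (v $ 3) ^ (d - i - j)))"

definition curve_pts :: "(complex^3 \<Rightarrow> complex) \<Rightarrow> (complex^3) set" where
  "curve_pts F = {v. v \<noteq> 0 \<and> F v = 0}"

text \<open>
  In what follows \<open>F\<close> is meant to be an irreducible form, so that a form which does not vanish
  identically on the curve has only finitely many zeros there.  A rational self-map of the curve
  is represented by a triple of forms of a common degree, not all vanishing identically on the
  curve, which sends the points of the curve where it is not \<open>0\<close> to points of the curve.
\<close>

definition rat_reps :: "(complex^3 \<Rightarrow> complex) \<Rightarrow> (complex^3 \<Rightarrow> complex^3) set" where
  "rat_reps F = {\<Phi>. (\<exists>d. \<forall>i. is_form d (\<lambda>v. \<Phi> v $ i)) \<and>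
                    (\<exists>v \<in> curve_pts F. \<Phi> v \<noteq> 0) \<and>
                    (\<forall>v \<in> curve_pts F. \<Phi> v \<noteq> 0 \<longrightarrow> \<Phi> v \<in> curve_pts F)}"

definition rat_equiv ::
  "(complex^3 \<Rightarrow> complex) \<Rightarrow> ((complex^3 \<Rightarrow> complex^3) \<times> (complex^3 \<Rightarrow> complex^3)) set" where
  "rat_equiv F = {(\<Phi>, \<Psi>). \<Phi> \<in> rat_reps F \<and> \<Psi> \<in> rat_reps F \<and>
                    (\<forall>v \<in> curve_pts F. \<Phi> v \<noteq> 0 \<longrightarrow> \<Psi> v \<noteq> 0 \<longrightarrow> proj_eq (\<Phi> v) (\<Psi> v))}"

definition rat_maps :: "(complex^3 \<Rightarrow> complex) \<Rightarrow> (complex^3 \<Rightarrow> complex^3) set set" where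
  "rat_maps F = rat_reps F // rat_equiv F"

definition rat_class ::
  "(complex^3 \<Rightarrow> complex) \<Rightarrow> (complex^3 \<Rightarrow> complex^3) \<Rightarrow> (complex^3 \<Rightarrow> complex^3) set" where
  "rat_class F \<Phi> = rat_equiv F `` {\<Phi>}"

text \<open>
  Composition is substitution of representatives.  The condition \<open>\<Phi> \<circ> \<Psi> \<in> rat_reps F\<close> only
  excludes triples that vanish identically on the curve after substitution; this can happen only
  if the inner map is constant.  For a nonconstant inner map all the classes in the union coincide.
\<close>

definition rat_comp ::
  "(complex^3 \<Rightarrow> complex) \<Rightarrow> (complex^3 \<Rightarrow> complex^3) set \<Rightarrow> (complex^3 \<Rightarrow> complex^3) set
     \<Rightarrow> (complex^3 \<Rightarrow> complex^3) set" where
  "rat_comp F f g =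
     \<Union> {rat_class F (\<Phi> \<circ> \<Psi>) | \<Phi> \<Psi>. \<Phi> \<in> f \<and> \<Psi> \<in> g \<and> \<Phi> \<circ> \<Psi> \<in> rat_reps F}"

definition Bir :: "(complex^3 \<Rightarrow> complex) \<Rightarrow> (complex^3 \<Rightarrow> complex^3) set monoid" where
  "Bir F =
     \<lparr>carrier = {f \<in> rat_maps F. \<exists>g \<in> rat_maps F.
                   rat_comp F f g = rat_class F id \<and> rat_comp F g f = rat_class F id},
      mult = rat_comp F,
      one = rat_class F id\<rparr>"

text \<open>
  The rational self-map given in the affine chart \<open>(x, y) = (X/Z, Y/Z)\<close> by the formula \<open>u\<close>,
  valid where the denominator \<open>q\<close> is nonzero: the set of all representatives that agree with the
  formula.  It is an element of \<^term>\<open>rat_maps F\<close> only if the formula does define a rational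
  self-map; if it defines none the set is empty, and if \<open>q\<close> vanishes on the whole curve the set
  consists of all representatives.
\<close>

definition affine_rat_map ::
  "(complex^3 \<Rightarrow> complex) \<Rightarrow> (complex \<Rightarrow> complex \<Rightarrow> complex) \<Rightarrow> (complex \<Rightarrow> complex \<Rightarrow> complex \<times> complex)
     \<Rightarrow> (complex^3 \<Rightarrow> complex^3) set" where
  "affine_rat_map F q u =
     {\<Phi> \<in> rat_reps F. \<forall>x y. vector [x, y, 1] \<in> curve_pts F \<longrightarrow> q x y \<noteq> 0 \<longrightarrow>
        \<Phi> (vector [x, y, 1]) \<noteq> 0 \<longrightarrow>
        proj_eq (\<Phi> (vector [x, y, 1])) (vector [fst (u x y), snd (u x y), 1])}"

definition collineation ::
  "(complex^3 \<Rightarrow> complex) \<Rightarrow> complex^3^3 \<Rightarrow> (complex^3 \<Rightarrow> complex^3) set" where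
  "collineation F M = rat_class F (\<lambda>v. M *v v)"


section \<open>The Hulek--Craig model of Bring's curve\<close>

definition HC :: "complex^3 \<Rightarrow> complex" where
  "HC v = (let X = v $ 1; Y = v $ 2; Z = v $ 3 in
     X * (Y^5 + Z^5) + (X * Y * Z)^2 - X^4 * Y * Z - 2 * (Y * Z)^3)"

definition zeta5 :: complex where
  "zeta5 = exp (2 * of_real pi * \<i> / 5)"

definition HC_R_matrix :: "complex^3^3" where
  "HC_R_matrix = (1 / sqrt 5) *\<^sub>R
     vector [vector [1, 2, 2],
             vector [1, zeta5 powi 2 + zeta5 powi (-2), zeta5 + zeta5 powi (-1)],
             vector [1, zeta5 + zeta5 powi (-1), zeta5 powi 2 + zeta5 powi (-2)]]"

definition HC_S_matrix :: "complex^3^3" where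
  "HC_S_matrix =
     vector [vector [1, 0, 0],
             vector [0, zeta5, 0],
             vector [0, 0, zeta5 powi (-1)]]"

definition HC_R :: "(complex^3 \<Rightarrow> complex^3) set" where
  "HC_R = collineation HC HC_R_matrix"

definition HC_S :: "(complex^3 \<Rightarrow> complex^3) set" where
  "HC_S = collineation HC HC_S_matrix"

definition HC_U :: "(complex^3 \<Rightarrow> complex^3) set" where
  "HC_U = affine_rat_map HC
     (\<lambda>x y. (y - x^2) * (y^3 - x))
     (\<lambda>x y. (- ((y^5 + x^3 * y - 3 * x * y^2 + 1) / ((y - x^2) * (y^3 - x))),
             - ((y^2 * x - 1) / (y^3 - x))))"

end

theory Submission
  imports Defs "HOL-Computational_Algebra.Field_as_Ring" "HOL-Computational_Algebra.Fundamental_Theorem_Algebra"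
    "HOL-Computational_Algebra.Polynomial_Factorial"
begin

text \<open>
  Bring's curve is cut out in the hyperplane \<open>x\<^sub>1 + \<dots> + x\<^sub>5 = 0\<close> by \<open>\<Sum>x\<^sub>i\<^sup>2 = \<Sum>x\<^sub>i\<^sup>3 = 0\<close>, and permutations of the \<open>x\<^sub>i\<close> act on it.
  The theorem says that for the plane model these are all birational self-maps, and that the three given ones generate.

  The plane curve is mapped to its canonical model by the cubic forms \<open>canonical_map\<close>, with the inverse \<open>quartic_map\<close>.  The
  canonical model lies on a smooth quadric; with coordinates \<open>(s, t)\<close> on the two rulings it is the curve \<open>bring_curve\<close> of
  bidegree \<open>(3, 3)\<close>.  Since a form vanishing at infinitely many points of the plane curve vanishes on it (\<open>form_vanishes\<close>), birational
  self-maps of the plane curve and of \<open>bring_curve\<close> are the same thing (\<open>carrier_Bir_birational\<close>).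

  That every birational self-map \<open>\<phi>\<close> is a permutation is shown in three steps.  The function \<open>s \<circ> \<phi>\<close> has degree \<open>3\<close>, and by the residue
  theorem no canonical form vanishes at exactly two of the three points of one of its fibres; so the fibre is
  collinear and lies on a line of the quadric (\<open>fibre_image_collinear\<close>).  Therefore \<open>\<phi>\<close> permutes the two rulings and acts on them by
  Moebius transformations (\<open>birational_Moebius\<close>); in particular it is linear on the canonical space and preserves quadric
  and cubic up to factors (\<open>birational_linear\<close>).  Finally the quadric and the cubic define a commutative product on this
  four-dimensional space, and five multiples of the projections of the coordinate vectors are distinguished among its
  idempotents; a linear map preserving the product permutes them (\<open>similitude_permutation\<close>, \<open>birational_permutation\<close>).

  The residue theorem is needed only for differentials with a single simple pole.  There it follows from the
  trace to the \<open>s\<close>-line, which is a rational function of one variable (\<open>trace_formula\<close>, \<open>residue_theorem\<close>).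

  Conversely every permutation gives a birational self-map of the plane curve, and different permutations give different maps
  (\<open>perm_class_iso\<close>).  Under this isomorphism \<open>S\<close> is a five-cycle, \<open>U\<close> a four-cycle and \<open>R\<close> a product of two
  transpositions, and \<open>U R\<close> is a transposition (\<open>generate_sym_group_5\<close>).
\<close>

section \<open>The curve on a product of two lines\<close>

text \<open>
  The canonical model of Bring's curve lies on a smooth quadric, that is, on a product of two projective
  lines.  In affine coordinates \<open>(s, t)\<close> on this product it is the zero set of a polynomial of degree \<open>3\<close> in each variable.
\<close>
definition bring_poly :: "complex \<Rightarrow> complex \<Rightarrow> complex" where
  "bring_poly s t = s * t^3 + s^3 * t^2 - t + s^2"

definition bring_curve :: "(complex \<times> complex) set" where
  "bring_curve = {e. bring_poly (fst e) (snd e) = 0}"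

text \<open>
  Statements about rational functions only hold outside a finite set of points of the curve; the filter
  keeps track of that.
\<close>
definition generic :: "(complex \<times> complex) filter" where
  "generic = inf cofinite (principal bring_curve)"

lemma in_bring_curve [simp]: "(s, t) \<in> bring_curve \<longleftrightarrow> bring_poly s t = 0"
  by (simp add: bring_curve_def)

lemma eventually_generic: "eventually P generic \<longleftrightarrow> finite {e \<in> bring_curve. \<not> P e}"
  unfolding generic_def eventually_inf_principal eventually_cofinite
  by (rule arg_cong[where f = finite]) auto

lemma generic_bring_curve: "eventually (\<lambda>e. e \<in> bring_curve) generic"
  by (simp add: eventually_generic)

lemma finite_bring_poly_fibre: "finite {t. bring_poly s t = 0}"
proof -
  have "bring_poly s t = poly [:s^2, -1, s^3, s:] t" for t
    by (simp add: bring_poly_def algebra_simps power2_eq_square power3_eq_cube)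
  then show ?thesis using poly_roots_finite[of "[:s^2, -1, s^3, s:]"] by simp
qed

text \<open>
  A finite set of points of the curve is cut out by a condition on \<open>s\<close> alone, because the fibres
  over \<open>s\<close> are finite.  This is how exceptional points are handled by polynomials in one variable.
\<close>
lemma eventually_generic_poly:
  "eventually P generic \<longleftrightarrow>
     (\<exists>r. r \<noteq> 0 \<and> (\<forall>s t. bring_poly s t = 0 \<longrightarrow> poly r s \<noteq> 0 \<longrightarrow> P (s, t)))"
proof
  assume "eventually P generic"
  then have fin: "finite {e \<in> bring_curve. \<not> P e}" by (simp add: eventually_generic)
  let ?r = "\<Prod>e\<in>{e \<in> bring_curve. \<not> P e}. [:- fst e, 1:]"
  have "?r \<noteq> 0" using fin by simp
  moreover have "P (s, t)" if "bring_poly s t = 0" "poly ?r s \<noteq> 0" for s t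
    using that fin by (force simp: poly_prod)
  ultimately show "\<exists>r. r \<noteq> 0 \<and> (\<forall>s t. bring_poly s t = 0 \<longrightarrow> poly r s \<noteq> 0 \<longrightarrow> P (s, t))"
    by blast
next
  assume "\<exists>r. r \<noteq> 0 \<and> (\<forall>s t. bring_poly s t = 0 \<longrightarrow> poly r s \<noteq> 0 \<longrightarrow> P (s, t))"
  then obtain r where r: "r \<noteq> 0" "\<And>s t. bring_poly s t = 0 \<Longrightarrow> poly r s \<noteq> 0 \<Longrightarrow> P (s, t)" by blast
  have "{e \<in> bring_curve. \<not> P e} \<subseteq> Sigma {s. poly r s = 0} (\<lambda>s. {t. bring_poly s t = 0})"
    using r(2) unfolding bring_curve_def by fastforce
  moreover have "finite (Sigma {s. poly r s = 0} (\<lambda>s. {t. bring_poly s t = 0}))"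
    using poly_roots_finite[OF r(1)] finite_bring_poly_fibre by blast
  ultimately show "eventually P generic"
    using finite_subset eventually_generic by blast
qed

lemma generic_polyI:
  assumes "r \<noteq> 0" "\<And>s t. bring_poly s t = 0 \<Longrightarrow> poly r s \<noteq> 0 \<Longrightarrow> P (s, t)"
  shows "eventually P generic"
  using assms eventually_generic_poly by blast

text \<open>
  Over \<open>s = 0\<close> two of the three points run off to infinity, hence the assumption.
\<close>
lemma bring_poly_factor:
  assumes "s \<noteq> 0"
  obtains t1 t2 t3 where "\<And>t. bring_poly s t = s * (t - t1) * (t - t2) * (t - t3)"
proof -
  have "\<not> constant (poly [:s^2, -1, s^3, s:])"
    using assms by (simp add: constant_degree)
  then obtain t1 where "poly [:s^2, -1, s^3, s:] t1 = 0"
    using fundamental_theorem_of_algebra by blast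
  then have t1: "s * t1^3 + s^3 * t1^2 - t1 + s^2 = 0"
    by (simp add: algebra_simps power2_eq_square power3_eq_cube)
  define b c where "b = s^2 + t1" and "c = t1^2 + s^2 * t1 - 1 / s"
  define w where "w = csqrt (b^2 - 4 * c)"
  have w: "w^2 = b^2 - 4 * c" by (simp add: w_def)
  have sc_eq: "s * c = s * t1^2 + s^3 * t1 - 1"
    using assms by (simp add: c_def field_simps power2_eq_square power3_eq_cube)
  define t2 t3 where "t2 = (- b + w) / 2" and "t3 = (- b - w) / 2"
  have sum: "t2 + t3 = - b" and "t2 * t3 = (b^2 - w^2) / 4"
    by (simp_all add: t2_def t3_def field_simps power2_eq_square)
  then have prod: "t2 * t3 = c" by (simp add: w)
  have "bring_poly s t = s * (t - t1) * (t - t2) * (t - t3)" for t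
  proof -
    have "s * (t - t1) * (t - t2) * (t - t3)
        = (t - t1) * (s * t^2 - s * t * (t2 + t3) + s * (t2 * t3))"
      by (simp add: algebra_simps power2_eq_square)
    also have "\<dots> = bring_poly s t - (s * t1^3 + s^3 * t1^2 - t1 + s^2)"
      unfolding sum prod sc_eq by (simp add: bring_poly_def b_def algebra_simps power2_eq_square power3_eq_cube)
    finally show ?thesis using t1 by simp
  qed
  then show thesis by (rule that)
qed

lemma bring_poly_zero_left: "bring_poly 0 t = 0 \<longleftrightarrow> t = 0"
  by (simp add: bring_poly_def)

lemma bring_poly_ex: "\<exists>t. bring_poly s t = 0"
proof (cases "s = 0")
  case False
  then show ?thesis by (metis bring_poly_factor cancel_comm_monoid_add_class.diff_cancel mult_zero_left mult_zero_right)
qed (use bring_poly_zero_left in blast)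

lemma generic_nontrivial: "generic \<noteq> bot"
proof
  assume "generic = bot"
  then obtain r where r: "r \<noteq> 0" "\<And>s t. bring_poly s t = 0 \<Longrightarrow> poly r s \<noteq> 0 \<Longrightarrow> False"
    using eventually_generic_poly[of "\<lambda>_. False"] by auto
  then have "\<forall>s. poly r s = 0" using bring_poly_ex by blast
  then show False using r(1) by (simp add: poly_all_0_iff_0)
qed

lemma poly_zero_frequently:
  assumes "frequently (\<lambda>e. poly p (fst e) = 0) generic"
  shows "p = 0"
proof (rule ccontr)
  assume "p \<noteq> 0"
  then have "eventually (\<lambda>e. poly p (fst e) \<noteq> 0) generic"
    by (rule generic_polyI) auto
  with assms show False by (simp add: frequently_def)
qed

lemma eventually_poly_generic: "p \<noteq> 0 \<Longrightarrow> eventually (\<lambda>e. poly p (fst e) \<noteq> 0) generic"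
  by (rule generic_polyI) auto

section \<open>Irreducibility\<close>

text \<open>
  In lowest terms a root \<open>p / q\<close> has \<open>q\<close> dividing the leading coefficient \<open>s\<close> and \<open>p\<close> dividing
  the constant term \<open>s^2\<close> of the cubic; the few remaining possibilities fail for reasons of degree.
\<close>
lemma no_rational_root:
  fixes p q :: "complex poly"
  assumes q: "q \<noteq> 0"
    and eq: "[:0,1:] * p^3 + [:0,1:]^3 * p^2 * q - p * q^2 + [:0,1:]^2 * q^3 = 0"
  shows False
proof -
  define X :: "complex poly" where "X = [:0,1:]"
  define d where "d = gcd p q"
  obtain p' q' where perm_quad: "p = d * p'" "q = d * q'"
    unfolding d_def by (meson dvdE gcd_dvd1 gcd_dvd2)
  have d0: "d \<noteq> 0" using q perm_quad by auto
  have cop: "coprime p' q'"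
    using perm_quad d0 q unfolding d_def
    by (metis div_gcd_coprime nonzero_mult_div_cancel_left)
  have "d^3 * (X * p'^3 + X^3 * p'^2 * q' - p' * q'^2 + X^2 * q'^3) = 0"
    using eq unfolding perm_quad X_def[symmetric] by (simp add: algebra_simps power2_eq_square power3_eq_cube)
  then have eq': "X * p'^3 + X^3 * p'^2 * q' - p' * q'^2 + X^2 * q'^3 = 0" using d0 by simp
  have q0: "q' \<noteq> 0" using q perm_quad by auto
  have X0: "X \<noteq> 0" by (simp add: X_def)
  have p0: "p' \<noteq> 0" using eq' q0 X0 by auto
  have "X * p'^3 = q' * (p' * q' - X^3 * p'^2 - X^2 * q'^2)"
    using eq' by (simp add: algebra_simps power2_eq_square power3_eq_cube add_eq_0_iff)
  then have "q' dvd X * p'^3" by simp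
  then have "q' dvd X" using cop
    by (metis coprime_commute coprime_dvd_mult_left_iff coprime_power_right_iff)
  then have dq: "degree q' \<le> 1" using X0 dvd_imp_degree_le[of q' X] by (simp add: X_def)
  have "X^2 * q'^3 = p' * (q'^2 - X * p'^2 - X^3 * p' * q')"
    using eq' by (simp add: algebra_simps power2_eq_square power3_eq_cube add_eq_0_iff)
  then have "p' dvd X^2 * q'^3" by simp
  then have "p' dvd X^2" using cop
    by (metis coprime_dvd_mult_left_iff coprime_power_right_iff)
  then have dp: "degree p' \<le> 2" using X0 dvd_imp_degree_le[of p' "X^2"]
    by (simp add: X_def degree_power_eq)
  obtain a0 a1 a2 where P: "p' = [:a0, a1, a2:]"
  proof
    show "p' = [:coeff p' 0, coeff p' 1, coeff p' 2:]"
      using dp by (intro poly_eqI) (auto simp: coeff_pCons coeff_eq_0 numeral_2_eq_2 split: nat.splits)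
  qed
  obtain b0 b1 where Q: "q' = [:b0, b1:]"
  proof
    show "q' = [:coeff q' 0, coeff q' 1:]"
      using dq by (intro poly_eqI) (auto simp: coeff_pCons coeff_eq_0 split: nat.splits)
  qed
  have "poly (p' * q'^2) 0 = 0"
    using arg_cong[OF eq', of "\<lambda>u. poly u 0"] by (simp add: X_def)
  then have ab: "a0 = 0 \<or> b0 = 0" by (simp add: P Q)
  show False
  proof (cases "b0 = 0")
    case True
    then have b1: "b1 \<noteq> 0" using q0 Q by auto
    have "a0^3 = 0"
      using arg_cong[OF eq', of "\<lambda>u. coeff u 1"]
      by (simp add: P Q True X_def power2_eq_square power3_eq_cube)
    then have "[:0,1:] dvd p'" "[:0,1:] dvd q'" using P Q True by (auto simp: dvd_iff_poly_eq_0)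
    then have "is_unit [:0, 1::complex:]" using cop by (meson not_coprimeI)
    then show False by (simp add: is_unit_pCons_iff)
  next
    case False
    then have a0: "a0 = 0" using ab by simp
    note eqs = eq'[unfolded P Q X_def a0 power2_eq_square power3_eq_cube]
    have a1: "a1 = 0" using eqs False by simp
    have "b0 * (b0 * b0) = a2 * (b0 * b0)" using eqs by (simp add: a1 algebra_simps)
    then have a2: "a2 = b0" using False by simp
    have "b0 * b0 * b1 = 0" using eqs by (simp add: a1 a2 algebra_simps)
    then have "b1 = 0" using False by simp
    then show False using eqs False by (simp add: a1 a2)
  qed
qed


lemma no_rational_root_frequently:
  assumes q: "q \<noteq> 0" and fr: "\<exists>\<^sub>F e in generic. poly p (fst e) + poly q (fst e) * snd e = 0"
  shows False
proof -
  let ?X = "[:0,1:] :: complex poly"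
  have "\<exists>\<^sub>F e in generic. poly (?X * (-p)^3 + ?X^3 * (-p)^2 * q - (-p) * q^2 + ?X^2 * q^3) (fst e) = 0"
    using frequently_eventually_frequently[OF fr generic_bring_curve]
  proof (rule frequently_elim1)
    fix e :: "complex \<times> complex"
    obtain s t where e: "e = (s, t)" by fastforce
    assume "poly p (fst e) + poly q (fst e) * snd e = 0 \<and> e \<in> bring_curve"
    then have p: "poly p s = - poly q s * t" and "bring_poly s t = 0" by (auto simp: e add_eq_0_iff)
    have "poly (?X * (-p)^3 + ?X^3 * (-p)^2 * q - (-p) * q^2 + ?X^2 * q^3) s = (poly q s)^3 * bring_poly s t"
      by (simp add: p bring_poly_def algebra_simps power2_eq_square power3_eq_cube)
    then show "poly (?X * (-p)^3 + ?X^3 * (-p)^2 * q - (-p) * q^2 + ?X^2 * q^3) (fst e) = 0"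
      using \<open>bring_poly s t = 0\<close> by (simp add: e)
  qed
  then show False using poly_zero_frequently no_rational_root[OF q] by blast
qed

text \<open>
  The powers \<open>1, t, t^2\<close> are linearly independent over the rational functions in \<open>s\<close>: division
  of the cubic by a quadratic relation would leave a linear one, and hence a rational root of the cubic.
\<close>
lemma identity_theorem:
  assumes "\<exists>\<^sub>F e in generic. poly c0 (fst e) + poly c1 (fst e) * snd e + poly c2 (fst e) * (snd e)^2 = 0"
  shows "c0 = 0 \<and> c1 = 0 \<and> c2 = 0"
proof -
  let ?X = "[:0,1:] :: complex poly"
  have c2: "c2 = 0"
  proof (rule ccontr)
    assume c2: "c2 \<noteq> 0"
    define l0 l1 where "l0 = ?X^3 * c2 - ?X * c1" and "l1 = ?X * c2"
    define r0 r1 where "r0 = ?X^2 * c2^2 - l0 * c0" and "r1 = - (c2^2) - l1 * c0 - l0 * c1"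
    have div: "(poly c2 s)^2 * bring_poly s t = (poly l0 s + poly l1 s * t) * (poly c0 s + poly c1 s * t + poly c2 s * t^2)
        + (poly r0 s + poly r1 s * t)" for s t
      by (simp add: bring_poly_def l0_def l1_def r0_def r1_def algebra_simps power2_eq_square power3_eq_cube)
    have fr: "\<exists>\<^sub>F e in generic. poly r0 (fst e) + poly r1 (fst e) * snd e = 0"
      using frequently_eventually_frequently[OF assms generic_bring_curve]
    proof (rule frequently_elim1)
      fix e assume "poly c0 (fst e) + poly c1 (fst e) * snd e + poly c2 (fst e) * (snd e)^2 = 0 \<and> e \<in> bring_curve"
      then show "poly r0 (fst e) + poly r1 (fst e) * snd e = 0"
        using div[of "fst e" "snd e"] by (simp add: bring_curve_def)
    qed
    have r1: "r1 = 0" using no_rational_root_frequently[OF _ fr] by blast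
    have r0: "r0 = 0" using fr poly_zero_frequently by (simp add: r1)
    have "poly (l1^2 * (?X * (-l0)^3 + ?X^3 * (-l0)^2 * l1 - (-l0) * l1^2 + ?X^2 * l1^3)) s = 0" for s
    proof (cases "poly c2 s = 0 \<or> s = 0")
      case True then show ?thesis by (auto simp: l1_def)
    next
      case False
      then have nz: "poly l1 s \<noteq> 0" by (simp add: l1_def)
      define t where "t = - poly l0 s / poly l1 s"
      have l0t: "poly l0 s = - poly l1 s * t" using nz by (simp add: t_def)
      then have "(poly c2 s)^2 * bring_poly s t = 0" using div[of s t] by (simp add: r0 r1)
      then have "bring_poly s t = 0" using False by simp
      moreover have "poly (?X * (-l0)^3 + ?X^3 * (-l0)^2 * l1 - (-l0) * l1^2 + ?X^2 * l1^3) s = (poly l1 s)^3 * bring_poly s t"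
        by (simp add: l0t bring_poly_def algebra_simps power2_eq_square power3_eq_cube)
      ultimately show ?thesis by simp
    qed
    then have "l1^2 * (?X * (-l0)^3 + ?X^3 * (-l0)^2 * l1 - (-l0) * l1^2 + ?X^2 * l1^3) = 0"
      using poly_all_0_iff_0 by blast
    moreover have "l1 \<noteq> 0" using c2 by (simp add: l1_def)
    ultimately show False using no_rational_root[of l1 "-l0"] by simp
  qed
  have c1: "c1 = 0"
    using no_rational_root_frequently[of c1 c0] assms by (auto simp: c2)
  show ?thesis using assms poly_zero_frequently by (simp add: c1 c2)
qed

section \<open>Rational functions on the curve\<close>

text \<open>
  A rational function on the curve written in the basis \<open>1, t, t^2\<close> over the rational functions in \<open>s\<close>.
\<close>
definition normal_form :: "complex poly \<Rightarrow> complex poly \<Rightarrow> complex poly \<Rightarrow> complex poly \<Rightarrow> complex \<times> complex \<Rightarrow> complex" where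
  "normal_form c0 c1 c2 r e = (poly c0 (fst e) + poly c1 (fst e) * snd e + poly c2 (fst e) * (snd e)^2) / poly r (fst e)"

definition ratfun :: "(complex \<times> complex \<Rightarrow> complex) \<Rightarrow> bool" where
  "ratfun h \<longleftrightarrow> (\<exists>c0 c1 c2 r. r \<noteq> 0 \<and> (\<forall>\<^sub>F e in generic. h e = normal_form c0 c1 c2 r e))"

lemma ratfunI: "r \<noteq> 0 \<Longrightarrow> \<forall>\<^sub>F e in generic. h e = normal_form c0 c1 c2 r e \<Longrightarrow> ratfun h"
  unfolding ratfun_def by blast

lemma ratfun_cong:
  assumes "ratfun h" "\<forall>\<^sub>F e in generic. h' e = h e"
  shows "ratfun h'"
proof -
  obtain c0 c1 c2 r where "r \<noteq> 0" "\<forall>\<^sub>F e in generic. h e = normal_form c0 c1 c2 r e"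
    using assms(1) unfolding ratfun_def by blast
  with assms(2) show ?thesis by (auto intro!: ratfunI[of r] elim: eventually_elim2)
qed

lemma ratfun_polyE:
  assumes "ratfun h"
  obtains c0 c1 c2 r where "r \<noteq> 0"
    "\<And>s t. bring_poly s t = 0 \<Longrightarrow> poly r s \<noteq> 0 \<Longrightarrow> h (s, t) = normal_form c0 c1 c2 r (s, t)"
proof -
  obtain c0 c1 c2 r where r: "r \<noteq> 0" and ev: "\<forall>\<^sub>F e in generic. h e = normal_form c0 c1 c2 r e"
    using assms unfolding ratfun_def by blast
  obtain q where q: "q \<noteq> 0" "\<And>s t. bring_poly s t = 0 \<Longrightarrow> poly q s \<noteq> 0 \<Longrightarrow> h (s, t) = normal_form c0 c1 c2 r (s, t)"
    using ev unfolding eventually_generic_poly by blast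
  show thesis
  proof (rule that[of "r * q" "c0 * q" "c1 * q" "c2 * q"])
    show "r * q \<noteq> 0" using r q(1) by simp
    show "h (s, t) = normal_form (c0 * q) (c1 * q) (c2 * q) (r * q) (s, t)"
      if "bring_poly s t = 0" "poly (r * q) s \<noteq> 0" for s t
      using q(2)[of s t] that by (simp add: normal_form_def field_simps)
  qed
qed

lemma ratfun_poly: "ratfun (\<lambda>e. poly p (fst e))"
  by (rule ratfunI[of 1 _ p 0 0]) (auto simp: normal_form_def)

lemma ratfun_const [intro, simp]: "ratfun (\<lambda>e. c)"
  using ratfun_poly[of "[:c:]"] by simp

lemma ratfun_fst [intro, simp]: "ratfun fst"
  using ratfun_poly[of "[:0,1:]"] by simp

lemma ratfun_snd [intro, simp]: "ratfun snd"
  by (rule ratfunI[of 1 _ 0 1 0]) (auto simp: normal_form_def)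

lemma ratfun_fst' [intro, simp]: "ratfun (\<lambda>e. fst e)" and ratfun_snd' [intro, simp]: "ratfun (\<lambda>e. snd e)"
  using ratfun_fst ratfun_snd by (simp_all add: eta_contract_eq)

lemma ratfun_add [intro]:
  assumes "ratfun f" "ratfun g" shows "ratfun (\<lambda>e. f e + g e)"
proof -
  obtain a0 a1 a2 r where f: "r \<noteq> 0" "\<And>s t. bring_poly s t = 0 \<Longrightarrow> poly r s \<noteq> 0 \<Longrightarrow> f (s, t) = normal_form a0 a1 a2 r (s, t)"
    using ratfun_polyE[OF assms(1)] by metis
  obtain b0 b1 b2 q where g: "q \<noteq> 0" "\<And>s t. bring_poly s t = 0 \<Longrightarrow> poly q s \<noteq> 0 \<Longrightarrow> g (s, t) = normal_form b0 b1 b2 q (s, t)"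
    using ratfun_polyE[OF assms(2)] by metis
  show ?thesis
  proof (rule ratfunI, safe)
    show "\<forall>\<^sub>F e in generic. f e + g e = normal_form (a0*q + b0*r) (a1*q + b1*r) (a2*q + b2*r) (r*q) e"
    proof (rule generic_polyI[of "r * q"])
      show "r * q \<noteq> 0" using f(1) g(1) by simp
      show "f (s, t) + g (s, t) = normal_form (a0*q + b0*r) (a1*q + b1*r) (a2*q + b2*r) (r*q) (s, t)"
        if "bring_poly s t = 0" "poly (r * q) s \<noteq> 0" for s t
      proof -
        have "poly r s \<noteq> 0" "poly q s \<noteq> 0" using that(2) by auto
        then show ?thesis
          using f(2)[OF that(1)] g(2)[OF that(1)] by (simp add: normal_form_def add_frac_eq) (simp add: algebra_simps)
      qed
    qed
    show "r * q = 0 \<Longrightarrow> False" using f(1) g(1) by simp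
  qed
qed

lemma ratfun_mult [intro]:
  assumes "ratfun f" "ratfun g" shows "ratfun (\<lambda>e. f e * g e)"
proof -
  obtain a0 a1 a2 r where f: "r \<noteq> 0" "\<And>s t. bring_poly s t = 0 \<Longrightarrow> poly r s \<noteq> 0 \<Longrightarrow> f (s, t) = normal_form a0 a1 a2 r (s, t)"
    using ratfun_polyE[OF assms(1)] by metis
  obtain b0 b1 b2 q where g: "q \<noteq> 0" "\<And>s t. bring_poly s t = 0 \<Longrightarrow> poly q s \<noteq> 0 \<Longrightarrow> g (s, t) = normal_form b0 b1 b2 q (s, t)"
    using ratfun_polyE[OF assms(2)] by metis
  define X :: "complex poly" where "X = [:0,1:]"
  define e0 e1 e2 e3 e4 where "e0 = a0*b0" and "e1 = a0*b1 + a1*b0" and "e2 = a0*b2 + a1*b1 + a2*b0"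
    and "e3 = a1*b2 + a2*b1" and "e4 = a2*b2"
  define c0 c1 c2 where "c0 = X^2*e0 - X^3*e3 + X^5*e4"
    and "c1 = X^2*e1 + X*e3 - 2*X^3*e4" and "c2 = X^2*e2 - X^4*e3 + (X+X^6)*e4"
  define m where "m = X^2*r*q"
  have m0: "m \<noteq> 0" using f(1) g(1) by (simp add: m_def X_def)
  have "f (s, t) * g (s, t) = normal_form c0 c1 c2 m (s, t)"
    if G: "bring_poly s t = 0" and m: "poly m s \<noteq> 0" for s t
  proof -
    let ?p = "\<lambda>u. poly u s"
    have s: "s \<noteq> 0" and r: "?p r \<noteq> 0" and q: "?p q \<noteq> 0" using m by (auto simp: m_def X_def)
    have "s^2 * ((?p a0 + ?p a1 * t + ?p a2 * t^2) * (?p b0 + ?p b1 * t + ?p b2 * t^2))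
       = ?p c0 + ?p c1 * t + ?p c2 * t^2 + (?p e3 * s + ?p e4 * (s * t - s^3)) * bring_poly s t"
      unfolding c0_def c1_def c2_def e0_def e1_def e2_def e3_def e4_def bring_poly_def X_def
      by simp algebra
    then have "(?p c0 + ?p c1 * t + ?p c2 * t^2) / ?p m
       = (?p a0 + ?p a1 * t + ?p a2 * t^2) * (?p b0 + ?p b1 * t + ?p b2 * t^2) / (?p r * ?p q)"
      using s r q by (simp add: G m_def X_def frac_eq_eq) (simp add: algebra_simps)
    then show ?thesis
      using f(2)[OF G r] g(2)[OF G q] by (simp add: normal_form_def)
  qed
  then show ?thesis using m0 by (intro ratfunI[OF m0 generic_polyI[OF m0]]) auto
qed

lemma ratfun_uminus [intro]: "ratfun f \<Longrightarrow> ratfun (\<lambda>e. - f e)"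
  using ratfun_mult[of "\<lambda>_. -1" f] by simp

lemma ratfun_diff [intro]: "ratfun f \<Longrightarrow> ratfun g \<Longrightarrow> ratfun (\<lambda>e. f e - g e)"
  using ratfun_add[of f "\<lambda>e. - g e"] by (simp add: ratfun_uminus)

lemma ratfun_power [intro]: "ratfun f \<Longrightarrow> ratfun (\<lambda>e. f e ^ n)"
  by (induction n) auto

lemma ratfun_sum [intro]: "(\<And>i. i \<in> A \<Longrightarrow> ratfun (f i)) \<Longrightarrow> ratfun (\<lambda>e. \<Sum>i\<in>A. f i e)"
  by (induction A rule: infinite_finite_induct) auto

text \<open>
  By the identity theorem the alternative can be read off from the coefficients.
\<close>
lemma ratfun_zero_or_nonzero:
  assumes "ratfun h"
  shows "(\<forall>\<^sub>F e in generic. h e = 0) \<or> (\<forall>\<^sub>F e in generic. h e \<noteq> 0)"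
proof -
  obtain c0 c1 c2 r where r: "r \<noteq> 0" and ev: "\<forall>\<^sub>F e in generic. h e = normal_form c0 c1 c2 r e"
    using assms unfolding ratfun_def by blast
  show ?thesis
  proof (cases "\<forall>\<^sub>F e in generic. h e \<noteq> 0")
    case False
    then have "\<exists>\<^sub>F e in generic. h e = 0" by (simp add: frequently_def)
    from frequently_eventually_frequently[OF this eventually_conj[OF ev eventually_poly_generic[OF r]]] have "\<exists>\<^sub>F e in generic. poly c0 (fst e) + poly c1 (fst e) * snd e + poly c2 (fst e) * (snd e)^2 = 0"
      by (rule frequently_elim1) (auto simp: normal_form_def)
    then have "c0 = 0 \<and> c1 = 0 \<and> c2 = 0" by (rule identity_theorem)
    with ev show ?thesis by (simp add: normal_form_def)
  qed simp
qed

lemma bring_poly_vieta: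
  assumes f: "\<And>t. bring_poly s t = s * (t - t1) * (t - t2) * (t - t3)" and s: "s \<noteq> 0"
  shows "t1 + t2 + t3 = - (s^2)" "s * (t1 * t2 + t1 * t3 + t2 * t3) = - 1" "t1 * t2 * t3 = - s"
proof -
  have a: "s^2 = - (s * (t1 * t2 * t3))" using f[of 0] by (simp add: bring_poly_def)
  have b: "s + s^3 - 1 + s^2 = s * (1 - t1) * (1 - t2) * (1 - t3)" using f[of 1] by (simp add: bring_poly_def)
  have c: "- s + s^3 + 1 + s^2 = s * (-1 - t1) * (-1 - t2) * (-1 - t3)" using f[of "-1"] by (simp add: bring_poly_def)
  have "s * (t1 * t2 * t3 + s) = 0" using a by algebra
  then show "t1 * t2 * t3 = - s" using s by (simp add: eq_neg_iff_add_eq_0)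
  have "2 * (s * (t1 * t2 + t1 * t3 + t2 * t3) + 1) = 0"
    using b c by algebra
  then show "s * (t1 * t2 + t1 * t3 + t2 * t3) = - 1" by algebra
  have "(2 * s) * (t1 + t2 + t3 + s^2) = 0"
    using a b c by algebra
  then show "t1 + t2 + t3 = - (s^2)" using s by (simp add: eq_neg_iff_add_eq_0)
qed

text \<open>
  The norm of \<open>c0 + c1 t + c2 t^2\<close> over the rational functions in \<open>s\<close>, multiplied by \<open>s^2\<close>, the square
  of the leading coefficient of the cubic; the three polynomials below are the coefficients of the product of the other two conjugates.
\<close>
definition norm_bring_poly :: "complex poly \<Rightarrow> complex poly \<Rightarrow> complex poly \<Rightarrow> complex poly" where
  "norm_bring_poly c0 c1 c2 = (let X = [:0,1:] in
     X^2*c0^3 - X^4*c0^2*c1 + c0^2*c2*(X^6+2*X) - X*c0*c1^2 + 4*X^3*c0*c1*c2 + c0*c2^2*(1-2*X^5)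
     - X^3*c1^3 + X^5*c1^2*c2 + X^2*c1*c2^2 + X^4*c2^3)"

definition adj0 :: "complex poly \<Rightarrow> complex poly \<Rightarrow> complex poly \<Rightarrow> complex poly" where
  "adj0 c0 c1 c2 = (let X = [:0,1:] in
     X^2*c0^2 - X^4*c0*c1 + c0*c2*(X^6+2*X) - X*c1^2 + 2*X^3*c1*c2 + c2^2*(1-X^5))"
definition adj1 :: "complex poly \<Rightarrow> complex poly \<Rightarrow> complex poly \<Rightarrow> complex poly" where
  "adj1 c0 c1 c2 = (let X = [:0,1:] in
     X * (X^3*c1^2 - X*c0*c1 - X^5*c1*c2 - 2*X^2*c2^2))"
definition adj2 :: "complex poly \<Rightarrow> complex poly \<Rightarrow> complex poly \<Rightarrow> complex poly" where
  "adj2 c0 c1 c2 = (let X = [:0,1:] in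
     X * (X*c1^2 - X*c0*c2 - X^3*c1*c2 - c2^2))"

lemma adj_norm:
  assumes "bring_poly s t = 0"
  shows "(poly c0 s + poly c1 s * t + poly c2 s * t^2) *
     (poly (adj0 c0 c1 c2) s + poly (adj1 c0 c1 c2) s * t + poly (adj2 c0 c1 c2) s * t^2)
     = poly (norm_bring_poly c0 c1 c2) s"
proof -
  define a b c where "a = poly c0 s" and "b = poly c1 s" and "c = poly c2 s"
  define k2 where "k2 = s*b^2 - s*a*c - s^3*b*c - c^2"
  define k1 where "k1 = s^3*b^2 - s*a*b - s^5*b*c - 2* s^2*c^2"
  define k0 where "k0 = s^2*a^2 - s^4*a*b + a*c*(s^6+2* s) - s*b^2 + 2* s^3*b*c + c^2*(1-s^5)"
  have "(a + b * t + c * t^2) * (k0 + s * k1 * t + s * k2 * t^2)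
     - (s^2*a^3 - s^4*a^2*b + a^2*c*(s^6+2* s) - s*a*b^2 + 4* s^3*a*b*c + a*c^2*(1-2* s^5)
     - s^3*b^3 + s^5*b^2*c + s^2*b*c^2 + s^4*c^3) = (c * k2 * t + (b * k2 + c * k1 - s^2 * c * k2)) * bring_poly s t"
    unfolding k0_def k1_def k2_def bring_poly_def by algebra
  moreover have "poly (adj0 c0 c1 c2) s = k0" "poly (adj1 c0 c1 c2) s = s * k1" "poly (adj2 c0 c1 c2) s = s * k2"
    by (simp_all add: adj0_def adj1_def adj2_def Let_def k0_def k1_def k2_def a_def b_def c_def algebra_simps)
  moreover have "poly (norm_bring_poly c0 c1 c2) s = s^2*a^3 - s^4*a^2*b + a^2*c*(s^6+2* s) - s*a*b^2 + 4* s^3*a*b*c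
     + a*c^2*(1-2* s^5) - s^3*b^3 + s^5*b^2*c + s^2*b*c^2 + s^4*c^3"
    by (simp add: norm_bring_poly_def Let_def a_def b_def c_def algebra_simps)
  ultimately show ?thesis using assms by (simp add: a_def b_def c_def)
qed

lemma norm_bring_poly_roots:
  fixes c0 c1 c2 :: "complex poly"
  assumes f: "\<And>t. bring_poly s t = s * (t - t1) * (t - t2) * (t - t3)" and s: "s \<noteq> 0"
  defines "D \<equiv> \<lambda>t. poly c0 s + poly c1 s * t + poly c2 s * t^2"
  shows "poly (norm_bring_poly c0 c1 c2) s = s^2 * (D t1 * D t2 * D t3)"
proof -
  define a b c where "a = poly c0 s" and "b = poly c1 s" and "c = poly c2 s"
  define x y where "x = t2 + t3" and "y = t2 * t3"
  have G: "bring_poly s t1 = 0" using f by simp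
  have x: "x = - (s^2) - t1" and y: "s * y = - 1 + s^3 * t1 + s * t1^2"
    using bring_poly_vieta[OF f s] unfolding x_def y_def by algebra+
  have xy: "s^2 * (y * x) = 2 * s^3 - s^6 * t1 - s^4 * t1^2 - s * bring_poly s t1"
    using x y unfolding bring_poly_def by algebra
  have yy: "s^2 * y^2 = 1 - s^5 - 2 * s^3 * t1 - s * t1^2 + (s * t1 + s^3) * bring_poly s t1"
    using y unfolding bring_poly_def by algebra
  have "D t2 * D t3 = a^2 + a*b*x + a*c*(x^2 - 2*y) + b^2*y + b*c*(y*x) + c^2*y^2"
    unfolding D_def a_def[symmetric] b_def[symmetric] c_def[symmetric] x_def y_def
    by (simp add: algebra_simps power2_eq_square)
  then have "s^2 * (D t2 * D t3) = s^2*a^2 + s^2*a*b*x + a*c*(s^2*x^2 - 2* s*(s*y)) + s*b^2*(s*y) + b*c*(s^2*(y*x)) + c^2*(s^2*y^2)"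
    by algebra
  also have "\<dots> = s^2*a^2 + s^2*a*b*(- (s^2) - t1) + a*c*(s^2*(- (s^2) - t1)^2 - 2* s*(- 1 + s^3 * t1 + s * t1^2))
      + s*b^2*(- 1 + s^3 * t1 + s * t1^2) + b*c*(2 * s^3 - s^6 * t1 - s^4 * t1^2) + c^2*(1 - s^5 - 2 * s^3 * t1 - s * t1^2)"
    unfolding xy yy unfolding y x by (simp add: G)
  also have "\<dots> = poly (adj0 c0 c1 c2) s + poly (adj1 c0 c1 c2) s * t1 + poly (adj2 c0 c1 c2) s * t1^2"
    unfolding adj0_def adj1_def adj2_def Let_def a_def b_def c_def by simp algebra
  finally have "D t1 * (s^2 * (D t2 * D t3)) = poly (norm_bring_poly c0 c1 c2) s"
    using adj_norm[OF G, of c0 c1 c2] by (simp only: D_def)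
  then show ?thesis by (simp add: mult.assoc mult.left_commute)
qed

text \<open>
  A zero of the norm over \<open>s\<close> is a zero of the function itself at a point over \<open>s\<close>, so a norm that
  vanishes identically contradicts the identity theorem.
\<close>
lemma norm_bring_poly_nonzero:
  assumes "c0 \<noteq> 0 \<or> c1 \<noteq> 0 \<or> c2 \<noteq> 0"
  shows "norm_bring_poly c0 c1 c2 \<noteq> 0"
proof
  assume N: "norm_bring_poly c0 c1 c2 = 0"
  let ?D = "\<lambda>s t. poly c0 s + poly c1 s * t + poly c2 s * t^2"
  have "\<not> (\<exists>\<^sub>F e in generic. ?D (fst e) (snd e) = 0)"
    using identity_theorem assms by blast
  then have "\<forall>\<^sub>F e in generic. ?D (fst e) (snd e) \<noteq> 0" by (simp add: frequently_def)
  then obtain r where r: "r \<noteq> 0" "\<And>s t. bring_poly s t = 0 \<Longrightarrow> poly r s \<noteq> 0 \<Longrightarrow> ?D s t \<noteq> 0"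
    by (auto simp: eventually_generic_poly)
  have "[:0,1:] * r \<noteq> 0" using r(1) by simp
  then obtain s where "poly ([:0,1:] * r) s \<noteq> 0" using poly_all_0_iff_0 by blast
  then have s: "s \<noteq> 0" "poly r s \<noteq> 0" by auto
  obtain t1 t2 t3 where f: "\<And>t. bring_poly s t = s * (t - t1) * (t - t2) * (t - t3)"
    using bring_poly_factor[OF s(1)] by blast
  have "?D s t1 * ?D s t2 * ?D s t3 = 0"
    using norm_bring_poly_roots[OF f s(1), of c0 c1 c2] s(1) by (simp add: N)
  moreover have "bring_poly s t1 = 0" "bring_poly s t2 = 0" "bring_poly s t3 = 0" using f by auto
  ultimately show False using r(2) s(2) by auto
qed

text \<open>
  The inverse is the product of the other conjugates divided by the norm.
\<close>
lemma ratfun_inverse [intro]: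
  assumes "ratfun h" shows "ratfun (\<lambda>e. inverse (h e))"
proof -
  obtain c0 c1 c2 r where r: "r \<noteq> 0"
    and h: "\<And>s t. bring_poly s t = 0 \<Longrightarrow> poly r s \<noteq> 0 \<Longrightarrow> h (s, t) = normal_form c0 c1 c2 r (s, t)"
    using ratfun_polyE[OF assms] by metis
  show ?thesis
  proof (cases "c0 = 0 \<and> c1 = 0 \<and> c2 = 0")
    case True
    have "\<forall>\<^sub>F e in generic. inverse (h e) = 0"
      by (rule generic_polyI[OF r]) (use h True in \<open>simp add: normal_form_def\<close>)
    then show ?thesis by (rule ratfun_cong[OF ratfun_const[of 0]])
  next
    case False
    define N where "N = norm_bring_poly c0 c1 c2"
    have N: "N \<noteq> 0" using norm_bring_poly_nonzero False by (auto simp: N_def)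
    have "\<forall>\<^sub>F e in generic. inverse (h e) = normal_form (r * adj0 c0 c1 c2) (r * adj1 c0 c1 c2) (r * adj2 c0 c1 c2) N e"
    proof (rule generic_polyI[of "r * N"])
      show "r * N \<noteq> 0" using r N by simp
      fix s t assume G: "bring_poly s t = 0" and nz: "poly (r * N) s \<noteq> 0"
      define A B where "A = poly c0 s + poly c1 s * t + poly c2 s * t^2"
        and "B = poly (adj0 c0 c1 c2) s + poly (adj1 c0 c1 c2) s * t + poly (adj2 c0 c1 c2) s * t^2"
      have AB: "A * B = poly N s"
        using adj_norm[OF G] by (simp add: N_def A_def B_def)
      moreover have "poly N s \<noteq> 0" and r: "poly r s \<noteq> 0" using nz by auto
      ultimately have "B \<noteq> 0" by auto
      then have "inverse (A / poly r s) = poly r s * B / (A * B)" by simp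
      moreover have "h (s, t) = A / poly r s" using h[OF G r] by (simp add: normal_form_def A_def)
      moreover have "poly r s * B = poly (r * adj0 c0 c1 c2) s + poly (r * adj1 c0 c1 c2) s * t
          + poly (r * adj2 c0 c1 c2) s * t^2"
        by (simp add: B_def algebra_simps)
      ultimately show "inverse (h (s, t)) = normal_form (r * adj0 c0 c1 c2) (r * adj1 c0 c1 c2) (r * adj2 c0 c1 c2) N (s, t)"
        by (simp add: normal_form_def AB)
    qed
    then show ?thesis by (rule ratfunI[OF N])
  qed
qed

lemma ratfun_divide [intro]: "ratfun f \<Longrightarrow> ratfun g \<Longrightarrow> ratfun (\<lambda>e. f e / g e)"
  unfolding divide_inverse by (intro ratfun_mult ratfun_inverse)

lemma ratfun_poly_comp: assumes "ratfun f" shows "ratfun (\<lambda>e. poly p (f e))"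
proof (induction p)
  case (pCons a p)
  have "ratfun (\<lambda>e. a + f e * poly p (f e))"
    by (intro ratfun_add ratfun_const ratfun_mult assms pCons.IH)
  then show ?case by simp
qed simp

text \<open>
  Composition needs the inner map to take generic points to generic points; a constant map would not.
\<close>
lemma ratfun_comp:
  assumes h: "ratfun h" and \<phi>: "filterlim \<phi> generic generic" "ratfun (\<lambda>e. fst (\<phi> e))" "ratfun (\<lambda>e. snd (\<phi> e))"
  shows "ratfun (\<lambda>e. h (\<phi> e))"
proof -
  obtain c0 c1 c2 r where "r \<noteq> 0" and ev: "\<forall>\<^sub>F e in generic. h e = normal_form c0 c1 c2 r e"
    using h unfolding ratfun_def by blast
  have ev': "\<forall>\<^sub>F e in generic. h (\<phi> e) = normal_form c0 c1 c2 r (\<phi> e)"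
    using eventually_compose_filterlim[OF ev \<phi>(1)] .
  have "ratfun (\<lambda>e. normal_form c0 c1 c2 r (\<phi> e))"
    unfolding normal_form_def
    by (rule ratfun_divide ratfun_add ratfun_mult ratfun_power ratfun_poly_comp \<phi>(2) \<phi>(3))+
  then show ?thesis using ev' by (rule ratfun_cong)
qed

lemma eventually_poly_nonzero_at: "p \<noteq> 0 \<Longrightarrow> \<forall>\<^sub>F s in at s0. poly p (s::complex) \<noteq> 0"
proof -
  assume "p \<noteq> 0"
  then have "finite {s. poly p s = 0}" by (rule poly_roots_finite)
  then have "\<forall>\<^sub>F s in at s0. s \<notin> {s. poly p s = 0}"
    by (rule islimpt_finite[unfolded islimpt_iff_eventually not_not, of _ s0])
  then show ?thesis by simp
qed

lemma eventually_poly_nonzero_infinity: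
  assumes "p \<noteq> 0" shows "\<forall>\<^sub>F s in at_infinity. poly p (s::complex) \<noteq> 0"
proof -
  have "bounded {s. poly p s = 0}" using poly_roots_finite[OF assms] by (rule finite_imp_bounded)
  then obtain B where "\<And>s. poly p s = 0 \<Longrightarrow> norm s \<le> B" by (auto simp: bounded_iff)
  then have "poly p s \<noteq> 0" if "B + 1 \<le> norm s" for s using that by fastforce
  then show ?thesis unfolding eventually_at_infinity by blast
qed

section \<open>Limits of rational functions of one variable\<close>

lemma poly_over_power_tendsto:
  "degree p \<le> n \<Longrightarrow> ((\<lambda>s::complex. poly p s / s ^ n) \<longlongrightarrow> coeff p n) at_infinity"
proof (induction p arbitrary: n)
  case (pCons a p)
  show ?case
  proof (cases n)
    case 0
    with pCons.prems have "p = 0" by (auto split: if_splits)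
    then show ?thesis by (simp add: 0)
  next
    case (Suc m)
    have "degree p \<le> m" using pCons.prems Suc by (auto split: if_splits)
    from tendsto_add[OF tendsto_mult[OF tendsto_const[of a] tendsto_power[OF tendsto_inverse_0, of "Suc m"]] pCons.IH[OF this]]
    have "((\<lambda>s. a * inverse s ^ Suc m + poly p s / s ^ m) \<longlongrightarrow> coeff (pCons a p) n) at_infinity"
      by (simp add: Suc)
    then show ?thesis
    proof (rule Lim_transform_eventually)
      have "\<forall>\<^sub>F s::complex in at_infinity. s \<noteq> 0"
        using eventually_poly_nonzero_infinity[of "[:0,1:]"] by simp
      then show "\<forall>\<^sub>F s in at_infinity. a * inverse s ^ Suc m + poly p s / s ^ m = poly (pCons a p) s / s ^ n"
        by eventually_elim (simp add: Suc add_divide_distrib power_divide inverse_eq_divide)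
    qed
  qed
qed simp

text \<open>
  A rational function of one variable without poles, simple poles included, is a polynomial, and one that
  tends to \<open>0\<close> at infinity vanishes.
\<close>
lemma rational_vanishing:
  fixes n d :: "complex poly"
  assumes d: "d \<noteq> 0"
    and fin: "\<And>s0. ((\<lambda>s. (s - s0) * (poly n s / poly d s)) \<longlongrightarrow> 0) (at s0)"
    and inf: "((\<lambda>s. poly n s / poly d s) \<longlongrightarrow> 0) at_infinity"
  shows "n = 0"
proof (rule ccontr)
  assume "n \<noteq> 0"
  define g where "g = gcd n d"
  obtain n' d' where nd: "n = g * n'" "d = g * d'"
    unfolding g_def by (meson dvdE gcd_dvd1 gcd_dvd2)
  have g: "g \<noteq> 0" and n': "n' \<noteq> 0" and d': "d' \<noteq> 0" using d \<open>n \<noteq> 0\<close> nd by auto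
  have cop: "coprime n' d'"
  proof -
    have "n div g = n'" "d div g = d'" using g nd by (metis nonzero_mult_div_cancel_left)+
    then show ?thesis using div_gcd_coprime[of n d] d by (simp add: g_def)
  qed
  have "poly d' s0 \<noteq> 0" for s0
  proof
    assume "poly d' s0 = 0"
    then obtain e where e: "d' = [:- s0, 1:] * e" by (meson dvdE poly_eq_0_iff_dvd)
    have e0: "e \<noteq> 0" using d' e by auto
    have "((\<lambda>s. ((s - s0) * (poly n s / poly d s)) * poly e s) \<longlongrightarrow> 0 * poly e s0) (at s0)"
      by (intro tendsto_mult fin tendsto_intros)
    then have "(poly n' \<longlongrightarrow> 0 * poly e s0) (at s0)"
    proof (rule Lim_transform_eventually)
      have "\<forall>\<^sub>F s in at s0. poly (g * e) s \<noteq> 0"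
        by (rule eventually_poly_nonzero_at) (use g e0 in simp)
      moreover have "\<forall>\<^sub>F s in at s0. s \<noteq> s0" by (simp add: eventually_at_filter)
      ultimately show "\<forall>\<^sub>F s in at s0. ((s - s0) * (poly n s / poly d s)) * poly e s = poly n' s"
        by eventually_elim (simp add: nd e field_simps)
    qed
    moreover have "(poly n' \<longlongrightarrow> poly n' s0) (at s0)" by (intro tendsto_intros)
    ultimately have "poly n' s0 = 0 * poly e s0" using LIM_unique by blast
    then have "poly n' s0 = 0" by simp
    then have "is_unit [:- s0, 1:]"
      using cop \<open>poly d' s0 = 0\<close> by (auto simp: poly_eq_0_iff_dvd intro: coprime_common_divisor)
    then show False by (simp add: is_unit_pCons_iff)
  qed
  then have "degree d' = 0" using fundamental_theorem_of_algebra[of d'] by (auto simp: constant_degree)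
  then obtain k where k: "d' = [:k:]" by (metis degree_eq_zeroE)
  then have k0: "k \<noteq> 0" using d' by auto
  have "((\<lambda>s. (poly n s / poly d s) * (k * inverse s ^ degree n')) \<longlongrightarrow> 0 * (k * 0 ^ degree n')) at_infinity"
    by (intro tendsto_mult inf tendsto_const tendsto_power tendsto_inverse_0)
  then have "((\<lambda>s. poly n' s / s ^ degree n') \<longlongrightarrow> 0 * (k * 0 ^ degree n')) at_infinity"
  proof (rule Lim_transform_eventually)
    show "\<forall>\<^sub>F s in at_infinity. (poly n s / poly d s) * (k * inverse s ^ degree n') = poly n' s / s ^ degree n'"
      using eventually_poly_nonzero_infinity[OF g]
    proof eventually_elim
      case (elim s)
      have "poly n s / poly d s = poly n' s / k" using elim by (simp add: nd k)
      then show ?case using k0 by (simp add: power_inverse divide_inverse)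
    qed
  qed
  moreover have "((\<lambda>s. poly n' s / s ^ degree n') \<longlongrightarrow> coeff n' (degree n')) at_infinity"
    by (rule poly_over_power_tendsto) simp
  ultimately have "coeff n' (degree n') = 0 * (k * 0 ^ degree n')"
    using tendsto_unique trivial_limit_at_infinity by blast
  then show False using n' by simp
qed

section \<open>Cluster values of rational functions\<close>

text \<open>
  The roots of a cubic depend continuously on its coefficients, in the weak form that they stay away from
  every number that is not a root of the limiting cubic.
\<close>
lemma cubic_root_repelled:
  fixes A0 A1 A2 A3 :: "complex \<Rightarrow> complex"
  assumes A: "(A0 \<longlongrightarrow> L0) F" "(A1 \<longlongrightarrow> L1) F" "(A2 \<longlongrightarrow> L2) F" "(A3 \<longlongrightarrow> L3) F"
    and c: "L0 + L1 * c + L2 * c^2 + L3 * c^3 \<noteq> 0"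
  shows "\<exists>\<delta>>0. \<forall>\<^sub>F s in F. \<forall>u. A0 s + A1 s * u + A2 s * u^2 + A3 s * u^3 = 0 \<longrightarrow> \<delta> \<le> norm (u - c)"
proof -
  let ?P = "F \<times>\<^sub>F nhds c"
  have fst: "((\<lambda>x. A (fst x)) \<longlongrightarrow> L) ?P" if "(A \<longlongrightarrow> L) F" for A L
    using filterlim_compose[OF that filterlim_fst] .
  have snd: "(snd \<longlongrightarrow> c) ?P" using filterlim_snd by blast
  have "((\<lambda>x. A0 (fst x) + A1 (fst x) * snd x + A2 (fst x) * (snd x)^2 + A3 (fst x) * (snd x)^3)
    \<longlongrightarrow> L0 + L1 * c + L2 * c^2 + L3 * c^3) ?P"
    by (intro tendsto_add tendsto_mult tendsto_power fst snd A)
  then have "\<forall>\<^sub>F x in ?P. A0 (fst x) + A1 (fst x) * snd x + A2 (fst x) * (snd x)^2 + A3 (fst x) * (snd x)^3 \<noteq> 0"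
    using c by (rule tendsto_imp_eventually_ne)
  then obtain P Q where P: "eventually P F" and Q: "eventually Q (nhds c)"
    and PQ: "\<And>s u. P s \<Longrightarrow> Q u \<Longrightarrow> A0 s + A1 s * u + A2 s * u^2 + A3 s * u^3 \<noteq> 0"
    unfolding eventually_prod_filter by auto
  obtain \<delta> where "\<delta> > 0" "\<And>u. dist u c < \<delta> \<Longrightarrow> Q u"
    using Q unfolding eventually_nhds_metric by blast
  then have "\<forall>\<^sub>F s in F. \<forall>u. A0 s + A1 s * u + A2 s * u^2 + A3 s * u^3 = 0 \<longrightarrow> \<delta> \<le> norm (u - c)"
    using P PQ by (elim eventually_mono) (force simp: dist_norm not_less[symmetric])
  with \<open>\<delta> > 0\<close> show ?thesis by blast
qed

lemma finite_cubic_roots: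
  fixes L0 :: complex
  assumes "L0 \<noteq> 0 \<or> L1 \<noteq> 0 \<or> L2 \<noteq> 0 \<or> L3 \<noteq> 0"
  shows "finite {c. L0 + L1 * c + L2 * c^2 + L3 * c^3 = 0}"
proof -
  have "{c. L0 + L1 * c + L2 * c^2 + L3 * c^3 = 0} = {c. poly [:L0, L1, L2, L3:] c = 0}"
    by (simp add: algebra_simps power2_eq_square power3_eq_cube)
  moreover have "[:L0, L1, L2, L3:] \<noteq> 0" using assms by auto
  ultimately show ?thesis using poly_roots_finite by metis
qed

definition repelled :: "(complex \<times> complex \<Rightarrow> complex) \<Rightarrow> complex \<Rightarrow> complex filter \<Rightarrow> bool" where
  "repelled h c F \<longleftrightarrow> (\<exists>\<delta>>0. \<forall>\<^sub>F s in F. \<forall>t. bring_poly s t = 0 \<longrightarrow> \<delta> \<le> norm (h (s, t) - c))"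

text \<open>
  A rational function satisfies its characteristic equation over the rational functions in \<open>s\<close>.  Common
  factors of the coefficients are removed, so that the equation does not degenerate at any \<open>s\<close>.
\<close>
lemma ratfun_cubic_equation:
  assumes "ratfun h"
  obtains n0 n1 n2 n3 q where "q \<noteq> 0" "\<And>s. poly n0 s \<noteq> 0 \<or> poly n1 s \<noteq> 0 \<or> poly n2 s \<noteq> 0 \<or> poly n3 s \<noteq> 0"
    "\<And>s t. bring_poly s t = 0 \<Longrightarrow> poly q s \<noteq> 0 \<Longrightarrow>
       poly n0 s + poly n1 s * h (s, t) + poly n2 s * h (s, t)^2 + poly n3 s * h (s, t)^3 = 0"
proof -
  obtain c0 c1 c2 r where r: "r \<noteq> 0"
    and h: "\<And>s t. bring_poly s t = 0 \<Longrightarrow> poly r s \<noteq> 0 \<Longrightarrow> h (s, t) = normal_form c0 c1 c2 r (s, t)"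
    using ratfun_polyE[OF assms] by metis
  define X :: "complex poly" where "X = [:0,1:]"
  define k3 k2 k1 k0 where "k3 = X^2" and "k2 = - (X^4*c1) + c2*(X^6+2*X)"
    and "k1 = - (X*c1^2) + 4*X^3*c1*c2 + c2^2*(1-2*X^5)"
    and "k0 = - (X^3*c1^3) + X^5*c1^2*c2 + X^2*c1*c2^2 + X^4*c2^3"
  define m0 m1 m2 m3 where "m0 = k3*c0^3 + k2*c0^2 + k1*c0 + k0"
    and "m1 = - (r*(3*k3*c0^2 + 2*k2*c0 + k1))" and "m2 = r^2*(3*k3*c0 + k2)" and "m3 = - (k3*r^3)"
  have m: "poly m0 s + poly m1 s * h (s, t) + poly m2 s * h (s, t)^2 + poly m3 s * h (s, t)^3 = 0"
    if G: "bring_poly s t = 0" and rs: "poly r s \<noteq> 0" for s t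
  proof -
    define u where "u = h (s, t)"
    define d where "d = c0 - smult u r"
    have d: "poly d s = poly c0 s - u * poly r s" by (simp add: d_def)
    have "poly r s * u = poly c0 s + poly c1 s * t + poly c2 s * t^2"
      using h[OF G rs] rs by (simp add: normal_form_def u_def)
    then have "poly d s + poly c1 s * t + poly c2 s * t^2 = 0" by (simp add: d algebra_simps)
    then have "poly (norm_bring_poly d c1 c2) s = 0" using adj_norm[OF G, of d c1 c2] by simp
    moreover have "poly (norm_bring_poly d c1 c2) s = poly k3 s * (poly d s)^3 + poly k2 s * (poly d s)^2 + poly k1 s * poly d s + poly k0 s"
      by (simp add: norm_bring_poly_def Let_def k0_def k1_def k2_def k3_def X_def) algebra
    moreover have "\<dots> = poly m0 s + poly m1 s * u + poly m2 s * u^2 + poly m3 s * u^3"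
      unfolding d m0_def m1_def m2_def m3_def by simp algebra
    ultimately show ?thesis by (simp add: u_def)
  qed
  define g where "g = gcd m0 (gcd m1 (gcd m2 m3))"
  have "m3 \<noteq> 0" using r by (simp add: m3_def k3_def X_def)
  then have g0: "g \<noteq> 0" by (simp add: g_def)
  have dv: "g dvd m0" "g dvd m1" "g dvd m2" "g dvd m3"
    unfolding g_def by (meson dvd_trans gcd_dvd1 gcd_dvd2)+
  then obtain n0 n1 n2 n3 where n: "m0 = g * n0" "m1 = g * n1" "m2 = g * n2" "m3 = g * n3"
    by (metis dvdE)
  show thesis
  proof (rule that[of "r * g" n0 n1 n2 n3])
    show "r * g \<noteq> 0" using r g0 by simp
    show "poly n0 s \<noteq> 0 \<or> poly n1 s \<noteq> 0 \<or> poly n2 s \<noteq> 0 \<or> poly n3 s \<noteq> 0" for s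
    proof (rule ccontr)
      assume "\<not> ?thesis"
      then have dv: "[:- s, 1:] dvd n0" "[:- s, 1:] dvd n1" "[:- s, 1:] dvd n2" "[:- s, 1:] dvd n3"
        by (auto simp: poly_eq_0_iff_dvd)
      have "g * [:- s, 1:] dvd m0" "g * [:- s, 1:] dvd m1" "g * [:- s, 1:] dvd m2" "g * [:- s, 1:] dvd m3"
        unfolding n by (rule mult_dvd_mono[OF dvd_refl dv(1)] mult_dvd_mono[OF dvd_refl dv(2)]
            mult_dvd_mono[OF dvd_refl dv(3)] mult_dvd_mono[OF dvd_refl dv(4)])+
      then have "g * [:- s, 1:] dvd gcd m0 (gcd m1 (gcd m2 m3))" by (intro gcd_greatest)
      then have "g * [:- s, 1:] dvd g" by (simp only: g_def[symmetric])
      then have "[:- s, 1:] dvd 1" using g0 by (metis dvd_times_left_cancel_iff mult.right_neutral)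
      then show False by (simp add: is_unit_pCons_iff)
    qed
    show "poly n0 s + poly n1 s * h (s, t) + poly n2 s * h (s, t)^2 + poly n3 s * h (s, t)^3 = 0"
      if "bring_poly s t = 0" "poly (r * g) s \<noteq> 0" for s t
    proof -
      have "poly g s * (poly n0 s + poly n1 s * h (s, t) + poly n2 s * h (s, t)^2 + poly n3 s * h (s, t)^3) = 0"
        using m[of s t] that by (simp add: n algebra_simps)
      then show ?thesis using that by simp
    qed
  qed
qed

text \<open>
  The exceptional values are the roots of the characteristic cubic at \<open>s0\<close>.
\<close>
lemma finite_not_repelled_at:
  assumes "ratfun h" shows "finite {c. \<not> repelled h c (at s0)}"
proof -
  obtain n0 n1 n2 n3 q where q: "q \<noteq> 0"
    and n: "\<And>s. poly n0 s \<noteq> 0 \<or> poly n1 s \<noteq> 0 \<or> poly n2 s \<noteq> 0 \<or> poly n3 s \<noteq> 0"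
    and eq: "\<And>s t. bring_poly s t = 0 \<Longrightarrow> poly q s \<noteq> 0 \<Longrightarrow>
       poly n0 s + poly n1 s * h (s, t) + poly n2 s * h (s, t)^2 + poly n3 s * h (s, t)^3 = 0"
    using ratfun_cubic_equation[OF assms] by metis
  have "repelled h c (at s0)"
    if c: "poly n0 s0 + poly n1 s0 * c + poly n2 s0 * c^2 + poly n3 s0 * c^3 \<noteq> 0" for c
  proof -
    have T: "(poly p \<longlongrightarrow> poly p s0) (at s0)" for p by (intro tendsto_intros)
    obtain \<delta> where "\<delta> > 0" and ev: "\<forall>\<^sub>F s in at s0. \<forall>u.
        poly n0 s + poly n1 s * u + poly n2 s * u^2 + poly n3 s * u^3 = 0 \<longrightarrow> \<delta> \<le> norm (u - c)"
      using cubic_root_repelled[OF T T T T c] by blast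
    have "\<forall>\<^sub>F s in at s0. \<forall>t. bring_poly s t = 0 \<longrightarrow> \<delta> \<le> norm (h (s, t) - c)"
      using ev eventually_poly_nonzero_at[OF q] by eventually_elim (use eq in blast)
    with \<open>\<delta> > 0\<close> show ?thesis unfolding repelled_def by blast
  qed
  then have "{c. \<not> repelled h c (at s0)} \<subseteq> {c. poly n0 s0 + poly n1 s0 * c + poly n2 s0 * c^2 + poly n3 s0 * c^3 = 0}"
    by blast
  then show ?thesis using finite_subset finite_cubic_roots[OF n] by blast
qed

text \<open>
  The coefficients of the characteristic cubic are first divided by the largest power of \<open>s\<close> that
  occurs; the exceptional values are the roots of the limiting cubic.
\<close>
lemma finite_not_repelled_infinity:
  assumes "ratfun h" shows "finite {c. \<not> repelled h c at_infinity}"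
proof -
  obtain n0 n1 n2 n3 q where q: "q \<noteq> 0"
    and n: "\<And>s. poly n0 s \<noteq> 0 \<or> poly n1 s \<noteq> 0 \<or> poly n2 s \<noteq> 0 \<or> poly n3 s \<noteq> 0"
    and eq: "\<And>s t. bring_poly s t = 0 \<Longrightarrow> poly q s \<noteq> 0 \<Longrightarrow>
       poly n0 s + poly n1 s * h (s, t) + poly n2 s * h (s, t)^2 + poly n3 s * h (s, t)^3 = 0"
    using ratfun_cubic_equation[OF assms] by metis
  define N where "N = Max (degree ` {n0, n1, n2, n3})"
  have le: "degree n0 \<le> N" "degree n1 \<le> N" "degree n2 \<le> N" "degree n3 \<le> N"
    unfolding N_def by (auto intro: Max_ge)
  have "N \<in> degree ` {n0, n1, n2, n3}" unfolding N_def by (rule Max_in) auto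
  then obtain p where p: "p \<in> {n0, n1, n2, n3}" "degree p = N" by blast
  have nz: "coeff n0 N \<noteq> 0 \<or> coeff n1 N \<noteq> 0 \<or> coeff n2 N \<noteq> 0 \<or> coeff n3 N \<noteq> 0"
  proof (rule ccontr)
    assume "\<not> ?thesis"
    then have z: "coeff q N = 0" if "q \<in> {n0, n1, n2, n3}" for q using that by auto
    then have "p = 0" using p leading_coeff_0_iff by metis
    then have "N = 0" using p(2) by simp
    have "q = 0" if "q \<in> {n0, n1, n2, n3}" for q
    proof -
      have "degree q = 0" using that le \<open>N = 0\<close> by auto
      then show ?thesis using z[OF that] \<open>N = 0\<close> leading_coeff_0_iff[of q] by simp
    qed
    then have "n0 = 0" "n1 = 0" "n2 = 0" "n3 = 0" by blast+
    then show False using n[of 0] by simp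
  qed
  have "repelled h c at_infinity"
    if c: "coeff n0 N + coeff n1 N * c + coeff n2 N * c^2 + coeff n3 N * c^3 \<noteq> 0" for c
  proof -
    note T = poly_over_power_tendsto
    obtain \<delta> where "\<delta> > 0" and ev: "\<forall>\<^sub>F s in at_infinity. \<forall>u.
        poly n0 s / s^N + poly n1 s / s^N * u + poly n2 s / s^N * u^2 + poly n3 s / s^N * u^3 = 0 \<longrightarrow> \<delta> \<le> norm (u - c)"
      using cubic_root_repelled[OF T[OF le(1)] T[OF le(2)] T[OF le(3)] T[OF le(4)] c] by blast
    have "\<forall>\<^sub>F s in at_infinity. \<forall>t. bring_poly s t = 0 \<longrightarrow> \<delta> \<le> norm (h (s, t) - c)"
      using ev eventually_poly_nonzero_infinity[OF q]
    proof eventually_elim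
      case (elim s)
      show ?case
      proof (intro allI impI)
        fix t assume "bring_poly s t = 0"
        then have "(poly n0 s + poly n1 s * h (s, t) + poly n2 s * h (s, t)^2 + poly n3 s * h (s, t)^3) / s^N = 0"
          using eq elim(2) by simp
        then show "\<delta> \<le> norm (h (s, t) - c)" using elim(1) by (simp add: add_divide_distrib)
      qed
    qed
    with \<open>\<delta> > 0\<close> show ?thesis unfolding repelled_def by blast
  qed
  then have "{c. \<not> repelled h c at_infinity} \<subseteq> {c. coeff n0 N + coeff n1 N * c + coeff n2 N * c^2 + coeff n3 N * c^3 = 0}"
    by blast
  then show ?thesis using finite_subset finite_cubic_roots[OF nz] by blast
qed

section \<open>Ramification and the size of the holomorphic differentials\<close>

text \<open>
  The three finite points over \<open>s\<close>, for \<open>s \<noteq> 0\<close>.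
\<close>
definition fibre_roots :: "complex \<Rightarrow> complex \<Rightarrow> complex \<Rightarrow> complex \<Rightarrow> bool" where
  "fibre_roots s t1 t2 t3 \<longleftrightarrow> (\<forall>t. bring_poly s t = s * (t - t1) * (t - t2) * (t - t3))"

text \<open>
  The branch points of the projection to \<open>s\<close> are the zeros of this polynomial together with \<open>0\<close> and \<open>\<infinity>\<close>: the twelve
  vertices of an icosahedron.
\<close>
definition icos :: "complex poly" where
  "icos = monom 1 10 + monom 11 5 - 1"

lemma poly_icos: "poly icos s = s^10 + 11 * s^5 - 1"
  by (simp add: icos_def poly_monom)

lemma icos_nonzero [simp]: "icos \<noteq> 0"
proof
  assume "icos = 0"
  then have "poly icos 0 = 0" by simp
  then show False by (simp add: poly_icos)
qed

lemma fibre_roots_ex: "s \<noteq> 0 \<Longrightarrow> \<exists>t1 t2 t3. fibre_roots s t1 t2 t3"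
  unfolding fibre_roots_def by (rule bring_poly_factor[of s]) auto

lemma fibre_roots_swap: "fibre_roots s t1 t2 t3 \<Longrightarrow> fibre_roots s t2 t1 t3" "fibre_roots s t1 t2 t3 \<Longrightarrow> fibre_roots s t3 t1 t2"
  unfolding fibre_roots_def by (simp_all add: algebra_simps)

lemma fibre_roots_root: "fibre_roots s t1 t2 t3 \<Longrightarrow> bring_poly s t1 = 0 \<and> bring_poly s t2 = 0 \<and> bring_poly s t3 = 0"
  unfolding fibre_roots_def by simp

lemma fibre_roots_root_iff: "fibre_roots s t1 t2 t3 \<Longrightarrow> s \<noteq> 0 \<Longrightarrow> bring_poly s t = 0 \<longleftrightarrow> t = t1 \<or> t = t2 \<or> t = t3"
  unfolding fibre_roots_def by auto

text \<open>
  The discriminant has only simple zeros, so all branch points are simple.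
\<close>
lemma bring_poly_disc:
  assumes f: "fibre_roots s t1 t2 t3" and s: "s \<noteq> 0"
  shows "s^4 * ((t1 - t2) * (t1 - t3) * (t2 - t3))^2 = - (4 * s * poly icos s)"
proof -
  define e1 e2 e3 where "e1 = t1 + t2 + t3" and "e2 = t1*t2 + t1*t3 + t2*t3" and "e3 = t1*t2*t3"
  have e: "e1 = - (s^2)" "s * e2 = - 1" "e3 = - s"
    using bring_poly_vieta[of s t1 t2 t3] f s by (simp_all add: e1_def e2_def e3_def fibre_roots_def)
  have "((t1 - t2) * (t1 - t3) * (t2 - t3))^2 = e1^2*e2^2 - 4*e2^3 - 4*e1^3*e3 + 18*e1*e2*e3 - 27*e3^2"
    unfolding e1_def e2_def e3_def by algebra
  then have "s^4 * ((t1 - t2) * (t1 - t3) * (t2 - t3))^2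
     = s^2*e1^2*(s*e2)^2 - 4 * s*(s*e2)^3 - 4 * s^4*e1^3*e3 + 18 * s^3*e1*(s*e2)*e3 - 27 * s^4*e3^2"
    by algebra
  also have "\<dots> = - (4 * s * poly icos s)"
    unfolding e poly_icos by algebra
  finally show ?thesis .
qed

lemma fibre_roots_distinct:
  assumes f: "fibre_roots s t1 t2 t3" and s: "s \<noteq> 0" "poly icos s \<noteq> 0"
  shows "t1 \<noteq> t2" "t1 \<noteq> t3" "t2 \<noteq> t3"
  using bring_poly_disc[OF f s(1)] s by auto

text \<open>
  The size of \<open>1 + \<bar>t\<bar>\<close> times the holomorphic differential \<open>ds\<close> divided by the partial derivative of the cubic with respect to \<open>t\<close>.
\<close>
definition trace_weight :: "complex \<Rightarrow> complex \<Rightarrow> complex \<Rightarrow> complex \<Rightarrow> real" where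
  "trace_weight s t1 t2 t3 = (1 + norm t1) / norm (s * (t1 - t2) * (t1 - t3))"

lemma trace_weight_square:
  assumes f: "fibre_roots s t1 t2 t3" and s: "s \<noteq> 0" "poly icos s \<noteq> 0"
  shows "(trace_weight s t1 t2 t3)^2 = ((1 + norm t1) * norm (t2 - t3))^2 * norm s / (4 * norm (poly icos s))"
proof -
  define p q r where "p = norm (t1 - t2)" and "q = norm (t1 - t3)" and "r = norm (t2 - t3)"
  have pos: "p > 0" "q > 0" "r > 0" using fibre_roots_distinct[OF f s] by (auto simp: p_def q_def r_def)
  have "norm (s^4 * ((t1 - t2) * (t1 - t3) * (t2 - t3))^2) = norm (- (4 * s * poly icos s))"
    using bring_poly_disc[OF f s(1)] by simp
  then have "norm s ^ 4 * (p * q * r)^2 = 4 * norm s * norm (poly icos s)"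
    unfolding p_def q_def r_def by (simp add: norm_mult norm_power)
  then have "norm s * (norm s ^ 3 * (p * q * r)^2) = norm s * (4 * norm (poly icos s))"
    by algebra
  then have E: "norm s ^ 3 * (p * q * r)^2 = 4 * norm (poly icos s)" using s by simp
  have "(trace_weight s t1 t2 t3)^2 = (1 + norm t1)^2 / (norm s ^ 2 * p^2 * q^2)"
    by (simp add: trace_weight_def norm_mult power_divide power_mult_distrib p_def q_def)
  also have "\<dots> = ((1 + norm t1)^2 * (r^2 * norm s)) / ((norm s ^ 2 * p^2 * q^2) * (r^2 * norm s))"
    using pos s by simp
  also have "(norm s ^ 2 * p^2 * q^2) * (r^2 * norm s) = norm s ^ 3 * (p * q * r)^2"
    by (simp add: power_mult_distrib power2_eq_square power3_eq_cube)
  finally show ?thesis unfolding E by (simp add: r_def power_mult_distrib)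
qed

lemma trace_weight_small:
  assumes nz: "\<forall>\<^sub>F s in F. s \<noteq> 0 \<and> poly icos s \<noteq> 0"
    and B: "\<forall>\<^sub>F s in F. \<forall>t1 t2 t3. fibre_roots s t1 t2 t3 \<longrightarrow> ((1 + norm t1) * norm (t2 - t3))^2 \<le> B s"
    and lim: "((\<lambda>s. (a s)^2 * (B s * norm s / (4 * norm (poly icos s)))) \<longlongrightarrow> 0) F"
    and \<eta>: "\<eta> > 0"
  shows "\<forall>\<^sub>F s in F. \<forall>t1 t2 t3. fibre_roots s t1 t2 t3 \<longrightarrow> a s * trace_weight s t1 t2 t3 \<le> \<eta>"
proof -
  have "\<forall>\<^sub>F s in F. (a s)^2 * (B s * norm s / (4 * norm (poly icos s))) < \<eta>^2"
    using lim \<eta> by (intro order_tendstoD(2)[OF lim]) simp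
  with nz B show ?thesis
  proof eventually_elim
    case (elim s)
    show ?case
    proof (intro allI impI)
      fix t1 t2 t3 assume f: "fibre_roots s t1 t2 t3"
      have "(a s * trace_weight s t1 t2 t3)^2 = (a s)^2 * (((1 + norm t1) * norm (t2 - t3))^2 * norm s / (4 * norm (poly icos s)))"
        using trace_weight_square[OF f] elim(1) by (simp add: power_mult_distrib)
      also have "\<dots> \<le> (a s)^2 * (B s * norm s / (4 * norm (poly icos s)))"
        using elim(2) f by (intro mult_left_mono divide_right_mono mult_right_mono) auto
      also have "\<dots> \<le> \<eta>^2" using elim(3) by simp
      finally have "(a s * trace_weight s t1 t2 t3)^2 \<le> \<eta>^2" .
      then show "a s * trace_weight s t1 t2 t3 \<le> \<eta>" by (rule power2_le_imp_le) (use \<eta> in simp)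
    qed
  qed
qed

lemma root_bound:
  assumes "bring_poly s t = 0" "s \<noteq> 0"
  shows "norm t \<le> 1 \<or> norm t \<le> norm s ^ 2 + 1 / norm s + norm s"
proof (cases "norm t \<le> 1")
  case False
  then have t: "norm t \<ge> 1" by simp
  have "s * t^3 = - (s * (s^2 * t^2)) + t - s * s" using assms(1)
    by (simp add: bring_poly_def power2_eq_square power3_eq_cube) algebra
  then have "t^3 = - (s^2 * t^2) + t / s - s"
    using assms(2) by (simp add: field_simps)
  then have "norm (t^3) \<le> norm (- (s^2 * t^2) + t / s) + norm s" by (metis norm_triangle_ineq4)
  also have "\<dots> \<le> norm (s^2 * t^2) + norm (t / s) + norm s"
    using norm_triangle_ineq[of "- (s^2 * t^2)" "t / s"] by simp
  also have "\<dots> = norm s ^ 2 * norm t ^ 2 + norm t * (1 / norm s) + norm s * 1"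
    by (simp add: norm_mult norm_power norm_divide)
  also have "\<dots> \<le> norm s ^ 2 * norm t ^ 2 + norm t ^ 2 * (1 / norm s) + norm s * norm t ^ 2"
    using t by (intro add_mono mult_left_mono mult_right_mono order_refl)
      (auto simp: power2_eq_square mult_le_cancel_left1 intro: mult_ge1_I)
  also have "\<dots> = norm t ^ 2 * (norm s ^ 2 + 1 / norm s + norm s)" by (simp add: algebra_simps)
  finally have "norm (t^3) \<le> norm t ^ 2 * (norm s ^ 2 + 1 / norm s + norm s)" .
  moreover have "norm (t^3) = norm t ^ 2 * norm t"
    unfolding norm_power by (simp add: power2_eq_square power3_eq_cube)
  ultimately have "norm t ^ 2 * norm t \<le> norm t ^ 2 * (norm s ^ 2 + 1 / norm s + norm s)" by simp
  moreover have "norm t ^ 2 > 0" using t by (intro zero_less_power) linarith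
  ultimately show ?thesis by (metis mult_le_cancel_left_pos)
qed simp

lemma root_bound_near_zero:
  assumes G: "bring_poly s t = 0" and s: "s \<noteq> 0" "norm s \<le> 1/2"
  shows "norm t ^ 2 * norm s \<le> 4"
proof (rule ccontr)
  assume "\<not> ?thesis"
  then have big: "norm t ^ 2 * norm s > 4" by simp
  have "norm t ^ 2 * (1/2) \<ge> norm t ^ 2 * norm s" using s by (intro mult_left_mono) auto
  with big have "norm t ^ 2 > 2 ^ 2" by simp
  then have t: "norm t > 2" by (rule power_less_imp_less_base) simp
  have "s * t^3 = t - s^2 - s^3 * t^2" using G by (simp add: bring_poly_def) algebra
  then have "norm (s * t^3) \<le> norm (t - s^2) + norm (s^3 * t^2)" by (metis norm_triangle_ineq4)
  also have "\<dots> \<le> norm t + norm s ^ 2 + norm s ^ 3 * norm t ^ 2"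
    using norm_triangle_ineq4[of t "s^2"] by (simp add: norm_mult norm_power)
  finally have 1: "norm s * norm t ^ 3 \<le> norm t + norm s ^ 2 + norm s ^ 3 * norm t ^ 2"
    by (simp add: norm_mult norm_power)
  have "norm s ^ 2 \<le> (1/2)^2" using s by (intro power_mono) auto
  then have s2: "norm s ^ 2 \<le> 1/4" by (simp add: power2_eq_square)
  define X where "X = norm t ^ 2 * norm s"
  have "norm s ^ 3 * norm t ^ 2 = norm s ^ 2 * X" by (simp add: X_def power2_eq_square power3_eq_cube)
  also have "\<dots> \<le> 1/4 * X" using s2 by (intro mult_right_mono) (auto simp: X_def)
  finally have 2: "norm s ^ 3 * norm t ^ 2 \<le> X / 4" by simp
  have 3: "norm s * norm t ^ 3 = norm t * X" by (simp add: X_def power2_eq_square power3_eq_cube)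
  have "(norm t - 1/4) * 4 \<le> (norm t - 1/4) * X" using big t by (intro mult_left_mono) (auto simp: X_def)
  then have "4 * norm t - 1 \<le> norm t * X - X / 4"
    by (simp add: left_diff_distrib)
  with 1 2 3 s2 t show False by linarith
qed

text \<open>
  At a branch point the derivative of the cubic vanishes only like a square root, since the
  discriminant has a simple zero there; hence the weight is of smaller order than a simple pole.
\<close>
lemma trace_weight_near_point:
  assumes \<eta>: "\<eta> > 0"
  shows "\<forall>\<^sub>F s in at s0. \<forall>t1 t2 t3. fibre_roots s t1 t2 t3 \<longrightarrow> norm (s - s0) * trace_weight s t1 t2 t3 \<le> \<eta>"
proof -
  have nz0: "\<forall>\<^sub>F s::complex in at s0. s \<noteq> 0" using eventually_poly_nonzero_at[of "[:0,1:]"] by simp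
  then have nz: "\<forall>\<^sub>F s in at s0. s \<noteq> 0 \<and> poly icos s \<noteq> 0"
    using eventually_poly_nonzero_at[OF icos_nonzero] by eventually_elim simp
  show ?thesis
  proof (cases "s0 = 0")
    case True
    have small: "\<forall>\<^sub>F s::complex in at s0. norm s < 1/2"
      unfolding True by (auto simp: eventually_at dist_norm intro!: exI[of _ "1/2"])
    have B: "\<forall>\<^sub>F s in at s0. \<forall>t1 t2 t3. fibre_roots s t1 t2 t3 \<longrightarrow> ((1 + norm t1) * norm (t2 - t3))^2 \<le> 160 / norm s ^ 2"
      using nz small
    proof eventually_elim
      case (elim s)
      show ?case
      proof (intro allI impI)
        fix t1 t2 t3 assume f: "fibre_roots s t1 t2 t3"
        have b: "norm t ^ 2 \<le> 4 / norm s" if "bring_poly s t = 0" for t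
          using root_bound_near_zero[OF that] elim by (simp add: field_simps)
        have sp: "norm s > 0" "1 / norm s \<ge> 1" using elim by (auto simp: field_simps)
        have "(1 + norm t1)^2 \<le> 2 + 2 * norm t1 ^ 2"
          using sum_squares_bound[of 1 "norm t1"] by (simp add: power2_eq_square algebra_simps)
        also have "\<dots> \<le> 2 * (1 / norm s) + 2 * (4 / norm s)"
        proof (rule add_mono)
          show "2 \<le> 2 * (1 / norm s)" using sp(2) by linarith
          show "2 * norm t1 ^ 2 \<le> 2 * (4 / norm s)" using b[of t1] fibre_roots_root[OF f] by simp
        qed
        also have "\<dots> = 10 / norm s" by simp
        finally have 1: "(1 + norm t1)^2 \<le> 10 / norm s" .
        have "norm (t2 - t3) ^ 2 \<le> (norm t2 + norm t3)^2" by (intro power_mono norm_triangle_ineq4) auto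
        also have "\<dots> \<le> 2 * norm t2 ^ 2 + 2 * norm t3 ^ 2"
          using sum_squares_bound[of "norm t2" "norm t3"] by (simp add: power2_eq_square algebra_simps)
        also have "\<dots> \<le> 16 / norm s" using b[of t2] b[of t3] fibre_roots_root[OF f] by simp
        finally have 2: "norm (t2 - t3) ^ 2 \<le> 16 / norm s" .
        have "((1 + norm t1) * norm (t2 - t3))^2 \<le> (10 / norm s) * (16 / norm s)"
          unfolding power_mult_distrib by (intro mult_mono 1 2) auto
        then show "((1 + norm t1) * norm (t2 - t3))^2 \<le> 160 / norm s ^ 2" by (simp add: power2_eq_square)
      qed
    qed
    have "((\<lambda>s. 40 * norm s / norm (poly icos s)) \<longlongrightarrow> 40 * norm s0 / norm (poly icos s0)) (at s0)"
      using True by (intro tendsto_intros) (simp add: poly_icos)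
    then have "((\<lambda>s. 40 * norm s / norm (poly icos s)) \<longlongrightarrow> 0) (at s0)" by (simp add: True)
    then have "((\<lambda>s. (norm (s - s0))^2 * (160 / norm s ^ 2 * norm s / (4 * norm (poly icos s)))) \<longlongrightarrow> 0) (at s0)"
    proof (rule Lim_transform_eventually)
      show "\<forall>\<^sub>F s in at s0. 40 * norm s / norm (poly icos s) = (norm (s - s0))^2 * (160 / norm s ^ 2 * norm s / (4 * norm (poly icos s)))"
        using nz by eventually_elim (simp add: True)
    qed
    from trace_weight_small[OF nz B this \<eta>] show ?thesis .
  next
    case False
    define C where "C = norm s0 ^ 2 + 1 / norm s0 + norm s0 + 1"
    have C: "C \<ge> 1" by (simp add: C_def)
    have "((\<lambda>s. norm s ^ 2 + 1 / norm s + norm s) \<longlongrightarrow> norm s0 ^ 2 + 1 / norm s0 + norm s0) (at s0)"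
      using False by (intro tendsto_intros) auto
    then have ev: "\<forall>\<^sub>F s in at s0. norm s ^ 2 + 1 / norm s + norm s < C"
      by (rule order_tendstoD(2)) (simp add: C_def)
    have B: "\<forall>\<^sub>F s in at s0. \<forall>t1 t2 t3. fibre_roots s t1 t2 t3 \<longrightarrow> ((1 + norm t1) * norm (t2 - t3))^2 \<le> ((1 + C) * (2 * C))^2"
      using nz ev
    proof eventually_elim
      case (elim s)
      show ?case
      proof (intro allI impI)
        fix t1 t2 t3 assume f: "fibre_roots s t1 t2 t3"
        have b: "norm t \<le> C" if "bring_poly s t = 0" for t
          using root_bound[OF that] elim C by linarith
        have "norm t1 \<le> C" "norm t2 \<le> C" "norm t3 \<le> C" using b fibre_roots_root[OF f] by auto
        moreover have "norm (t2 - t3) \<le> norm t2 + norm t3" by (rule norm_triangle_ineq4)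
        ultimately have "(1 + norm t1) * norm (t2 - t3) \<le> (1 + C) * (2 * C)"
          using C by (intro mult_mono) auto
        then show "((1 + norm t1) * norm (t2 - t3))^2 \<le> ((1 + C) * (2 * C))^2"
          by (intro power_mono) auto
      qed
    qed
    have sq: "((\<lambda>s. (s - s0)^2 / poly icos s) \<longlongrightarrow> 0) (at s0)"
    proof (cases "poly icos s0 = 0")
      case nonroot: False
      have "((\<lambda>s. (s - s0)^2 / poly icos s) \<longlongrightarrow> (s0 - s0)^2 / poly icos s0) (at s0)"
        using nonroot by (intro tendsto_intros)
      then show ?thesis by simp
    next
      case root: True
      have D: "((\<lambda>s. (poly icos s - poly icos s0) / (s - s0)) \<longlongrightarrow> poly (pderiv icos) s0) (at s0)"
        using poly_DERIV[of icos s0] by (simp add: has_field_derivative_iff)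
      have pd: "poly (pderiv icos) s0 = 5 * s0^4 * (2 * s0^5 + 11)"
        by (simp add: icos_def pderiv_add pderiv_diff pderiv_monom poly_monom algebra_simps)
      have "2 * s0^5 + 11 \<noteq> 0"
      proof
        assume "2 * s0^5 + 11 = 0"
        then have "s0^5 = - 11 / 2" by algebra
        moreover have "(s0^5)^2 + 11 * s0^5 - 1 = 0" using root by (simp add: poly_icos)
        ultimately show False by (simp add: power2_eq_square)
      qed
      then have nz': "poly (pderiv icos) s0 \<noteq> 0" using False pd by simp
      have "((\<lambda>s. s - s0) \<longlongrightarrow> s0 - s0) (at s0)" by (intro tendsto_intros)
      from tendsto_divide[OF this D nz']
      have "((\<lambda>s. (s - s0) / ((poly icos s - poly icos s0) / (s - s0))) \<longlongrightarrow> 0) (at s0)"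
        by simp
      then show ?thesis by (simp add: root power2_eq_square)
    qed
    have "((\<lambda>s. norm ((s - s0)^2 / poly icos s) * (((1 + C) * (2 * C))^2 * norm s / 4)) \<longlongrightarrow> norm (0::complex) * (((1 + C) * (2 * C))^2 * norm s0 / 4)) (at s0)"
      by (intro tendsto_intros sq) auto
    then have "((\<lambda>s. (norm (s - s0))^2 * (((1 + C) * (2 * C))^2 * norm s / (4 * norm (poly icos s)))) \<longlongrightarrow> 0) (at s0)"
      by (simp add: norm_divide norm_power mult_ac)
    from trace_weight_small[OF nz B this \<eta>] show ?thesis .
  qed
qed

text \<open>
  The differentials \<open>ds\<close> and \<open>t ds\<close> divided by the derivative of the cubic are not only holomorphic at the points over
  infinity but vanish there, as \<open>1\<close> and \<open>t\<close> do relative to \<open>s\<close> and \<open>s t\<close>.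
\<close>
lemma trace_weight_infinity:
  assumes \<eta>: "\<eta> > 0"
  shows "\<forall>\<^sub>F s in at_infinity. \<forall>t1 t2 t3. fibre_roots s t1 t2 t3 \<longrightarrow> norm s ^ 2 * trace_weight s t1 t2 t3 \<le> \<eta>"
proof -
  have large: "\<forall>\<^sub>F s::complex in at_infinity. 2 \<le> norm s"
    unfolding eventually_at_infinity by blast
  have nz: "\<forall>\<^sub>F s in at_infinity. s \<noteq> 0 \<and> poly icos s \<noteq> 0"
    using large eventually_poly_nonzero_infinity[OF icos_nonzero] by eventually_elim auto
  have B: "\<forall>\<^sub>F s in at_infinity. \<forall>t1 t2 t3. fibre_roots s t1 t2 t3 \<longrightarrow> ((1 + norm t1) * norm (t2 - t3))^2 \<le> (6 * norm s ^ 2)^2"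
    using large
  proof eventually_elim
    case (elim s)
    then have s0: "s \<noteq> 0" by auto
    have s2: "norm s ^ 2 \<ge> 2 * norm s" using mult_right_mono[OF elim, of "norm s"] by (simp add: power2_eq_square)
    have inv: "1 / norm s \<le> 1/2" using le_imp_inverse_le[OF elim] by (simp add: inverse_eq_divide)
    have up: "norm t \<le> 2 * norm s ^ 2" if "bring_poly s t = 0" for t
      using root_bound[OF that s0] s2 inv elim by linarith
    have low: "1 / norm s \<le> norm t" if "bring_poly s t = 0" for t
    proof (rule ccontr)
      assume "\<not> ?thesis"
      then have t: "norm t < 1 / norm s" by simp
      have ts: "norm t * norm s \<le> 1" using t s0 by (simp add: field_simps)
      have "s^2 = t - s * t^3 - s^3 * t^2" using that by (simp add: bring_poly_def) algebra
      then have "norm (s^2) \<le> norm (t - s * t^3) + norm (s^3 * t^2)" by (metis norm_triangle_ineq4)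
      also have "\<dots> \<le> norm t + norm (s * t^3) + norm (s^3 * t^2)"
        using norm_triangle_ineq4[of t "s * t^3"] by simp
      also have "\<dots> = norm t + (norm t * norm s) * norm t ^ 2 + norm s * (norm t * norm s)^2"
        by (simp add: norm_mult norm_power power2_eq_square power3_eq_cube)
      also have "\<dots> \<le> 1/2 + 1 * (1/2)^2 + norm s * 1^2"
        using t inv ts by (intro add_mono mult_mono power_mono) auto
      finally show False using s2 elim unfolding norm_power by (simp add: power2_eq_square)
    qed
    show ?case
    proof (intro allI impI)
      fix t1 t2 t3 assume f: "fibre_roots s t1 t2 t3"
      have "t1 * t2 * t3 = - s" using bring_poly_vieta(3)[of s t1 t2 t3] f s0 by (simp add: fibre_roots_def)
      then have prod: "norm t1 * norm t2 * norm t3 = norm s" by (metis norm_minus_cancel norm_mult)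
      have bnd: "x \<le> norm s ^ 2" if "x * y = norm s" "1 / norm s \<le> y" "x \<ge> 0" for x y :: real
      proof -
        have "x * (1 / norm s) \<le> norm s" using mult_left_mono[OF that(2,3)] that(1) by simp
        then show ?thesis using s0 by (simp add: field_simps power2_eq_square)
      qed
      have 12: "norm t1 * norm t2 \<le> norm s ^ 2" using prod low fibre_roots_root[OF f] by (intro bnd) auto
      have 13: "norm t1 * norm t3 \<le> norm s ^ 2"
        by (rule bnd[of _ "norm t2"]) (use prod low fibre_roots_root[OF f] in \<open>auto simp: mult_ac\<close>)
      have u: "norm t2 \<le> 2 * norm s ^ 2" "norm t3 \<le> 2 * norm s ^ 2" using up fibre_roots_root[OF f] by auto
      have "(1 + norm t1) * norm (t2 - t3) \<le> (1 + norm t1) * (norm t2 + norm t3)"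
        by (intro mult_left_mono norm_triangle_ineq4) auto
      also have "\<dots> = norm t2 + norm t3 + norm t1 * norm t2 + norm t1 * norm t3" by (simp add: algebra_simps)
      also have "\<dots> \<le> 6 * norm s ^ 2" using 12 13 u by linarith
      finally show "((1 + norm t1) * norm (t2 - t3))^2 \<le> (6 * norm s ^ 2)^2"
        by (intro power_mono) auto
    qed
  qed
  have lead: "((\<lambda>s. poly icos s / s ^ 10) \<longlongrightarrow> 1) at_infinity"
  proof -
    have "degree icos \<le> 10" unfolding icos_def
      by (intro degree_diff_le degree_add_le) (auto simp: degree_monom_le order.trans[OF degree_monom_le])
    moreover have "coeff icos 10 = 1" by (simp add: icos_def)
    ultimately show ?thesis using poly_over_power_tendsto[of icos 10] by simp
  qed
  have "((\<lambda>s. norm (inverse s * inverse (poly icos s / s ^ 10)) * 9) \<longlongrightarrow> norm (0 * inverse (1::complex)) * 9) at_infinity"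
    by (intro tendsto_mult tendsto_norm tendsto_inverse_0 tendsto_inverse lead tendsto_const) simp
  then have "((\<lambda>s. norm (inverse s * inverse (poly icos s / s ^ 10)) * 9) \<longlongrightarrow> 0) at_infinity" by simp
  then have "((\<lambda>s. (norm s ^ 2)^2 * ((6 * norm s ^ 2)^2 * norm s / (4 * norm (poly icos s)))) \<longlongrightarrow> 0) at_infinity"
  proof (rule Lim_transform_eventually)
    show "\<forall>\<^sub>F s in at_infinity. norm (inverse s * inverse (poly icos s / s ^ 10)) * 9
        = (norm s ^ 2)^2 * ((6 * norm s ^ 2)^2 * norm s / (4 * norm (poly icos s)))"
      using nz
    proof eventually_elim
      case (elim s)
      have "norm (inverse s * inverse (poly icos s / s ^ 10)) = norm s ^ 9 / norm (poly icos s)"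
        using elim by (simp add: norm_mult norm_inverse norm_divide norm_power eval_nat_numeral)
      moreover have "(norm s ^ 2)^2 * ((6 * norm s ^ 2)^2 * norm s) = norm s ^ 9 * 36"
        by (simp add: eval_nat_numeral)
      ultimately show ?case by (simp add: field_simps)
    qed
  qed
  from trace_weight_small[OF nz B this \<eta>] show ?thesis .
qed

section \<open>A residue theorem\<close>

text \<open>
  Lagrange interpolation: the sum is the leading coefficient of the polynomial interpolating a quadratic at
  the three nodes, which is the quadratic itself.
\<close>
lemma lagrange_sum:
  fixes t1 t2 t3 :: complex
  assumes "t1 \<noteq> t2" "t1 \<noteq> t3" "t2 \<noteq> t3"
  shows "(c0 + c1 * t1 + c2 * t1^2) / ((t1 - t2) * (t1 - t3)) + (c0 + c1 * t2 + c2 * t2^2) / ((t2 - t1) * (t2 - t3))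
     + (c0 + c1 * t3 + c2 * t3^2) / ((t3 - t1) * (t3 - t2)) = c2"
proof -
  define a b c where "a = t1 - t2" and "b = t1 - t3" and "c = t2 - t3"
  have nz: "a \<noteq> 0" "b \<noteq> 0" "c \<noteq> 0" using assms by (auto simp: a_def b_def c_def)
  let ?f = "\<lambda>t. c0 + c1 * t + c2 * t^2"
  have "?f t1 / (a * b) = ?f t1 * c / (a * b * c)" "?f t2 / ((- a) * c) = - (?f t2 * b) / (a * b * c)"
    "?f t3 / ((- b) * (- c)) = ?f t3 * a / (a * b * c)"
    using nz by simp_all
  moreover have "?f t1 * c - ?f t2 * b + ?f t3 * a = c2 * (a * b * c)"
    unfolding a_def b_def c_def by algebra
  ultimately have "?f t1 / (a * b) + ?f t2 / ((- a) * c) + ?f t3 / ((- b) * (- c)) = c2 * (a * b * c) / (a * b * c)"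
    by (simp only: add_divide_distrib[symmetric]) simp
  then show ?thesis using nz by (simp add: a_def b_def c_def)
qed

text \<open>
  The coefficient of \<open>t^2\<close> in a rational function is, up to the factor \<open>s r\<close>, the trace of the function times the
  differential \<open>ds\<close> divided by the derivative of the cubic.  It is a rational function of \<open>s\<close>, and this is what makes the
  residue theorem below a statement about one variable.
\<close>
lemma trace_formula:
  assumes f: "fibre_roots s t1 t2 t3" and s: "s \<noteq> 0" "poly icos s \<noteq> 0" "poly r s \<noteq> 0"
    and F: "\<And>t. bring_poly s t = 0 \<Longrightarrow> F (s, t) = normal_form c0 c1 c2 r (s, t)"
  shows "poly c2 s / (s * poly r s) = F (s, t1) / (s * (t1 - t2) * (t1 - t3))
      + F (s, t2) / (s * (t2 - t1) * (t2 - t3)) + F (s, t3) / (s * (t3 - t1) * (t3 - t2))"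
proof -
  note d = fibre_roots_distinct[OF f s(1,2)]
  have "F (s, t1) / (s * (t1 - t2) * (t1 - t3))
      + F (s, t2) / (s * (t2 - t1) * (t2 - t3)) + F (s, t3) / (s * (t3 - t1) * (t3 - t2))
    = ((poly c0 s + poly c1 s * t1 + poly c2 s * t1^2) / ((t1 - t2) * (t1 - t3))
      + (poly c0 s + poly c1 s * t2 + poly c2 s * t2^2) / ((t2 - t1) * (t2 - t3))
     + (poly c0 s + poly c1 s * t3 + poly c2 s * t3^2) / ((t3 - t1) * (t3 - t2))) / (s * poly r s)"
    using F fibre_roots_root[OF f] by (simp add: normal_form_def add_divide_distrib mult_ac)
  then show ?thesis unfolding lagrange_sum[OF d] by simp
qed

lemma trace_bound:
  assumes f: "fibre_roots s t1 t2 t3" and s: "s \<noteq> 0" "poly icos s \<noteq> 0" "poly r s \<noteq> 0"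
    and F: "\<And>t. bring_poly s t = 0 \<Longrightarrow> F (s, t) = normal_form c0 c1 c2 r (s, t)"
    and m: "m \<ge> 0" and B: "\<And>t. bring_poly s t = 0 \<Longrightarrow> m * norm (F (s, t)) \<le> K * (1 + norm t)"
  shows "m * norm (poly c2 s / (s * poly r s)) \<le> K * (trace_weight s t1 t2 t3 + trace_weight s t2 t1 t3 + trace_weight s t3 t1 t2)"
proof -
  have *: "m * norm (F (s, t) / (s * (t - u) * (t - v))) \<le> K * trace_weight s t u v" if "bring_poly s t = 0" for t u v
    using divide_right_mono[OF B[OF that], of "norm (s * (t - u) * (t - v))"]
    by (simp add: trace_weight_def norm_divide)
  have tf: "poly c2 s / (s * poly r s) = F (s, t1) / (s * (t1 - t2) * (t1 - t3))
      + F (s, t2) / (s * (t2 - t1) * (t2 - t3)) + F (s, t3) / (s * (t3 - t1) * (t3 - t2))"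
    by (rule trace_formula[OF f s]) (rule F)
  have "norm (poly c2 s / (s * poly r s))
     \<le> norm (F (s, t1) / (s * (t1 - t2) * (t1 - t3)))
      + norm (F (s, t2) / (s * (t2 - t1) * (t2 - t3))) + norm (F (s, t3) / (s * (t3 - t1) * (t3 - t2)))"
    unfolding tf
    by (intro order_trans[OF norm_triangle_ineq] add_right_mono norm_triangle_ineq)
  then have "m * norm (poly c2 s / (s * poly r s))
     \<le> m * (norm (F (s, t1) / (s * (t1 - t2) * (t1 - t3)))
      + norm (F (s, t2) / (s * (t2 - t1) * (t2 - t3))) + norm (F (s, t3) / (s * (t3 - t1) * (t3 - t2))))"
    using m by (rule mult_left_mono)
  also have "\<dots> \<le> K * (trace_weight s t1 t2 t3 + trace_weight s t2 t1 t3 + trace_weight s t3 t1 t2)"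
    using *[of t1 t2 t3] *[of t2 t1 t3] *[of t3 t1 t2] fibre_roots_root[OF f] by (simp add: distrib_left)
  finally show ?thesis .
qed

text \<open>
  The bounds say that \<open>F\<close> times the basic holomorphic differential has no poles except at most simple ones over
  the single value \<open>s3\<close>.  Its trace is a differential on the projective line with at most one simple pole, so the trace has
  residue \<open>0\<close> there and is identically zero.
\<close>
lemma residue_theorem:
  assumes r: "r \<noteq> 0"
    and F: "\<And>s t. bring_poly s t = 0 \<Longrightarrow> poly r s \<noteq> 0 \<Longrightarrow> F (s, t) = normal_form c0 c1 c2 r (s, t)"
    and fin: "\<And>s0. \<exists>K. \<forall>\<^sub>F s in at s0. \<forall>t. bring_poly s t = 0 \<longrightarrow> norm (s - s3) * norm (F (s, t)) \<le> K * (1 + norm t)"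
    and inf: "\<exists>K. \<forall>\<^sub>F s in at_infinity. \<forall>t. bring_poly s t = 0 \<longrightarrow> norm (F (s, t)) \<le> K * norm s * (1 + norm t)"
  shows "c2 = 0"
proof -
  let ?n = "[:- s3, 1:] * c2" and ?d = "[:0, 1:] * r"
  have d0: "?d \<noteq> 0" using r by simp
  have nd: "norm (poly ?n s / poly ?d s) = norm (s - s3) * norm (poly c2 s / (s * poly r s))" for s
  proof -
    have "poly ?n s = (s - s3) * poly c2 s" by (simp add: algebra_simps)
    then show ?thesis by (simp add: norm_mult norm_divide)
  qed
  have 1: "((\<lambda>s. (s - s0) * (poly ?n s / poly ?d s)) \<longlongrightarrow> 0) (at s0)" for s0
  proof (rule tendstoI)
    fix e :: real assume e: "e > 0"
    obtain K where K: "\<forall>\<^sub>F s in at s0. \<forall>t. bring_poly s t = 0 \<longrightarrow> norm (s - s3) * norm (F (s, t)) \<le> K * (1 + norm t)"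
      using fin by blast
    define \<eta> where "\<eta> = e / (4 * (\<bar>K\<bar> + 1))"
    have \<eta>: "\<eta> > 0" using e by (simp add: \<eta>_def)
    have L: "L * (e / (4 * L)) = e / 4" if "L > 0" for L using that by simp
    have K\<eta>: "(\<bar>K\<bar> + 1) * \<eta> = e / 4" unfolding \<eta>_def by (rule L) linarith
    have "\<forall>\<^sub>F s in at s0. poly (?d * icos) s \<noteq> 0"
      by (rule eventually_poly_nonzero_at) (use d0 in simp)
    with K trace_weight_near_point[OF \<eta>, of s0]
    show "\<forall>\<^sub>F s in at s0. dist ((s - s0) * (poly ?n s / poly ?d s)) 0 < e"
    proof eventually_elim
      case (elim s)
      then have s: "s \<noteq> 0" "poly icos s \<noteq> 0" "poly r s \<noteq> 0" by auto
      obtain t1 t2 t3 where f: "fibre_roots s t1 t2 t3" using fibre_roots_ex[OF s(1)] by blast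
      have "norm (s - s3) * norm (poly c2 s / (s * poly r s)) \<le> (\<bar>K\<bar> + 1) * (trace_weight s t1 t2 t3 + trace_weight s t2 t1 t3 + trace_weight s t3 t1 t2)"
      proof (rule trace_bound[OF f s])
        fix t assume t: "bring_poly s t = 0"
        show "F (s, t) = normal_form c0 c1 c2 r (s, t)" by (rule F[OF t s(3)])
        have "K * (1 + norm t) \<le> (\<bar>K\<bar> + 1) * (1 + norm t)" by (intro mult_right_mono) auto
        then show "norm (s - s3) * norm (F (s, t)) \<le> (\<bar>K\<bar> + 1) * (1 + norm t)"
          using elim(1) t by force
      qed auto
      from mult_left_mono[OF this, of "norm (s - s0)"]
      have "norm ((s - s0) * (poly ?n s / poly ?d s))
         \<le> (\<bar>K\<bar> + 1) * (norm (s - s0) * trace_weight s t1 t2 t3 + norm (s - s0) * trace_weight s t2 t1 t3 + norm (s - s0) * trace_weight s t3 t1 t2)"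
        unfolding norm_mult[of "s - s0"] nd by (simp add: algebra_simps)
      also have "\<dots> \<le> (\<bar>K\<bar> + 1) * (\<eta> + \<eta> + \<eta>)"
        using elim(2) f fibre_roots_swap[OF f] by (intro mult_left_mono add_mono) auto
      also have "\<dots> < e" using e K\<eta> by (simp only: distrib_left mult.assoc)
      finally show ?case by simp
    qed
  qed
  have 2: "((\<lambda>s. poly ?n s / poly ?d s) \<longlongrightarrow> 0) at_infinity"
  proof (rule tendstoI)
    fix e :: real assume e: "e > 0"
    obtain K where K: "\<forall>\<^sub>F s in at_infinity. \<forall>t. bring_poly s t = 0 \<longrightarrow> norm (F (s, t)) \<le> K * norm s * (1 + norm t)"
      using inf by blast
    define \<eta> where "\<eta> = e / (7 * (\<bar>K\<bar> + 1))"
    have \<eta>: "\<eta> > 0" using e by (simp add: \<eta>_def)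
    have L: "L * (e / (7 * L)) = e / 7" if "L > 0" for L using that by simp
    have K\<eta>: "(\<bar>K\<bar> + 1) * \<eta> = e / 7" unfolding \<eta>_def by (rule L) linarith
    have large: "\<forall>\<^sub>F s::complex in at_infinity. norm s3 \<le> norm s"
      unfolding eventually_at_infinity by blast
    have "\<forall>\<^sub>F s in at_infinity. poly (?d * icos) s \<noteq> 0"
      by (rule eventually_poly_nonzero_infinity) (use d0 in simp)
    with K trace_weight_infinity[OF \<eta>] large
    show "\<forall>\<^sub>F s in at_infinity. dist (poly ?n s / poly ?d s) 0 < e"
    proof eventually_elim
      case (elim s)
      then have s: "s \<noteq> 0" "poly icos s \<noteq> 0" "poly r s \<noteq> 0" by auto
      obtain t1 t2 t3 where f: "fibre_roots s t1 t2 t3" using fibre_roots_ex[OF s(1)] by blast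
      have tb: "1 * norm (poly c2 s / (s * poly r s)) \<le> ((\<bar>K\<bar> + 1) * norm s) * (trace_weight s t1 t2 t3 + trace_weight s t2 t1 t3 + trace_weight s t3 t1 t2)"
      proof (rule trace_bound[OF f s])
        fix t assume t: "bring_poly s t = 0"
        show "F (s, t) = normal_form c0 c1 c2 r (s, t)" by (rule F[OF t s(3)])
        have "K * norm s * (1 + norm t) \<le> (\<bar>K\<bar> + 1) * norm s * (1 + norm t)" by (intro mult_right_mono) auto
        then show "1 * norm (F (s, t)) \<le> (\<bar>K\<bar> + 1) * norm s * (1 + norm t)"
          using elim(1) t by force
      qed auto
      have wt0: "trace_weight s a b c \<ge> 0" for a b c by (simp add: trace_weight_def)
      have "norm (s - s3) \<le> 2 * norm s" using norm_triangle_ineq4[of s s3] elim(3) by linarith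
      then have "norm (poly ?n s / poly ?d s)
         \<le> (2 * norm s) * (((\<bar>K\<bar> + 1) * norm s) * (trace_weight s t1 t2 t3 + trace_weight s t2 t1 t3 + trace_weight s t3 t1 t2))"
        unfolding nd using tb by (intro mult_mono) auto
      also have "\<dots> = 2 * (\<bar>K\<bar> + 1) * (norm s ^ 2 * trace_weight s t1 t2 t3 + norm s ^ 2 * trace_weight s t2 t1 t3 + norm s ^ 2 * trace_weight s t3 t1 t2)"
        by (simp add: algebra_simps power2_eq_square)
      also have "\<dots> \<le> 2 * (\<bar>K\<bar> + 1) * (\<eta> + \<eta> + \<eta>)"
        using elim(2) f fibre_roots_swap[OF f] by (intro mult_left_mono add_mono) auto
      also have "\<dots> = 6 * ((\<bar>K\<bar> + 1) * \<eta>)" by algebra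
      also have "\<dots> < e" using e unfolding K\<eta> by simp
      finally show ?case by simp
    qed
  qed
  have "?n = 0" by (rule rational_vanishing[OF d0 1 2])
  moreover have "[:- s3, 1:] \<noteq> 0" by simp
  ultimately show ?thesis using mult_eq_0_iff by blast
qed

section \<open>Local estimates at unramified points\<close>

definition lipschitz_at :: "(complex \<times> complex \<Rightarrow> complex) \<Rightarrow> complex \<times> complex \<Rightarrow> bool" where
  "lipschitz_at f P \<longleftrightarrow> (\<exists>K. \<forall>\<^sub>F p in nhds P. norm (f p - f P) \<le> K * norm (p - P))"

lemma differentiable_imp_lipschitz_at:
  assumes "f differentiable (at P)"
  shows "lipschitz_at f P"
proof -
  obtain D where D: "(f has_derivative D) (at P)" using assms unfolding differentiable_def by blast
  then have bl: "bounded_linear D" by (rule has_derivative_bounded_linear)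
  obtain B where B: "\<And>x. norm (D x) \<le> norm x * B" using bounded_linear.bounded[OF bl] by blast
  obtain d where d: "d > 0" "\<And>y. norm (y - P) < d \<Longrightarrow> norm (f y - f P - D (y - P)) \<le> 1 * norm (y - P)"
    using D unfolding has_derivative_at_alt by (metis zero_less_one)
  have "norm (f p - f P) \<le> (1 + B) * norm (p - P)" if "norm (p - P) < d" for p
    using d(2)[OF that] B[of "p - P"] norm_triangle_ineq[of "f p - f P - D (p - P)" "D (p - P)"]
    by (simp add: algebra_simps)
  then show ?thesis unfolding lipschitz_at_def eventually_nhds_metric dist_norm using d(1) by blast
qed

lemma differentiable_fst [intro]: "fst differentiable (at P)" and differentiable_snd [intro]: "snd differentiable (at P)"
  for P :: "complex \<times> complex"
  by (auto intro: bounded_linear_imp_differentiable bounded_linear_fst bounded_linear_snd)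

lemma differentiable_poly_fst: "(\<lambda>p::complex \<times> complex. poly q (fst p)) differentiable (at P)"
proof (induction q)
  case (pCons a q)
  have "(\<lambda>p. a + fst p * poly q (fst p)) differentiable (at P)"
    by (intro differentiable_add differentiable_mult differentiable_const pCons.IH differentiable_fst)
  then show ?case by simp
qed simp

lemma lipschitz_at_normal_form: "poly r (fst P) \<noteq> 0 \<Longrightarrow> lipschitz_at (normal_form c0 c1 c2 r) P"
proof (rule differentiable_imp_lipschitz_at)
  assume "poly r (fst P) \<noteq> 0"
  then have "(\<lambda>e. (poly c0 (fst e) + poly c1 (fst e) * snd e + poly c2 (fst e) * (snd e)^2) / poly r (fst e)) differentiable (at P)"
    by (intro differentiable_divide differentiable_add differentiable_mult differentiable_power differentiable_poly_fst differentiable_snd)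
  then show "normal_form c0 c1 c2 r differentiable (at P)" unfolding normal_form_def[abs_def] .
qed

lemma lipschitz_at_tendsto:
  assumes "lipschitz_at f P" shows "(f \<longlongrightarrow> f P) (nhds P)"
proof -
  obtain K where K: "\<forall>\<^sub>F p in nhds P. norm (f p - f P) \<le> K * norm (p - P)" using assms lipschitz_at_def by blast
  have "((\<lambda>p. K * norm (p - P)) \<longlongrightarrow> K * norm (P - P)) (nhds P)" by (intro tendsto_intros filterlim_ident)
  then have "((\<lambda>p. K * norm (p - P)) \<longlongrightarrow> 0) (nhds P)" by simp
  then have "((\<lambda>p. f p - f P) \<longlongrightarrow> 0) (nhds P)" by (rule Lim_null_comparison[OF K])
  then show ?thesis using Lim_null by blast
qed

lemma norm_pair_le: "norm (p - P) \<le> norm (fst p - fst P) + norm (snd p - snd P)"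
  for p P :: "complex \<times> complex"
  by (metis fst_diff snd_diff norm_Pair_le norm_prod_def prod.collapse)

definition bring_poly_dt :: "complex \<Rightarrow> complex \<Rightarrow> complex" where
  "bring_poly_dt s t = 3 * s * t^2 + 2 * s^3 * t - 1"

text \<open>
  At a point where the projection to \<open>s\<close> is unramified, \<open>s\<close> is a local coordinate.  A Lipschitz estimate
  replaces the implicit function theorem.
\<close>
lemma simple_root_lipschitz:
  assumes P: "P \<in> bring_curve" and d: "bring_poly_dt (fst P) (snd P) \<noteq> 0"
  shows "\<exists>K. \<forall>\<^sub>F p in nhds P. p \<in> bring_curve \<longrightarrow> norm (p - P) \<le> K * norm (fst p - fst P)"
proof -
  obtain c \<tau> where [simp]: "P = (c, \<tau>)" by fastforce
  define D where "D p = fst p * (snd p^2 + snd p * \<tau> + \<tau>^2) + fst p^3 * (snd p + \<tau>) - 1" for p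
  define E where "E p = \<tau>^3 + \<tau>^2 * (fst p^2 + fst p * c + c^2) + (fst p + c)" for p :: "complex \<times> complex"
  have id: "D p * (snd p - \<tau>) = - (E p * (fst p - c))" if "p \<in> bring_curve" for p
  proof -
    have "D p * (snd p - \<tau>) + E p * (fst p - c) = bring_poly (fst p) (snd p) - bring_poly c \<tau>"
      unfolding D_def E_def bring_poly_def by algebra
    also have "\<dots> = 0" using that P by (simp add: bring_curve_def)
    finally show ?thesis by (simp add: eq_neg_iff_add_eq_0)
  qed
  have fs: "(fst \<longlongrightarrow> c) (nhds P)" "(snd \<longlongrightarrow> \<tau>) (nhds P)"
    using tendsto_fst[OF filterlim_ident, of P] tendsto_snd[OF filterlim_ident, of P] by simp_all
  have "(D \<longlongrightarrow> c * (\<tau>^2 + \<tau> * \<tau> + \<tau>^2) + c^3 * (\<tau> + \<tau>) - 1) (nhds P)"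
    unfolding D_def by (intro tendsto_intros fs)
  moreover have "c * (\<tau>^2 + \<tau> * \<tau> + \<tau>^2) + c^3 * (\<tau> + \<tau>) - 1 = bring_poly_dt c \<tau>"
    by (simp add: bring_poly_dt_def algebra_simps power2_eq_square)
  ultimately have "((\<lambda>p. norm (D p)) \<longlongrightarrow> norm (bring_poly_dt c \<tau>)) (nhds P)" using tendsto_norm by metis
  then have 1: "\<forall>\<^sub>F p in nhds P. norm (D p) > norm (bring_poly_dt c \<tau>) / 2"
    by (rule order_tendstoD(1)) (use d in simp)
  have "(E \<longlongrightarrow> \<tau>^3 + \<tau>^2 * (c^2 + c * c + c^2) + (c + c)) (nhds P)"
    unfolding E_def by (intro tendsto_intros fs)
  moreover have "\<tau>^3 + \<tau>^2 * (c^2 + c * c + c^2) + (c + c) = E P" by (simp add: E_def)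
  ultimately have "((\<lambda>p. norm (E p)) \<longlongrightarrow> norm (E P)) (nhds P)" using tendsto_norm by metis
  then have 2: "\<forall>\<^sub>F p in nhds P. norm (E p) < norm (E P) + 1"
    by (rule order_tendstoD(2)) simp
  define K where "K = (norm (E P) + 1) / (norm (bring_poly_dt c \<tau>) / 2)"
  have "\<forall>\<^sub>F p in nhds P. p \<in> bring_curve \<longrightarrow> norm (p - P) \<le> (1 + K) * norm (fst p - fst P)"
    using 1 2
  proof eventually_elim
    case (elim p)
    show ?case
    proof
      assume "p \<in> bring_curve"
      then have "norm (D p) * norm (snd p - \<tau>) = norm (E p) * norm (fst p - c)"
        using id by (metis norm_minus_cancel norm_mult)
      moreover have "norm (bring_poly_dt c \<tau>) / 2 * norm (snd p - \<tau>) \<le> norm (D p) * norm (snd p - \<tau>)"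
        using elim(1) by (intro mult_right_mono) auto
      moreover have "norm (E p) * norm (fst p - c) \<le> (norm (E P) + 1) * norm (fst p - c)"
        using elim(2) by (intro mult_right_mono) auto
      ultimately have "norm (bring_poly_dt c \<tau>) / 2 * norm (snd p - \<tau>) \<le> (norm (E P) + 1) * norm (fst p - c)" by linarith
      then have "norm (snd p - \<tau>) \<le> K * norm (fst p - c)"
        using d by (simp add: K_def field_simps)
      then show "norm (p - P) \<le> (1 + K) * norm (fst p - fst P)"
        using norm_pair_le[of p P] by (simp add: distrib_right)
    qed
  qed
  then show ?thesis by blast
qed

lemma fibre_roots_bring_poly_dt:
  assumes f: "fibre_roots s t1 t2 t3"
  shows "bring_poly_dt s t1 = s * (t1 - t2) * (t1 - t3)"
proof (cases "s = 0")
  case True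
  then have "bring_poly 0 1 = 0" using f unfolding fibre_roots_def by simp
  then show ?thesis by (simp add: bring_poly_def)
next
  case False
  have f': "\<And>t. bring_poly s t = s * (t - t1) * (t - t2) * (t - t3)" using f by (simp add: fibre_roots_def)
  have v: "t1 + t2 + t3 = - (s^2)" "s * (t1 * t2 + t1 * t3 + t2 * t3) = - 1"
    using bring_poly_vieta[OF f' False] by auto
  have "s * (t1 - t2) * (t1 - t3) = 3 * s * t1^2 - 2 * s * t1 * (t1 + t2 + t3) + s * (t1 * t2 + t1 * t3 + t2 * t3)"
    by algebra
  then show ?thesis unfolding v bring_poly_dt_def by (simp add: algebra_simps power2_eq_square power3_eq_cube)
qed

lemma bring_poly_dt_nonzero:
  assumes "bring_poly s t = 0" "s \<noteq> 0" "poly icos s \<noteq> 0"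
  shows "bring_poly_dt s t \<noteq> 0"
proof -
  obtain t1 t2 t3 where f: "fibre_roots s t1 t2 t3" using fibre_roots_ex[OF assms(2)] by blast
  then have "t = t1 \<or> t = t2 \<or> t = t3" using fibre_roots_root_iff assms by blast
  then obtain u v where "fibre_roots s t u v" using f fibre_roots_swap[OF f] by blast
  then show ?thesis using fibre_roots_bring_poly_dt fibre_roots_distinct assms by auto
qed

text \<open>
  The roots of the cubic over nearby \<open>s\<close> are close to those over \<open>s0\<close>, so a local property at each of the
  three points holds on all nearby fibres.
\<close>
lemma fibre_cover:
  assumes f: "fibre_roots s0 t1 t2 t3" and s0: "s0 \<noteq> 0"
    and Q: "\<forall>\<^sub>F p in nhds (s0, t1). Q p" "\<forall>\<^sub>F p in nhds (s0, t2). Q p" "\<forall>\<^sub>F p in nhds (s0, t3). Q p"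
  shows "\<forall>\<^sub>F s in nhds s0. \<forall>t. bring_poly s t = 0 \<longrightarrow> Q (s, t)"
proof -
  obtain e1 where e1: "e1 > 0" "\<And>p. dist p (s0, t1) < e1 \<Longrightarrow> Q p" using Q(1) unfolding eventually_nhds_metric by blast
  obtain e2 where e2: "e2 > 0" "\<And>p. dist p (s0, t2) < e2 \<Longrightarrow> Q p" using Q(2) unfolding eventually_nhds_metric by blast
  obtain e3 where e3: "e3 > 0" "\<And>p. dist p (s0, t3) < e3 \<Longrightarrow> Q p" using Q(3) unfolding eventually_nhds_metric by blast
  define e where "e = min e1 (min e2 e3) / 2"
  have e: "e > 0" using e1 e2 e3 by (simp add: e_def)
  have close: "Q (s, t)" if "norm (s - s0) < e" "norm (t - u) < e" "u \<in> {t1, t2, t3}" for s t u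
  proof -
    have "dist (s, t) (s0, u) < 2 * e"
      using norm_pair_le[of "(s, t)" "(s0, u)"] that by (simp add: dist_norm)
    then show ?thesis using that(3) e1 e2 e3 by (auto simp: e_def)
  qed
  define C where "C = norm s0 ^ 2 + 1 / norm s0 + norm s0 + 1"
  have C: "C \<ge> 1" by (simp add: C_def)
  have "((\<lambda>s. norm s ^ 2 + 1 / norm s + norm s) \<longlongrightarrow> norm s0 ^ 2 + 1 / norm s0 + norm s0) (nhds s0)"
    using s0 by (intro tendsto_intros filterlim_ident) auto
  then have ev1: "\<forall>\<^sub>F s in nhds s0. norm s ^ 2 + 1 / norm s + norm s < C"
    by (rule order_tendstoD(2)) (simp add: C_def)
  define M where "M s = norm (s - s0) * (C^3 + C^2 * norm (s^2 + s * s0 + s0^2) + norm (s + s0))" for s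
  have "(M \<longlongrightarrow> norm (s0 - s0) * (C^3 + C^2 * norm (s0^2 + s0 * s0 + s0^2) + norm (s0 + s0))) (nhds s0)"
    unfolding M_def by (intro tendsto_intros filterlim_ident)
  then have ev2: "\<forall>\<^sub>F s in nhds s0. M s < norm s0 * e^3"
    by (rule order_tendstoD(2)) (use s0 e in simp)
  have ev3: "\<forall>\<^sub>F s in nhds s0. norm (s - s0) < e"
    unfolding eventually_nhds_metric using e by (auto simp: dist_norm)
  have ev4: "\<forall>\<^sub>F s in nhds s0. s \<noteq> 0" using s0 by (rule t1_space_nhds)
  show ?thesis using ev1 ev2 ev3 ev4
  proof eventually_elim
    case (elim s)
    show ?case
    proof (intro allI impI)
      fix t assume t: "bring_poly s t = 0"
      have tC: "norm t \<le> C" using root_bound[OF t elim(4)] elim(1) C by linarith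
      have "s0 * (t - t1) * (t - t2) * (t - t3) = bring_poly s0 t - bring_poly s t" using f t by (simp add: fibre_roots_def)
      also have "\<dots> = - ((s - s0) * (t^3 + t^2 * (s^2 + s * s0 + s0^2) + (s + s0)))"
        unfolding bring_poly_def by algebra
      finally have "norm (s0 * (t - t1) * (t - t2) * (t - t3)) = norm (s - s0) * norm (t^3 + t^2 * (s^2 + s * s0 + s0^2) + (s + s0))"
        by (simp only: norm_minus_cancel norm_mult)
      also have "\<dots> \<le> norm (s - s0) * (norm t ^ 3 + norm t ^ 2 * norm (s^2 + s * s0 + s0^2) + norm (s + s0))"
        using norm_triangle_ineq[of "t^3 + t^2 * (s^2 + s * s0 + s0^2)" "s + s0"] norm_triangle_ineq[of "t^3" "t^2 * (s^2 + s * s0 + s0^2)"]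
        by (intro mult_left_mono) (auto simp: norm_mult norm_power)
      also have "\<dots> \<le> M s" unfolding M_def using tC C
        by (intro mult_left_mono add_mono mult_right_mono power_mono) auto
      finally have "norm s0 * (norm (t - t1) * norm (t - t2) * norm (t - t3)) < norm s0 * e^3"
        using elim(2) by (simp add: norm_mult mult.assoc)
      then have lt: "norm (t - t1) * norm (t - t2) * norm (t - t3) < e^3" using s0 by simp
      have "norm (t - t1) < e \<or> norm (t - t2) < e \<or> norm (t - t3) < e"
      proof (rule ccontr)
        assume "\<not> ?thesis"
        then have "e * e * e \<le> norm (t - t1) * norm (t - t2) * norm (t - t3)" using e by (intro mult_mono) auto
        with lt show False by (simp add: power3_eq_cube)
      qed
      then show "Q (s, t)" using close elim(3) by blast
    qed
  qed
qed

text \<open>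
  The fibre over \<open>s\<close> near \<open>s0\<close> meets every neighbourhood of every point over \<open>s0\<close>.
\<close>
lemma nearby_root:
  assumes t0: "bring_poly s0 t0 = 0" and s0: "s0 \<noteq> 0" and e: "e > 0"
  shows "\<forall>\<^sub>F s in nhds s0. \<exists>t. bring_poly s t = 0 \<and> norm (t - t0) < e"
proof -
  have "((\<lambda>s. norm (bring_poly s t0 / s)) \<longlongrightarrow> norm (bring_poly s0 t0 / s0)) (nhds s0)"
    unfolding bring_poly_def using s0 by (intro tendsto_intros filterlim_ident)
  then have "\<forall>\<^sub>F s in nhds s0. norm (bring_poly s t0 / s) < e^3"
    by (rule order_tendstoD(2)) (use t0 e in simp)
  moreover have "\<forall>\<^sub>F s in nhds s0. s \<noteq> 0" using s0 by (rule t1_space_nhds)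
  ultimately show ?thesis
  proof eventually_elim
    case (elim s)
    obtain t1 t2 t3 where f: "fibre_roots s t1 t2 t3" using fibre_roots_ex elim(2) by blast
    have lt: "norm (t0 - t1) * norm (t0 - t2) * norm (t0 - t3) < e^3"
      using elim f by (simp add: fibre_roots_def norm_mult norm_divide mult.assoc)
    have "norm (t0 - t1) < e \<or> norm (t0 - t2) < e \<or> norm (t0 - t3) < e"
    proof (rule ccontr)
      assume "\<not> ?thesis"
      then have "e * e * e \<le> norm (t0 - t1) * norm (t0 - t2) * norm (t0 - t3)" using e by (intro mult_mono) auto
      with lt show False by (simp add: power3_eq_cube)
    qed
    then show ?case using fibre_roots_root[OF f] by (metis norm_minus_commute)
  qed
qed

section \<open>Collinearity of the fibres of a birational self-map\<close>

definition birational :: "(complex \<times> complex \<Rightarrow> complex \<times> complex) \<Rightarrow> (complex \<times> complex \<Rightarrow> complex \<times> complex) \<Rightarrow> bool" where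
  "birational \<phi> \<psi> \<longleftrightarrow> ratfun (\<lambda>e. fst (\<phi> e)) \<and> ratfun (\<lambda>e. snd (\<phi> e)) \<and> ratfun (\<lambda>e. fst (\<psi> e)) \<and> ratfun (\<lambda>e. snd (\<psi> e)) \<and>
     (\<forall>\<^sub>F e in generic. \<phi> e \<in> bring_curve \<and> \<psi> (\<phi> e) = e) \<and> (\<forall>\<^sub>F e in generic. \<psi> e \<in> bring_curve \<and> \<phi> (\<psi> e) = e)"

lemma birational_sym: "birational \<phi> \<psi> \<Longrightarrow> birational \<psi> \<phi>"
  unfolding birational_def by blast

text \<open>
  A map with a left inverse is injective, so the preimage of a finite set is finite.
\<close>
lemma filterlim_generic:
  assumes "\<forall>\<^sub>F e in generic. \<phi> e \<in> bring_curve \<and> \<psi> (\<phi> e) = e"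
  shows "filterlim \<phi> generic generic"
  unfolding filterlim_iff
proof (intro allI impI)
  fix P assume "eventually P generic"
  then have 1: "finite {e \<in> bring_curve. \<not> P e}" by (simp add: eventually_generic)
  have 2: "finite {e \<in> bring_curve. \<not> (\<phi> e \<in> bring_curve \<and> \<psi> (\<phi> e) = e)}" using assms by (simp add: eventually_generic)
  have "{e \<in> bring_curve. \<not> P (\<phi> e)} \<subseteq> {e \<in> bring_curve. \<not> (\<phi> e \<in> bring_curve \<and> \<psi> (\<phi> e) = e)} \<union> \<psi> ` {e \<in> bring_curve. \<not> P e}"
  proof
    fix e assume "e \<in> {e \<in> bring_curve. \<not> P (\<phi> e)}"
    then have e: "e \<in> bring_curve" "\<not> P (\<phi> e)" by auto
    show "e \<in> {e \<in> bring_curve. \<not> (\<phi> e \<in> bring_curve \<and> \<psi> (\<phi> e) = e)} \<union> \<psi> ` {e \<in> bring_curve. \<not> P e}"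
    proof (cases "\<phi> e \<in> bring_curve \<and> \<psi> (\<phi> e) = e")
      case True
      then have "e = \<psi> (\<phi> e)" "\<phi> e \<in> {e \<in> bring_curve. \<not> P e}" using e by auto
      then show ?thesis by (rule UnI2[OF image_eqI])
    qed (use e in blast)
  qed
  then have "finite {e \<in> bring_curve. \<not> P (\<phi> e)}" using 1 2 by (meson finite_UnI finite_imageI finite_subset)
  then show "\<forall>\<^sub>F e in generic. P (\<phi> e)" by (simp add: eventually_generic)
qed

lemma birational_filterlim: "birational \<phi> \<psi> \<Longrightarrow> filterlim \<phi> generic generic"
  unfolding birational_def using filterlim_generic by blast

text \<open>
  Away from the zeros of \<open>r\<close>, a birational map is defined, is given by Lipschitz functions, and has its inverse available.
\<close>
locale bir_chart =
  fixes \<phi> \<psi> :: "complex \<times> complex \<Rightarrow> complex \<times> complex" and r :: "complex poly" and H K :: "complex \<times> complex \<Rightarrow> complex"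
  assumes r0: "r \<noteq> 0"
    and lipH: "poly r (fst P) \<noteq> 0 \<Longrightarrow> lipschitz_at H P" and lipK: "poly r (fst P) \<noteq> 0 \<Longrightarrow> lipschitz_at K P"
    and nz: "P \<in> bring_curve \<Longrightarrow> poly r (fst P) \<noteq> 0 \<Longrightarrow> fst P \<noteq> 0 \<and> poly icos (fst P) \<noteq> 0"
    and eq: "P \<in> bring_curve \<Longrightarrow> poly r (fst P) \<noteq> 0 \<Longrightarrow> \<phi> P = (H P, K P)"
    and mem: "P \<in> bring_curve \<Longrightarrow> poly r (fst P) \<noteq> 0 \<Longrightarrow> \<phi> P \<in> bring_curve"
    and inv: "P \<in> bring_curve \<Longrightarrow> poly r (fst P) \<noteq> 0 \<Longrightarrow> \<psi> (\<phi> P) = P"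

text \<open>
  The polynomial \<open>r\<close> collects the denominators, the branch points and the exceptional set of \<open>Q\<close>.
\<close>
lemma birational_chart:
  assumes b: "birational \<phi> \<psi>" and Q: "eventually Q generic"
  obtains r H K where "bir_chart \<phi> \<psi> r H K" "\<And>P. P \<in> bring_curve \<Longrightarrow> poly r (fst P) \<noteq> 0 \<Longrightarrow> Q P"
proof -
  obtain a0 a1 a2 ra where a: "ra \<noteq> 0" "\<forall>\<^sub>F e in generic. fst (\<phi> e) = normal_form a0 a1 a2 ra e"
    using b unfolding birational_def ratfun_def by blast
  obtain b0 b1 b2 rb where b': "rb \<noteq> 0" "\<forall>\<^sub>F e in generic. snd (\<phi> e) = normal_form b0 b1 b2 rb e"
    using b unfolding birational_def ratfun_def by blast
  have "\<forall>\<^sub>F e in generic. \<phi> e \<in> bring_curve \<and> \<psi> (\<phi> e) = e" using b by (simp add: birational_def)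
  with Q a(2) b'(2) have "\<forall>\<^sub>F e in generic. Q e \<and> fst (\<phi> e) = normal_form a0 a1 a2 ra e \<and> snd (\<phi> e) = normal_form b0 b1 b2 rb e
      \<and> \<phi> e \<in> bring_curve \<and> \<psi> (\<phi> e) = e" by eventually_elim auto
  then obtain q where q: "q \<noteq> 0" "\<And>s t. bring_poly s t = 0 \<Longrightarrow> poly q s \<noteq> 0 \<Longrightarrow> Q (s, t) \<and> fst (\<phi> (s, t)) = normal_form a0 a1 a2 ra (s, t)
      \<and> snd (\<phi> (s, t)) = normal_form b0 b1 b2 rb (s, t) \<and> \<phi> (s, t) \<in> bring_curve \<and> \<psi> (\<phi> (s, t)) = (s, t)"
    unfolding eventually_generic_poly by blast
  have q': "Q P \<and> fst (\<phi> P) = normal_form a0 a1 a2 ra P \<and> snd (\<phi> P) = normal_form b0 b1 b2 rb P \<and> \<phi> P \<in> bring_curve \<and> \<psi> (\<phi> P) = P"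
    if "P \<in> bring_curve" "poly q (fst P) \<noteq> 0" for P
    using q(2) that by (metis in_bring_curve prod.collapse)
  define r where "r = q * ra * rb * ([:0,1:] * icos)"
  have "bir_chart \<phi> \<psi> r (normal_form a0 a1 a2 ra) (normal_form b0 b1 b2 rb)"
  proof
    show "r \<noteq> 0" using q(1) a(1) b'(1) by (simp add: r_def)
    show "lipschitz_at (normal_form a0 a1 a2 ra) P" "lipschitz_at (normal_form b0 b1 b2 rb) P" if "poly r (fst P) \<noteq> 0" for P
      using that by (auto intro!: lipschitz_at_normal_form simp: r_def)
    fix P assume P: "P \<in> bring_curve" "poly r (fst P) \<noteq> 0"
    then have "poly q (fst P) \<noteq> 0" by (simp add: r_def)
    from q'[OF P(1) this] show "\<phi> P = (normal_form a0 a1 a2 ra P, normal_form b0 b1 b2 rb P)" "\<phi> P \<in> bring_curve" "\<psi> (\<phi> P) = P"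
      by (simp_all add: prod_eq_iff)
    show "fst P \<noteq> 0 \<and> poly icos (fst P) \<noteq> 0" using P by (simp add: r_def)
  qed
  moreover have "Q P" if "P \<in> bring_curve" "poly r (fst P) \<noteq> 0" for P
    using q'[of P] that by (simp add: r_def)
  ultimately show thesis by (rule that)
qed

lemma lipschitz_at_pos:
  assumes "lipschitz_at f P" obtains K where "K > 0" "\<forall>\<^sub>F p in nhds P. norm (f p - f P) \<le> K * norm (p - P)"
proof -
  obtain K where K: "\<forall>\<^sub>F p in nhds P. norm (f p - f P) \<le> K * norm (p - P)" using assms lipschitz_at_def by blast
  have "\<forall>\<^sub>F p in nhds P. norm (f p - f P) \<le> (\<bar>K\<bar> + 1) * norm (p - P)"
    using K
  proof eventually_elim
    case (elim p)
    have "K * norm (p - P) \<le> (\<bar>K\<bar> + 1) * norm (p - P)" by (intro mult_right_mono) auto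
    with elim show ?case by linarith
  qed
  then show thesis using that[of "\<bar>K\<bar> + 1"] by simp
qed

lemma simple_root_lipschitz_pos:
  assumes "P \<in> bring_curve" "fst P \<noteq> 0" "poly icos (fst P) \<noteq> 0"
  obtains K where "K > 0" "\<forall>\<^sub>F p in nhds P. p \<in> bring_curve \<longrightarrow> norm (p - P) \<le> K * norm (fst p - fst P)"
proof -
  have "bring_poly_dt (fst P) (snd P) \<noteq> 0" using bring_poly_dt_nonzero assms by (simp add: bring_curve_def)
  then obtain K where K: "\<forall>\<^sub>F p in nhds P. p \<in> bring_curve \<longrightarrow> norm (p - P) \<le> K * norm (fst p - fst P)"
    using simple_root_lipschitz assms(1) by blast
  have "\<forall>\<^sub>F p in nhds P. p \<in> bring_curve \<longrightarrow> norm (p - P) \<le> (\<bar>K\<bar> + 1) * norm (fst p - fst P)"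
    using K
  proof eventually_elim
    case (elim p)
    have "K * norm (fst p - fst P) \<le> (\<bar>K\<bar> + 1) * norm (fst p - fst P)" by (intro mult_right_mono) auto
    with elim show ?case by fastforce
  qed
  then show thesis using that[of "\<bar>K\<bar> + 1"] by simp
qed

lemma eventually_nhds_poly_fst:
  fixes P :: "complex \<times> complex"
  assumes "poly r (fst P) \<noteq> 0"
  shows "\<forall>\<^sub>F p in nhds P. poly r (fst p) \<noteq> (0::complex)"
proof -
  have "lipschitz_at (normal_form r 0 0 1) P" by (rule lipschitz_at_normal_form) simp
  then have "(normal_form r 0 0 1 \<longlongrightarrow> normal_form r 0 0 1 P) (nhds P)" by (rule lipschitz_at_tendsto)
  then have "((\<lambda>p. poly r (fst p)) \<longlongrightarrow> poly r (fst P)) (nhds P)" by (simp add: normal_form_def[abs_def])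
  then show ?thesis using assms by (rule tendsto_imp_eventually_ne)
qed

lemma (in bir_chart) upper_bound:
  assumes P: "P \<in> bring_curve" "poly r (fst P) \<noteq> 0"
  obtains C where "C > 0" "\<forall>\<^sub>F p in nhds P. p \<in> bring_curve \<longrightarrow> norm (fst (\<phi> p) - fst (\<phi> P)) \<le> C * norm (fst p - fst P)"
proof -
  obtain A where A: "A > 0" "\<forall>\<^sub>F p in nhds P. norm (H p - H P) \<le> A * norm (p - P)"
    using lipschitz_at_pos[OF lipH[OF P(2)]] by blast
  obtain B where B: "B > 0" "\<forall>\<^sub>F p in nhds P. p \<in> bring_curve \<longrightarrow> norm (p - P) \<le> B * norm (fst p - fst P)"
    using simple_root_lipschitz_pos[OF P(1)] nz[OF P] by blast
  have "\<forall>\<^sub>F p in nhds P. p \<in> bring_curve \<longrightarrow> norm (fst (\<phi> p) - fst (\<phi> P)) \<le> (A * B) * norm (fst p - fst P)"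
    using A(2) B(2) eventually_nhds_poly_fst[OF P(2)]
  proof eventually_elim
    case (elim p)
    show ?case
    proof
      assume p: "p \<in> bring_curve"
      have "norm (H p - H P) \<le> A * (B * norm (fst p - fst P))"
        using elim p mult_left_mono[of "norm (p - P)" "B * norm (fst p - fst P)" A] A(1) by linarith
      then show "norm (fst (\<phi> p) - fst (\<phi> P)) \<le> (A * B) * norm (fst p - fst P)"
        using eq[OF p elim(3)] eq[OF P] by (simp add: mult.assoc)
    qed
  qed
  then show thesis using that[of "A * B"] A(1) B(1) by simp
qed

text \<open>
  This is \<open>upper_bound\<close> for the inverse map: a birational map is a local isomorphism, so \<open>fst \<circ> \<phi>\<close> is again a local coordinate.
\<close>
lemma lower_bound:
  assumes 1: "bir_chart \<phi> \<psi> r H K" and 2: "bir_chart \<psi> \<phi> r' S T"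
    and P: "P \<in> bring_curve" "poly r (fst P) \<noteq> 0" and P': "poly r' (fst (\<phi> P)) \<noteq> 0"
  obtains C where "C > 0" "\<forall>\<^sub>F p in nhds P. p \<in> bring_curve \<longrightarrow> norm (fst p - fst P) \<le> C * norm (fst (\<phi> p) - fst (\<phi> P))"
proof -
  interpret c1: bir_chart \<phi> \<psi> r H K by (rule 1)
  interpret c2: bir_chart \<psi> \<phi> r' S T by (rule 2)
  define Q where "Q = \<phi> P"
  have Q: "Q \<in> bring_curve" "poly r' (fst Q) \<noteq> 0" using c1.mem[OF P] P' by (auto simp: Q_def)
  obtain A where A: "A > 0" "\<forall>\<^sub>F q in nhds Q. norm (S q - S Q) \<le> A * norm (q - Q)"
    using lipschitz_at_pos[OF c2.lipH[OF Q(2)]] by blast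
  obtain B where B: "B > 0" "\<forall>\<^sub>F q in nhds Q. q \<in> bring_curve \<longrightarrow> norm (q - Q) \<le> B * norm (fst q - fst Q)"
    using simple_root_lipschitz_pos[OF Q(1)] c2.nz[OF Q] by blast
  have "\<forall>\<^sub>F q in nhds Q. q \<in> bring_curve \<longrightarrow> norm (fst (\<psi> q) - fst P) \<le> (A * B) * norm (fst q - fst Q)"
    using A(2) B(2) eventually_nhds_poly_fst[OF Q(2)]
  proof eventually_elim
    case (elim q)
    show ?case
    proof
      assume q: "q \<in> bring_curve"
      have "norm (S q - S Q) \<le> A * (B * norm (fst q - fst Q))"
        using elim q mult_left_mono[of "norm (q - Q)" "B * norm (fst q - fst Q)" A] A(1) by linarith
      moreover have "fst (\<psi> q) = S q" "fst P = S Q"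
        using c2.eq[OF q elim(3)] c2.eq[OF Q] c1.inv[OF P] by (auto simp: Q_def prod_eq_iff)
      ultimately show "norm (fst (\<psi> q) - fst P) \<le> (A * B) * norm (fst q - fst Q)"
        by (simp add: mult.assoc)
    qed
  qed
  moreover have "filterlim (\<lambda>p. (H p, K p)) (nhds Q) (nhds P)"
    using tendsto_Pair[OF lipschitz_at_tendsto[OF c1.lipH[OF P(2)]] lipschitz_at_tendsto[OF c1.lipK[OF P(2)]]]
      c1.eq[OF P] by (simp add: Q_def)
  ultimately have "\<forall>\<^sub>F p in nhds P. (H p, K p) \<in> bring_curve \<longrightarrow> norm (fst (\<psi> (H p, K p)) - fst P) \<le> (A * B) * norm (fst (H p, K p) - fst Q)"
    by (rule eventually_compose_filterlim)
  then have "\<forall>\<^sub>F p in nhds P. p \<in> bring_curve \<longrightarrow> norm (fst p - fst P) \<le> (A * B) * norm (fst (\<phi> p) - fst (\<phi> P))"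
    using eventually_nhds_poly_fst[OF P(2)]
  proof eventually_elim
    case (elim p)
    then show ?case using c1.eq[of p] c1.mem[of p] c1.inv[of p] by (auto simp: Q_def)
  qed
  then show thesis using that[of "A * B"] A(1) B(1) by simp
qed

text \<open>
  The function \<open>h = fst \<circ> \<phi>\<close> takes the value \<open>c\<close> at the three points \<open>\<psi> (c, \<tau>)\<close>.  If the linear form \<open>l\<close> vanished at
  all of them but one, then \<open>l / (h - c)\<close> times the basic differential would be a differential with exactly one pole, a simple
  one, in contradiction to the residue theorem.  The hypotheses on \<open>repelled\<close> make sure that \<open>h - c\<close> does not vanish at the points
  where the map is not under control.  The growth of \<open>l\<close> is that of \<open>1\<close>, \<open>s\<close>, \<open>t\<close> and \<open>s t\<close>, whose products with the basic
  differential are exactly the holomorphic differentials.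
\<close>
lemma single_pole_impossible:
  assumes 1: "bir_chart \<phi> \<psi> r H K" and 2: "bir_chart \<psi> \<phi> r' S T"
    and RFh: "ratfun (\<lambda>e. fst (\<phi> e))"
    and c: "poly r' c \<noteq> 0" "\<And>\<tau>. bring_poly c \<tau> = 0 \<Longrightarrow> poly r (fst (\<psi> (c, \<tau>))) \<noteq> 0"
    and rep: "\<And>s0. poly r s0 = 0 \<Longrightarrow> repelled (\<lambda>e. fst (\<phi> e)) c (at s0)"
    and repi: "repelled (\<lambda>e. fst (\<phi> e)) c at_infinity"
    and l: "ratfun l" "\<And>P. lipschitz_at l P" and growth: "\<And>s t. norm (l (s, t)) \<le> L * (1 + norm s) * (1 + norm t)"
    and \<tau>0: "bring_poly c \<tau>0 = 0" and lP: "l (\<psi> (c, \<tau>0)) \<noteq> 0"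
    and l0: "\<And>\<tau>. bring_poly c \<tau> = 0 \<Longrightarrow> \<tau> \<noteq> \<tau>0 \<Longrightarrow> l (\<psi> (c, \<tau>)) = 0"
  shows False
proof -
  interpret c1: bir_chart \<phi> \<psi> r H K by (rule 1)
  interpret c2: bir_chart \<psi> \<phi> r' S T by (rule 2)
  define P where "P = \<psi> (c, \<tau>0)"
  define s3 where "s3 = fst P"
  \<comment> \<open>the only pole of this function, relative to the holomorphic differentials, is the simple pole at \<open>P\<close>\<close>
  define F where "F e = l e / (fst (\<phi> e) - c)" for e
  have Pm: "P \<in> bring_curve" "\<phi> P = (c, \<tau>0)" using c2.mem[of "(c, \<tau>0)"] c2.inv[of "(c, \<tau>0)"] c(1) \<tau>0 by (auto simp: P_def)
  have Pr: "poly r s3 \<noteq> 0" using c(2)[OF \<tau>0] by (simp add: P_def s3_def)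
  have "norm (l (0, 0)) \<le> L" using growth[of 0 0] by simp
  then have growth0: "L \<ge> 0" using norm_ge_zero[of "l (0, 0)"] by linarith
  have A: "\<exists>C\<ge>0. \<forall>\<^sub>F p in nhds q. p \<in> bring_curve \<longrightarrow> norm (F p) \<le> C"
    if q: "q \<in> bring_curve" "poly r (fst q) \<noteq> 0" "q \<noteq> P" for q
  proof (cases "fst (\<phi> q) = c")
    case True
    then obtain \<tau> where \<tau>: "\<phi> q = (c, \<tau>)" by (metis prod.collapse)
    then have "bring_poly c \<tau> = 0" "q = \<psi> (c, \<tau>)" using c1.mem[OF q(1,2)] c1.inv[OF q(1,2)] by auto
    then have lq: "l q = 0" using l0 q(3) by (auto simp: P_def)
    obtain A where A: "A > 0" "\<forall>\<^sub>F p in nhds q. norm (l p - l q) \<le> A * norm (p - q)"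
      using lipschitz_at_pos[OF l(2)] by blast
    obtain B where B: "B > 0" "\<forall>\<^sub>F p in nhds q. p \<in> bring_curve \<longrightarrow> norm (p - q) \<le> B * norm (fst p - fst q)"
      using simple_root_lipschitz_pos[OF q(1)] c1.nz[OF q(1,2)] by blast
    obtain C where C: "C > 0" "\<forall>\<^sub>F p in nhds q. p \<in> bring_curve \<longrightarrow> norm (fst p - fst q) \<le> C * norm (fst (\<phi> p) - fst (\<phi> q))"
      using lower_bound[OF 1 2 q(1,2)] c(1) True by blast
    have "\<forall>\<^sub>F p in nhds q. p \<in> bring_curve \<longrightarrow> norm (F p) \<le> A * (B * C)"
      using A(2) B(2) C(2)
    proof eventually_elim
      case (elim p)
      show ?case
      proof
        assume p: "p \<in> bring_curve"
        have "norm (l p) \<le> A * norm (p - q)" using elim(1) lq by simp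
        also have "\<dots> \<le> A * (B * norm (fst p - fst q))" using elim(2) p A(1) by (intro mult_left_mono) auto
        also have "\<dots> \<le> A * (B * (C * norm (fst (\<phi> p) - c)))"
          using elim(3) p A(1) B(1) True by (intro mult_left_mono) auto
        finally have "norm (l p) \<le> A * (B * C) * norm (fst (\<phi> p) - c)" by (simp add: mult.assoc)
        then show "norm (F p) \<le> A * (B * C)"
          using A(1) B(1) C(1) by (cases "fst (\<phi> p) = c") (simp_all add: F_def norm_divide divide_le_eq)
      qed
    qed
    then show ?thesis using A(1) B(1) C(1) by (intro exI[of _ "A * (B * C)"]) auto
  next
    case False
    define d where "d = norm (H q - c)"
    have d: "d > 0" using False c1.eq[OF q(1,2)] by (simp add: d_def)
    have "((\<lambda>p. norm (H p - c)) \<longlongrightarrow> d) (nhds q)"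
      unfolding d_def by (intro tendsto_intros lipschitz_at_tendsto c1.lipH q)
    then have e1: "\<forall>\<^sub>F p in nhds q. d / 2 < norm (H p - c)" by (rule order_tendstoD(1)) (use d in simp)
    have "((\<lambda>p. norm (l p)) \<longlongrightarrow> norm (l q)) (nhds q)" by (intro tendsto_intros lipschitz_at_tendsto l(2))
    then have e2: "\<forall>\<^sub>F p in nhds q. norm (l p) < norm (l q) + 1" by (rule order_tendstoD(2)) simp
    have "\<forall>\<^sub>F p in nhds q. p \<in> bring_curve \<longrightarrow> norm (F p) \<le> (norm (l q) + 1) / (d / 2)"
      using e1 e2 eventually_nhds_poly_fst[OF q(2)]
    proof eventually_elim
      case (elim p)
      show ?case
      proof
        assume p: "p \<in> bring_curve"
        have "norm (F p) = norm (l p) / norm (H p - c)" using c1.eq[OF p elim(3)] by (simp add: F_def norm_divide)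
        also have "\<dots> \<le> (norm (l q) + 1) / (d / 2)" using elim d by (intro frac_le) auto
        finally show "norm (F p) \<le> (norm (l q) + 1) / (d / 2)" .
      qed
    qed
    then show ?thesis using d by (intro exI[of _ "(norm (l q) + 1) / (d / 2)"]) auto
  qed
  obtain CL where CL: "CL > 0" "\<forall>\<^sub>F p in nhds P. p \<in> bring_curve \<longrightarrow> norm (fst p - fst P) \<le> CL * norm (fst (\<phi> p) - fst (\<phi> P))"
    using lower_bound[OF 1 2 Pm(1)] Pr Pm(2) c(1) by (auto simp: s3_def)
  obtain CU where CU: "CU > 0" "\<forall>\<^sub>F p in nhds P. p \<in> bring_curve \<longrightarrow> norm (fst (\<phi> p) - fst (\<phi> P)) \<le> CU * norm (fst p - fst P)"
    using c1.upper_bound[OF Pm(1)] Pr by (auto simp: s3_def)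
  have lt: "((\<lambda>p. norm (l p)) \<longlongrightarrow> norm (l P)) (nhds P)" by (intro tendsto_intros lipschitz_at_tendsto l(2))
  have l1: "\<forall>\<^sub>F p in nhds P. norm (l p) < norm (l P) + 1" using lt by (rule order_tendstoD(2)) simp
  have l2: "\<forall>\<^sub>F p in nhds P. norm (l P) / 2 < norm (l p)" using lt by (rule order_tendstoD(1)) (use lP in \<open>simp add: P_def\<close>)
  have B: "\<forall>\<^sub>F p in nhds P. p \<in> bring_curve \<longrightarrow> norm (fst p - s3) * norm (F p) \<le> CL * (norm (l P) + 1)"
    using CL(2) l1
  proof eventually_elim
    case (elim p)
    show ?case
    proof
      assume p: "p \<in> bring_curve"
      show "norm (fst p - s3) * norm (F p) \<le> CL * (norm (l P) + 1)"
      proof (cases "fst (\<phi> p) = c")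
        case True
        then show ?thesis using CL(1) by (simp add: F_def)
      next
        case False
        have "norm (fst p - s3) * norm (F p) \<le> (CL * norm (fst (\<phi> p) - c)) * norm (F p)"
          using elim(1) p Pm(2) by (intro mult_right_mono) (auto simp: s3_def)
        also have "\<dots> = CL * norm (l p)" using False by (simp add: F_def norm_divide)
        also have "\<dots> \<le> CL * (norm (l P) + 1)" using elim(2) CL(1) by (intro mult_left_mono) auto
        finally show ?thesis .
      qed
    qed
  qed
  define \<kappa> where "\<kappa> = norm (l P) / 2 / CU"
  have \<kappa>: "\<kappa> > 0" using lP CU(1) by (simp add: \<kappa>_def P_def)
  have C: "\<forall>\<^sub>F p in nhds P. p \<in> bring_curve \<longrightarrow> fst p \<noteq> s3 \<longrightarrow> \<kappa> \<le> norm (fst p - s3) * norm (F p)"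
    using CL(2) CU(2) l2
  proof eventually_elim
    case (elim p)
    show ?case
    proof (intro impI)
      assume p: "p \<in> bring_curve" and ne: "fst p \<noteq> s3"
      have "0 < norm (fst p - s3)" using ne by simp
      also have "\<dots> \<le> CL * norm (fst (\<phi> p) - c)" using elim(1) p Pm(2) by (simp add: s3_def)
      finally have pos: "0 < norm (fst (\<phi> p) - c)" using CL(1) by (simp add: zero_less_mult_iff)
      have "\<kappa> = norm (l P) / 2 * norm (fst (\<phi> p) - c) / (CU * norm (fst (\<phi> p) - c))"
        using pos by (simp add: \<kappa>_def)
      also have "\<dots> \<le> norm (l P) / 2 * (CU * norm (fst p - s3)) / (CU * norm (fst (\<phi> p) - c))"
        using elim(2) p Pm(2) CU(1) by (intro divide_right_mono mult_left_mono) (auto simp: s3_def)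
      also have "\<dots> = norm (fst p - s3) * (norm (l P) / 2 / norm (fst (\<phi> p) - c))" using CU(1) by (simp add: field_simps)
      also have "\<dots> \<le> norm (fst p - s3) * norm (F p)"
        using elim(3) unfolding F_def norm_divide by (intro mult_left_mono divide_right_mono) auto
      finally show "\<kappa> \<le> norm (fst p - s3) * norm (F p)" .
    qed
  qed
  have "ratfun F" unfolding F_def using RFh l(1) by (intro ratfun_divide ratfun_diff ratfun_const)
  then obtain a0 a1 a2 rF where rF: "rF \<noteq> 0"
    and F: "\<And>s t. bring_poly s t = 0 \<Longrightarrow> poly rF s \<noteq> 0 \<Longrightarrow> F (s, t) = normal_form a0 a1 a2 rF (s, t)"
    using ratfun_polyE by metis
  have "a2 = 0"
  proof (rule residue_theorem[OF rF F])
    fix s0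
    show "\<exists>C. \<forall>\<^sub>F s in at s0. \<forall>t. bring_poly s t = 0 \<longrightarrow> norm (s - s3) * norm (F (s, t)) \<le> C * (1 + norm t)"
    proof (cases "poly r s0 = 0")
      case True
      then obtain \<delta> where \<delta>: "\<delta> > 0" "\<forall>\<^sub>F s in at s0. \<forall>t. bring_poly s t = 0 \<longrightarrow> \<delta> \<le> norm (fst (\<phi> (s, t)) - c)"
        using rep unfolding repelled_def by blast
      have near: "\<forall>\<^sub>F s in at s0. norm (s - s0) < 1" unfolding eventually_at dist_norm by (intro exI[of _ 1]) auto
      define A where "A = norm s0 + norm s3 + 1"
      have "\<forall>\<^sub>F s in at s0. \<forall>t. bring_poly s t = 0 \<longrightarrow> norm (s - s3) * norm (F (s, t)) \<le> (A * (L * (1 + A) / \<delta>)) * (1 + norm t)"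
        using \<delta>(2) near
      proof eventually_elim
        case (elim s)
        show ?case
        proof (intro allI impI)
          fix t assume t: "bring_poly s t = 0"
          have s: "norm (s - s3) \<le> A" "norm s \<le> A"
            using elim(2) norm_triangle_ineq2[of s s0] norm_triangle_ineq4[of s s3] norm_ge_zero[of s3]
            unfolding A_def by linarith+
          have "norm (F (s, t)) = norm (l (s, t)) / norm (fst (\<phi> (s, t)) - c)" by (simp add: F_def norm_divide)
          also have "\<dots> \<le> (L * (1 + norm s) * (1 + norm t)) / \<delta>"
            using growth elim(1) t \<delta>(1) growth0 by (intro frac_le) (auto intro!: mult_nonneg_nonneg)
          also have "\<dots> \<le> (L * (1 + A) * (1 + norm t)) / \<delta>"
            using s growth0 \<delta>(1) by (intro divide_right_mono mult_right_mono mult_left_mono) auto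
          finally have "norm (F (s, t)) \<le> L * (1 + A) / \<delta> * (1 + norm t)" by simp
          with s(1) have "norm (s - s3) * norm (F (s, t)) \<le> A * (L * (1 + A) / \<delta> * (1 + norm t))"
            by (intro mult_mono) (auto simp: A_def)
          then show "norm (s - s3) * norm (F (s, t)) \<le> (A * (L * (1 + A) / \<delta>)) * (1 + norm t)"
            by (simp add: mult.assoc)
        qed
      qed
      then show ?thesis by blast
    next
      case False
      obtain t where "bring_poly s0 t = 0" using bring_poly_ex by blast
      then have s0: "s0 \<noteq> 0" using c1.nz[of "(s0, t)"] False by simp
      obtain t1 t2 t3 where f: "fibre_roots s0 t1 t2 t3" using fibre_roots_ex[OF s0] by blast
      have loc: "\<exists>C\<ge>0. \<forall>\<^sub>F p in nhds (s0, u). p \<in> bring_curve \<longrightarrow> norm (fst p - s3) * norm (F p) \<le> C"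
        if u: "bring_poly s0 u = 0" for u
      proof (cases "(s0, u) = P")
        case True
        then show ?thesis using B CL(1) by (intro exI[of _ "CL * (norm (l P) + 1)"]) auto
      next
        case False
        then obtain C where C: "C \<ge> 0" "\<forall>\<^sub>F p in nhds (s0, u). p \<in> bring_curve \<longrightarrow> norm (F p) \<le> C"
          using A[of "(s0, u)"] u \<open>poly r s0 \<noteq> 0\<close> by auto
        have "((\<lambda>p. norm (fst p - s3)) \<longlongrightarrow> norm (fst (s0, u) - s3)) (nhds (s0, u))"
          by (intro tendsto_intros filterlim_ident)
        then have "\<forall>\<^sub>F p in nhds (s0, u). norm (fst p - s3) < norm (s0 - s3) + 1"
          by (rule order_tendstoD(2)) simp
        with C(2) have "\<forall>\<^sub>F p in nhds (s0, u). p \<in> bring_curve \<longrightarrow> norm (fst p - s3) * norm (F p) \<le> (norm (s0 - s3) + 1) * C"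
          by eventually_elim (auto intro!: mult_mono)
        then show ?thesis using C(1) by (intro exI[of _ "(norm (s0 - s3) + 1) * C"]) auto
      qed
      obtain C1 where C1: "C1 \<ge> 0" "\<forall>\<^sub>F p in nhds (s0, t1). p \<in> bring_curve \<longrightarrow> norm (fst p - s3) * norm (F p) \<le> C1"
        using loc[of t1] fibre_roots_root[OF f] by blast
      obtain C2 where C2: "C2 \<ge> 0" "\<forall>\<^sub>F p in nhds (s0, t2). p \<in> bring_curve \<longrightarrow> norm (fst p - s3) * norm (F p) \<le> C2"
        using loc[of t2] fibre_roots_root[OF f] by blast
      obtain C3 where C3: "C3 \<ge> 0" "\<forall>\<^sub>F p in nhds (s0, t3). p \<in> bring_curve \<longrightarrow> norm (fst p - s3) * norm (F p) \<le> C3"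
        using loc[of t3] fibre_roots_root[OF f] by blast
      define D where "D = C1 + C2 + C3"
      have "\<forall>\<^sub>F s in nhds s0. \<forall>t. bring_poly s t = 0 \<longrightarrow> ((s, t) \<in> bring_curve \<longrightarrow> norm (fst (s, t) - s3) * norm (F (s, t)) \<le> D)"
        by (rule fibre_cover[OF f s0]; rule eventually_mono[OF C1(2)] eventually_mono[OF C2(2)] eventually_mono[OF C3(2)])
          (use C1(1) C2(1) C3(1) in \<open>auto simp: D_def\<close>)
      then have "\<forall>\<^sub>F s in at s0. \<forall>t. bring_poly s t = 0 \<longrightarrow> norm (s - s3) * norm (F (s, t)) \<le> D"
        unfolding at_within_def by (intro filter_leD[OF inf_le1]) simp
      then have "\<forall>\<^sub>F s in at s0. \<forall>t. bring_poly s t = 0 \<longrightarrow> norm (s - s3) * norm (F (s, t)) \<le> D * (1 + norm t)"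
      proof eventually_elim
        case (elim s)
        show ?case
        proof (intro allI impI)
          fix t assume "bring_poly s t = 0"
          then have "norm (s - s3) * norm (F (s, t)) \<le> D" using elim by blast
          also have "D \<le> D * (1 + norm t)"
            using C1(1) C2(1) C3(1) mult_left_mono[of 1 "1 + norm t" D] by (simp add: D_def)
          finally show "norm (s - s3) * norm (F (s, t)) \<le> D * (1 + norm t)" by simp
        qed
      qed
      then show ?thesis by blast
    qed
  next
    obtain \<delta> where \<delta>: "\<delta> > 0" "\<forall>\<^sub>F s in at_infinity. \<forall>t. bring_poly s t = 0 \<longrightarrow> \<delta> \<le> norm (fst (\<phi> (s, t)) - c)"
      using repi unfolding repelled_def by blast
    have large: "\<forall>\<^sub>F s::complex in at_infinity. 1 \<le> norm s" unfolding eventually_at_infinity by blast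
    have "\<forall>\<^sub>F s in at_infinity. \<forall>t. bring_poly s t = 0 \<longrightarrow> norm (F (s, t)) \<le> (2 * L / \<delta>) * norm s * (1 + norm t)"
      using \<delta>(2) large
    proof eventually_elim
      case (elim s)
      show ?case
      proof (intro allI impI)
        fix t assume t: "bring_poly s t = 0"
        have "norm (F (s, t)) = norm (l (s, t)) / norm (fst (\<phi> (s, t)) - c)" by (simp add: F_def norm_divide)
        also have "\<dots> \<le> (L * (1 + norm s) * (1 + norm t)) / \<delta>"
          using growth elim(1) t \<delta>(1) growth0 by (intro frac_le) (auto intro!: mult_nonneg_nonneg)
        also have "\<dots> \<le> (L * (2 * norm s) * (1 + norm t)) / \<delta>"
          using elim(2) growth0 \<delta>(1) by (intro divide_right_mono mult_right_mono mult_left_mono) auto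
        finally show "norm (F (s, t)) \<le> (2 * L / \<delta>) * norm s * (1 + norm t)" by (simp add: mult_ac)
      qed
    qed
    then show "\<exists>C. \<forall>\<^sub>F s in at_infinity. \<forall>t. bring_poly s t = 0 \<longrightarrow> norm (F (s, t)) \<le> C * norm s * (1 + norm t)" by blast
  qed
  have s3: "s3 \<noteq> 0" "poly icos s3 \<noteq> 0" using c1.nz[OF Pm(1)] Pr by (auto simp: s3_def)
  obtain tP where tP: "P = (s3, tP)" by (metis s3_def prod.collapse)
  then have GP: "bring_poly s3 tP = 0" using Pm(1) by simp
  obtain u v where f: "fibre_roots s3 tP u v"
    by (metis GP fibre_roots_ex fibre_roots_root_iff fibre_roots_swap s3(1))
  note dist3 = fibre_roots_distinct[OF f s3]
  obtain C2 where C2: "C2 \<ge> 0" "\<forall>\<^sub>F p in nhds (s3, u). p \<in> bring_curve \<longrightarrow> norm (F p) \<le> C2"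
    using A[of "(s3, u)"] fibre_roots_root[OF f] Pr dist3 tP by auto
  obtain C3 where C3: "C3 \<ge> 0" "\<forall>\<^sub>F p in nhds (s3, v). p \<in> bring_curve \<longrightarrow> norm (F p) \<le> C3"
    using A[of "(s3, v)"] fibre_roots_root[OF f] Pr dist3 tP by auto
  obtain e1 where e1: "e1 > 0" "\<And>p. dist p P < e1 \<Longrightarrow> p \<in> bring_curve \<Longrightarrow> fst p \<noteq> s3 \<Longrightarrow> \<kappa> \<le> norm (fst p - s3) * norm (F p)"
    using C unfolding eventually_nhds_metric by blast
  obtain e2 where e2: "e2 > 0" "\<And>p. dist p (s3, u) < e2 \<Longrightarrow> p \<in> bring_curve \<Longrightarrow> norm (F p) \<le> C2"
    using C2(2) unfolding eventually_nhds_metric by blast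
  obtain e3 where e3: "e3 > 0" "\<And>p. dist p (s3, v) < e3 \<Longrightarrow> p \<in> bring_curve \<Longrightarrow> norm (F p) \<le> C3"
    using C3(2) unfolding eventually_nhds_metric by blast
  \<comment> \<open>As \<open>a2 = 0\<close>, the function is affine in \<open>t\<close> on each fibre: bounded values at two points bound the third, so there is no pole at \<open>P\<close> after all.\<close>
  define d where "d = norm (u - v)"
  have d: "d > 0" using dist3 by (simp add: d_def)
  define e where "e = min (min e1 e2) (min e3 (d / 2)) / 2"
  have e: "e > 0" "2 * e \<le> e1" "2 * e \<le> e2" "2 * e \<le> e3" "4 * e \<le> d" using e1 e2 e3 d by (auto simp: e_def)
  define M where "M = norm (tP - u) + 2 * e"
  define D where "D = C2 + (C2 + C3) / (d / 2) * M"
  have "((\<lambda>s. norm (s - s3) * D) \<longlongrightarrow> norm (s3 - s3) * D) (at s3)" by (intro tendsto_intros)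
  then have n1: "\<forall>\<^sub>F s in at s3. norm (s - s3) * D < \<kappa>" by (rule order_tendstoD(2)) (use \<kappa> in simp)
  have n2: "\<forall>\<^sub>F s in at s3. poly rF s \<noteq> 0" by (rule eventually_poly_nonzero_at[OF rF])
  have n3: "\<forall>\<^sub>F s in at s3. \<exists>t. bring_poly s t = 0 \<and> norm (t - w) < e" if "bring_poly s3 w = 0" for w
    using nearby_root[OF that s3(1) e(1)] unfolding at_within_def by (rule filter_leD[OF inf_le1])
  have n4: "\<forall>\<^sub>F s in at s3. norm (s - s3) < e \<and> s \<noteq> s3"
    unfolding eventually_at dist_norm using e(1) by (intro exI[of _ e]) auto
  have roots: "bring_poly s3 u = 0" "bring_poly s3 v = 0" using fibre_roots_root[OF f] by auto
  have "\<forall>\<^sub>F s in at s3. False"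
    using n1 n2 n3[OF GP] n3[OF roots(1)] n3[OF roots(2)] n4
  proof eventually_elim
    case (elim s)
    obtain x where x: "bring_poly s x = 0" "norm (x - tP) < e" using elim(3) by blast
    obtain y where y: "bring_poly s y = 0" "norm (y - u) < e" using elim(4) by blast
    obtain z where z: "bring_poly s z = 0" "norm (z - v) < e" using elim(5) by blast
    have ne: "s \<noteq> s3" "norm (s - s3) < e" using elim(6) by auto
    have dx: "dist (s, x) P < e1" using norm_pair_le[of "(s, x)" P] x ne e tP by (simp add: dist_norm)
    have dy: "dist (s, y) (s3, u) < e2" using norm_pair_le[of "(s, y)" "(s3, u)"] y ne e by (simp add: dist_norm)
    have dz: "dist (s, z) (s3, v) < e3" using norm_pair_le[of "(s, z)" "(s3, v)"] z ne e by (simp add: dist_norm)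
    have Fx: "\<kappa> \<le> norm (s - s3) * norm (F (s, x))" using e1(2)[OF dx] x ne by simp
    have Fy: "norm (F (s, y)) \<le> C2" using e2(2)[OF dy] y by simp
    have Fz: "norm (F (s, z)) \<le> C3" using e3(2)[OF dz] z by simp
    define b where "b = poly a1 s / poly rF s"
    have lin_eq: "F (s, t) = poly a0 s / poly rF s + b * t" if "bring_poly s t = 0" for t
      using F[OF that elim(2)] \<open>a2 = 0\<close> by (simp add: normal_form_def b_def add_divide_distrib)
    have yz: "d / 2 \<le> norm (y - z)"
    proof -
      have "u - v = (y - z) + ((z - v) - (y - u))" by simp
      then have "d \<le> norm (y - z) + norm ((z - v) - (y - u))" unfolding d_def by (metis norm_triangle_ineq)
      also have "norm ((z - v) - (y - u)) \<le> norm (z - v) + norm (y - u)" by (rule norm_triangle_ineq4)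
      finally show ?thesis using y(2) z(2) e(5) by linarith
    qed
    have "b * (y - z) = F (s, y) - F (s, z)" using lin_eq y z by (simp add: algebra_simps)
    then have "norm b * norm (y - z) = norm (F (s, y) - F (s, z))" by (metis norm_mult)
    also have "\<dots> \<le> C2 + C3" using norm_triangle_ineq4[of "F (s, y)" "F (s, z)"] Fy Fz by linarith
    finally have "norm b * norm (y - z) \<le> C2 + C3" .
    moreover have "norm b * (d / 2) \<le> norm b * norm (y - z)" using yz by (intro mult_left_mono) auto
    ultimately have "norm b * (d / 2) \<le> C2 + C3" by linarith
    then have nb: "norm b \<le> (C2 + C3) / (d / 2)" using d by (simp add: field_simps)
    have xy: "norm (x - y) \<le> M"
    proof -
      have "x - y = (tP - u) + ((x - tP) - (y - u))" by simp
      then have "norm (x - y) \<le> norm (tP - u) + norm ((x - tP) - (y - u))" by (metis norm_triangle_ineq)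
      also have "norm ((x - tP) - (y - u)) \<le> norm (x - tP) + norm (y - u)" by (rule norm_triangle_ineq4)
      finally show ?thesis using x(2) y(2) by (simp add: M_def)
    qed
    have "F (s, x) = F (s, y) + b * (x - y)" using lin_eq x y by (simp add: algebra_simps)
    then have "norm (F (s, x)) \<le> norm (F (s, y)) + norm b * norm (x - y)" by (metis norm_mult norm_triangle_ineq)
    also have "\<dots> \<le> D" unfolding D_def using Fy nb xy C2 C3 d by (intro add_mono mult_mono) auto
    finally have "norm (s - s3) * norm (F (s, x)) \<le> norm (s - s3) * D" by (intro mult_left_mono) auto
    with Fx elim(1) show False by linarith
  qed
  then show False by (simp add: trivial_limit_at)
qed

lemma lipschitz_at_minus_fst: "lipschitz_at (\<lambda>e. fst e - a) P" and lipschitz_at_minus_snd: "lipschitz_at (\<lambda>e. snd e - b) P"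
  by (auto intro!: differentiable_imp_lipschitz_at differentiable_diff)

lemma lipschitz_at_minus_mult: "lipschitz_at (\<lambda>e. (fst e - a) * (snd e - b)) P"
  by (auto intro!: differentiable_imp_lipschitz_at differentiable_diff differentiable_mult)

lemma growth_minus: "norm (x - a) \<le> (1 + norm a) * (1 + norm x)" for x :: complex
proof -
  have "norm (x - a) \<le> norm x + norm a" by (rule norm_triangle_ineq4)
  also have "\<dots> \<le> (1 + norm a) * (1 + norm x)" by (simp add: algebra_simps)
  finally show ?thesis .
qed

text \<open>
  By \<open>single_pole_impossible\<close> a plane in space, that is, a form in \<open>1, s, t, s t\<close>, that contains two of
  the three points of a fibre of \<open>fst \<circ> \<phi>\<close> contains the third: the three points are collinear.  This is the geometric
  Riemann-Roch theorem for a pencil of degree \<open>3\<close>.  A line with three points on a quadric lies on the quadric, so one of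
  the coordinates \<open>s\<close> and \<open>t\<close> is constant on the fibre.
\<close>
lemma fibre_image_collinear:
  assumes b: "birational \<phi> \<psi>"
  shows "\<forall>\<^sub>F c in cofinite. (\<forall>\<tau> \<tau>'. bring_poly c \<tau> = 0 \<longrightarrow> bring_poly c \<tau>' = 0 \<longrightarrow> fst (\<psi> (c, \<tau>)) = fst (\<psi> (c, \<tau>')))
     \<or> (\<forall>\<tau> \<tau>'. bring_poly c \<tau> = 0 \<longrightarrow> bring_poly c \<tau>' = 0 \<longrightarrow> snd (\<psi> (c, \<tau>)) = snd (\<psi> (c, \<tau>')))"
proof -
  obtain r H K where 1: "bir_chart \<phi> \<psi> r H K" using birational_chart[OF b, of "\<lambda>_. True"] by auto
  interpret c1: bir_chart \<phi> \<psi> r H K by (rule 1)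
  have "\<forall>\<^sub>F e in generic. poly r (fst (\<psi> e)) \<noteq> 0"
    using eventually_compose_filterlim[OF eventually_poly_generic[OF c1.r0] birational_filterlim[OF birational_sym[OF b]]] .
  from birational_chart[OF birational_sym[OF b] this]
  obtain r' S T where 2: "bir_chart \<psi> \<phi> r' S T" and Q: "\<And>P. P \<in> bring_curve \<Longrightarrow> poly r' (fst P) \<noteq> 0 \<Longrightarrow> poly r (fst (\<psi> P)) \<noteq> 0"
    by blast
  interpret c2: bir_chart \<psi> \<phi> r' S T by (rule 2)
  have RFh: "ratfun (\<lambda>e. fst (\<phi> e))" using b by (simp add: birational_def)
  \<comment> \<open>the finitely many values whose fibre meets a point where the map is not under control\<close>
  define Bad where "Bad = {c. poly r' c = 0} \<union> (\<Union>s0\<in>{s. poly r s = 0}. {c. \<not> repelled (\<lambda>e. fst (\<phi> e)) c (at s0)})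
      \<union> {c. \<not> repelled (\<lambda>e. fst (\<phi> e)) c at_infinity}"
  have "finite Bad" unfolding Bad_def
    using poly_roots_finite[OF c1.r0] poly_roots_finite[OF c2.r0] finite_not_repelled_at[OF RFh] finite_not_repelled_infinity[OF RFh]
    by blast
  have good: "(\<forall>\<tau> \<tau>'. bring_poly c \<tau> = 0 \<longrightarrow> bring_poly c \<tau>' = 0 \<longrightarrow> fst (\<psi> (c, \<tau>)) = fst (\<psi> (c, \<tau>')))
     \<or> (\<forall>\<tau> \<tau>'. bring_poly c \<tau> = 0 \<longrightarrow> bring_poly c \<tau>' = 0 \<longrightarrow> snd (\<psi> (c, \<tau>)) = snd (\<psi> (c, \<tau>')))" if "c \<notin> Bad" for c
  proof -
    have c: "poly r' c \<noteq> 0" "\<And>s0. poly r s0 = 0 \<Longrightarrow> repelled (\<lambda>e. fst (\<phi> e)) c (at s0)"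
      "repelled (\<lambda>e. fst (\<phi> e)) c at_infinity" using that by (auto simp: Bad_def)
    obtain \<tau> where "bring_poly c \<tau> = 0" using bring_poly_ex by blast
    then have c0: "c \<noteq> 0" "poly icos c \<noteq> 0" using c2.nz[of "(c, \<tau>)"] c(1) by auto
    obtain u1 u2 u3 where f: "fibre_roots c u1 u2 u3" using fibre_roots_ex[OF c0(1)] by blast
    note roots = fibre_roots_root_iff[OF f c0(1)]
    note ds = fibre_roots_distinct[OF f c0]
    have vanish: "l (\<psi> (c, \<tau>0)) = 0"
      if "ratfun l" "\<And>P. lipschitz_at l P" "\<And>s t. norm (l (s, t)) \<le> L * (1 + norm s) * (1 + norm t)" "bring_poly c \<tau>0 = 0"
        "\<And>\<tau>. bring_poly c \<tau> = 0 \<Longrightarrow> \<tau> \<noteq> \<tau>0 \<Longrightarrow> l (\<psi> (c, \<tau>)) = 0" for l L \<tau>0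
    proof (rule ccontr)
      assume nz: "l (\<psi> (c, \<tau>0)) \<noteq> 0"
      show False
        by (rule single_pole_impossible[OF 1 2 RFh c(1) _ c(2) c(3) that(1,2,3,4) nz that(5)])
          (use Q c(1) in auto)
    qed
    define P where "P u = \<psi> (c, u)" for u
    have S: "fst (P u) = fst (P v)" if "bring_poly c u = 0" "\<And>\<tau>. bring_poly c \<tau> = 0 \<Longrightarrow> \<tau> \<noteq> u \<Longrightarrow> fst (P \<tau>) = fst (P v)" for u v
    proof -
      have "(\<lambda>e. fst e - fst (P v)) (\<psi> (c, u)) = 0"
      proof (rule vanish)
        show "norm (fst (s, t) - fst (P v)) \<le> (1 + norm (fst (P v))) * (1 + norm s) * (1 + norm t)" for s t
        proof -
          have "norm (s - fst (P v)) * 1 \<le> ((1 + norm (fst (P v))) * (1 + norm s)) * (1 + norm t)"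
            by (rule mult_mono[OF growth_minus]) auto
          then show ?thesis by simp
        qed
      qed (use that in \<open>auto simp: P_def lipschitz_at_minus_fst\<close>)
      then show ?thesis by (simp add: P_def)
    qed
    have T: "snd (P u) = snd (P v)" if "bring_poly c u = 0" "\<And>\<tau>. bring_poly c \<tau> = 0 \<Longrightarrow> \<tau> \<noteq> u \<Longrightarrow> snd (P \<tau>) = snd (P v)" for u v
    proof -
      have "(\<lambda>e. snd e - snd (P v)) (\<psi> (c, u)) = 0"
      proof (rule vanish)
        show "norm (snd (s, t) - snd (P v)) \<le> (1 + norm (snd (P v))) * (1 + norm s) * (1 + norm t)" for s t
        proof -
          have "norm (t - snd (P v)) * 1 \<le> ((1 + norm (snd (P v))) * (1 + norm t)) * (1 + norm s)"
            by (rule mult_mono[OF growth_minus]) auto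
          then show ?thesis by (simp add: mult_ac)
        qed
      qed (use that in \<open>auto simp: P_def lipschitz_at_minus_snd\<close>)
      then show ?thesis by (simp add: P_def)
    qed
    have ST: "fst (P u3) = fst (P u1) \<or> snd (P u3) = snd (P u2)"
    proof -
      have "(\<lambda>e. (fst e - fst (P u1)) * (snd e - snd (P u2))) (\<psi> (c, u3)) = 0"
      proof (rule vanish)
        show "norm ((fst (s, t) - fst (P u1)) * (snd (s, t) - snd (P u2)))
          \<le> ((1 + norm (fst (P u1))) * (1 + norm (snd (P u2)))) * (1 + norm s) * (1 + norm t)" for s t
        proof -
          have "norm (s - fst (P u1)) * norm (t - snd (P u2)) \<le> ((1 + norm (fst (P u1))) * (1 + norm s)) * ((1 + norm (snd (P u2))) * (1 + norm t))"
            by (intro mult_mono growth_minus) auto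
          then show ?thesis by (simp add: norm_mult mult_ac)
        qed
        show "ratfun (\<lambda>e. (fst e - fst (P u1)) * (snd e - snd (P u2)))"
          by (intro ratfun_mult ratfun_diff ratfun_const ratfun_fst' ratfun_snd')
        show "(fst (\<psi> (c, \<tau>)) - fst (P u1)) * (snd (\<psi> (c, \<tau>)) - snd (P u2)) = 0" if "bring_poly c \<tau> = 0" "\<tau> \<noteq> u3" for \<tau>
          using that roots by (auto simp: P_def)
      qed (use roots in \<open>auto simp: lipschitz_at_minus_mult\<close>)
      then show ?thesis by (simp add: P_def)
    qed
    have all_s: "fst (P u1) = fst (P u2) \<and> fst (P u1) = fst (P u3)"
      if "fst (P u1) = fst (P u2) \<or> fst (P u1) = fst (P u3) \<or> fst (P u2) = fst (P u3)"
      using that S[of u1 u2] S[of u2 u1] S[of u3 u1] roots by metis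
    have all_t: "snd (P u1) = snd (P u2) \<and> snd (P u1) = snd (P u3)"
      if "snd (P u1) = snd (P u2) \<or> snd (P u1) = snd (P u3) \<or> snd (P u2) = snd (P u3)"
      using that T[of u1 u2] T[of u2 u1] T[of u3 u1] roots by metis
    have "(fst (P u1) = fst (P u2) \<and> fst (P u1) = fst (P u3)) \<or> (snd (P u1) = snd (P u2) \<and> snd (P u1) = snd (P u3))"
      using ST all_s all_t by metis
    then show ?thesis using roots by (auto simp: P_def)
  qed
  show ?thesis
    unfolding eventually_cofinite by (rule finite_subset[OF _ \<open>finite Bad\<close>]) (use good in blast)
qed

definition dep_fst :: "(complex \<times> complex \<Rightarrow> complex) \<Rightarrow> bool" where
  "dep_fst f \<longleftrightarrow> (\<exists>p q. q \<noteq> 0 \<and> (\<forall>\<^sub>F e in generic. f e = poly p (fst e) / poly q (fst e)))"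

text \<open>
  Constancy on infinitely many fibres makes the coefficients of \<open>t\<close> and \<open>t^2\<close> vanish at infinitely
  many \<open>s\<close>, hence identically.
\<close>
lemma constant_on_fibres_dep_fst:
  assumes f: "ratfun f" and fr: "\<exists>\<^sub>F c in cofinite. \<forall>\<tau> \<tau>'. bring_poly c \<tau> = 0 \<longrightarrow> bring_poly c \<tau>' = 0 \<longrightarrow> f (c, \<tau>) = f (c, \<tau>')"
  shows "dep_fst f"
proof -
  obtain c0 c1 c2 r where r: "r \<noteq> 0"
    and normal_form: "\<And>s t. bring_poly s t = 0 \<Longrightarrow> poly r s \<noteq> 0 \<Longrightarrow> f (s, t) = normal_form c0 c1 c2 r (s, t)"
    using ratfun_polyE[OF f] by metis
  define q where "q = r * ([:0,1:] * icos)"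
  have q: "q \<noteq> 0" using r by (simp add: q_def)
  define B where "B = {c. \<forall>\<tau> \<tau>'. bring_poly c \<tau> = 0 \<longrightarrow> bring_poly c \<tau>' = 0 \<longrightarrow> f (c, \<tau>) = f (c, \<tau>')}"
  have inf: "infinite (B - {c. poly q c = 0})"
    using fr poly_roots_finite[OF q] by (simp add: B_def frequently_cofinite)
  have z: "poly c1 c = 0 \<and> poly c2 c = 0" if "c \<in> B - {c. poly q c = 0}" for c
  proof -
    have c: "c \<noteq> 0" "poly icos c \<noteq> 0" "poly r c \<noteq> 0" using that by (auto simp: q_def)
    obtain u1 u2 u3 where u: "fibre_roots c u1 u2 u3" using fibre_roots_ex[OF c(1)] by blast
    note d = fibre_roots_distinct[OF u c(1,2)]
    have G: "bring_poly c u1 = 0" "bring_poly c u2 = 0" "bring_poly c u3 = 0" using fibre_roots_root[OF u] by auto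
    have "f (c, u1) = f (c, u2)" "f (c, u1) = f (c, u3)" using that G unfolding B_def by blast+
    then have "poly c1 c * u1 + poly c2 c * u1^2 = poly c1 c * u2 + poly c2 c * u2^2"
      "poly c1 c * u1 + poly c2 c * u1^2 = poly c1 c * u3 + poly c2 c * u3^2"
      using normal_form G c(3) by (auto simp: normal_form_def add.assoc)
    then have "(u1 - u2) * (poly c1 c + poly c2 c * (u1 + u2)) = 0" "(u1 - u3) * (poly c1 c + poly c2 c * (u1 + u3)) = 0"
      by algebra+
    then have e: "poly c1 c + poly c2 c * (u1 + u2) = 0" "poly c1 c + poly c2 c * (u1 + u3) = 0" using d by auto
    then have "poly c2 c * (u2 - u3) = 0" by algebra
    then have "poly c2 c = 0" using d by simp
    with e show ?thesis by simp
  qed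
  have "B - {c. poly q c = 0} \<subseteq> {c. poly c1 c = 0}" "B - {c. poly q c = 0} \<subseteq> {c. poly c2 c = 0}" using z by blast+
  then have "infinite {c. poly c1 c = 0}" "infinite {c. poly c2 c = 0}" using inf infinite_super by blast+
  then have "c1 = 0" using poly_roots_finite by blast
  moreover have "c2 = 0" using \<open>infinite {c. poly c2 c = 0}\<close> poly_roots_finite by blast
  ultimately have "\<forall>\<^sub>F e in generic. f e = poly c0 (fst e) / poly r (fst e)"
    by (intro generic_polyI[OF r]) (use normal_form in \<open>simp add: normal_form_def\<close>)
  then show ?thesis unfolding dep_fst_def using r by blast
qed

text \<open>
  One of the two alternatives for collinear fibres holds for infinitely many fibres.
\<close>
lemma birational_dep_fst:
  assumes b: "birational \<phi> \<psi>"
  shows "dep_fst (\<lambda>e. fst (\<psi> e)) \<or> dep_fst (\<lambda>e. snd (\<psi> e))"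
proof (rule ccontr)
  assume "\<not> ?thesis"
  moreover have "ratfun (\<lambda>e. fst (\<psi> e))" "ratfun (\<lambda>e. snd (\<psi> e))" using b by (auto simp: birational_def)
  ultimately have "\<not> (\<exists>\<^sub>F c in cofinite. \<forall>\<tau> \<tau>'. bring_poly c \<tau> = 0 \<longrightarrow> bring_poly c \<tau>' = 0 \<longrightarrow> fst (\<psi> (c, \<tau>)) = fst (\<psi> (c, \<tau>')))"
    "\<not> (\<exists>\<^sub>F c in cofinite. \<forall>\<tau> \<tau>'. bring_poly c \<tau> = 0 \<longrightarrow> bring_poly c \<tau>' = 0 \<longrightarrow> snd (\<psi> (c, \<tau>)) = snd (\<psi> (c, \<tau>')))"
    using constant_on_fibres_dep_fst by blast+
  then have n: "\<forall>\<^sub>F c in cofinite. \<not> (\<forall>\<tau> \<tau>'. bring_poly c \<tau> = 0 \<longrightarrow> bring_poly c \<tau>' = 0 \<longrightarrow> fst (\<psi> (c, \<tau>)) = fst (\<psi> (c, \<tau>')))"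
    "\<forall>\<^sub>F c in cofinite. \<not> (\<forall>\<tau> \<tau>'. bring_poly c \<tau> = 0 \<longrightarrow> bring_poly c \<tau>' = 0 \<longrightarrow> snd (\<psi> (c, \<tau>)) = snd (\<psi> (c, \<tau>')))"
    unfolding not_frequently .
  have "\<forall>\<^sub>F c::complex in cofinite. False"
    using n fibre_image_collinear[OF b] by eventually_elim blast
  then show False by (simp add: eventually_cofinite infinite_UNIV_char_0)
qed

lemma generic_fibre:
  assumes "eventually P generic"
  obtains s t1 t2 where "P (s, t1)" "P (s, t2)" "bring_poly s t1 = 0" "bring_poly s t2 = 0" "t1 \<noteq> t2"
proof -
  obtain q where q: "q \<noteq> 0" "\<And>s t. bring_poly s t = 0 \<Longrightarrow> poly q s \<noteq> 0 \<Longrightarrow> P (s, t)"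
    using assms unfolding eventually_generic_poly by blast
  have "q * ([:0,1:] * icos) \<noteq> 0" using q(1) by simp
  then obtain s where "poly (q * ([:0,1:] * icos)) s \<noteq> 0" using poly_all_0_iff_0 by blast
  then have s: "s \<noteq> 0" "poly icos s \<noteq> 0" "poly q s \<noteq> 0" by auto
  obtain u1 u2 u3 where u: "fibre_roots s u1 u2 u3" using fibre_roots_ex[OF s(1)] by blast
  show thesis by (rule that[of s u1 u2]) (use fibre_roots_distinct[OF u s(1,2)] fibre_roots_root[OF u] q(2) s in auto)
qed

section \<open>Moebius transformations of the two rulings\<close>

lemma one_simple_root_degree:
  fixes p :: "complex poly"
  assumes "\<And>a b. poly p a = 0 \<Longrightarrow> poly p b = 0 \<Longrightarrow> a = b" "\<And>a. poly p a = 0 \<Longrightarrow> poly (pderiv p) a \<noteq> 0"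
  shows "degree p \<le> 1"
proof (cases "degree p = 0")
  case False
  then obtain a where a: "poly p a = 0" using fundamental_theorem_of_algebra[of p] by (auto simp: constant_degree)
  then obtain q where q: "p = [:- a, 1:] * q" by (meson dvdE poly_eq_0_iff_dvd)
  have "poly (pderiv p) a = poly q a" unfolding q pderiv_mult by (simp add: pderiv_pCons)
  then have qa: "poly q a \<noteq> 0" using assms(2)[OF a] by simp
  have "degree q = 0"
  proof (rule ccontr)
    assume "degree q \<noteq> 0"
    then obtain b where b: "poly q b = 0" using fundamental_theorem_of_algebra[of q] by (auto simp: constant_degree)
    then have "poly p b = 0" by (simp add: q)
    then have "b = a" using assms(1) a by blast
    with b qa show False by simp
  qed
  moreover have "q \<noteq> 0" using qa by auto
  ultimately show ?thesis unfolding q by (subst degree_mult_eq) auto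
qed simp

lemma infinite_two_elements:
  assumes "infinite A" obtains a b where "a \<in> A" "b \<in> A" "a \<noteq> b"
proof -
  obtain a where a: "a \<in> A" using infinite_imp_nonempty[OF assms] by blast
  have "infinite (A - {a})" using assms by simp
  then obtain b where "b \<in> A - {a}" using infinite_imp_nonempty by blast
  then show thesis using that a by blast
qed

text \<open>
  For all but finitely many values \<open>c\<close> the equation \<open>p - c q = 0\<close> has only simple roots, and by
  injectivity only one.  Two such values bound the degrees of \<open>p\<close> and \<open>q\<close> by \<open>1\<close>.
\<close>
lemma injective_rational_function:
  fixes p q R :: "complex poly"
  assumes q: "q \<noteq> 0" and R: "R \<noteq> 0"
    and inj: "\<And>s s'. poly R s \<noteq> 0 \<Longrightarrow> poly R s' \<noteq> 0 \<Longrightarrow> poly p s / poly q s = poly p s' / poly q s' \<Longrightarrow> s = s'"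
  shows "\<exists>\<alpha> \<beta> \<gamma> \<delta>. \<alpha> * \<delta> - \<beta> * \<gamma> \<noteq> 0 \<and>
    (\<forall>s. poly q s \<noteq> 0 \<longrightarrow> poly R s \<noteq> 0 \<longrightarrow> \<gamma> * s + \<delta> \<noteq> 0 \<and> poly p s / poly q s = (\<alpha> * s + \<beta>) / (\<gamma> * s + \<delta>))"
proof -
  define g where "g = gcd p q"
  obtain p' q' where perm_quad: "p = g * p'" "q = g * q'" unfolding g_def by (meson dvdE gcd_dvd1 gcd_dvd2)
  have g: "g \<noteq> 0" and q': "q' \<noteq> 0" using q perm_quad by auto
  have cop: "coprime p' q'"
  proof -
    have "p div g = p'" "q div g = q'" using g perm_quad by (metis nonzero_mult_div_cancel_left)+
    then show ?thesis using div_gcd_coprime[of p q] q by (simp add: g_def)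
  qed
  define R' where "R' = R * g * q'"
  have R': "R' \<noteq> 0" using R g q' by (simp add: R'_def)
  have inj': "s = s'" if "poly R' s \<noteq> 0" "poly R' s' \<noteq> 0" "poly p' s / poly q' s = poly p' s' / poly q' s'" for s s'
    by (rule inj) (use that in \<open>simp_all add: R'_def perm_quad\<close>)
  have two: "\<exists>s s'. s \<noteq> s' \<and> poly R' s \<noteq> 0 \<and> poly R' s' \<noteq> 0"
  proof -
    have i: "infinite (UNIV - {s. poly R' s = 0})" using poly_roots_finite[OF R'] by (simp add: infinite_UNIV_char_0)
    then show ?thesis using infinite_two_elements by blast
  qed
  define W where "W = pderiv p' * q' - p' * pderiv q'"
  have W: "W \<noteq> 0"
  proof
    assume "W = 0"
    then have e: "pderiv p' * q' = p' * pderiv q'" by (simp add: W_def)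
    have "q' dvd p' * pderiv q'" by (metis e dvd_triv_right)
    then have "q' dvd pderiv q'" using cop by (metis coprime_commute coprime_dvd_mult_right_iff)
    then have "pderiv q' = 0" using dvd_imp_degree_le[of q' "pderiv q'"] degree_pderiv[of q'] q'
      by (metis One_nat_def diff_Suc_less leD neq0_conv pderiv_eq_0_iff)
    then have dq: "degree q' = 0" by (simp add: pderiv_eq_0_iff)
    have "p' dvd pderiv p' * q'" by (metis e dvd_triv_left)
    then have "p' dvd pderiv p'" using cop by (metis coprime_dvd_mult_left_iff)
    then have "pderiv p' = 0" using dvd_imp_degree_le[of p' "pderiv p'"] degree_pderiv[of p']
      by (metis One_nat_def diff_Suc_less leD neq0_conv pderiv_eq_0_iff)
    then have dp: "degree p' = 0" by (simp add: pderiv_eq_0_iff)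
    obtain a b where "p' = [:a:]" "q' = [:b:]" using dp dq degree_eq_zeroE by metis
    then show False using two inj' by (metis mult_zero_right poly_const_conv)
  qed
  define C0 where "C0 = (\<lambda>s. poly p' s / poly q' s) ` {s. poly (R' * W) s = 0}"
  have "finite C0" unfolding C0_def by (intro finite_imageI poly_roots_finite) (use R' W in simp)
  have deg: "degree (p' - smult c q') \<le> 1" if c: "c \<notin> C0" for c
  proof -
    have root: "poly q' s \<noteq> 0 \<and> poly p' s / poly q' s = c \<and> poly R' s \<noteq> 0 \<and> poly W s \<noteq> 0"
      if z: "poly (p' - smult c q') s = 0" for s
    proof -
      have q0: "poly q' s \<noteq> 0"
      proof
        assume "poly q' s = 0"
        then have "poly p' s = 0" using z by simp
        then have "is_unit [:- s, 1:]" using cop \<open>poly q' s = 0\<close>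
          by (auto simp: poly_eq_0_iff_dvd intro: coprime_common_divisor)
        then show False by (simp add: is_unit_pCons_iff)
      qed
      then have cs: "poly p' s / poly q' s = c" using z by (simp add: field_simps)
      have "poly (R' * W) s \<noteq> 0" using c cs unfolding C0_def by blast
      with q0 cs show ?thesis by simp
    qed
    show ?thesis
    proof (rule one_simple_root_degree)
      fix a b assume "poly (p' - smult c q') a = 0" "poly (p' - smult c q') b = 0"
      then show "a = b" using root inj' by metis
    next
      fix a assume z: "poly (p' - smult c q') a = 0"
      show "poly (pderiv (p' - smult c q')) a \<noteq> 0"
      proof
        assume "poly (pderiv (p' - smult c q')) a = 0"
        then have "poly (pderiv p') a = c * poly (pderiv q') a" "poly p' a = c * poly q' a"
          using z by (simp_all add: pderiv_diff pderiv_smult)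
        then have "poly W a = 0" by (simp add: W_def)
        with root[OF z] show False by simp
      qed
    qed
  qed
  have i: "infinite (UNIV - C0)" using \<open>finite C0\<close> by (simp add: infinite_UNIV_char_0)
  then obtain c1 c2 where c1: "c1 \<in> UNIV - C0" and c2: "c2 \<in> (UNIV - C0) - {c1}"
    using infinite_two_elements by blast
  define d1 d2 where "d1 = p' - smult c1 q'" and "d2 = p' - smult c2 q'"
  have dd: "degree d1 \<le> 1" "degree d2 \<le> 1" using deg c1 c2 by (auto simp: d1_def d2_def)
  have "smult (c2 - c1) q' = d1 - d2" by (simp add: d1_def d2_def smult_diff_left)
  moreover have "degree (d1 - d2) \<le> 1" using dd by (intro degree_diff_le)
  ultimately have "degree q' \<le> 1" using c2 by (metis DiffD2 degree_smult_eq insertI1 right_minus_eq)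
  moreover have "degree p' \<le> 1"
  proof -
    have "p' = d1 + smult c1 q'" by (simp add: d1_def)
    then show ?thesis using dd(1) \<open>degree q' \<le> 1\<close> by (metis degree_add_le degree_smult_le order.trans)
  qed
  moreover have lin_eq: "u = [:coeff u 0, coeff u 1:]" if "degree u \<le> 1" for u :: "complex poly"
    using that by (intro poly_eqI) (auto simp: coeff_pCons coeff_eq_0 split: nat.splits)
  ultimately obtain \<alpha> \<beta> \<gamma> \<delta> where ab: "p' = [:\<beta>, \<alpha>:]" "q' = [:\<delta>, \<gamma>:]" by metis
  have pe: "poly p' s = \<alpha> * s + \<beta>" "poly q' s = \<gamma> * s + \<delta>" for s by (simp_all add: ab)
  show ?thesis
  proof (rule exI[of _ \<alpha>], rule exI[of _ \<beta>], rule exI[of _ \<gamma>], rule exI[of _ \<delta>], rule conjI)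
    show "\<alpha> * \<delta> - \<beta> * \<gamma> \<noteq> 0"
    proof
      assume z: "\<alpha> * \<delta> - \<beta> * \<gamma> = 0"
      obtain s s' where s: "s \<noteq> s'" "poly R' s \<noteq> 0" "poly R' s' \<noteq> 0" using two by blast
      then have "\<gamma> * s + \<delta> \<noteq> 0" "\<gamma> * s' + \<delta> \<noteq> 0" by (auto simp: R'_def pe)
      moreover have "(\<alpha> * s + \<beta>) * (\<gamma> * s' + \<delta>) = (\<alpha> * s' + \<beta>) * (\<gamma> * s + \<delta>)" using z by algebra
      ultimately have "poly p' s / poly q' s = poly p' s' / poly q' s'" by (simp add: pe frac_eq_eq)
      then show False using inj' s by blast
    qed
    show "\<forall>s. poly q s \<noteq> 0 \<longrightarrow> poly R s \<noteq> 0 \<longrightarrow> \<gamma> * s + \<delta> \<noteq> 0 \<and> poly p s / poly q s = (\<alpha> * s + \<beta>) / (\<gamma> * s + \<delta>)"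
      by (auto simp: perm_quad pe)
  qed
qed

definition moebius_of :: "(complex \<times> complex \<Rightarrow> complex) \<Rightarrow> (complex \<times> complex \<Rightarrow> complex) \<Rightarrow> bool" where
  "moebius_of f g \<longleftrightarrow> (\<exists>\<alpha> \<beta> \<gamma> \<delta>. \<alpha> * \<delta> - \<beta> * \<gamma> \<noteq> 0 \<and> (\<forall>\<^sub>F e in generic. \<gamma> * g e + \<delta> \<noteq> 0 \<and> f e = (\<alpha> * g e + \<beta>) / (\<gamma> * g e + \<delta>)))"

text \<open>
  If \<open>fst \<circ> \<phi>\<close> depends on \<open>s\<close> alone then, \<open>\<phi>\<close> being birational, it is generically injective as a function of \<open>s\<close>.
\<close>
lemma dep_fst_moebius_of:
  assumes b: "birational \<phi> \<psi>" and d: "dep_fst (\<lambda>e. fst (\<phi> e))"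
  shows "moebius_of (\<lambda>e. fst (\<phi> e)) fst"
proof -
  obtain p q where q: "q \<noteq> 0" and h: "\<forall>\<^sub>F e in generic. fst (\<phi> e) = poly p (fst e) / poly q (fst e)"
    using d unfolding dep_fst_def by blast
  have inv: "\<forall>\<^sub>F e in generic. \<psi> (\<phi> e) = e" using b unfolding birational_def by (auto elim: eventually_mono)
  have not_snd: "\<not> dep_fst (\<lambda>e. snd (\<psi> e))"
  proof
    assume "dep_fst (\<lambda>e. snd (\<psi> e))"
    then obtain p' q' where "\<forall>\<^sub>F e in generic. snd (\<psi> e) = poly p' (fst e) / poly q' (fst e)"
      unfolding dep_fst_def by blast
    from eventually_compose_filterlim[OF this birational_filterlim[OF b]] h inv
    have "\<forall>\<^sub>F e in generic. snd e = poly p' (poly p (fst e) / poly q (fst e)) / poly q' (poly p (fst e) / poly q (fst e))"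
      by eventually_elim metis
    from generic_fibre[OF this] show False by (metis fst_conv snd_conv)
  qed
  then obtain p' q' where "\<forall>\<^sub>F e in generic. fst (\<psi> e) = poly p' (fst e) / poly q' (fst e)"
    using birational_dep_fst[OF b] unfolding dep_fst_def by blast
  from eventually_compose_filterlim[OF this birational_filterlim[OF b]] h inv
  have "\<forall>\<^sub>F e in generic. fst e = poly p' (poly p (fst e) / poly q (fst e)) / poly q' (poly p (fst e) / poly q (fst e))"
    by eventually_elim metis
  then obtain R where R: "R \<noteq> 0" and Re: "\<And>s t. bring_poly s t = 0 \<Longrightarrow> poly R s \<noteq> 0 \<Longrightarrow>
      s = poly p' (poly p s / poly q s) / poly q' (poly p s / poly q s)"
    unfolding eventually_generic_poly fst_conv by blast
  have inj: "s = s'" if "poly R s \<noteq> 0" "poly R s' \<noteq> 0" "poly p s / poly q s = poly p s' / poly q s'" for s s'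
    using Re that bring_poly_ex by metis
  have "\<exists>\<alpha> \<beta> \<gamma> \<delta>. \<alpha> * \<delta> - \<beta> * \<gamma> \<noteq> 0 \<and>
    (\<forall>s. poly q s \<noteq> 0 \<longrightarrow> poly R s \<noteq> 0 \<longrightarrow> \<gamma> * s + \<delta> \<noteq> 0 \<and> poly p s / poly q s = (\<alpha> * s + \<beta>) / (\<gamma> * s + \<delta>))"
    by (rule injective_rational_function[OF q R]) (rule inj)
  then obtain \<alpha> \<beta> \<gamma> \<delta> where m: "\<alpha> * \<delta> - \<beta> * \<gamma> \<noteq> 0"
    "\<forall>s. poly q s \<noteq> 0 \<longrightarrow> poly R s \<noteq> 0 \<longrightarrow> \<gamma> * s + \<delta> \<noteq> 0 \<and> poly p s / poly q s = (\<alpha> * s + \<beta>) / (\<gamma> * s + \<delta>)"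
    by blast
  have "\<forall>\<^sub>F e in generic. \<gamma> * fst e + \<delta> \<noteq> 0 \<and> fst (\<phi> e) = (\<alpha> * fst e + \<beta>) / (\<gamma> * fst e + \<delta>)"
    using h eventually_poly_generic[OF q] eventually_poly_generic[OF R] by eventually_elim (use m(2) in simp)
  with m(1) show ?thesis unfolding moebius_of_def by blast
qed

lemma birational_comp:
  assumes a: "birational \<phi> \<psi>" and b: "birational \<phi>' \<psi>'"
  shows "birational (\<lambda>e. \<phi>' (\<phi> e)) (\<lambda>e. \<psi> (\<psi>' e))"
proof -
  have F: "filterlim \<phi> generic generic" "filterlim \<psi>' generic generic" using a b birational_filterlim birational_sym by blast+
  have R: "ratfun (\<lambda>e. fst (\<phi>' (\<phi> e)))" "ratfun (\<lambda>e. snd (\<phi>' (\<phi> e)))" "ratfun (\<lambda>e. fst (\<psi> (\<psi>' e)))" "ratfun (\<lambda>e. snd (\<psi> (\<psi>' e)))"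
    using a b F ratfun_comp[of "\<lambda>e. fst (\<phi>' e)" \<phi>] ratfun_comp[of "\<lambda>e. snd (\<phi>' e)" \<phi>]
      ratfun_comp[of "\<lambda>e. fst (\<psi> e)" \<psi>'] ratfun_comp[of "\<lambda>e. snd (\<psi> e)" \<psi>'] unfolding birational_def by blast+
  have 1: "\<forall>\<^sub>F e in generic. \<phi> e \<in> bring_curve \<and> \<psi> (\<phi> e) = e" "\<forall>\<^sub>F e in generic. \<phi>' e \<in> bring_curve \<and> \<psi>' (\<phi>' e) = e"
    "\<forall>\<^sub>F e in generic. \<psi> e \<in> bring_curve \<and> \<phi> (\<psi> e) = e" "\<forall>\<^sub>F e in generic. \<psi>' e \<in> bring_curve \<and> \<phi>' (\<psi>' e) = e"
    using a b unfolding birational_def by blast+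
  have "\<forall>\<^sub>F e in generic. \<phi>' (\<phi> e) \<in> bring_curve \<and> \<psi> (\<psi>' (\<phi>' (\<phi> e))) = e"
    using 1(1) eventually_compose_filterlim[OF 1(2) F(1)] by eventually_elim auto
  moreover have "\<forall>\<^sub>F e in generic. \<psi> (\<psi>' e) \<in> bring_curve \<and> \<phi>' (\<phi> (\<psi> (\<psi>' e))) = e"
    using 1(4) eventually_compose_filterlim[OF 1(3) F(2)] by eventually_elim auto
  ultimately show ?thesis using R unfolding birational_def by blast
qed

text \<open>
  An automorphism of order four that exchanges the two rulings of the quadric.  It reduces statements about \<open>t\<close>
  to statements about \<open>s\<close>; it is also the map that \<open>U\<close> induces.
\<close>
definition four_cycle :: "complex \<times> complex \<Rightarrow> complex \<times> complex" where "four_cycle e = (snd e, - 1 / fst e)"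
definition four_cycle_inv :: "complex \<times> complex \<Rightarrow> complex \<times> complex" where "four_cycle_inv e = (- 1 / snd e, fst e)"

lemma generic_nonzero: "\<forall>\<^sub>F e in generic. fst e \<noteq> 0 \<and> snd e \<noteq> 0"
  by (rule generic_polyI[of "[:0,1:]"]) (auto simp: bring_poly_def)

lemma birational_tau: "birational four_cycle four_cycle_inv"
proof -
  have "\<forall>\<^sub>F e in generic. four_cycle e \<in> bring_curve \<and> four_cycle_inv (four_cycle e) = e"
    using generic_nonzero generic_bring_curve
  proof eventually_elim
    case (elim e)
    obtain s t where e: "e = (s, t)" by fastforce
    have "bring_poly t (- 1 / s) * s^3 = bring_poly s t" using elim(1) by (simp add: e bring_poly_def field_simps power2_eq_square power3_eq_cube)
    then have "bring_poly t (- 1 / s) = 0" using elim by (simp add: e)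
    then show ?case using elim by (simp add: e four_cycle_def four_cycle_inv_def)
  qed
  moreover have "\<forall>\<^sub>F e in generic. four_cycle_inv e \<in> bring_curve \<and> four_cycle (four_cycle_inv e) = e"
    using generic_nonzero generic_bring_curve
  proof eventually_elim
    case (elim e)
    obtain s t where e: "e = (s, t)" by fastforce
    have "bring_poly (- 1 / t) s * t^3 = - bring_poly s t" using elim(1) by (simp add: e bring_poly_def field_simps power2_eq_square power3_eq_cube)
    then have "bring_poly (- 1 / t) s = 0" using elim by (simp add: e)
    then show ?case using elim by (simp add: e four_cycle_def four_cycle_inv_def)
  qed
  moreover have "ratfun (\<lambda>e. - 1 / fst e)" "ratfun (\<lambda>e. - 1 / snd e)"
    by (intro ratfun_divide ratfun_const ratfun_fst' ratfun_snd')+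
  ultimately show ?thesis unfolding birational_def by (simp add: four_cycle_def four_cycle_inv_def ratfun_fst' ratfun_snd')
qed

lemma moebius_of_fst:
  assumes b: "birational \<phi> \<psi>"
  shows "moebius_of (\<lambda>e. fst (\<phi> e)) fst \<or> moebius_of (\<lambda>e. snd (\<phi> e)) fst"
proof -
  consider "dep_fst (\<lambda>e. fst (\<phi> e))" | "dep_fst (\<lambda>e. snd (\<phi> e))"
    using birational_dep_fst[OF birational_sym[OF b]] by blast
  then show ?thesis
  proof cases
    case 1 then show ?thesis using dep_fst_moebius_of[OF b] by blast
  next
    case 2 then show ?thesis using dep_fst_moebius_of[OF birational_comp[OF b birational_tau]] by (simp add: four_cycle_def)
  qed
qed

lemma moebius_of_snd:
  assumes b: "birational \<phi> \<psi>"
  shows "moebius_of (\<lambda>e. fst (\<phi> e)) snd \<or> moebius_of (\<lambda>e. snd (\<phi> e)) snd"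
proof -
  have "\<forall>\<^sub>F e in generic. four_cycle_inv (four_cycle e) = e" using birational_tau unfolding birational_def by (auto elim: eventually_mono)
  have *: "moebius_of f snd" if "moebius_of (\<lambda>e. f (four_cycle_inv e)) fst" for f
  proof -
    obtain \<alpha> \<beta> \<gamma> \<delta> where m: "\<alpha> * \<delta> - \<beta> * \<gamma> \<noteq> 0"
      "\<forall>\<^sub>F e in generic. \<gamma> * fst e + \<delta> \<noteq> 0 \<and> f (four_cycle_inv e) = (\<alpha> * fst e + \<beta>) / (\<gamma> * fst e + \<delta>)"
      using \<open>moebius_of (\<lambda>e. f (four_cycle_inv e)) fst\<close> unfolding moebius_of_def by blast
    have "\<forall>\<^sub>F e in generic. \<gamma> * snd e + \<delta> \<noteq> 0 \<and> f e = (\<alpha> * snd e + \<beta>) / (\<gamma> * snd e + \<delta>)"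
      using eventually_compose_filterlim[OF m(2) birational_filterlim[OF birational_tau]] \<open>\<forall>\<^sub>F e in generic. four_cycle_inv (four_cycle e) = e\<close>
      by eventually_elim (simp add: four_cycle_def)
    with m(1) show ?thesis unfolding moebius_of_def by blast
  qed
  show ?thesis using moebius_of_fst[OF birational_comp[OF birational_sym[OF birational_tau] b]] * by auto
qed

text \<open>
  Otherwise \<open>t\<close> would be a Moebius function of \<open>s\<close>, against the identity theorem.
\<close>
lemma not_moebius_of_both: "\<not> (moebius_of f fst \<and> moebius_of f snd)"
proof
  assume "moebius_of f fst \<and> moebius_of f snd"
  then obtain \<alpha> \<beta> \<gamma> \<delta> \<alpha>' \<beta>' \<gamma>' \<delta>' where m': "\<alpha>' * \<delta>' - \<beta>' * \<gamma>' \<noteq> (0::complex)"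
      "\<forall>\<^sub>F e in generic. \<gamma> * fst e + \<delta> \<noteq> 0 \<and> f e = (\<alpha> * fst e + \<beta>) / (\<gamma> * fst e + \<delta>)"
      "\<forall>\<^sub>F e in generic. \<gamma>' * snd e + \<delta>' \<noteq> 0 \<and> f e = (\<alpha>' * snd e + \<beta>') / (\<gamma>' * snd e + \<delta>')"
    unfolding moebius_of_def by blast
  from generic_fibre[OF eventually_conj[OF m'(2,3)]]
  obtain s t1 t2 where st: "t1 \<noteq> t2" "\<gamma>' * t1 + \<delta>' \<noteq> 0" "\<gamma>' * t2 + \<delta>' \<noteq> 0"
     "(\<alpha>' * t1 + \<beta>') / (\<gamma>' * t1 + \<delta>') = (\<alpha>' * t2 + \<beta>') / (\<gamma>' * t2 + \<delta>')"
    by (metis fst_conv snd_conv)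
  then have "(\<alpha>' * t1 + \<beta>') * (\<gamma>' * t2 + \<delta>') = (\<alpha>' * t2 + \<beta>') * (\<gamma>' * t1 + \<delta>')" by (simp add: frac_eq_eq)
  then have "(\<alpha>' * \<delta>' - \<beta>' * \<gamma>') * (t1 - t2) = 0" by algebra
  then show False using m'(1) st(1) by simp
qed

text \<open>
  Every birational self-map of the curve extends to an automorphism of the product of two projective lines.
\<close>
theorem birational_Moebius:
  assumes "birational \<phi> \<psi>"
  shows "(moebius_of (\<lambda>e. fst (\<phi> e)) fst \<and> moebius_of (\<lambda>e. snd (\<phi> e)) snd) \<or> (moebius_of (\<lambda>e. fst (\<phi> e)) snd \<and> moebius_of (\<lambda>e. snd (\<phi> e)) fst)"
  using moebius_of_fst[OF assms] moebius_of_snd[OF assms] not_moebius_of_both by blast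

section \<open>The canonical model in three-space\<close>

type_synonym quad = "complex \<times> complex \<times> complex \<times> complex"

text \<open>
  The quadric and the cubic that cut out the canonical model of Bring's curve in projective three-space, in
  coordinates diagonalising the five-cycle of the coordinates \<open>x\<^sub>i\<close>.
\<close>
fun quadric :: "quad \<Rightarrow> complex" where "quadric (a, b, c, d) = a * d + b * c"
fun cubic :: "quad \<Rightarrow> complex" where "cubic (a, b, c, d) = a^2 * c + a * b^2 + c^2 * d + b * d^2"
fun quadric_bilinear :: "quad \<Rightarrow> quad \<Rightarrow> complex" where
  "quadric_bilinear (a, b, c, d) (a', b', c', d') = a * d' + d * a' + b * c' + c * b'"
text \<open>
  The commutative product defined by the cubic and the quadric: the pairing of the product of \<open>u\<close> and \<open>v\<close> with \<open>w\<close>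
  is the polarisation of the cubic.
\<close>
fun cubic_product :: "quad \<Rightarrow> quad \<Rightarrow> quad" where
  "cubic_product (a, b, c, d) (a', b', c', d') =
     (c * c' + b * d' + d * b', a * a' + c * d' + d * c', a * b' + b * a' + d * d', a * c' + c * a' + b * b')"
definition cubic_trilinear :: "quad \<Rightarrow> quad \<Rightarrow> quad \<Rightarrow> complex" where "cubic_trilinear u v w = quadric_bilinear (cubic_product u v) w"
fun scale :: "complex \<Rightarrow> quad \<Rightarrow> quad" where "scale k (a, b, c, d) = (k * a, k * b, k * c, k * d)"
fun combine :: "quad \<Rightarrow> quad \<Rightarrow> quad \<Rightarrow> quad \<Rightarrow> quad \<Rightarrow> quad" where
  "combine p q r s (a, b, c, d) = scale a p + scale b q + scale c r + scale d s"
text \<open>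
  The parametrisation of the quadric by the product of its two rulings.
\<close>
definition segre :: "complex \<times> complex \<Rightarrow> quad" where "segre e = (1, fst e, - snd e, fst e * snd e)"

lemma cubic_segre: "cubic (segre (s, t)) = bring_poly s t"
  by (simp add: segre_def bring_poly_def power2_eq_square power3_eq_cube)

lemma quadric_segre: "quadric (segre e) = 0"
  by (simp add: segre_def)

lemma cubic_combine:
  "3 * cubic (combine p q r s (a, b, c, d)) =
    a^3 * cubic_trilinear p p p + b^3 * cubic_trilinear q q q + c^3 * cubic_trilinear r r r + d^3 * cubic_trilinear s s s
    + 3 * (a^2 * b * cubic_trilinear p p q + a^2 * c * cubic_trilinear p p r + a^2 * d * cubic_trilinear p p s
         + a * b^2 * cubic_trilinear p q q + b^2 * c * cubic_trilinear q q r + b^2 * d * cubic_trilinear q q s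
         + a * c^2 * cubic_trilinear p r r + b * c^2 * cubic_trilinear q r r + c^2 * d * cubic_trilinear r r s
         + a * d^2 * cubic_trilinear p s s + b * d^2 * cubic_trilinear q s s + c * d^2 * cubic_trilinear r s s)
    + 6 * (a * b * c * cubic_trilinear p q r + a * b * d * cubic_trilinear p q s + a * c * d * cubic_trilinear p r s + b * c * d * cubic_trilinear q r s)"
proof -
  obtain p1 p2 p3 p4 where p: "p = (p1, p2, p3, p4)" by (metis prod_cases4)
  obtain q1 q2 q3 q4 where q: "q = (q1, q2, q3, q4)" by (metis prod_cases4)
  obtain r1 r2 r3 r4 where r: "r = (r1, r2, r3, r4)" by (metis prod_cases4)
  obtain s1 s2 s3 s4 where s: "s = (s1, s2, s3, s4)" by (metis prod_cases4)
  show ?thesis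
    unfolding p q r s cubic_trilinear_def combine.simps scale.simps add_Pair cubic.simps cubic_product.simps quadric_bilinear.simps by algebra
qed

lemma cubic_polynomial_zero:
  fixes a0 :: complex
  assumes "\<And>x. a0 + a1 * x + a2 * x^2 + a3 * x^3 = 0"
  shows "a0 = 0 \<and> a1 = 0 \<and> a2 = 0 \<and> a3 = 0"
proof -
  have "poly [:a0, a1, a2, a3:] x = 0" for x
    using assms[of x] by (simp add: algebra_simps power2_eq_square power3_eq_cube)
  then have "[:a0, a1, a2, a3:] = 0" using poly_all_0_iff_0 by blast
  then show ?thesis by auto
qed

text \<open>
  The restriction to the quadric determines a cubic up to multiples of the quadric by linear forms.  The
  hypothesis \<open>H\<close>, that the contraction with the dual quadric vanishes, excludes these multiples.
\<close>
lemma harmonic_cubic: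
  assumes H: "cubic_trilinear p s p + cubic_trilinear q r p = 0" "cubic_trilinear p s q + cubic_trilinear q r q = 0" "cubic_trilinear p s r + cubic_trilinear q r r = 0" "cubic_trilinear p s s + cubic_trilinear q r s = 0"
    and V: "\<And>x y. cubic (combine p q r s (segre (x, y))) = \<kappa> * bring_poly x y"
  shows "cubic (combine p q r s v) = \<kappa> * cubic v"
proof -
  have sym: "cubic_trilinear u v w = cubic_trilinear v u w" "cubic_trilinear u v w = cubic_trilinear u w v" for u v w
    unfolding cubic_trilinear_def by (cases u; cases v; cases w; simp add: algebra_simps)+
  have "(cubic_trilinear p p p + 3 * (\<kappa> - cubic_trilinear p p r) * y + 3 * cubic_trilinear p r r * y^2 + (- cubic_trilinear r r r) * y^3)
      + (3 * cubic_trilinear p p q + (3 * cubic_trilinear p p s - 6 * cubic_trilinear p q r) * y + (3 * cubic_trilinear q r r - 6 * cubic_trilinear p r s) * y^2 + 3 * (cubic_trilinear r r s - \<kappa>) * y^3) * x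
      + (3 * (cubic_trilinear p q q - \<kappa>) + (6 * cubic_trilinear p q s - 3 * cubic_trilinear q q r) * y + (3 * cubic_trilinear p s s - 6 * cubic_trilinear q r s) * y^2 + (- (3 * cubic_trilinear r s s)) * y^3) * x^2
      + (cubic_trilinear q q q + 3 * cubic_trilinear q q s * y + 3 * (cubic_trilinear q s s - \<kappa>) * y^2 + cubic_trilinear s s s * y^3) * x^3 = 0" for x y
    using V[of x y] cubic_combine[of p q r s 1 x "- y" "x * y"] 
    unfolding segre_def fst_conv snd_conv bring_poly_def power_one mult_1_left mult_1_right by algebra
  from cubic_polynomial_zero[OF this]
  have "cubic_trilinear p p p + 3 * (\<kappa> - cubic_trilinear p p r) * y + 3 * cubic_trilinear p r r * y^2 + (- cubic_trilinear r r r) * y^3 = 0"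
    "3 * cubic_trilinear p p q + (3 * cubic_trilinear p p s - 6 * cubic_trilinear p q r) * y + (3 * cubic_trilinear q r r - 6 * cubic_trilinear p r s) * y^2 + 3 * (cubic_trilinear r r s - \<kappa>) * y^3 = 0"
    "3 * (cubic_trilinear p q q - \<kappa>) + (6 * cubic_trilinear p q s - 3 * cubic_trilinear q q r) * y + (3 * cubic_trilinear p s s - 6 * cubic_trilinear q r s) * y^2 + (- (3 * cubic_trilinear r s s)) * y^3 = 0"
    "cubic_trilinear q q q + 3 * cubic_trilinear q q s * y + 3 * (cubic_trilinear q s s - \<kappa>) * y^2 + cubic_trilinear s s s * y^3 = 0" for y by blast+
  note c = cubic_polynomial_zero[OF this(1)] cubic_polynomial_zero[OF this(2)] cubic_polynomial_zero[OF this(3)] cubic_polynomial_zero[OF this(4)]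
  have z: "cubic_trilinear p p s = 0" "cubic_trilinear p q r = 0" "cubic_trilinear q r r = 0" "cubic_trilinear p r s = 0" "cubic_trilinear p q s = 0" "cubic_trilinear q q r = 0" "cubic_trilinear p s s = 0" "cubic_trilinear q r s = 0"
  proof -
    have e: "cubic_trilinear p p s = 2 * cubic_trilinear p q r" "cubic_trilinear q r r = 2 * cubic_trilinear p r s" "2 * cubic_trilinear p q s = cubic_trilinear q q r" "cubic_trilinear p s s = 2 * cubic_trilinear q r s"
      using c by (auto simp: field_simps)
    have h: "cubic_trilinear p p s + cubic_trilinear p q r = 0" "cubic_trilinear p q s + cubic_trilinear q q r = 0" "cubic_trilinear p r s + cubic_trilinear q r r = 0" "cubic_trilinear p s s + cubic_trilinear q r s = 0"
      using H sym by metis+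
    show "cubic_trilinear p p s = 0" "cubic_trilinear p q r = 0" "cubic_trilinear q r r = 0" "cubic_trilinear p r s = 0" "cubic_trilinear p q s = 0" "cubic_trilinear q q r = 0" "cubic_trilinear p s s = 0" "cubic_trilinear q r s = 0"
      using e h by algebra+
  qed
  have c': "cubic_trilinear p p p = 0" "cubic_trilinear p p r = \<kappa>" "cubic_trilinear p r r = 0" "cubic_trilinear r r r = 0" "cubic_trilinear p p q = 0" "cubic_trilinear r r s = \<kappa>" "cubic_trilinear p q q = \<kappa>"
    "cubic_trilinear r s s = 0" "cubic_trilinear q q q = 0" "cubic_trilinear q q s = 0" "cubic_trilinear q s s = \<kappa>" "cubic_trilinear s s s = 0" using c by auto
  obtain a b c d where v: "v = (a, b, c, d)" by (metis prod_cases4)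
  have "3 * cubic (combine p q r s v) = 3 * (\<kappa> * cubic v)"
    unfolding v cubic_combine z c' by (simp add: algebra_simps)
  then show ?thesis by simp
qed

text \<open>
  A polynomial of bidegree \<open>(3, 3)\<close> that vanishes on the curve is a multiple of the equation of the curve:
  reducing modulo the equation, the identity theorem determines all coefficients up to the factor \<open>p 1\<close>, and this
  factor is constant because the degree in \<open>s\<close> is at most \<open>3\<close>.
\<close>
lemma bidegree_multiple:
  fixes f g :: "nat \<Rightarrow> complex poly"
  assumes K: "finite K" and deg: "\<And>k. k \<in> K \<Longrightarrow> degree (f k) \<le> 3" "\<And>k. k \<in> K \<Longrightarrow> degree (g k) \<le> 3"
    and ev: "\<forall>\<^sub>F e in generic. (\<Sum>k\<in>K. poly (f k) (fst e) * poly (g k) (snd e)) = 0"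
  shows "\<exists>\<kappa>. \<forall>s t. (\<Sum>k\<in>K. poly (f k) s * poly (g k) t) = \<kappa> * bring_poly s t"
proof -
  define X :: "complex poly" where "X = [:0, 1:]"
  define p where "p j = (\<Sum>k\<in>K. smult (coeff (g k) j) (f k))" for j
  have dp: "degree (p j) \<le> 3" for j
    unfolding p_def by (intro degree_sum_le K) (use deg degree_smult_le order_trans in blast)
  have expand: "(\<Sum>k\<in>K. poly (f k) s * poly (g k) t) = poly (p 0) s + poly (p 1) s * t + poly (p 2) s * t^2 + poly (p 3) s * t^3" for s t
  proof -
    have "poly (g k) t = coeff (g k) 0 + coeff (g k) 1 * t + coeff (g k) 2 * t^2 + coeff (g k) 3 * t^3" if "k \<in> K" for k
    proof -
      have "poly (g k) t = (\<Sum>i\<le>3. coeff (g k) i * t^i)"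
        unfolding poly_altdef using deg(2)[OF that]
        by (intro sum.mono_neutral_left) (auto simp: coeff_eq_0 not_le)
      then show ?thesis by (simp add: numeral_eq_Suc)
    qed
    then have "(\<Sum>k\<in>K. poly (f k) s * poly (g k) t) = (\<Sum>k\<in>K. poly (f k) s * (coeff (g k) 0 + coeff (g k) 1 * t + coeff (g k) 2 * t^2 + coeff (g k) 3 * t^3))"
      by (intro sum.cong) auto
    then show ?thesis
      by (simp add: p_def poly_sum sum.distrib sum_distrib_left sum_distrib_right algebra_simps)
  qed
  have "\<forall>\<^sub>F e in generic. poly (X * p 0 - X^2 * p 3) (fst e) + poly (X * p 1 + p 3) (fst e) * snd e + poly (X * p 2 - X^3 * p 3) (fst e) * (snd e)^2 = 0"
    using ev generic_bring_curve
  proof eventually_elim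
    case (elim e)
    obtain s t where e: "e = (s, t)" by fastforce
    have "poly (p 0) s + poly (p 1) s * t + poly (p 2) s * t^2 + poly (p 3) s * t^3 = 0" "s * t^3 + s^3 * t^2 - t + s^2 = 0"
      using elim unfolding expand e by (simp_all add: bring_poly_def)
    then show ?case unfolding e X_def by simp algebra
  qed
  then have "\<exists>\<^sub>F e in generic. poly (X * p 0 - X^2 * p 3) (fst e) + poly (X * p 1 + p 3) (fst e) * snd e + poly (X * p 2 - X^3 * p 3) (fst e) * (snd e)^2 = 0"
    using generic_nontrivial by (rule eventually_frequently[rotated])
  from identity_theorem[OF this]
  have e: "X * p 0 - X^2 * p 3 = 0" "X * p 1 + p 3 = 0" "X * p 2 - X^3 * p 3 = 0" by auto
  have X0: "X \<noteq> 0" by (simp add: X_def)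
  have p3: "p 3 = - (X * p 1)" using e(2) by (simp add: eq_neg_iff_add_eq_0 add.commute)
  have "X * (p 0 - X * p 3) = 0" using e(1) by (simp add: algebra_simps power2_eq_square)
  then have "p 0 = X * p 3" using X0 by simp
  then have p0: "p 0 = - (X^2 * p 1)" by (simp add: p3 power2_eq_square mult.assoc)
  have "X * (p 2 - X^2 * p 3) = 0" using e(3) by (simp add: algebra_simps power2_eq_square power3_eq_cube)
  then have "p 2 = X^2 * p 3" using X0 by simp
  then have p2: "p 2 = - (X^3 * p 1)" by (simp add: p3 power2_eq_square power3_eq_cube mult.assoc)
  have "degree (p 1) = 0"
  proof (cases "p 1 = 0")
    case False
    then have "degree (X^3 * p 1) = 3 + degree (p 1)" using X0 by (simp add: degree_mult_eq degree_power_eq X_def)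
    then show ?thesis using dp[of 2] unfolding p2 by simp
  qed simp
  then obtain k where k: "p 1 = [:k:]" using degree_eq_zeroE by metis
  have "(\<Sum>j\<in>K. poly (f j) s * poly (g j) t) = (- k) * bring_poly s t" for s t
    unfolding expand p0 p2 p3 k X_def bring_poly_def by (simp add: algebra_simps power2_eq_square power3_eq_cube)
  then show ?thesis by blast
qed

section \<open>Linear extension of birational self-maps\<close>

definition similitude :: "(quad \<Rightarrow> quad) \<Rightarrow> bool" where
  "similitude L \<longleftrightarrow> (\<forall>u v. L (u + v) = L u + L v) \<and> (\<forall>k u. L (scale k u) = scale k (L u)) \<and> surj L
     \<and> (\<exists>\<nu>. \<nu> \<noteq> 0 \<and> (\<forall>v. quadric (L v) = \<nu> * quadric v)) \<and> (\<exists>\<kappa>. \<forall>v. cubic (L v) = \<kappa> * cubic v)"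

lemma quad_cases:
  fixes v :: quad obtains a b c d where "v = (a, b, c, d)"
  by (metis prod_cases4)

lemma combine_add: "combine p q r s (u + v) = combine p q r s u + combine p q r s v"
proof -
  have sc_add: "scale (k + l) x = scale k x + scale l x" for k l x by (cases x) (simp add: algebra_simps)
  show ?thesis by (cases u; cases v) (simp add: sc_add)
qed

lemma combine_scale: "combine p q r s (scale k v) = scale k (combine p q r s v)"
proof -
  have "scale k (x + y) = scale k x + scale k y" "scale k (scale l x) = scale (k * l) x" for k l x y
    by (cases x; cases y; simp add: algebra_simps)+
  then show ?thesis by (cases v) simp
qed

text \<open>
  The image under the Segre map of a pair of points of the projective line in homogeneous coordinates.
\<close>
definition segre_vec :: "complex \<Rightarrow> complex \<Rightarrow> complex \<Rightarrow> complex \<Rightarrow> quad" where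
  "segre_vec x y x' y' = (y * y', x * y', - (y * x'), x * x')"

lemma combine_segre:
  "combine (segre_vec \<beta> \<delta> \<beta>' \<delta>') (segre_vec \<alpha> \<gamma> \<beta>' \<delta>')
     (scale (- 1) (segre_vec \<beta> \<delta> \<alpha>' \<gamma>')) (segre_vec \<alpha> \<gamma> \<alpha>' \<gamma>') (segre (x, y)) =
     ((\<gamma> * x + \<delta>) * (\<gamma>' * y + \<delta>'), (\<alpha> * x + \<beta>) * (\<gamma>' * y + \<delta>'),
      - ((\<gamma> * x + \<delta>) * (\<alpha>' * y + \<beta>')), (\<alpha> * x + \<beta>) * (\<alpha>' * y + \<beta>'))"
  unfolding segre_vec_def segre_def fst_conv snd_conv combine.simps scale.simps add_Pair by (simp add: algebra_simps)

lemma combine_swap: "combine p (scale (- 1) r) (scale (- 1) q) s (a, b, c, d) = combine p q r s (a, - c, - b, d)"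
  by (cases p; cases q; cases r; cases s) (simp add: algebra_simps)

lemma combine_swap_segre: "combine p (scale (- 1) r) (scale (- 1) q) s (segre (x, y)) = combine p q r s (segre (y, x))"
  by (simp add: segre_def combine_swap mult.commute del: combine.simps)

lemma quadric_combine_swap:
  assumes "\<And>v. quadric (combine p q r s v) = \<nu> * quadric v"
  shows "quadric (combine p (scale (- 1) r) (scale (- 1) q) s v) = \<nu> * quadric v"
  by (cases v rule: quad_cases) (simp add: combine_swap assms del: combine.simps)

lemma quadric_combine_segre_vec:
  "quadric (combine (segre_vec \<beta> \<delta> \<beta>' \<delta>') (segre_vec \<alpha> \<gamma> \<beta>' \<delta>')
     (scale (- 1) (segre_vec \<beta> \<delta> \<alpha>' \<gamma>')) (segre_vec \<alpha> \<gamma> \<alpha>' \<gamma>') v)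
     = (\<alpha> * \<delta> - \<beta> * \<gamma>) * (\<alpha>' * \<delta>' - \<beta>' * \<gamma>') * quadric v"
  by (cases v rule: quad_cases) (simp add: segre_vec_def algebra_simps)

text \<open>
  The cubic has zero contraction with the dual quadric, and a similitude of the quadric preserves this property.
\<close>
lemma contraction:
  assumes "w = (segre_vec \<beta> \<delta> \<beta>' \<delta>') \<or> w = (segre_vec \<alpha> \<gamma> \<beta>' \<delta>')
     \<or> w = (scale (- 1) (segre_vec \<beta> \<delta> \<alpha>' \<gamma>')) \<or> w = (segre_vec \<alpha> \<gamma> \<alpha>' \<gamma>')"
  shows "cubic_trilinear (segre_vec \<beta> \<delta> \<beta>' \<delta>') (segre_vec \<alpha> \<gamma> \<alpha>' \<gamma>') w
     + cubic_trilinear (segre_vec \<alpha> \<gamma> \<beta>' \<delta>') (scale (- 1) (segre_vec \<beta> \<delta> \<alpha>' \<gamma>')) w = 0"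
  using assms unfolding cubic_trilinear_def segre_vec_def by (auto simp: algebra_simps)

lemma combine_segre_vec_adj:
  "combine (segre_vec \<beta> \<delta> \<beta>' \<delta>') (segre_vec \<alpha> \<gamma> \<beta>' \<delta>')
     (scale (- 1) (segre_vec \<beta> \<delta> \<alpha>' \<gamma>')) (segre_vec \<alpha> \<gamma> \<alpha>' \<gamma>')
     (combine (segre_vec (- \<beta>) \<alpha> (- \<beta>') \<alpha>') (segre_vec \<delta> (- \<gamma>) (- \<beta>') \<alpha>')
       (scale (- 1) (segre_vec (- \<beta>) \<alpha> \<delta>' (- \<gamma>'))) (segre_vec \<delta> (- \<gamma>) \<delta>' (- \<gamma>')) v)
   = scale ((\<alpha> * \<delta> - \<beta> * \<gamma>) * (\<alpha>' * \<delta>' - \<beta>' * \<gamma>')) v"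
  by (cases v rule: quad_cases) (simp add: segre_vec_def algebra_simps)

lemma deg3:
  fixes a b c :: "complex poly"
  assumes "degree a \<le> 1" "degree b \<le> 1" "degree c \<le> 1" shows "degree (a * b * c) \<le> 3"
  using assms degree_mult_le[of "a * b" c] degree_mult_le[of a b] by linarith

lemma cubic_proportional:
  fixes \<alpha> \<beta> \<gamma> \<delta> \<alpha>' \<beta>' \<gamma>' \<delta>' :: complex
  defines "P \<equiv> \<lambda>x y. cubic ((\<gamma> * x + \<delta>) * (\<gamma>' * y + \<delta>'), (\<alpha> * x + \<beta>) * (\<gamma>' * y + \<delta>'),
      - ((\<gamma> * x + \<delta>) * (\<alpha>' * y + \<beta>')), (\<alpha> * x + \<beta>) * (\<alpha>' * y + \<beta>'))"
  shows "(\<forall>\<^sub>F e in generic. P (fst e) (snd e) = 0) \<Longrightarrow> \<exists>\<kappa>. \<forall>x y. P x y = \<kappa> * bring_poly x y"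
    and "(\<forall>\<^sub>F e in generic. P (snd e) (fst e) = 0) \<Longrightarrow> \<exists>\<kappa>. \<forall>x y. P y x = \<kappa> * bring_poly x y"
proof -
  define u w U W where "u = [:\<beta>, \<alpha>:]" and "w = [:\<delta>, \<gamma>:]" and "U = [:\<beta>', \<alpha>':]" and "W = [:\<delta>', \<gamma>':]"
  define f where "f k = [- (w * w * w), w * u * u, w * w * u, u * u * u] ! k" for k
  define g where "g k = [W * W * U, W * W * W, U * U * U, W * U * U] ! k" for k
  have d1: "degree u \<le> 1" "degree w \<le> 1" "degree U \<le> 1" "degree W \<le> 1" by (simp_all add: u_def w_def U_def W_def)
  have df: "degree (f k) \<le> 3" "degree (g k) \<le> 3" if "k \<in> {0, 1, 2, 3}" for k
    using that d1 deg3 by (auto simp: f_def g_def)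
  have P: "P x y = (\<Sum>k\<in>{0, 1, 2, 3}. poly (f k) x * poly (g k) y)" for x y
    by (simp add: P_def f_def g_def u_def w_def U_def W_def) algebra
  then have P': "P y x = (\<Sum>k\<in>{0, 1, 2, 3}. poly (g k) x * poly (f k) y)" for x y
    by (simp add: mult.commute)
  show "\<exists>\<kappa>. \<forall>x y. P x y = \<kappa> * bring_poly x y" if "\<forall>\<^sub>F e in generic. P (fst e) (snd e) = 0"
    unfolding P by (rule bidegree_multiple) (use that df in \<open>auto simp: P\<close>)
  show "\<exists>\<kappa>. \<forall>x y. P y x = \<kappa> * bring_poly x y" if "\<forall>\<^sub>F e in generic. P (snd e) (fst e) = 0"
    unfolding P' by (rule bidegree_multiple) (use that df in \<open>auto simp: P'\<close>)
qed

lemma scale_scale: "scale k (scale l v) = scale (k * l) v"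
  by (cases v) simp

lemma scale_one: "scale 1 v = v"
  by (cases v) simp

lemma cubic_scale: "cubic (scale k v) = k^3 * cubic v"
  by (cases v) (simp add: algebra_simps power2_eq_square power3_eq_cube)

lemma quadric_scale: "quadric (scale k v) = k^2 * quadric v"
  by (cases v) (simp add: algebra_simps power2_eq_square)

lemma surj_combine_segre_vec:
  assumes "\<alpha> * \<delta> - \<beta> * \<gamma> \<noteq> 0" "\<alpha>' * \<delta>' - \<beta>' * \<gamma>' \<noteq> 0"
  shows "surj (combine (segre_vec \<beta> \<delta> \<beta>' \<delta>') (segre_vec \<alpha> \<gamma> \<beta>' \<delta>')
     (scale (- 1) (segre_vec \<beta> \<delta> \<alpha>' \<gamma>')) (segre_vec \<alpha> \<gamma> \<alpha>' \<gamma>'))" (is "surj ?L")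
  unfolding surj_def
proof
  fix v :: quad
  let ?k = "(\<alpha> * \<delta> - \<beta> * \<gamma>) * (\<alpha>' * \<delta>' - \<beta>' * \<gamma>')"
  have k: "scale (1 / ?k) (scale ?k v) = v" using assms by (simp add: scale_scale scale_one)
  obtain w where "?L w = scale ?k v" using combine_segre_vec_adj by blast
  then have "v = ?L (scale (1 / ?k) w)" unfolding combine_scale using k by simp
  then show "\<exists>x. v = ?L x" by blast
qed

text \<open>
  A pair of Moebius transformations of the rulings acts linearly on the Segre coordinates and preserves the
  quadric up to a factor.  It maps the curve to itself, so it multiplies the restriction of the cubic by a constant, and
  since the cubic is harmonic also the cubic itself.
\<close>
lemma birational_linear:
  assumes b: "birational \<phi> \<psi>"
  shows "\<exists>L. similitude L \<and> (\<forall>\<^sub>F e in generic. \<exists>k. k \<noteq> 0 \<and> L (segre e) = scale k (segre (\<phi> e)))"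
proof -
  have mem: "\<forall>\<^sub>F e in generic. \<phi> e \<in> bring_curve" using b unfolding birational_def by (auto elim: eventually_mono)
  have key: "\<exists>k. k \<noteq> 0 \<and> ((\<gamma> * x + \<delta>) * (\<gamma>' * y + \<delta>'), (\<alpha> * x + \<beta>) * (\<gamma>' * y + \<delta>'),
      - ((\<gamma> * x + \<delta>) * (\<alpha>' * y + \<beta>')), (\<alpha> * x + \<beta>) * (\<alpha>' * y + \<beta>')) = scale k (segre p)"
    if "\<gamma> * x + \<delta> \<noteq> 0 \<and> fst p = (\<alpha> * x + \<beta>) / (\<gamma> * x + \<delta>)" "\<gamma>' * y + \<delta>' \<noteq> 0 \<and> snd p = (\<alpha>' * y + \<beta>') / (\<gamma>' * y + \<delta>')"
    for \<alpha> \<beta> \<gamma> \<delta> \<alpha>' \<beta>' \<gamma>' \<delta>' x y :: complex and p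
    by (rule exI[of _ "(\<gamma> * x + \<delta>) * (\<gamma>' * y + \<delta>')"]) (use that in \<open>simp add: segre_def\<close>)
  have zero: "cubic v = 0" if "v = scale k (segre p)" "p \<in> bring_curve" for v k p
    using that cubic_segre[of "fst p" "snd p"] by (simp add: cubic_scale bring_curve_def)
  consider "moebius_of (\<lambda>e. fst (\<phi> e)) fst" "moebius_of (\<lambda>e. snd (\<phi> e)) snd" | "moebius_of (\<lambda>e. fst (\<phi> e)) snd" "moebius_of (\<lambda>e. snd (\<phi> e)) fst"
    using birational_Moebius[OF b] by blast
  then show ?thesis
  proof cases
    case 1
    obtain \<alpha> \<beta> \<gamma> \<delta> where m: "\<alpha> * \<delta> - \<beta> * \<gamma> \<noteq> 0"
      "\<forall>\<^sub>F e in generic. \<gamma> * fst e + \<delta> \<noteq> 0 \<and> fst (\<phi> e) = (\<alpha> * fst e + \<beta>) / (\<gamma> * fst e + \<delta>)" using 1(1) unfolding moebius_of_def by blast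
    obtain \<alpha>' \<beta>' \<gamma>' \<delta>' where m': "\<alpha>' * \<delta>' - \<beta>' * \<gamma>' \<noteq> 0"
      "\<forall>\<^sub>F e in generic. \<gamma>' * snd e + \<delta>' \<noteq> 0 \<and> snd (\<phi> e) = (\<alpha>' * snd e + \<beta>') / (\<gamma>' * snd e + \<delta>')" using 1(2) unfolding moebius_of_def by blast
    define p q r s where "p = (segre_vec \<beta> \<delta> \<beta>' \<delta>')" and "q = (segre_vec \<alpha> \<gamma> \<beta>' \<delta>')"
      and "r = (scale (- 1) (segre_vec \<beta> \<delta> \<alpha>' \<gamma>'))" and "s = (segre_vec \<alpha> \<gamma> \<alpha>' \<gamma>')"
    note k = combine_segre[where \<alpha> = \<alpha> and \<beta> = \<beta> and \<gamma> = \<gamma> and \<delta> = \<delta> and \<alpha>' = \<alpha>' and \<beta>' = \<beta>' and \<gamma>' = \<gamma>' and \<delta>' = \<delta>', folded p_def q_def r_def s_def]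
    have act_eq: "\<forall>\<^sub>F e in generic. \<exists>k. k \<noteq> 0 \<and> combine p q r s (segre e) = scale k (segre (\<phi> e))"
      using m(2) m'(2)
    proof eventually_elim
      case (elim e)
      then show ?case using key[of \<gamma> "fst e" \<delta> "\<phi> e" \<alpha> \<beta> \<gamma>' "snd e" \<delta>' \<alpha>' \<beta>'] k[of "fst e" "snd e"] by simp
    qed
    have "\<forall>\<^sub>F e in generic. cubic (combine p q r s (segre (fst e, snd e))) = 0"
      using act_eq mem by eventually_elim (use zero in \<open>metis prod.collapse\<close>)
    then obtain \<kappa> where \<kappa>: "cubic (combine p q r s (segre (x, y))) = \<kappa> * bring_poly x y" for x y
      unfolding k using cubic_proportional(1)[where \<alpha> = \<alpha> and \<beta> = \<beta> and \<gamma> = \<gamma> and \<delta> = \<delta> and \<alpha>' = \<alpha>' and \<beta>' = \<beta>' and \<gamma>' = \<gamma>' and \<delta>' = \<delta>'] by blast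
    have "cubic (combine p q r s v) = \<kappa> * cubic v" for v
      by (rule harmonic_cubic[OF _ _ _ _ \<kappa>]; unfold p_def q_def r_def s_def; rule contraction; simp)
    moreover have "surj (combine p q r s)"
      unfolding p_def q_def r_def s_def by (rule surj_combine_segre_vec) (use m(1) m'(1) in auto)
    moreover have "\<exists>\<nu>. \<nu> \<noteq> 0 \<and> (\<forall>v. quadric (combine p q r s v) = \<nu> * quadric v)"
      using quadric_combine_segre_vec[where \<alpha> = \<alpha> and \<beta> = \<beta> and \<gamma> = \<gamma> and \<delta> = \<delta> and \<alpha>' = \<alpha>' and \<beta>' = \<beta>' and \<gamma>' = \<gamma>' and \<delta>' = \<delta>', folded p_def q_def r_def s_def] m(1) m'(1)
      by (intro exI[of _ "(\<alpha> * \<delta> - \<beta> * \<gamma>) * (\<alpha>' * \<delta>' - \<beta>' * \<gamma>')"]) auto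
    ultimately have "similitude (combine p q r s)" unfolding similitude_def using combine_add combine_scale by blast
    with act_eq show ?thesis by blast
  next
    case 2
    obtain \<alpha> \<beta> \<gamma> \<delta> where m: "\<alpha> * \<delta> - \<beta> * \<gamma> \<noteq> 0"
      "\<forall>\<^sub>F e in generic. \<gamma> * snd e + \<delta> \<noteq> 0 \<and> fst (\<phi> e) = (\<alpha> * snd e + \<beta>) / (\<gamma> * snd e + \<delta>)" using 2(1) unfolding moebius_of_def by blast
    obtain \<alpha>' \<beta>' \<gamma>' \<delta>' where m': "\<alpha>' * \<delta>' - \<beta>' * \<gamma>' \<noteq> 0"
      "\<forall>\<^sub>F e in generic. \<gamma>' * fst e + \<delta>' \<noteq> 0 \<and> snd (\<phi> e) = (\<alpha>' * fst e + \<beta>') / (\<gamma>' * fst e + \<delta>')" using 2(2) unfolding moebius_of_def by blast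
    define p q r s where "p = (segre_vec \<beta> \<delta> \<beta>' \<delta>')" and "q = (segre_vec \<alpha> \<gamma> \<beta>' \<delta>')"
      and "r = (scale (- 1) (segre_vec \<beta> \<delta> \<alpha>' \<gamma>'))" and "s = (segre_vec \<alpha> \<gamma> \<alpha>' \<gamma>')"
    define q' r' where "q' = scale (- 1) r" and "r' = scale (- 1) q"
    note k = combine_segre[where \<alpha> = \<alpha> and \<beta> = \<beta> and \<gamma> = \<gamma> and \<delta> = \<delta> and \<alpha>' = \<alpha>' and \<beta>' = \<beta>' and \<gamma>' = \<gamma>' and \<delta>' = \<delta>', folded p_def q_def r_def s_def]
    have ks: "combine p q' r' s (segre (x, y)) = combine p q r s (segre (y, x))" for x y
      unfolding q'_def r'_def by (rule combine_swap_segre)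
    have act_eq: "\<forall>\<^sub>F e in generic. \<exists>k. k \<noteq> 0 \<and> combine p q' r' s (segre e) = scale k (segre (\<phi> e))"
      using m(2) m'(2)
    proof eventually_elim
      case (elim e)
      then show ?case using key[of \<gamma> "snd e" \<delta> "\<phi> e" \<alpha> \<beta> \<gamma>' "fst e" \<delta>' \<alpha>' \<beta>'] k[of "snd e" "fst e"] ks[of "fst e" "snd e"] by simp
    qed
    have "\<forall>\<^sub>F e in generic. cubic (combine p q r s (segre (snd e, fst e))) = 0"
      using act_eq mem by eventually_elim (use zero ks in \<open>metis prod.collapse\<close>)
    then obtain \<kappa> where \<kappa>: "cubic (combine p q r s (segre (y, x))) = \<kappa> * bring_poly x y" for x y
      unfolding k using cubic_proportional(2)[where \<alpha> = \<alpha> and \<beta> = \<beta> and \<gamma> = \<gamma> and \<delta> = \<delta> and \<alpha>' = \<alpha>' and \<beta>' = \<beta>' and \<gamma>' = \<gamma>' and \<delta>' = \<delta>'] by blast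
    have T3s: "cubic_trilinear (scale (- 1) u) (scale (- 1) v) w = cubic_trilinear u v w" "cubic_trilinear u v w = cubic_trilinear v u w" "cubic_trilinear u v (scale (- 1) w) = - cubic_trilinear u v w" for u v w
      unfolding cubic_trilinear_def by (cases u; cases v; cases w; simp add: algebra_simps)+
    have ct: "cubic_trilinear p s w + cubic_trilinear q' r' w = 0" if "cubic_trilinear p s w + cubic_trilinear q r w = 0" for w
      using that unfolding q'_def r'_def T3s(1) by (simp add: T3s(2)[of r q])
    have c0: "cubic_trilinear p s w + cubic_trilinear q r w = 0" if "w \<in> {p, q, r, s}" for w
      using contraction[where w = w and \<alpha> = \<alpha> and \<beta> = \<beta> and \<gamma> = \<gamma> and \<delta> = \<delta> and \<alpha>' = \<alpha>' and \<beta>' = \<beta>' and \<gamma>' = \<gamma>' and \<delta>' = \<delta>'] that by (simp add: p_def q_def r_def s_def)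
    have c1: "cubic_trilinear p s (scale (- 1) w) + cubic_trilinear q r (scale (- 1) w) = 0" if "w \<in> {p, q, r, s}" for w
      using c0[OF that] unfolding T3s(3) by (simp add: add_eq_0_iff)
    have "cubic (combine p q' r' s v) = \<kappa> * cubic v" for v
    proof (rule harmonic_cubic)
      show "cubic_trilinear p s p + cubic_trilinear q' r' p = 0" "cubic_trilinear p s q' + cubic_trilinear q' r' q' = 0" "cubic_trilinear p s r' + cubic_trilinear q' r' r' = 0" "cubic_trilinear p s s + cubic_trilinear q' r' s = 0"
        using ct[OF c0[of p]] ct[OF c1[of r]] ct[OF c1[of q]] ct[OF c0[of s]] by (auto simp: q'_def r'_def)
      show "cubic (combine p q' r' s (segre (x, y))) = \<kappa> * bring_poly x y" for x y unfolding ks by (rule \<kappa>)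
    qed
    moreover have "surj (combine p q' r' s)"
      unfolding surj_def
    proof
      fix v :: quad
      have "surj (combine p q r s)"
        unfolding p_def q_def r_def s_def by (rule surj_combine_segre_vec) (use m(1) m'(1) in auto)
      then obtain x where x: "v = combine p q r s x" by blast
      obtain a b c d where "x = (a, b, c, d)" by (rule quad_cases)
      then have "v = combine p q' r' s (a, - c, - b, d)" using x combine_swap[of p r q s a "- c" "- b" d]
        by (simp only: q'_def r'_def minus_minus)
      then show "\<exists>x. v = combine p q' r' s x" by blast
    qed
    moreover have "\<exists>\<nu>. \<nu> \<noteq> 0 \<and> (\<forall>v. quadric (combine p q' r' s v) = \<nu> * quadric v)"
      using quadric_combine_swap[of p q r s, OF quadric_combine_segre_vec[where \<alpha> = \<alpha> and \<beta> = \<beta> and \<gamma> = \<gamma> and \<delta> = \<delta> and \<alpha>' = \<alpha>' and \<beta>' = \<beta>' and \<gamma>' = \<gamma>' and \<delta>' = \<delta>', folded p_def q_def r_def s_def]] m(1) m'(1)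
      by (intro exI[of _ "(\<alpha> * \<delta> - \<beta> * \<gamma>) * (\<alpha>' * \<delta>' - \<beta>' * \<gamma>')"]) (auto simp: q'_def r'_def)
    ultimately have "similitude (combine p q' r' s)" unfolding similitude_def using combine_add combine_scale by blast
    with act_eq show ?thesis by blast
  qed
qed

section \<open>The five coordinates and the idempotents of the cubic\<close>

lemma zeta5_pow5: "zeta5 ^ 5 = 1"
proof -
  have "zeta5 ^ 5 = exp (of_nat 5 * (2 * of_real pi * \<i> / 5))" by (simp only: zeta5_def exp_of_nat_mult)
  also have "of_nat 5 * (2 * of_real pi * \<i> / 5) = 2 * of_real pi * \<i>" by simp
  finally show ?thesis by simp
qed

lemma zeta5_cis: "zeta5 = cis (2 * pi / 5)"
  by (simp add: zeta5_def cis_conv_exp mult_ac)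

lemma zeta5_sum: "1 + zeta5 + zeta5^2 + zeta5^3 + zeta5^4 = 0"
proof -
  have "zeta5 \<noteq> 1"
  proof
    assume "zeta5 = 1"
    then have "sin (2 * pi / 5) = 0" by (simp add: zeta5_cis complex_eq_iff)
    moreover have "sin (2 * pi / 5) > 0" by (rule sin_gt_zero) (use pi_gt_zero in linarith)+
    ultimately show False by simp
  qed
  moreover have "(zeta5 - 1) * (1 + zeta5 + zeta5^2 + zeta5^3 + zeta5^4) = 0"
    using zeta5_pow5 by algebra
  ultimately show ?thesis by simp
qed

lemma zeta5_nonzero: "zeta5 \<noteq> 0"
  by (simp add: zeta5_def)

text \<open>
  The discrete Fourier transform, with the constant term left out.
\<close>
fun bring_form :: "quad \<Rightarrow> complex \<Rightarrow> complex" where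
  "bring_form (a, b, c, d) w = w * a + w^2 * b + w^3 * c + w^4 * d"

text \<open>
  The five coordinates \<open>x\<^sub>i\<close> of Bring's curve on the hyperplane of coordinate sum \<open>0\<close>.
\<close>
definition bring_coord :: "quad \<Rightarrow> nat \<Rightarrow> complex" where "bring_coord v i = bring_form v (zeta5 ^ i)"

lemma zeta5_pow_pow5: "(zeta5 ^ i) ^ 5 = 1"
  by (metis power_commutes power_mult power_one zeta5_pow5 mult.commute)

lemma sum5: "(\<Sum>i\<in>{1..5::nat}. f i) = f 1 + f 2 + f 3 + f 4 + f 5"
  by (simp add: eval_nat_numeral add.assoc)

lemma atLeastAtMost5: "{1..5::nat} = {1, 2, 3, 4, 5}"
  by auto

lemma bring_coord_values:
  "bring_coord (a, b, c, d) 1 = zeta5 * a + zeta5^2 * b + zeta5^3 * c + zeta5^4 * d"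
  "bring_coord (a, b, c, d) 2 = zeta5^2 * a + zeta5^4 * b + zeta5 * c + zeta5^3 * d"
  "bring_coord (a, b, c, d) 3 = zeta5^3 * a + zeta5 * b + zeta5^4 * c + zeta5^2 * d"
  "bring_coord (a, b, c, d) 4 = zeta5^4 * a + zeta5^3 * b + zeta5^2 * c + zeta5 * d"
  "bring_coord (a, b, c, d) 5 = a + b + c + d"
proof -
  have z: "zeta5 ^ (5 + n) = zeta5 ^ n" for n by (simp add: power_add zeta5_pow5)
  have p: "zeta5^6 = zeta5" "zeta5^8 = zeta5^3" "zeta5^9 = zeta5^4" "zeta5^12 = zeta5^2" "zeta5^16 = zeta5"
    using z[of 1] z[of 3] z[of 4] z[of 2] z[of 7] z[of 11] z[of 6] by simp_all
  show "bring_coord (a, b, c, d) 1 = zeta5 * a + zeta5^2 * b + zeta5^3 * c + zeta5^4 * d"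
    "bring_coord (a, b, c, d) 2 = zeta5^2 * a + zeta5^4 * b + zeta5 * c + zeta5^3 * d"
    "bring_coord (a, b, c, d) 3 = zeta5^3 * a + zeta5 * b + zeta5^4 * c + zeta5^2 * d"
    "bring_coord (a, b, c, d) 4 = zeta5^4 * a + zeta5^3 * b + zeta5^2 * c + zeta5 * d"
    "bring_coord (a, b, c, d) 5 = a + b + c + d"
    by (simp_all add: bring_coord_def power_mult[symmetric] p zeta5_pow5)
qed

lemma bring_coord_sum: "(\<Sum>i\<in>{1..5}. bring_coord v i) = 0"
proof -
  obtain a b c d where v: "v = (a, b, c, d)" by (rule quad_cases)
  show ?thesis unfolding v sum5 bring_coord_values using zeta5_sum by algebra
qed

lemma bring_coord_add: "bring_coord (u + v) i = bring_coord u i + bring_coord v i"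
  by (cases u rule: quad_cases; cases v rule: quad_cases) (simp add: bring_coord_def algebra_simps)

lemma bring_coord_scale: "bring_coord (scale k v) i = k * bring_coord v i"
  by (cases v rule: quad_cases) (simp add: bring_coord_def algebra_simps)

lemma bring_coord_surj:
  assumes "(\<Sum>i\<in>{1..5}. y i) = 0"
  shows "\<exists>v. \<forall>i\<in>{1..5}. bring_coord v i = y i"
proof -
  define z where "z = zeta5"
  have z: "1 + z + z^2 + z^3 + z^4 = 0" using zeta5_sum by (simp add: z_def)
  have s: "y 1 + y 2 + y 3 + y 4 + y 5 = 0" using assms by (simp only: sum5)
  define a b c d where "a = z^4 * y 1 + z^3 * y 2 + z^2 * y 3 + z * y 4 + y 5"
    and "b = z^3 * y 1 + z * y 2 + z^4 * y 3 + z^2 * y 4 + y 5"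
    and "c = z^2 * y 1 + z^4 * y 2 + z * y 3 + z^3 * y 4 + y 5"
    and "d = z * y 1 + z^2 * y 2 + z^3 * y 3 + z^4 * y 4 + y 5"
  have 5: "z * a + z^2 * b + z^3 * c + z^4 * d = 5 * y 1" "z^2 * a + z^4 * b + z * c + z^3 * d = 5 * y 2"
    "z^3 * a + z * b + z^4 * c + z^2 * d = 5 * y 3" "z^4 * a + z^3 * b + z^2 * c + z * d = 5 * y 4" "a + b + c + d = 5 * y 5"
    using z s unfolding a_def b_def c_def d_def by algebra+
  have "bring_coord (a, b, c, d) 1 = 5 * y 1" "bring_coord (a, b, c, d) 2 = 5 * y 2" "bring_coord (a, b, c, d) 3 = 5 * y 3"
    "bring_coord (a, b, c, d) 4 = 5 * y 4" "bring_coord (a, b, c, d) 5 = 5 * y 5"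
    unfolding bring_coord_values z_def[symmetric] by (fact 5)+
  then have "\<forall>i\<in>{1..5}. bring_coord (scale (1/5) (a, b, c, d)) i = y i"
    unfolding atLeastAtMost5 bring_coord_scale by simp
  then show ?thesis by blast
qed

lemma bring_coord_inverse:
  fixes a b c d :: complex
  defines "X \<equiv> bring_coord (a, b, c, d)" and "z \<equiv> zeta5"
  shows "z^4 * X 1 + z^3 * X 2 + z^2 * X 3 + z * X 4 + X 5 = 5 * a"
    "z^3 * X 1 + z * X 2 + z^4 * X 3 + z^2 * X 4 + X 5 = 5 * b"
    "z^2 * X 1 + z^4 * X 2 + z * X 3 + z^3 * X 4 + X 5 = 5 * c"
    "z * X 1 + z^2 * X 2 + z^3 * X 3 + z^4 * X 4 + X 5 = 5 * d"
  unfolding X_def z_def bring_coord_values using zeta5_sum by algebra+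

lemma bring_coord_inj:
  assumes "\<And>i. i \<in> {1..5} \<Longrightarrow> bring_coord u i = bring_coord v i" shows "u = v"
proof -
  obtain a b c d where u: "u = (a, b, c, d)" by (rule quad_cases)
  obtain a' b' c' d' where v: "v = (a', b', c', d')" by (rule quad_cases)
  have e: "bring_coord u 1 = bring_coord v 1" "bring_coord u 2 = bring_coord v 2" "bring_coord u 3 = bring_coord v 3" "bring_coord u 4 = bring_coord v 4" "bring_coord u 5 = bring_coord v 5" using assms by auto
  have "5 * a = 5 * a'"
    using bring_coord_inverse(1)[of a b c d] bring_coord_inverse(1)[of a' b' c' d'] e[unfolded u v] by metis
  moreover have "5 * b = 5 * b'"
    using bring_coord_inverse(2)[of a b c d] bring_coord_inverse(2)[of a' b' c' d'] e[unfolded u v] by metis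
  moreover have "5 * c = 5 * c'"
    using bring_coord_inverse(3)[of a b c d] bring_coord_inverse(3)[of a' b' c' d'] e[unfolded u v] by metis
  moreover have "5 * d = 5 * d'"
    using bring_coord_inverse(4)[of a b c d] bring_coord_inverse(4)[of a' b' c' d'] e[unfolded u v] by metis
  ultimately show ?thesis by (simp add: u v)
qed

text \<open>
  In the coordinates \<open>x\<^sub>i\<close> the product is coordinatewise multiplication followed by the projection to
  coordinate sum \<open>0\<close>.
\<close>
lemma bring_coord_square: "bring_coord (cubic_product v v) i = (bring_coord v i)^2 - 2 * quadric v"
proof -
  define w where "w = zeta5 ^ i"
  have "w^5 = 1" using zeta5_pow_pow5 by (simp add: w_def)
  obtain a b c d where v: "v = (a, b, c, d)" by (rule quad_cases)
  show ?thesis unfolding v bring_coord_def w_def[symmetric] bring_form.simps cubic_product.simps quadric.simps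
    using \<open>w^5 = 1\<close> by algebra
qed

lemma bring_coord_sum_squares: "(\<Sum>i\<in>{1..5}. (bring_coord v i)^2) = 10 * quadric v"
proof -
  have "(\<Sum>i\<in>{1..5}. (bring_coord v i)^2 - 2 * quadric v) = 0" using bring_coord_sum[of "cubic_product v v"] by (simp only: bring_coord_square)
  then show ?thesis by (simp add: sum_subtractf)
qed

lemma quadric_add: "quadric (u + v) = quadric u + quadric v + quadric_bilinear u v"
  by (cases u rule: quad_cases; cases v rule: quad_cases) (simp add: algebra_simps)

lemma bring_coord_sum_mult: "(\<Sum>i\<in>{1..5}. bring_coord u i * bring_coord v i) = 5 * quadric_bilinear u v"
proof -
  have "(\<Sum>i\<in>{1..5}. (bring_coord u i)^2 + (bring_coord v i)^2 + 2 * (bring_coord u i * bring_coord v i)) = 10 * quadric (u + v)"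
    unfolding bring_coord_sum_squares[of "u + v", symmetric] bring_coord_add by (rule sum.cong) (auto simp: power2_eq_square algebra_simps)
  then have "10 * quadric u + 10 * quadric v + 2 * (\<Sum>i\<in>{1..5}. bring_coord u i * bring_coord v i) = 10 * (quadric u + quadric v + quadric_bilinear u v)"
    unfolding sum.distrib bring_coord_sum_squares quadric_add sum_distrib_left[symmetric] .
  then show ?thesis by simp
qed

text \<open>
  The coordinates of an idempotent satisfy one quadratic equation, so they take at most two values, which
  the condition on the sum then determines.
\<close>
lemma idempotent_values:
  fixes x1 x2 x3 x4 x5 m :: complex
  assumes e: "x1^2 - x1 = m" "x2^2 - x2 = m" "x3^2 - x3 = m" "x4^2 - x4 = m" "x5^2 - x5 = m"
    and s: "x1 + x2 + x3 + x4 + x5 = 0"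
  shows "(m = 0) \<or> m = 6 \<or> (m = 4/9 \<and> ((x1, x2, x3, x4, x5) = (4/3, -1/3, -1/3, -1/3, -1/3) \<or> (x1, x2, x3, x4, x5) = (-1/3, 4/3, -1/3, -1/3, -1/3)
     \<or> (x1, x2, x3, x4, x5) = (-1/3, -1/3, 4/3, -1/3, -1/3) \<or> (x1, x2, x3, x4, x5) = (-1/3, -1/3, -1/3, 4/3, -1/3)
     \<or> (x1, x2, x3, x4, x5) = (-1/3, -1/3, -1/3, -1/3, 4/3)))"
proof -
  have two: "x = x1 \<or> x = 1 - x1" if "x^2 - x = m" for x
  proof -
    have "(x - x1) * (x - (1 - x1)) = (x^2 - x) - (x1^2 - x1)" by (simp add: algebra_simps power2_eq_square)
    then have "(x - x1) * (x - (1 - x1)) = 0" using that e(1) by simp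
    then show ?thesis by auto
  qed
  have "\<exists>n. (n = 0 \<or> n = 1) \<and> x = (1 - x1) + n * (2 * x1 - 1)" if "x^2 - x = m" for x
    using two[OF that] by (elim disjE) (rule exI[of _ 1], simp, rule exI[of _ 0], simp)
  then obtain n2 n3 n4 n5 where n: "n2 = 0 \<or> n2 = 1" "n3 = 0 \<or> n3 = 1" "n4 = 0 \<or> n4 = 1" "n5 = 0 \<or> n5 = 1"
    and x: "x2 = (1 - x1) + n2 * (2 * x1 - 1)" "x3 = (1 - x1) + n3 * (2 * x1 - 1)"
      "x4 = (1 - x1) + n4 * (2 * x1 - 1)" "x5 = (1 - x1) + n5 * (2 * x1 - 1)"
    using e by metis
  define N where "N = 1 + n2 + n3 + n4 + n5"
  have "N = 1 \<or> N = 2 \<or> N = 3 \<or> N = 4 \<or> N = 5" using n by (auto simp: N_def)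
  moreover have N: "5 * (1 - x1) + N * (2 * x1 - 1) = 0" using s unfolding x N_def by algebra
  have "x1 = 4/3" if "N = 1"
  proof -
    have "3 * x1 = 4" using N that by algebra
    then show ?thesis by (simp add: eq_divide_eq mult.commute)
  qed
  moreover have "x1 = 3" if "N = 2" using N that by algebra
  moreover have "x1 = -2" if "N = 3" using N that by algebra
  moreover have "x1 = -1/3" if "N = 4"
  proof -
    have "3 * x1 = -1" using N that by algebra
    moreover have "x1 = (3 * x1) / 3" by simp
    ultimately show ?thesis by metis
  qed
  moreover have "x1 = 0" if "N = 5"
  proof -
    have "5 * x1 = 0" using N that by algebra
    then show ?thesis by simp
  qed
  ultimately have val: "x1 = 0 \<or> x1 = -1/3 \<or> x1 = 4/3 \<or> x1 = -2 \<or> x1 = 3" by blast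
  then consider "x1 = 0" | "x1 = -1/3" | "x1 = 4/3" | "x1 = -2" | "x1 = 3" by blast
  then show ?thesis
  proof cases
    case 2
    have m: "m = 4/9" using e(1) 2 by (simp add: power2_eq_square)
    have "y = -1/3 \<or> y = 4/3" if "y^2 - y = m" for y using two[OF that] by (auto simp: 2)
    then have "x2 = -1/3 \<or> x2 = 4/3" "x3 = -1/3 \<or> x3 = 4/3" "x4 = -1/3 \<or> x4 = 4/3" "x5 = -1/3 \<or> x5 = 4/3"
      using e by blast+
    then show ?thesis using s 2 m by (elim disjE) simp_all
  next
    case 3
    have m: "m = 4/9" using e(1) 3 by (simp add: power2_eq_square)
    have "y = 4/3 \<or> y = -1/3" if "y^2 - y = m" for y using two[OF that] by (auto simp: 3)
    then have "x2 = -1/3 \<or> x2 = 4/3" "x3 = -1/3 \<or> x3 = 4/3" "x4 = -1/3 \<or> x4 = 4/3" "x5 = -1/3 \<or> x5 = 4/3"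
      using e by blast+
    then show ?thesis using s 3 m by (elim disjE) simp_all
  qed (use e(1) in \<open>auto simp: power2_eq_square\<close>)
qed


text \<open>
  The idempotents of this shape are multiples of the projections of the coordinate vectors; a permutation of them is a
  permutation of the coordinates.
\<close>
definition vertex_coord :: "nat \<Rightarrow> nat \<Rightarrow> complex" where "vertex_coord k i = (if i = k then 4/3 else - 1/3)"

lemma vertex_coord_exists:
  assumes "k \<in> {1..5}"
  shows "\<exists>v. (\<forall>i\<in>{1..5}. bring_coord v i = vertex_coord k i) \<and> cubic_product v v = v \<and> quadric v = 2/9"
proof -
  have k: "k \<in> {1, 2, 3, 4, 5}" using assms by auto
  have "(\<Sum>i\<in>{1..5}. vertex_coord k i) = 0" unfolding sum5 using k by (auto simp: vertex_coord_def)
  then obtain v where v: "\<forall>i\<in>{1..5}. bring_coord v i = vertex_coord k i" using bring_coord_surj by blast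
  have "10 * quadric v = (\<Sum>i\<in>{1..5}. (vertex_coord k i)^2)" unfolding bring_coord_sum_squares[symmetric] using v by (intro sum.cong) auto
  also have "\<dots> = 20/9" unfolding sum5 using k by (auto simp: vertex_coord_def power2_eq_square)
  finally have "9 * quadric v = 2" by simp
  moreover have "quadric v = (9 * quadric v) / 9" by simp
  ultimately have q: "quadric v = 2/9" by metis
  have "cubic_product v v = v"
  proof (rule bring_coord_inj)
    fix i :: nat assume "i \<in> {1..5}"
    then have "bring_coord v i = vertex_coord k i" using v by blast
    then show "bring_coord (cubic_product v v) i = bring_coord v i" unfolding bring_coord_square q by (simp add: vertex_coord_def power2_eq_square)
  qed
  with v q show ?thesis by blast
qed

lemma exceptional_idempotent_exists: "\<exists>v. cubic_product v v = v \<and> quadric v = 3"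
proof -
  define y :: "nat \<Rightarrow> complex" where "y i = (if i \<le> 2 then 3 else -2)" for i
  have "(\<Sum>i\<in>{1..5}. y i) = 0" unfolding sum5 by (simp add: y_def)
  then obtain v where v: "\<forall>i\<in>{1..5}. bring_coord v i = y i" using bring_coord_surj by blast
  have "10 * quadric v = (\<Sum>i\<in>{1..5}. (y i)^2)" unfolding bring_coord_sum_squares[symmetric] using v by (intro sum.cong) auto
  also have "\<dots> = 30" unfolding sum5 by (simp add: y_def)
  finally have q: "quadric v = 3" by simp
  have "cubic_product v v = v" by (rule bring_coord_inj) (use v q in \<open>auto simp: bring_coord_square y_def power2_eq_square\<close>)
  with q show ?thesis by blast
qed

text \<open>
  The value of the quadric separates the five vertices from the other idempotents.
\<close>
lemma idempotent_cases:
  assumes "cubic_product v v = v"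
  shows "quadric v = 0 \<or> quadric v = 3 \<or> (quadric v = 2/9 \<and> (\<exists>k\<in>{1..5}. \<forall>i\<in>{1..5}. bring_coord v i = vertex_coord k i))"
proof -
  have e: "(bring_coord v i)^2 - bring_coord v i = 2 * quadric v" for i
    using bring_coord_square[of v i] assms by (simp add: algebra_simps)
  have s: "bring_coord v 1 + bring_coord v 2 + bring_coord v 3 + bring_coord v 4 + bring_coord v 5 = 0" using bring_coord_sum[of v] unfolding sum5 .
  have half: "quadric v = (2 * quadric v) / 2" by simp
  consider "2 * quadric v = 0" | "2 * quadric v = 6" | k where "2 * quadric v = 4/9" "k \<in> {1..5}" "\<forall>i\<in>{1..5}. bring_coord v i = vertex_coord k i"
  proof -
    have pick: thesis if "2 * quadric v = 4/9" "k \<in> {1..5}" "bring_coord v 1 = vertex_coord k 1" "bring_coord v 2 = vertex_coord k 2" "bring_coord v 3 = vertex_coord k 3"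
      "bring_coord v 4 = vertex_coord k 4" "bring_coord v 5 = vertex_coord k 5" for k
    proof -
      have "\<forall>i\<in>{1..5}. bring_coord v i = vertex_coord k i" unfolding atLeastAtMost5 using that(3-7) by blast
      then show thesis using that(1,2) \<open>\<And>k. 2 * quadric v = 4/9 \<Longrightarrow> k \<in> {1..5} \<Longrightarrow> \<forall>i\<in>{1..5}. bring_coord v i = vertex_coord k i \<Longrightarrow> thesis\<close> by blast
    qed
    show thesis
      using idempotent_values[OF e e e e e s]
    proof (elim disjE conjE)
      assume "2 * quadric v = 0" then show thesis by (rule that(1))
    next
      assume "2 * quadric v = 6" then show thesis by (rule that(2))
    qed (rule pick[of 1] pick[of 2] pick[of 3] pick[of 4] pick[of 5]; simp add: vertex_coord_def; fail)+
  qed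
  then show ?thesis
  proof cases
    case 1 then show ?thesis by simp
  next
    case 2 then show ?thesis using half by simp
  next
    case 3
    have "quadric v = 2/9" using half unfolding 3(1) by simp
    with 3 show ?thesis by blast
  qed
qed

lemma quadric_bilinear_cubic_product: "quadric_bilinear (cubic_product x x) z = (cubic (x + z) - cubic (x + scale (-1) z) - 2 * cubic z) / 2"
  by (cases x rule: quad_cases; cases z rule: quad_cases) (simp add: field_simps power2_eq_square)

lemma quadric_bilinear_nondegenerate:
  assumes "\<And>w. quadric_bilinear u w = quadric_bilinear v w" shows "u = v"
proof -
  obtain a b c d where u: "u = (a, b, c, d)" by (rule quad_cases)
  obtain a' b' c' d' where v: "v = (a', b', c', d')" by (rule quad_cases)
  show ?thesis
    using assms[of "(1, 0, 0, 0)"] assms[of "(0, 1, 0, 0)"] assms[of "(0, 0, 1, 0)"] assms[of "(0, 0, 0, 1)"]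
    by (simp add: u v)
qed

lemma quadric_bilinear_scale: "quadric_bilinear (scale k u) v = k * quadric_bilinear u v" "quadric_bilinear u (scale k v) = k * quadric_bilinear u v"
  by (cases u rule: quad_cases; cases v rule: quad_cases; simp add: algebra_simps)+

lemma cubic_product_scale: "cubic_product (scale k u) (scale k u) = scale (k^2) (cubic_product u u)"
  by (cases u rule: quad_cases) (simp add: algebra_simps power2_eq_square)

text \<open>
  After scaling, a similitude is an automorphism of the product, so it permutes the idempotents.  It multiplies
  their values on the quadric by a factor, which must be \<open>1\<close> because it permutes the values \<open>3\<close> and \<open>2/9\<close>; hence it permutes the five vertices.
\<close>
lemma similitude_permutation:
  assumes "similitude L"
  obtains \<pi> \<theta> where "\<pi> permutes {1..5}" "\<theta> \<noteq> 0" "\<And>v i. i \<in> {1..5} \<Longrightarrow> bring_coord (L v) (\<pi> i) = \<theta> * bring_coord v i"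
proof -
  have add: "L (u + v) = L u + L v" and hom: "L (scale k u) = scale k (L u)" and sur: "surj L" for u v k
    using assms unfolding similitude_def by blast+
  obtain \<nu> where \<nu>: "\<nu> \<noteq> 0" "\<And>v. quadric (L v) = \<nu> * quadric v" using assms unfolding similitude_def by blast
  obtain \<kappa> where \<kappa>: "\<And>v. cubic (L v) = \<kappa> * cubic v" using assms unfolding similitude_def by blast
  have bfL: "quadric_bilinear (L u) (L v) = \<nu> * quadric_bilinear u v" for u v
    using quadric_add[of "L u" "L v"] \<nu>(2)[of "u + v"] \<nu>(2)[of u] \<nu>(2)[of v] quadric_add[of u v] by (simp add: add algebra_simps)
  have "\<kappa> \<noteq> 0"
  proof
    assume "\<kappa> = 0"
    then have "cubic (L v) = 0" for v using \<kappa> by simp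
    moreover obtain v where "(1, 1, 1, 1) = L v" using sur by (metis surjD)
    ultimately have "cubic (1, 1, 1, 1) = 0" by metis
    then show False by simp
  qed
  define \<theta> where "\<theta> = \<kappa> / \<nu>"
  have \<theta>: "\<theta> \<noteq> 0" using \<open>\<kappa> \<noteq> 0\<close> \<nu>(1) by (simp add: \<theta>_def)
  have sq: "cubic_product (L x) (L x) = scale \<theta> (L (cubic_product x x))" for x
  proof (rule quadric_bilinear_nondegenerate)
    fix w
    obtain z where z: "w = L z" using sur by (metis surjD)
    have "quadric_bilinear (cubic_product (L x) (L x)) (L z) = \<kappa> * quadric_bilinear (cubic_product x x) z"
      unfolding quadric_bilinear_cubic_product add[symmetric] hom[symmetric] \<kappa> by (simp add: field_simps)
    also have "\<dots> = quadric_bilinear (scale \<theta> (L (cubic_product x x))) (L z)"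
      using \<nu>(1) by (simp add: quadric_bilinear_scale bfL \<theta>_def)
    finally show "quadric_bilinear (cubic_product (L x) (L x)) w = quadric_bilinear (scale \<theta> (L (cubic_product x x))) w" by (simp add: z)
  qed
  define N where "N v = scale (1 / \<theta>) (L v)" for v
  have idem: "cubic_product (N v) (N v) = N v" if "cubic_product v v = v" for v
    using \<theta> by (simp add: N_def cubic_product_scale sq that scale_scale power2_eq_square)
  \<comment> \<open>the factor by which the normalised map changes the quadric\<close>
  define \<mu> where "\<mu> = \<nu> / \<theta>^2"
  have qfN: "quadric (N v) = \<mu> * quadric v" for v using \<theta> by (simp add: N_def quadric_scale \<nu>(2) \<mu>_def power_divide)
  have \<mu>0: "\<mu> \<noteq> 0" using \<theta> \<nu>(1) by (simp add: \<mu>_def)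
  obtain w where w: "cubic_product w w = w" "quadric w = 3" using exceptional_idempotent_exists by blast
  obtain u1 where u1: "cubic_product u1 u1 = u1" "quadric u1 = 2/9" using vertex_coord_exists[of 1] by auto
  have "\<mu> * 3 = 3 \<or> \<mu> * 3 = 2/9" using idempotent_cases[OF idem[OF w(1)]] \<mu>0 by (auto simp: qfN w(2))
  moreover have "\<mu> * (2/9) = 3 \<or> \<mu> * (2/9) = 2/9" using idempotent_cases[OF idem[OF u1(1)]] \<mu>0 by (auto simp: qfN u1(2))
  moreover have "\<not> (\<mu> * 3 = 2/9 \<and> \<mu> * (2/9) = 3)"
  proof
    assume a: "\<mu> * 3 = 2/9 \<and> \<mu> * (2/9) = 3"
    have "\<mu> * (2/9) = (\<mu> * 3) * (2/27)" by simp
    then have "(3::complex) = 2/9 * (2/27)" using a by metis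
    then show False by simp
  qed
  ultimately have "\<mu> * 3 = 3 \<or> \<mu> * (2/9) = 2/9" by blast
  then have \<mu>1: "\<mu> = 1" by auto
  have "\<exists>U. \<forall>k\<in>{1..5}. (\<forall>i\<in>{1..5}. bring_coord (U k) i = vertex_coord k i) \<and> cubic_product (U k) (U k) = U k \<and> quadric (U k) = 2/9"
    using vertex_coord_exists by (intro bchoice) blast
  then obtain U where U: "\<And>k i. k \<in> {1..5} \<Longrightarrow> i \<in> {1..5} \<Longrightarrow> bring_coord (U k) i = vertex_coord k i"
    "\<And>k. k \<in> {1..5} \<Longrightarrow> cubic_product (U k) (U k) = U k" "\<And>k. k \<in> {1..5} \<Longrightarrow> quadric (U k) = 2/9" by blast
  have "\<exists>j\<in>{1..5}. N (U k) = U j" if k: "k \<in> {1..5}" for k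
  proof -
    have "quadric (N (U k)) = 2/9" using U(3)[OF k] by (simp add: qfN \<mu>1)
    then obtain j where j: "j \<in> {1..5}" "\<forall>i\<in>{1..5}. bring_coord (N (U k)) i = vertex_coord j i"
      using idempotent_cases[OF idem[OF U(2)[OF k]]] by auto
    then have "N (U k) = U j" by (intro bring_coord_inj) (use U(1) in auto)
    with j show ?thesis by blast
  qed
  then obtain \<sigma> where \<sigma>: "\<And>k. k \<in> {1..5} \<Longrightarrow> \<sigma> k \<in> {1..5}" "\<And>k. k \<in> {1..5} \<Longrightarrow> N (U k) = U (\<sigma> k)" by metis
  have coord: "bring_coord v k = 3 * quadric_bilinear v (U k)" if k: "k \<in> {1..5}" for v k
  proof -
    have "5 * quadric_bilinear v (U k) = (\<Sum>i\<in>{1..5}. bring_coord v i * vertex_coord k i)"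
      unfolding bring_coord_sum_mult[symmetric] using U(1)[OF k] by (intro sum.cong) auto
    also have "\<dots> = (\<Sum>i\<in>{1..5}. (5/3) * (if i = k then bring_coord v i else 0) - (1/3) * bring_coord v i)"
      by (intro sum.cong) (auto simp: vertex_coord_def)
    also have "\<dots> = (5/3) * bring_coord v k"
      unfolding sum_subtractf sum_distrib_left[symmetric] bring_coord_sum using k by simp
    finally show ?thesis by simp
  qed
  have act_eq: "bring_coord (L v) (\<sigma> k) = \<theta> * bring_coord v k" if k: "k \<in> {1..5}" for v k
  proof -
    have "bring_coord (L v) (\<sigma> k) = 3 * quadric_bilinear (L v) (N (U k))" using coord[OF \<sigma>(1)[OF k]] \<sigma>(2)[OF k] by simp
    also have "\<dots> = 3 * (\<nu> / \<theta>) * quadric_bilinear v (U k)" by (simp add: N_def quadric_bilinear_scale bfL)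
    also have "\<nu> / \<theta> = \<theta>" using \<mu>1 \<theta> by (simp add: \<mu>_def field_simps power2_eq_square)
    finally show ?thesis using coord[OF k] by simp
  qed
  have inj: "inj_on \<sigma> {1..5}"
  proof
    fix j k assume jk: "j \<in> {1..5}" "k \<in> {1..5}" "\<sigma> j = \<sigma> k"
    have "\<theta> * bring_coord (U j) j = \<theta> * bring_coord (U j) k" using act_eq[OF jk(1)] act_eq[OF jk(2)] jk(3) by metis
    then have "vertex_coord j j = vertex_coord j k" using \<theta> U(1) jk by simp
    then show "j = k" by (auto simp: vertex_coord_def split: if_splits)
  qed
  define \<pi> where "\<pi> k = (if k \<in> {1..5} then \<sigma> k else k)" for k
  have "bij_betw \<pi> {1..5} {1..5}"
  proof -
    have "\<sigma> ` {1..5} = {1..5}" using inj \<sigma>(1) by (intro endo_inj_surj) auto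
    then have "bij_betw \<sigma> {1..5} {1..5}" using inj by (simp add: bij_betw_def)
    then show ?thesis by (rule bij_betw_cong[THEN iffD1, rotated]) (simp add: \<pi>_def)
  qed
  then have "\<pi> permutes {1..5}" by (rule bij_imp_permutes) (auto simp: \<pi>_def)
  then show thesis using that[of \<pi> \<theta>] \<theta> act_eq by (simp add: \<pi>_def)
qed

theorem birational_permutation:
  assumes b: "birational \<phi> \<psi>"
  shows "\<exists>\<pi>. \<pi> permutes {1..5} \<and> (\<forall>\<^sub>F e in generic. \<exists>k. k \<noteq> 0 \<and> (\<forall>i\<in>{1..5}. bring_coord (segre (\<phi> e)) (\<pi> i) = k * bring_coord (segre e) i))"
proof -
  obtain L where L: "similitude L" "\<forall>\<^sub>F e in generic. \<exists>k. k \<noteq> 0 \<and> L (segre e) = scale k (segre (\<phi> e))" using birational_linear[OF b] by blast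
  obtain \<pi> \<theta> where \<pi>: "\<pi> permutes {1..5}" "\<theta> \<noteq> 0" "\<And>v i. i \<in> {1..5} \<Longrightarrow> bring_coord (L v) (\<pi> i) = \<theta> * bring_coord v i"
    using similitude_permutation[OF L(1)] by blast
  have "\<forall>\<^sub>F e in generic. \<exists>k. k \<noteq> 0 \<and> (\<forall>i\<in>{1..5}. bring_coord (segre (\<phi> e)) (\<pi> i) = k * bring_coord (segre e) i)"
    using L(2)
  proof eventually_elim
    case (elim e)
    then obtain k where k: "k \<noteq> 0" "L (segre e) = scale k (segre (\<phi> e))" by blast
    have "bring_coord (segre (\<phi> e)) (\<pi> i) = \<theta> / k * bring_coord (segre e) i" if "i \<in> {1..5}" for i
      using \<pi>(3)[OF that, of "segre e"] k by (simp add: bring_coord_scale field_simps)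
    then show ?case using k(1) \<pi>(2) by (intro exI[of _ "\<theta> / k"]) auto
  qed
  with \<pi>(1) show ?thesis by blast
qed

section \<open>Forms in three variables\<close>

lemma is_form_monomial:
  assumes "i + j + k = d"
  shows "is_form d (\<lambda>v. c * (v $ 1) ^ i * (v $ 2) ^ j * (v $ 3) ^ k)"
  unfolding is_form_def
proof (intro exI allI)
  fix v :: "complex^3"
  let ?a = "\<lambda>i' j'. if i' = i then (if j' = j then c else 0) else 0"
  have "(\<Sum>j'\<le>d - i'. ?a i' j' * (v $ 1) ^ i' * (v $ 2) ^ j' * (v $ 3) ^ (d - i' - j'))
      = (if i' = i then c * (v $ 1) ^ i * (v $ 2) ^ j * (v $ 3) ^ k else 0)" for i'
  proof (cases "i' = i")
    case True
    have "(\<Sum>j'\<le>d - i'. ?a i' j' * (v $ 1) ^ i' * (v $ 2) ^ j' * (v $ 3) ^ (d - i' - j'))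
       = (\<Sum>j'\<le>d - i'. if j' = j then c * (v $ 1) ^ i * (v $ 2) ^ j * (v $ 3) ^ k else 0)"
      by (intro sum.cong refl) (use True assms in auto)
    then show ?thesis using True assms by simp
  qed simp
  then have "(\<Sum>i'\<le>d. \<Sum>j'\<le>d - i'. ?a i' j' * (v $ 1) ^ i' * (v $ 2) ^ j' * (v $ 3) ^ (d - i' - j'))
      = (\<Sum>i'\<le>d. if i' = i then c * (v $ 1) ^ i * (v $ 2) ^ j * (v $ 3) ^ k else 0)"
    by (simp only:)
  also have "\<dots> = c * (v $ 1) ^ i * (v $ 2) ^ j * (v $ 3) ^ k" using assms by auto
  finally show "c * (v $ 1) ^ i * (v $ 2) ^ j * (v $ 3) ^ k
      = (\<Sum>i'\<le>d. \<Sum>j'\<le>d - i'. ?a i' j' * (v $ 1) ^ i' * (v $ 2) ^ j' * (v $ 3) ^ (d - i' - j'))" by simp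
qed

lemma is_form_add [intro]:
  assumes "is_form d P" "is_form d Q" shows "is_form d (\<lambda>v. P v + Q v)"
proof -
  obtain a where a: "\<And>v. P v = (\<Sum>i\<le>d. \<Sum>j\<le>d - i. a i j * (v $ 1) ^ i * (v $ 2) ^ j * (v $ 3) ^ (d - i - j))"
    using assms(1) unfolding is_form_def by blast
  obtain b where b: "\<And>v. Q v = (\<Sum>i\<le>d. \<Sum>j\<le>d - i. b i j * (v $ 1) ^ i * (v $ 2) ^ j * (v $ 3) ^ (d - i - j))"
    using assms(2) unfolding is_form_def by blast
  show ?thesis unfolding is_form_def
    by (intro exI[of _ "\<lambda>i j. a i j + b i j"]) (simp add: a b sum.distrib distrib_right)
qed

lemma is_form_zero [intro]: "is_form d (\<lambda>v. 0)"
  unfolding is_form_def by (intro exI[of _ "\<lambda>_ _. 0"]) simp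

lemma is_form_sum: "(\<And>x. x \<in> A \<Longrightarrow> is_form d (f x)) \<Longrightarrow> is_form d (\<lambda>v. \<Sum>x\<in>A. f x v)"
  by (induction A rule: infinite_finite_induct) (auto intro: is_form_add is_form_zero)

lemma is_form_mult_monomial:
  assumes "is_form d P" "i + j + k = e"
  shows "is_form (d + e) (\<lambda>v. (c * (v $ 1) ^ i * (v $ 2) ^ j * (v $ 3) ^ k) * P v)"
proof -
  obtain a where a: "\<And>v. P v = (\<Sum>i\<le>d. \<Sum>j\<le>d - i. a i j * (v $ 1) ^ i * (v $ 2) ^ j * (v $ 3) ^ (d - i - j))"
    using assms(1) unfolding is_form_def by blast
  have "is_form (d + e) (\<lambda>v. \<Sum>i'\<le>d. \<Sum>j'\<le>d - i'. (c * a i' j') * (v $ 1) ^ (i + i') * (v $ 2) ^ (j + j') * (v $ 3) ^ (k + (d - i' - j')))"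
    by (intro is_form_sum is_form_monomial) (use assms(2) in auto)
  moreover have "(\<lambda>v. c * v $ 1 ^ i * v $ 2 ^ j * v $ 3 ^ k * P v)
      = (\<lambda>v. \<Sum>i'\<le>d. \<Sum>j'\<le>d - i'. (c * a i' j') * (v $ 1) ^ (i + i') * (v $ 2) ^ (j + j') * (v $ 3) ^ (k + (d - i' - j')))"
    unfolding a sum_distrib_left power_add by (intro ext sum.cong refl) (simp only: mult_ac)
  ultimately show ?thesis by simp
qed

lemma is_form_mult [intro]:
  assumes "is_form d P" "is_form e Q" shows "is_form (d + e) (\<lambda>v. P v * Q v)"
proof -
  obtain a where a: "\<And>v. Q v = (\<Sum>i\<le>e. \<Sum>j\<le>e - i. a i j * (v $ 1) ^ i * (v $ 2) ^ j * (v $ 3) ^ (e - i - j))"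
    using assms(2) unfolding is_form_def by blast
  have "is_form (d + e) (\<lambda>v. \<Sum>i\<le>e. \<Sum>j\<le>e - i. (a i j * (v $ 1) ^ i * (v $ 2) ^ j * (v $ 3) ^ (e - i - j)) * P v)"
    by (intro is_form_sum is_form_mult_monomial assms(1)) auto
  then show ?thesis unfolding a by (simp add: sum_distrib_left mult_ac)
qed

lemma is_form_const: "is_form 0 (\<lambda>v. c)"
  using is_form_monomial[of 0 0 0 0 c] by simp

lemma is_form_cmult: "is_form d P \<Longrightarrow> is_form d (\<lambda>v. c * P v)"
  using is_form_mult[OF is_form_const, of d P c] by simp

lemma is_form_uminus: "is_form d P \<Longrightarrow> is_form d (\<lambda>v. - P v)"
  using is_form_cmult[of d P "-1"] by simp

lemma is_form_diff: "is_form d P \<Longrightarrow> is_form d Q \<Longrightarrow> is_form d (\<lambda>v. P v - Q v)"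
  using is_form_add[of d P "\<lambda>v. - Q v"] is_form_uminus by simp

lemma is_form_coord: "is_form 1 (\<lambda>v. v $ 1)" "is_form 1 (\<lambda>v. v $ 2)" "is_form 1 (\<lambda>v. v $ 3)"
  using is_form_monomial[of 1 0 0 1 1] is_form_monomial[of 0 1 0 1 1] is_form_monomial[of 0 0 1 1 1] by simp_all

lemma is_form_power: "is_form d P \<Longrightarrow> is_form (n * d) (\<lambda>v. P v ^ n)"
proof (induction n)
  case 0 show ?case using is_form_const[of 1] by simp
next
  case (Suc n) then show ?case using is_form_mult[of d P "n * d" "\<lambda>v. P v ^ n"] by simp
qed

lemma is_form_compose:
  fixes \<Phi> :: "complex^3 \<Rightarrow> complex^3"
  assumes "is_form d P" "\<And>i. is_form e (\<lambda>v. \<Phi> v $ i)"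
  shows "is_form (d * e) (\<lambda>v. P (\<Phi> v))"
proof -
  obtain a where a: "\<And>v. P v = (\<Sum>i\<le>d. \<Sum>j\<le>d - i. a i j * (v $ 1) ^ i * (v $ 2) ^ j * (v $ 3) ^ (d - i - j))"
    using assms(1) unfolding is_form_def by blast
  have "is_form (d * e) (\<lambda>v. a i j * (\<Phi> v $ 1) ^ i * (\<Phi> v $ 2) ^ j * (\<Phi> v $ 3) ^ (d - i - j))" if "i \<le> d" "j \<le> d - i" for i j
  proof -
    have "is_form (i * e + j * e + (d - i - j) * e) (\<lambda>v. (a i j * (\<Phi> v $ 1) ^ i) * (\<Phi> v $ 2) ^ j * (\<Phi> v $ 3) ^ (d - i - j))"
      by (intro is_form_mult is_form_cmult is_form_power assms(2))
    moreover have "i * e + j * e + (d - i - j) * e = d * e" using that by (simp add: add_mult_distrib[symmetric])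
    ultimately show ?thesis by simp
  qed
  then show ?thesis unfolding a by (intro is_form_sum) auto
qed

lemma is_form_homogeneous:
  assumes "is_form d P" shows "P (c *s v) = c ^ d * P v"
proof -
  obtain a where a: "\<And>v. P v = (\<Sum>i\<le>d. \<Sum>j\<le>d - i. a i j * (v $ 1) ^ i * (v $ 2) ^ j * (v $ 3) ^ (d - i - j))"
    using assms unfolding is_form_def by blast
  have "a i j * (c * v $ 1) ^ i * (c * v $ 2) ^ j * (c * v $ 3) ^ (d - i - j)
      = c ^ d * (a i j * (v $ 1) ^ i * (v $ 2) ^ j * (v $ 3) ^ (d - i - j))" if "i \<le> d" "j \<le> d - i" for i j
  proof -
    have "c ^ d = c ^ i * c ^ j * c ^ (d - i - j)" using that by (simp add: power_add[symmetric])
    then show ?thesis by (simp add: power_mult_distrib)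
  qed
  then show ?thesis unfolding a vector_smult_component sum_distrib_left by (intro sum.cong refl) auto
qed

lemma is_form_continuous:
  assumes "is_form d P" shows "continuous_on UNIV P"
proof -
  obtain a where a: "P = (\<lambda>v. \<Sum>i\<le>d. \<Sum>j\<le>d - i. a i j * (v $ 1) ^ i * (v $ 2) ^ j * (v $ 3) ^ (d - i - j))"
    using assms unfolding is_form_def by blast
  show ?thesis unfolding a by (intro continuous_intros)
qed

text \<open>
  Forms restricted to a parametrised curve are rational functions.
\<close>
lemma is_form_ratfun:
  fixes g :: "complex \<times> complex \<Rightarrow> complex^3"
  assumes "is_form d P" "\<And>i. ratfun (\<lambda>e. g e $ i)"
  shows "ratfun (\<lambda>e. P (g e))"
proof -
  obtain a where a: "\<And>v. P v = (\<Sum>i\<le>d. \<Sum>j\<le>d - i. a i j * (v $ 1) ^ i * (v $ 2) ^ j * (v $ 3) ^ (d - i - j))"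
    using assms(1) unfolding is_form_def by blast
  show ?thesis unfolding a by (intro ratfun_sum ratfun_mult ratfun_const ratfun_power assms(2))
qed

section \<open>The plane curve and its canonical model\<close>

text \<open>
  The canonical map of the plane curve, given by cubic forms through its singular points.
\<close>
definition canonical_map :: "complex^3 \<Rightarrow> quad" where
  "canonical_map v = (let X = v $ 1; Y = v $ 2; Z = v $ 3 in
     (Y * (X^2 - Y * Z), - (X * Y^2 - Z^3), X * Z^2 - Y^3, - (Z * (X^2 - Y * Z))))"

text \<open>
  The inverse of the canonical map, given by quartic forms; the composition multiplies the homogeneous
  coordinates by a form of degree \<open>11\<close>.
\<close>
fun quartic_map :: "quad \<Rightarrow> complex^3" where
  "quartic_map (a, b, c, d) = vector [c * d^3 - a^3 * b, - (a * (a^2 * c + b * d^2)), d * (a^2 * c + b * d^2)]"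

definition canonical_factor :: "complex^3 \<Rightarrow> complex" where
  "canonical_factor v = ((v $ 1)^2 - v $ 2 * v $ 3)^3 * ((v $ 2)^5 - (v $ 3)^5)"

definition plane_point :: "complex \<times> complex \<Rightarrow> complex^3" where "plane_point e = quartic_map (segre e)"
text \<open>
  The canonical image of a point, expressed in the coordinates of the two rulings.
\<close>
definition segre_coords :: "complex^3 \<Rightarrow> complex \<times> complex" where
  "segre_coords v = (case canonical_map v of (a, b, c, d) \<Rightarrow> (b / a, - c / a))"

text \<open>
  The equation of the plane curve is the pull-back of the quadric, whereas the cubic pulls back to zero identically.
\<close>
lemma quadric_canonical_map: "quadric (canonical_map v) = HC v"
  unfolding canonical_map_def HC_def Let_def quadric.simps by algebra

lemma cubic_canonical_map: "cubic (canonical_map v) = 0"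
  unfolding canonical_map_def Let_def cubic.simps by algebra

lemma vec3_eq: "v = w \<longleftrightarrow> v $ 1 = w $ 1 \<and> v $ 2 = w $ 2 \<and> v $ 3 = w $ 3" for v w :: "'a^3"
  by (simp add: vec_eq_iff forall_3)

lemma quartic_map_canonical_map: "quartic_map (canonical_map v) = canonical_factor v *s v"
proof -
  define X Y Z where "X = v $ 1" and "Y = v $ 2" and "Z = v $ 3"
  show ?thesis
    unfolding vec3_eq canonical_map_def Let_def quartic_map.simps vector_3 canonical_factor_def vector_smult_component X_def[symmetric] Y_def[symmetric] Z_def[symmetric]
    by (intro conjI; algebra)
qed

lemma quartic_map_scale: "quartic_map (scale k q) = k^4 *s quartic_map q"
  by (cases q rule: quad_cases) (simp add: vec3_eq algebra_simps eval_nat_numeral)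

lemma canonical_map_smult: "canonical_map (k *s v) = scale (k^3) (canonical_map v)"
  by (simp add: canonical_map_def Let_def algebra_simps power2_eq_square power3_eq_cube)

lemma plane_point_nth: "plane_point (s, t) $ 1 = - (s^3 * t^4) - s" "plane_point (s, t) $ 2 = t - s^3 * t^2" "plane_point (s, t) $ 3 = s^4 * t^3 - s * t^2"
  by (simp_all add: plane_point_def segre_def algebra_simps eval_nat_numeral)

lemma canonical_map_plane_point:
  assumes "e \<in> bring_curve" shows "canonical_map (plane_point e) = scale (fst (canonical_map (plane_point e))) (segre e)"
proof -
  obtain s t where e: "e = (s, t)" by fastforce
  have G: "bring_poly s t = 0" using assms by (simp add: e)
  define X Y Z where "X = - (s^3 * t^4) - s" and "Y = t - s^3 * t^2" and "Z = s^4 * t^3 - s * t^2"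
  have k: "canonical_map (plane_point (s, t)) = (Y * (X^2 - Y * Z), - (X * Y^2 - Z^3), X * Z^2 - Y^3, - (Z * (X^2 - Y * Z)))"
    by (simp add: canonical_map_def plane_point_nth X_def Y_def Z_def Let_def)
  have "- (X * Y^2 - Z^3) - s * (Y * (X^2 - Y * Z)) = (s^9 * t^7 - s^6 * t^6 + s^4 * t^2 - s * t) * bring_poly s t"
    unfolding X_def Y_def Z_def bring_poly_def by algebra
  moreover have "X * Z^2 - Y^3 + t * (Y * (X^2 - Y * Z)) = (- (s^8 * t^8) + s^5 * t^7 - s^3 * t^3 + t^2) * bring_poly s t"
    unfolding X_def Y_def Z_def bring_poly_def by algebra
  moreover have "- (Z * (X^2 - Y * Z)) = s * t * (Y * (X^2 - Y * Z))"
    unfolding X_def Y_def Z_def by algebra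
  ultimately show ?thesis unfolding e k segre_def fst_conv snd_conv scale.simps G
    by (simp add: eq_neg_iff_add_eq_0 algebra_simps)
qed

lemma HC_plane_point: "e \<in> bring_curve \<Longrightarrow> HC (plane_point e) = 0"
  using canonical_map_plane_point[of e] quadric_canonical_map[of "plane_point e"] by (metis mult_zero_right quadric_segre quadric_scale)

lemma canonical_map_segre_coords:
  assumes "HC v = 0" "fst (canonical_map v) \<noteq> 0"
  shows "segre_coords v \<in> bring_curve" "canonical_map v = scale (fst (canonical_map v)) (segre (segre_coords v))"
proof -
  obtain a b c d where k: "canonical_map v = (a, b, c, d)" by (rule quad_cases)
  have a: "a \<noteq> 0" using assms(2) k by simp
  have "a * d + b * c = 0" using quadric_canonical_map[of v] assms(1) k by simp
  then have "a * d = - (b * c)" by (simp add: eq_neg_iff_add_eq_0)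
  then have d: "d = - (b * c) / a" using a by (simp add: field_simps)
  have e: "segre_coords v = (b / a, - c / a)" by (simp add: segre_coords_def k)
  show k': "canonical_map v = scale (fst (canonical_map v)) (segre (segre_coords v))" using a by (simp add: k e segre_def d)
  have "cubic (segre (segre_coords v)) = 0" using cubic_canonical_map[of v] k' a k by (metis cubic_scale fst_conv mult_eq_0_iff power_eq_0_iff)
  then show "segre_coords v \<in> bring_curve" by (simp add: e cubic_segre)
qed

lemma plane_point_segre_coords:
  assumes "HC v = 0" "fst (canonical_map v) \<noteq> 0"
  shows "canonical_factor v *s v = (fst (canonical_map v))^4 *s plane_point (segre_coords v)"
  using canonical_map_segre_coords(2)[OF assms] quartic_map_canonical_map[of v] quartic_map_scale by (metis plane_point_def)

lemma ratfun_plane_point: "ratfun (\<lambda>e. plane_point e $ i)"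
proof -
  have "ratfun (\<lambda>e. plane_point (fst e, snd e) $ 1)" "ratfun (\<lambda>e. plane_point (fst e, snd e) $ 2)" "ratfun (\<lambda>e. plane_point (fst e, snd e) $ 3)"
    unfolding plane_point_nth by (intro ratfun_diff ratfun_uminus ratfun_mult ratfun_power ratfun_fst' ratfun_snd')+
  then show ?thesis using exhaust_3[of i] by auto
qed

lemma generic_gam2: "\<forall>\<^sub>F e in generic. plane_point e $ 2 \<noteq> 0"
proof (rule ccontr)
  assume "\<not> ?thesis"
  then have "\<exists>\<^sub>F e in generic. plane_point e $ 2 = 0" by (simp add: frequently_def)
  moreover have "plane_point e $ 2 = poly 0 (fst e) + poly 1 (fst e) * snd e + poly [:0, 0, 0, -1:] (fst e) * (snd e)^2" for e
    using plane_point_nth(2)[of "fst e" "snd e"] by (simp add: power3_eq_cube)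
  ultimately have "\<exists>\<^sub>F e in generic. poly 0 (fst e) + poly 1 (fst e) * snd e + poly [:0, 0, 0, -1:] (fst e) * (snd e)^2 = 0"
    by simp
  from identity_theorem[OF this] show False by simp
qed

text \<open>
  The excluded points satisfy \<open>t = h / s\<close> with \<open>h\<close> one of the five numbers with \<open>h\<^sup>5 = -1\<close>, and for each \<open>h\<close> the
  equation of the curve leaves finitely many \<open>s\<close>.
\<close>
lemma generic_product_root: "\<forall>\<^sub>F e in generic. (fst e * snd e)^5 \<noteq> -1"
proof -
  let ?S = "SIGMA h:{h::complex. poly (monom 1 5 + 1) h = 0}. {s. poly [:h^3, -h, 0, h^2, 1:] s = 0}"
  have "poly (monom 1 5 + 1) 0 \<noteq> (0 :: complex)" by (simp add: poly_monom)
  then have "monom 1 5 + 1 \<noteq> (0 :: complex poly)" by (metis poly_0)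
  then have "finite ?S" by (intro finite_SigmaI poly_roots_finite) auto
  moreover have "{e \<in> bring_curve. \<not> (fst e * snd e)^5 \<noteq> -1} \<subseteq> (\<lambda>(h, s). (s, h / s)) ` ?S"
  proof
    fix e assume "e \<in> {e \<in> bring_curve. \<not> (fst e * snd e)^5 \<noteq> -1}"
    moreover obtain s t where e: "e = (s, t)" by fastforce
    ultimately have G: "bring_poly s t = 0" and p: "(s * t)^5 = -1" by auto
    have s: "s \<noteq> 0" using p by auto
    define h where "h = s * t"
    have t: "t = h / s" using s by (simp add: h_def)
    have "h^3 - h * s + h^2 * s^3 + s^4 = s^2 * bring_poly s t"
      unfolding h_def bring_poly_def by algebra
    moreover have "poly [:h^3, -h, 0, h^2, 1:] s = h^3 - h * s + h^2 * s^3 + s^4" by (simp add: algebra_simps eval_nat_numeral)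
    ultimately have "poly [:h^3, -h, 0, h^2, 1:] s = 0" using G by simp
    moreover have "poly (monom 1 5 + 1) h = 0" using p by (simp add: poly_monom h_def)
    ultimately show "e \<in> (\<lambda>(h, s). (s, h / s)) ` ?S" unfolding e t by (intro image_eqI[of _ _ "(h, s)"]) auto
  qed
  ultimately show ?thesis unfolding eventually_generic by (rule finite_surj)
qed

text \<open>
  On the conic \<open>X\<^sup>2 = Y Z\<close> the equation of the plane curve reduces to \<open>Y\<^sup>5 = Z\<^sup>5\<close>, and this is
  impossible at generic points.
\<close>
lemma generic_canonical_map_plane_point: "\<forall>\<^sub>F e in generic. fst (canonical_map (plane_point e)) \<noteq> 0"
  using generic_gam2 generic_product_root generic_nonzero generic_bring_curve
proof eventually_elim
  fix e assume Y0: "plane_point e $ 2 \<noteq> 0" and p: "(fst e * snd e)^5 \<noteq> -1" and nz: "fst e \<noteq> 0 \<and> snd e \<noteq> 0" and E: "e \<in> bring_curve"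
  obtain s t where e: "e = (s, t)" by fastforce
  define X Y Z where "X = plane_point e $ 1" and "Y = plane_point e $ 2" and "Z = plane_point e $ 3"
  have Z: "Z = - (s * t) * Y" by (simp add: Z_def Y_def e plane_point_nth) algebra
  have Y: "Y \<noteq> 0" using Y0 by (simp add: Y_def)
  then have Z0: "Z \<noteq> 0" using nz Z by (simp add: e)
  have H: "X * (Y^5 + Z^5) + (X * Y * Z)^2 - X^4 * Y * Z - 2 * (Y * Z)^3 = 0"
    using HC_plane_point[OF E] by (simp add: HC_def X_def Y_def Z_def Let_def)
  have "X^2 - Y * Z \<noteq> 0"
  proof
    assume q: "X^2 - Y * Z = 0"
    then have X: "X \<noteq> 0" using Y Z0 by auto
    have "X * (Y^5 + Z^5 - 2 * X^5) = 0" using H q by algebra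
    then have "Y^5 + Z^5 = 2 * X^5" using X by simp
    then have "(Y^5 - Z^5)^2 = 0" using q by algebra
    then have "Y^5 = Z^5" by simp
    then have "Y^5 * 1 = Y^5 * (- ((s * t)^5))" unfolding Z by (simp add: power_mult_distrib mult_ac)
    then have "1 = - ((s * t)^5)" using Y by (metis mult_cancel_left power_eq_0_iff)
    then show False using p e by (metis fst_conv snd_conv minus_minus)
  qed
  then show "fst (canonical_map (plane_point e)) \<noteq> 0" using Y by (simp add: canonical_map_def Let_def X_def Y_def Z_def)
qed

lemma segre_coords_plane_point:
  assumes "e \<in> bring_curve" "fst (canonical_map (plane_point e)) \<noteq> 0"
  shows "segre_coords (plane_point e) = e" "plane_point e \<noteq> 0" "canonical_factor (plane_point e) \<noteq> 0"
proof -
  obtain m where m: "canonical_map (plane_point e) = scale m (segre e)" "m \<noteq> 0" using canonical_map_plane_point[OF assms(1)] assms(2) by metis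
  show "segre_coords (plane_point e) = e" using m by (cases e) (simp add: segre_coords_def segre_def)
  show g: "plane_point e \<noteq> 0" using assms(2) by (auto simp: canonical_map_def)
  have "m^4 *s plane_point e = canonical_factor (plane_point e) *s plane_point e" using quartic_map_canonical_map[of "plane_point e"] unfolding m(1) quartic_map_scale plane_point_def[symmetric] .
  then show "canonical_factor (plane_point e) \<noteq> 0" using m(2) g by (auto simp: vec_eq_iff)
qed

lemma plane_point_in_curve: "e \<in> bring_curve \<Longrightarrow> fst (canonical_map (plane_point e)) \<noteq> 0 \<Longrightarrow> plane_point e \<in> curve_pts HC"
  using segre_coords_plane_point HC_plane_point by (simp add: curve_pts_def)

lemma is_form_HC: "is_form 6 HC"
proof -
  have "is_form 6 (\<lambda>v. 1 * v $ 1 ^ 1 * v $ 2 ^ 5 * v $ 3 ^ 0 + 1 * v $ 1 ^ 1 * v $ 2 ^ 0 * v $ 3 ^ 5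
      + 1 * v $ 1 ^ 2 * v $ 2 ^ 2 * v $ 3 ^ 2 + (-1) * v $ 1 ^ 4 * v $ 2 ^ 1 * v $ 3 ^ 1 + (-2) * v $ 1 ^ 0 * v $ 2 ^ 3 * v $ 3 ^ 3)"
    by (intro is_form_add is_form_monomial) auto
  moreover have "HC = (\<lambda>v. 1 * v $ 1 ^ 1 * v $ 2 ^ 5 * v $ 3 ^ 0 + 1 * v $ 1 ^ 1 * v $ 2 ^ 0 * v $ 3 ^ 5
      + 1 * v $ 1 ^ 2 * v $ 2 ^ 2 * v $ 3 ^ 2 + (-1) * v $ 1 ^ 4 * v $ 2 ^ 1 * v $ 3 ^ 1 + (-2) * v $ 1 ^ 0 * v $ 2 ^ 3 * v $ 3 ^ 3)"
    by (rule ext) (simp add: HC_def Let_def power_mult_distrib algebra_simps)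
  ultimately show ?thesis by simp
qed

lemma HC_smult: "HC (c *s v) = c^6 * HC v"
  by (rule is_form_homogeneous[OF is_form_HC])

lemma curve_pts_smult: "c \<noteq> 0 \<Longrightarrow> v \<in> curve_pts HC \<Longrightarrow> c *s v \<in> curve_pts HC"
  by (simp add: curve_pts_def HC_smult)

section \<open>The identity principle for forms on the plane curve\<close>

text \<open>
  The product of the moduli of the roots is the modulus of the constant term, so the smallest root is small.
\<close>
lemma monic_small_root:
  fixes p :: "complex poly"
  assumes "degree p = n" "lead_coeff p = 1" "n > 0"
  shows "\<exists>r. poly p r = 0 \<and> norm r ^ n \<le> norm (poly p 0)"
  using assms
proof (induction n arbitrary: p)
  case (Suc n)
  have "\<not> constant (poly p)" using Suc.prems by (simp add: constant_degree)
  then obtain z where z: "poly p z = 0" using fundamental_theorem_of_algebra by blast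
  then obtain q where q: "p = [:-z, 1:] * q" by (auto simp: poly_eq_0_iff_dvd)
  have q0: "q \<noteq> 0" using Suc.prems q by auto
  have dq: "degree q = n" using Suc.prems(1) q q0 by (subst (asm) q, subst (asm) degree_mult_eq) auto
  have lq: "lead_coeff q = 1" using Suc.prems(2) unfolding q lead_coeff_mult by simp
  have p0: "norm (poly p 0) = norm z * norm (poly q 0)" by (simp add: q norm_mult)
  show ?case
  proof (cases "n = 0")
    case True
    then have "q = 1" using dq lq by (metis degree_eq_zeroE lead_coeff_pCons(2) one_pCons)
    then show ?thesis using z p0 True by auto
  next
    case False
    then obtain r where r: "poly q r = 0" "norm r ^ n \<le> norm (poly q 0)" using Suc.IH[OF dq lq] by blast
    show ?thesis
    proof (cases "norm r \<le> norm z")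
      case True
      then have "norm r * norm r ^ n \<le> norm z * norm (poly q 0)" by (intro mult_mono r(2)) auto
      then show ?thesis using r(1) p0 q by (intro exI[of _ r]) simp
    next
      case False
      then have "norm z ^ n \<le> norm r ^ n" by (intro power_mono) auto
      then have "norm z * norm z ^ n \<le> norm z * norm (poly q 0)" using r(2) by (intro mult_left_mono) auto
      then show ?thesis using z p0 by (intro exI[of _ z]) simp
    qed
  qed
qed simp

text \<open>
  A direction off the curve: the equation restricted to lines in this direction is monic.
\<close>
definition diagonal :: "complex^3" where "diagonal = vector [1, 1, 0]"

lemma small_root_HC: "\<exists>r. HC (v + r *s diagonal) = 0 \<and> norm r ^ 6 \<le> norm (HC v)"
proof -
  define x y z where "x = v $ 1" and "y = v $ 2" and "z = v $ 3"
  define q where "q = [:x, 1:] * [:z^5:] + [:x, 1:]^2 * [:y, 1:]^2 * [:z^2:] - [:x, 1:]^4 * [:y, 1:] * [:z:] - [:y, 1:]^3 * [:2 * z^3:]"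
  define p where "p = [:x, 1:] * [:y, 1:]^5 + q"
  have 1: "degree ([:x, 1:] * [:z^5:]) \<le> 5" by simp
  have 2: "degree ([:x, 1:]^2 * [:y, 1:]^2 * [:z^2:]) \<le> 5" 
    using degree_mult_le[of "[:x, 1:]^2 * [:y, 1:]^2" "[:z^2:]"] degree_mult_le[of "[:x, 1:]^2" "[:y, 1:]^2"] by (simp add: degree_power_eq)
  have 3: "degree ([:x, 1:]^4 * [:y, 1:] * [:z:]) \<le> 5" 
  proof -
    have "degree ([:x, 1:]^4) = 4" "degree [:y, 1:] = 1" "degree [:z:] = 0" by (simp_all add: degree_power_eq)
    then show ?thesis using degree_mult_le[of "[:x, 1:]^4 * [:y, 1:]" "[:z:]"] degree_mult_le[of "[:x, 1:]^4" "[:y, 1:]"] by linarith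
  qed
  have 4: "degree ([:y, 1:]^3 * [:2 * z^3:]) \<le> 5" 
    using degree_mult_le[of "[:y, 1:]^3" "[:2 * z^3:]"] by (simp add: degree_power_eq)
  have dq: "degree q \<le> 5" unfolding q_def by (intro degree_add_le degree_diff_le 1 2 3 4)
  have d6: "degree ([:x, 1:] * [:y, 1:]^5) = 6" by (subst degree_mult_eq) (auto simp: degree_power_eq)
  have p6: "degree p = 6" unfolding p_def by (rule trans[OF degree_add_eq_left]) (use dq d6 in auto)
  have "coeff p 6 = lead_coeff ([:x, 1:] * [:y, 1:]^5)" using dq d6 by (simp add: p_def coeff_eq_0)
  also have "\<dots> = 1" by (simp only: lead_coeff_mult lead_coeff_power) simp
  finally have lc: "lead_coeff p = 1" by (simp add: p6)
  have HC: "HC (v + r *s diagonal) = poly p r" for r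
    by (simp add: HC_def Let_def diagonal_def p_def q_def x_def y_def z_def power_mult_distrib algebra_simps)
  have "HC v = poly p 0" using HC[of 0] by simp
  then show ?thesis using monic_small_root[OF p6 lc] HC by simp
qed

text \<open>
  A point near \<open>v0\<close> can be moved onto the curve along the fixed direction by a small amount.  Starting from the points of
  a line through \<open>v0\<close> gives points of the curve in infinitely many directions from the origin, only finitely
  many of which meet the finite set.
\<close>
lemma curve_point_nearby:
  assumes v0: "v0 \<in> curve_pts HC" and fin: "finite B" and pos: "\<epsilon> > 0"
  shows "\<exists>v. HC v = 0 \<and> norm (v - v0) < \<epsilon> \<and> (\<forall>b\<in>B. \<forall>c. v \<noteq> c *s b)"
proof -
  \<comment> \<open>coordinates on the quotient by the fixed direction\<close>
  define l m where "l = (\<lambda>v :: complex^3. v $ 1 - v $ 2)" and "m = (\<lambda>v :: complex^3. v $ 3)"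
  have "l v0 \<noteq> 0 \<or> m v0 \<noteq> 0"
  proof (rule ccontr)
    assume "\<not> ?thesis"
    then have "v0 = v0 $ 1 *s diagonal" by (simp add: vec3_eq diagonal_def l_def m_def)
    moreover have "HC diagonal = 1" by (simp add: HC_def diagonal_def)
    moreover have "HC v0 = 0" "v0 \<noteq> 0" using v0 by (auto simp: curve_pts_def)
    ultimately show False by (metis HC_smult mult.right_neutral power_eq_0_iff vector_smult_lzero)
  qed
  then obtain u :: "complex^3" and f :: "complex^3 \<Rightarrow> complex" where
    f: "\<And>c v. c \<noteq> 0 \<Longrightarrow> f (c *s v) = f v" "inj (\<lambda>h. f (v0 + h *s u))" "\<And>h r. f (v0 + h *s u + r *s diagonal) = f (v0 + h *s u)"
    and nz: "\<And>h r. v0 + h *s u + r *s diagonal \<noteq> 0"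
  proof (elim disjE)
    assume L: "l v0 \<noteq> 0"
    show thesis
      by (rule that[of "\<lambda>v. m v / l v" "vector [0, 0, 1]"])
        ((use L in \<open>auto simp: l_def m_def inj_def diagonal_def vec3_eq vector_smult_component right_diff_distrib[symmetric]\<close>), metis add_right_cancel)
  next
    assume M: "m v0 \<noteq> 0"
    show thesis
      by (rule that[of "\<lambda>v. l v / m v" "vector [1, 0, 0]"])
        (use M in \<open>auto simp: l_def m_def inj_def diagonal_def vec3_eq vector_smult_component right_diff_distrib[symmetric]\<close>)
  qed
  have lim: "((\<lambda>h. HC (v0 + h *s u)) \<longlongrightarrow> HC v0) (at 0)"
  proof -
    have "isCont HC v0" using is_form_continuous[OF is_form_HC] by (simp add: continuous_on_eq_continuous_at)
    moreover have "((\<lambda>h. v0 + h *s u) \<longlongrightarrow> v0) (at 0)"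
    proof (rule vec_tendstoI)
      fix i show "((\<lambda>h. (v0 + h *s u) $ i) \<longlongrightarrow> v0 $ i) (at 0)"
        unfolding vector_add_component vector_smult_component by (auto intro!: tendsto_eq_intros)
    qed
    ultimately show ?thesis by (rule isCont_tendsto_compose)
  qed
  define N where "N = norm u + norm diagonal + 1"
  have N: "N > 0" by (simp add: N_def add_nonneg_pos)
  define \<delta> where "\<delta> = \<epsilon> / (2 * N)"
  have \<delta>: "\<delta> > 0" using pos N by (simp add: \<delta>_def)
  have HC0: "HC v0 = 0" using v0 by (simp add: curve_pts_def)
  have "\<forall>\<^sub>F h in at 0. norm (HC (v0 + h *s u)) < \<delta>^6"
    using tendstoD[OF lim, of "\<delta>^6"] \<delta> HC0 by simp
  moreover have "\<forall>\<^sub>F h in at (0::complex). norm h < \<delta>"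
    using \<delta> by (auto simp: eventually_at intro!: exI[of _ \<delta>])
  ultimately have ev: "\<forall>\<^sub>F h in at 0. norm (HC (v0 + h *s u)) < \<delta>^6 \<and> norm h < \<delta>" by (rule eventually_conj)
  have "finite {h. f (v0 + h *s u) \<in> f ` B}"
    using finite_vimageI[OF finite_imageI[OF fin] f(2), of f] by (simp add: vimage_def)
  then have "\<forall>\<^sub>F h in at 0. h \<notin> {h. f (v0 + h *s u) \<in> f ` B}"
    using islimpt_finite islimpt_iff_eventually by blast
  with ev have "\<forall>\<^sub>F h in at 0. norm (HC (v0 + h *s u)) < \<delta>^6 \<and> norm h < \<delta> \<and> f (v0 + h *s u) \<notin> f ` B"
    by eventually_elim auto
  then obtain h where h: "norm (HC (v0 + h *s u)) < \<delta>^6" "norm h < \<delta>" "f (v0 + h *s u) \<notin> f ` B"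
    using eventually_happens[of _ "at (0::complex)"] by auto
  obtain r where r: "HC (v0 + h *s u + r *s diagonal) = 0" "norm r ^ 6 \<le> norm (HC (v0 + h *s u))"
    using small_root_HC by blast
  have "norm r ^ 6 < \<delta> ^ 6" using r(2) h(1) by simp
  then have r6: "norm r < \<delta>" using \<delta> by (meson less_eq_real_def power_less_imp_less_base)
  have ns: "norm (c *s w) = norm c * norm w" for c and w :: "complex^3"
    by (simp add: norm_vec_def norm_mult L2_set_right_distrib)
  have "norm (h *s u + r *s diagonal) \<le> norm h * norm u + norm r * norm diagonal"
    using norm_triangle_ineq[of "h *s u" "r *s diagonal"] by (simp add: ns)
  also have "\<dots> \<le> \<delta> * norm u + \<delta> * norm diagonal" using h(2) r6 by (intro add_mono mult_right_mono) auto
  also have "\<dots> < \<delta> * (2 * N)"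
  proof -
    have "norm u + norm diagonal < N" "N < 2 * N" using N by (simp_all add: N_def)
    then have "norm u + norm diagonal < 2 * N" by (rule less_trans)
    from mult_strict_left_mono[OF this \<delta>] show ?thesis by (simp add: distrib_left)
  qed
  also have "\<dots> = \<epsilon>" using N by (simp add: \<delta>_def)
  finally have n: "norm (v0 + h *s u + r *s diagonal - v0) < \<epsilon>" by (simp add: algebra_simps)
  have "v0 + h *s u + r *s diagonal \<noteq> c *s b" if b: "b \<in> B" for b c
  proof
    assume e: "v0 + h *s u + r *s diagonal = c *s b"
    then have "c \<noteq> 0" using nz by (metis vector_smult_lzero)
    from f(1)[OF this, of b] f(3)[of h r] have "f b = f (v0 + h *s u)" unfolding e by (rule trans[OF sym])
    then show False using h(3) imageI[OF b, of f] by simp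
  qed
  then show ?thesis using r(1) n by blast
qed

text \<open>
  Where the canonical map or its inverse degenerates, \<open>Y = 0\<close> or \<open>X\<^sup>2 = Y Z\<close> or \<open>Y\<^sup>5 = Z\<^sup>5\<close>; each of these meets the
  curve in finitely many points.
\<close>
lemma finite_bad_points:
  "\<exists>B. finite B \<and> (\<forall>v. HC v = 0 \<longrightarrow> fst (canonical_map v) = 0 \<or> canonical_factor v = 0 \<longrightarrow> (\<exists>b\<in>B. \<exists>c. v = c *s b))"
proof -
  define W where "W = {w::complex. poly (monom 1 5 - 1) w = 0}"
  have W_iff: "w \<in> W \<longleftrightarrow> w^5 = 1" for w by (simp add: W_def poly_monom)
  have "poly (monom 1 5 - 1) 0 \<noteq> (0 :: complex)" by (simp add: poly_monom)
  then have "monom 1 5 - 1 \<noteq> (0 :: complex poly)" by (metis poly_0)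
  then have finW: "finite W" unfolding W_def by (rule poly_roots_finite)
  define q where "q w = [:- 2 * w^3, 2, w^2, 0, - w:]" for w :: complex
  have finq: "finite {x. poly (q w) x = 0}" for w by (rule poly_roots_finite) (simp add: q_def)
  define B :: "(complex^3) set" where "B = {vector [1, 0, 0], vector [0, 1, 0], vector [0, 0, 1]}
    \<union> (\<lambda>w. vector [1, w, w^4]) ` W \<union> (\<lambda>(w, x). vector [x, 1, w]) ` (SIGMA w:W. {x. poly (q w) x = 0})"
  have "finite B" unfolding B_def using finW finq by auto
  moreover have "\<exists>b\<in>B. \<exists>c. v = c *s b" if H: "HC v = 0" and bad: "fst (canonical_map v) = 0 \<or> canonical_factor v = 0" for v
  proof -
    define X Y Z where "X = v $ 1" and "Y = v $ 2" and "Z = v $ 3"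
    have H: "X * (Y^5 + Z^5) + (X * Y * Z)^2 - X^4 * Y * Z - 2 * (Y * Z)^3 = 0"
      using H by (simp add: HC_def X_def Y_def Z_def Let_def)
    have goal: ?thesis if "vector [p1, p2, p3] \<in> B" "X = c * p1" "Y = c * p2" "Z = c * p3" for c p1 p2 p3
      by (rule bexI[OF _ that(1)], rule exI[of _ c]) (use that in \<open>simp add: vec3_eq X_def Y_def Z_def\<close>)
    have axes: ?thesis if "Y = 0 \<and> Z = 0 \<or> X = 0 \<and> Z = 0 \<or> X = 0 \<and> Y = 0"
      using that goal[of 1 0 0 X] goal[of 0 1 0 Y] goal[of 0 0 1 Z] by (auto simp: B_def)
    have "Y = 0 \<or> X^2 = Y * Z \<or> Y^5 = Z^5"
      using bad by (auto simp: canonical_map_def canonical_factor_def Let_def X_def Y_def Z_def)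
    then consider "Y = 0" | "X^2 = Y * Z" "Y \<noteq> 0" | "Y^5 = Z^5" "Y \<noteq> 0" by blast
    then show ?thesis
    proof cases
      case 1
      then have "X = 0 \<or> Z = 0" using H by simp
      then show ?thesis using axes 1 by blast
    next
      case 2
      show ?thesis
      proof (cases "X = 0")
        case True
        then show ?thesis using axes 2 by auto
      next
        case False
        have "X * (Y^5 + Z^5 - 2 * X^5) = 0" using H 2(1) by algebra
        then have s: "Y^5 + Z^5 = 2 * X^5" using False by simp
        then have "(Y^5 - X^5)^2 = 0" using 2(1) by algebra
        then have Y5: "Y^5 = X^5" by simp
        have "(Y / X)^5 = 1" using Y5 False by (simp add: power_divide)
        then have "Y / X \<in> W" by (simp add: W_iff)
        then have "vector [1, Y / X, (Y / X)^4] \<in> B" by (auto simp: B_def)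
        moreover have "Z = X * (Y / X)^4"
        proof -
          have "Y * (Z * X^4) = Y * (X * Y^4)" using Y5 2(1) by algebra
          then have "Z * X^4 = X * Y^4" using 2(2) by simp
          then show ?thesis using False by (simp add: power_divide field_simps)
        qed
        ultimately show ?thesis using goal[of 1 "Y / X" "(Y / X)^4" X] False by simp
      qed
    next
      case 3
      define w x where "w = Z / Y" and "x = X / Y"
      have ZX: "Z = Y * w" "X = Y * x" using 3(2) by (simp_all add: w_def x_def)
      have w: "w^5 = 1" using 3(1)[symmetric] 3(2) by (simp add: w_def power_divide)
      have "Y^6 * poly (q w) x = X * (Y^5 + Z^5) + (X * Y * Z)^2 - X^4 * Y * Z - 2 * (Y * Z)^3 - Y^6 * x * (w^5 - 1)"
        unfolding ZX by (simp add: q_def) algebra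
      then have "poly (q w) x = 0" using H w 3(2) by simp
      then have "vector [x, 1, w] \<in> B" using w W_iff unfolding B_def by (auto intro!: image_eqI[of _ _ "(w, x)"])
      then show ?thesis using goal[of x 1 w Y] ZX by simp
    qed
  qed
  ultimately show ?thesis by blast
qed

text \<open>
  The identity principle that replaces irreducibility of the plane curve.  A form vanishing at infinitely many points
  of the parametrisation vanishes at all but finitely many points of the curve, and every point is a limit of the remaining ones.
\<close>
theorem form_vanishes:
  assumes P: "is_form d P" and fr: "\<exists>\<^sub>F e in generic. P (plane_point e) = 0" and v0: "v0 \<in> curve_pts HC"
  shows "P v0 = 0"
proof (rule ccontr)
  assume P0: "P v0 \<noteq> 0"
  have "ratfun (\<lambda>e. P (plane_point e))" by (rule is_form_ratfun[OF P ratfun_plane_point])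
  from ratfun_zero_or_nonzero[OF this] have "\<forall>\<^sub>F e in generic. P (plane_point e) = 0" using fr by (auto simp: frequently_def)
  then have fin: "finite {e \<in> bring_curve. P (plane_point e) \<noteq> 0}" by (simp add: eventually_generic)
  obtain B where B: "finite B" "\<And>v. HC v = 0 \<Longrightarrow> fst (canonical_map v) = 0 \<or> canonical_factor v = 0 \<Longrightarrow> \<exists>b\<in>B. \<exists>c. v = c *s b"
    using finite_bad_points by blast
  have "isCont P v0" using is_form_continuous[OF P] by (simp add: continuous_on_eq_continuous_at)
  then have "\<forall>\<^sub>F v in nhds v0. P v \<noteq> 0" using P0 by (simp add: isCont_def tendsto_at_iff_tendsto_nhds tendsto_imp_eventually_ne)
  then obtain \<epsilon> where \<epsilon>: "\<epsilon> > 0" "\<And>v. dist v v0 < \<epsilon> \<Longrightarrow> P v \<noteq> 0" unfolding eventually_nhds_metric by blast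
  obtain v where v: "HC v = 0" "norm (v - v0) < \<epsilon>" "\<And>b c. b \<in> B \<union> plane_point ` {e \<in> bring_curve. P (plane_point e) \<noteq> 0} \<Longrightarrow> v \<noteq> c *s b"
    using curve_point_nearby[OF v0 _ \<epsilon>(1), of "B \<union> plane_point ` {e \<in> bring_curve. P (plane_point e) \<noteq> 0}"] B(1) fin by blast
  have k: "fst (canonical_map v) \<noteq> 0" and s: "canonical_factor v \<noteq> 0" using B(2)[OF v(1)] v(3) by auto
  have g: "canonical_factor v *s v = (fst (canonical_map v))^4 *s plane_point (segre_coords v)" by (rule plane_point_segre_coords[OF v(1) k])
  then have "v = ((fst (canonical_map v))^4 / canonical_factor v) *s plane_point (segre_coords v)"
    using s by (metis (no_types) divide_inverse_commute left_inverse vector_smult_assoc vector_smult_lid)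
  then have "segre_coords v \<notin> {e \<in> bring_curve. P (plane_point e) \<noteq> 0}" using v(3) by blast
  then have "P (plane_point (segre_coords v)) = 0" using canonical_map_segre_coords(1)[OF v(1) k] by blast
  then have "P (canonical_factor v *s v) = 0" unfolding g is_form_homogeneous[OF P] by simp
  then have "P v = 0" using s by (simp add: is_form_homogeneous[OF P])
  then show False using \<epsilon>(2)[of v] v(2) by (simp add: dist_norm)
qed

section \<open>Rational self-maps of the plane curve\<close>

text \<open>
  The identity principle read backwards.
\<close>
lemma generic_nonvanishing:
  assumes "is_form d P" "v \<in> curve_pts HC" "P v \<noteq> 0"
  shows "\<forall>\<^sub>F e in generic. P (plane_point e) \<noteq> 0"
  using form_vanishes[OF assms(1) _ assms(2)] assms(3) unfolding frequently_def by blast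

lemma generic_rep_component:
  assumes "\<Phi> \<in> rat_reps HC"
  shows "\<exists>i. \<forall>\<^sub>F e in generic. \<Phi> (plane_point e) $ i \<noteq> 0"
proof -
  obtain d where d: "\<And>i. is_form d (\<lambda>v. \<Phi> v $ i)" using assms unfolding rat_reps_def by blast
  obtain v where v: "v \<in> curve_pts HC" "\<Phi> v \<noteq> 0" using assms unfolding rat_reps_def by blast
  then obtain i where "\<Phi> v $ i \<noteq> 0" by (auto simp: vec_eq_iff)
  then show ?thesis using generic_nonvanishing[OF d v(1)] by blast
qed

lemma generic_curve: "\<forall>\<^sub>F e in generic. plane_point e \<in> curve_pts HC \<and> segre_coords (plane_point e) = e"
  using generic_canonical_map_plane_point generic_bring_curve by eventually_elim (blast intro: plane_point_in_curve segre_coords_plane_point(1))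

lemma generic_rep:
  assumes "\<Phi> \<in> rat_reps HC" shows "\<forall>\<^sub>F e in generic. \<Phi> (plane_point e) \<in> curve_pts HC"
proof -
  obtain i where "\<forall>\<^sub>F e in generic. \<Phi> (plane_point e) $ i \<noteq> 0" using generic_rep_component[OF assms] by blast
  then show ?thesis using generic_curve
  proof eventually_elim
    case (elim e)
    then have "\<Phi> (plane_point e) \<noteq> 0" by auto
    then show ?case using assms elim unfolding rat_reps_def by blast
  qed
qed

text \<open>
  It suffices to check at generic points that a triple of forms maps the curve to itself.
\<close>
lemma rat_repI:
  assumes d: "\<And>i. is_form d (\<lambda>v. \<Phi> v $ i)" and ev: "\<forall>\<^sub>F e in generic. \<Phi> (plane_point e) \<in> curve_pts HC"
  shows "\<Phi> \<in> rat_reps HC"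
proof -
  have "\<forall>\<^sub>F e in generic. plane_point e \<in> curve_pts HC \<and> \<Phi> (plane_point e) \<noteq> 0"
    using ev generic_curve by eventually_elim (auto simp: curve_pts_def)
  then obtain e where "plane_point e \<in> curve_pts HC" "\<Phi> (plane_point e) \<noteq> 0"
    using eventually_happens'[OF generic_nontrivial] by blast
  then have "\<exists>v\<in>curve_pts HC. \<Phi> v \<noteq> 0" by blast
  moreover have "\<forall>\<^sub>F e in generic. HC (\<Phi> (plane_point e)) = 0" using ev by eventually_elim (simp add: curve_pts_def)
  then have "\<exists>\<^sub>F e in generic. HC (\<Phi> (plane_point e)) = 0" by (rule eventually_frequently[OF generic_nontrivial])
  from form_vanishes[OF is_form_compose[OF is_form_HC d] this] have "\<Phi> v \<in> curve_pts HC"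
    if "v \<in> curve_pts HC" "\<Phi> v \<noteq> 0" for v using that by (simp add: curve_pts_def)
  ultimately show ?thesis unfolding rat_reps_def using d by blast
qed

text \<open>
  Proportionality becomes a polynomial condition, to which the identity principle applies.
\<close>
lemma proj_eq_minors:
  assumes "v \<noteq> 0" "w \<noteq> 0"
  shows "proj_eq v w \<longleftrightarrow> (\<forall>i j. v $ i * w $ j = v $ j * w $ i)"
proof
  assume "proj_eq v w"
  then show "\<forall>i j. v $ i * w $ j = v $ j * w $ i" by (auto simp: proj_eq_def)
next
  assume m: "\<forall>i j. v $ i * w $ j = v $ j * w $ i"
  obtain k where k: "v $ k \<noteq> 0" using assms(1) by (auto simp: vec_eq_iff)
  have w: "w = (w $ k / v $ k) *s v"
    unfolding vec_eq_iff vector_smult_component using m k by (metis mult.commute nonzero_mult_div_cancel_left times_divide_eq_left)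
  then have "w $ k / v $ k \<noteq> 0" using assms(2) by (metis vector_smult_lzero)
  then show "proj_eq v w" using w unfolding proj_eq_def by blast
qed

lemma proj_eq_refl: "proj_eq v v"
  unfolding proj_eq_def by (intro exI[of _ 1]) simp

lemma proj_eq_sym: "proj_eq v w \<Longrightarrow> proj_eq w v"
  unfolding proj_eq_def by (metis (no_types) inverse_nonzero_iff_nonzero left_inverse vector_smult_assoc vector_smult_lid)

lemma proj_eq_trans: "proj_eq u v \<Longrightarrow> proj_eq v w \<Longrightarrow> proj_eq u w"
  unfolding proj_eq_def by (metis mult_eq_0_iff vector_smult_assoc)

lemma proj_eq_smult: "c \<noteq> 0 \<Longrightarrow> proj_eq v (c *s v)"
  unfolding proj_eq_def by blast

lemma proj_eq_rep:
  assumes d: "\<And>i. is_form d (\<lambda>v. \<Phi> v $ i)" and "proj_eq v w"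
  shows "proj_eq (\<Phi> v) (\<Phi> w)"
proof -
  obtain c where c: "c \<noteq> 0" "w = c *s v" using assms(2) unfolding proj_eq_def by blast
  have "\<Phi> w = c^d *s \<Phi> v" by (simp add: vec_eq_iff c is_form_homogeneous[OF d])
  then show ?thesis using c unfolding proj_eq_def by (intro exI[of _ "c^d"]) simp
qed

lemma rat_repE:
  assumes "\<Phi> \<in> rat_reps HC"
  obtains d where "\<And>i. is_form d (\<lambda>v. \<Phi> v $ i)"
  using assms unfolding rat_reps_def by blast

lemma proj_eq_curve: "proj_eq v w \<Longrightarrow> v \<in> curve_pts HC \<Longrightarrow> w \<in> curve_pts HC"
  unfolding proj_eq_def using curve_pts_smult by blast

text \<open>
  Two rational maps that agree at infinitely many points agree everywhere.
\<close>
lemma rat_equivI: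
  assumes R: "\<Phi> \<in> rat_reps HC" "\<Psi> \<in> rat_reps HC"
    and fr: "\<exists>\<^sub>F e in generic. proj_eq (\<Phi> (plane_point e)) (\<Psi> (plane_point e))"
  shows "(\<Phi>, \<Psi>) \<in> rat_equiv HC"
proof -
  obtain d d' where d: "\<And>i. is_form d (\<lambda>v. \<Phi> v $ i)" "\<And>i. is_form d' (\<lambda>v. \<Psi> v $ i)" using R by (metis rat_repE)
  have "\<Phi> v $ i * \<Psi> v $ j - \<Phi> v $ j * \<Psi> v $ i = 0" if v: "v \<in> curve_pts HC" for v i j
  proof (rule form_vanishes[OF _ _ v, of "d + d'"])
    show "is_form (d + d') (\<lambda>v. \<Phi> v $ i * \<Psi> v $ j - \<Phi> v $ j * \<Psi> v $ i)"
      by (intro is_form_diff is_form_mult d)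
    show "\<exists>\<^sub>F e in generic. \<Phi> (plane_point e) $ i * \<Psi> (plane_point e) $ j - \<Phi> (plane_point e) $ j * \<Psi> (plane_point e) $ i = 0"
      using fr by (rule frequently_elim1) (auto simp: proj_eq_def)
  qed
  then show ?thesis using R by (simp add: rat_equiv_def proj_eq_minors)
qed

lemma rat_equivD:
  assumes "(\<Phi>, \<Psi>) \<in> rat_equiv HC"
  shows "\<forall>\<^sub>F e in generic. proj_eq (\<Phi> (plane_point e)) (\<Psi> (plane_point e))" "\<Phi> \<in> rat_reps HC" "\<Psi> \<in> rat_reps HC"
proof -
  show R: "\<Phi> \<in> rat_reps HC" "\<Psi> \<in> rat_reps HC" using assms by (auto simp: rat_equiv_def)
  show "\<forall>\<^sub>F e in generic. proj_eq (\<Phi> (plane_point e)) (\<Psi> (plane_point e))"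
    using generic_curve generic_rep[OF R(1)] generic_rep[OF R(2)]
  proof eventually_elim
    case (elim e)
    then show ?case using assms by (auto simp: rat_equiv_def curve_pts_def)
  qed
qed

lemma rat_equiv_equiv: "equiv (rat_reps HC) (rat_equiv HC)"
proof (rule equivI)
  show "rat_equiv HC \<subseteq> rat_reps HC \<times> rat_reps HC" by (auto simp: rat_equiv_def)
  show "refl_on (rat_reps HC) (rat_equiv HC)" by (auto simp: rat_equiv_def refl_on_def proj_eq_refl)
  show "sym (rat_equiv HC)" by (auto simp: rat_equiv_def sym_def proj_eq_sym)
  show "trans (rat_equiv HC)"
  proof (rule transI)
    fix \<Phi> \<Psi> \<Theta> assume 1: "(\<Phi>, \<Psi>) \<in> rat_equiv HC" "(\<Psi>, \<Theta>) \<in> rat_equiv HC"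
    have "\<forall>\<^sub>F e in generic. proj_eq (\<Phi> (plane_point e)) (\<Theta> (plane_point e))"
      using rat_equivD(1)[OF 1(1)] rat_equivD(1)[OF 1(2)] by eventually_elim (rule proj_eq_trans)
    then show "(\<Phi>, \<Theta>) \<in> rat_equiv HC"
      by (intro rat_equivI rat_equivD(2)[OF 1(1)] rat_equivD(3)[OF 1(2)] eventually_frequently[OF generic_nontrivial])
  qed
qed

lemmas rat_class_eq_iff = eq_equiv_class_iff[OF rat_equiv_equiv, folded rat_class_def]
lemmas rat_class_self = equiv_class_self[OF rat_equiv_equiv, folded rat_class_def]

section \<open>Rational maps induced on the parametrising curve\<close>

text \<open>
  The rational map of the plane curve corresponds to the map \<open>\<phi>\<close> of the parametrising curve.
\<close>
definition induces :: "(complex^3 \<Rightarrow> complex^3) \<Rightarrow> (complex \<times> complex \<Rightarrow> complex \<times> complex) \<Rightarrow> bool" where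
  "induces \<Phi> \<phi> \<longleftrightarrow> \<Phi> \<in> rat_reps HC \<and> filterlim \<phi> generic generic \<and> (\<forall>\<^sub>F e in generic. proj_eq (plane_point (\<phi> e)) (\<Phi> (plane_point e)))"

lemma inducesI:
  assumes "\<And>i. is_form d (\<lambda>v. \<Phi> v $ i)" "filterlim \<phi> generic generic" "\<forall>\<^sub>F e in generic. proj_eq (plane_point (\<phi> e)) (\<Phi> (plane_point e))"
  shows "induces \<Phi> \<phi>"
proof -
  have "\<forall>\<^sub>F e in generic. \<Phi> (plane_point e) \<in> curve_pts HC"
    using assms(3) eventually_compose_filterlim[OF generic_curve assms(2)] by eventually_elim (blast intro: proj_eq_curve)
  then show ?thesis using assms rat_repI unfolding induces_def by blast
qed

lemma is_form_coordinate: "is_form 1 (\<lambda>v. v $ i)"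
  using is_form_coord exhaust_3[of i] by metis

lemma induces_id: "induces id id"
  by (rule inducesI[of 1]) (simp_all add: is_form_coordinate proj_eq_refl id_def filterlim_ident del: One_nat_def)

lemma segre_coords_proj_eq: assumes "proj_eq v w" shows "segre_coords v = segre_coords w"
proof -
  obtain c where "c \<noteq> 0" "w = c *s v" using assms unfolding proj_eq_def by blast
  moreover obtain a b c' d where "canonical_map v = (a, b, c', d)" by (rule quad_cases)
  ultimately show ?thesis by (simp add: segre_coords_def canonical_map_smult)
qed

lemma induces_cong:
  assumes "induces \<Phi> \<phi>" "\<forall>\<^sub>F e in generic. \<phi> e = \<phi>' e" shows "induces \<Phi> \<phi>'"
proof -
  have "filterlim \<phi>' generic generic" using assms filterlim_cong[OF refl refl assms(2)] by (simp add: induces_def)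
  moreover have "\<forall>\<^sub>F e in generic. proj_eq (plane_point (\<phi>' e)) (\<Phi> (plane_point e))"
    using assms unfolding induces_def by (auto elim: eventually_elim2)
  ultimately show ?thesis using assms(1) by (simp add: induces_def)
qed

lemma induces_equiv:
  assumes "induces \<Phi> \<phi>" shows "induces \<Psi> \<phi> \<longleftrightarrow> (\<Phi>, \<Psi>) \<in> rat_equiv HC"
proof
  assume "induces \<Psi> \<phi>"
  then have "\<forall>\<^sub>F e in generic. proj_eq (plane_point (\<phi> e)) (\<Psi> (plane_point e))" by (simp add: induces_def)
  moreover have "\<forall>\<^sub>F e in generic. proj_eq (plane_point (\<phi> e)) (\<Phi> (plane_point e))" using assms by (simp add: induces_def)
  ultimately have "\<forall>\<^sub>F e in generic. proj_eq (\<Phi> (plane_point e)) (\<Psi> (plane_point e))"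
    by eventually_elim (blast intro: proj_eq_sym proj_eq_trans)
  then show "(\<Phi>, \<Psi>) \<in> rat_equiv HC"
    using assms \<open>induces \<Psi> \<phi>\<close> by (intro rat_equivI eventually_frequently[OF generic_nontrivial]) (auto simp: induces_def)
next
  assume e: "(\<Phi>, \<Psi>) \<in> rat_equiv HC"
  have "\<forall>\<^sub>F e in generic. proj_eq (plane_point (\<phi> e)) (\<Phi> (plane_point e))" using assms by (simp add: induces_def)
  then have "\<forall>\<^sub>F e in generic. proj_eq (plane_point (\<phi> e)) (\<Psi> (plane_point e))"
    using rat_equivD(1)[OF e] by eventually_elim (rule proj_eq_trans)
  then show "induces \<Psi> \<phi>" using assms rat_equivD(3)[OF e] by (simp add: induces_def)
qed

lemma induces_unique:
  assumes "induces \<Phi> \<phi>" "induces \<Phi> \<psi>" shows "\<forall>\<^sub>F e in generic. \<phi> e = \<psi> e"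
proof -
  have "\<forall>\<^sub>F e in generic. proj_eq (plane_point (\<phi> e)) (\<Phi> (plane_point e))" "\<forall>\<^sub>F e in generic. proj_eq (plane_point (\<psi> e)) (\<Phi> (plane_point e))"
    "\<forall>\<^sub>F e in generic. plane_point (\<phi> e) \<in> curve_pts HC \<and> segre_coords (plane_point (\<phi> e)) = \<phi> e"
    "\<forall>\<^sub>F e in generic. plane_point (\<psi> e) \<in> curve_pts HC \<and> segre_coords (plane_point (\<psi> e)) = \<psi> e"
    using assms eventually_compose_filterlim[OF generic_curve] unfolding induces_def by blast+
  then show ?thesis by eventually_elim (metis segre_coords_proj_eq)
qed

lemma is_form_comp:
  assumes "\<And>i. is_form d (\<lambda>v. \<Phi> v $ i)" "\<And>i. is_form d' (\<lambda>v. \<Psi> v $ i)"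
  shows "is_form (d * d') (\<lambda>v. (\<Phi> \<circ> \<Psi>) v $ i)"
  using is_form_compose[OF assms(1) assms(2)] by simp

lemma induces_comp:
  assumes \<Phi>: "induces \<Phi> \<phi>" and \<Psi>: "induces \<Psi> \<psi>" shows "induces (\<Phi> \<circ> \<Psi>) (\<phi> \<circ> \<psi>)"
proof -
  obtain d where d: "\<And>i. is_form d (\<lambda>v. \<Phi> v $ i)" using \<Phi> unfolding induces_def by (metis rat_repE)
  obtain d' where d': "\<And>i. is_form d' (\<lambda>v. \<Psi> v $ i)" using \<Psi> unfolding induces_def by (metis rat_repE)
  have "\<forall>\<^sub>F e in generic. proj_eq (plane_point (\<phi> (\<psi> e))) (\<Phi> (plane_point (\<psi> e)))"
    using \<Phi> \<Psi> eventually_compose_filterlim unfolding induces_def by blast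
  moreover have "\<forall>\<^sub>F e in generic. proj_eq (plane_point (\<psi> e)) (\<Psi> (plane_point e))" using \<Psi> by (simp add: induces_def)
  ultimately have "\<forall>\<^sub>F e in generic. proj_eq (plane_point ((\<phi> \<circ> \<psi>) e)) ((\<Phi> \<circ> \<Psi>) (plane_point e))"
    by eventually_elim (auto intro: proj_eq_trans proj_eq_rep[OF d])
  moreover have "filterlim (\<phi> \<circ> \<psi>) generic generic"
    using \<Phi> \<Psi> filterlim_compose[of \<phi> generic generic \<psi> generic] by (simp add: induces_def comp_def)
  ultimately show ?thesis by (intro inducesI[OF is_form_comp[OF d d']])
qed

text \<open>
  All compositions of representatives induce the same map, so the union in the definition of the
  composition has only one member.
\<close>
lemma rat_comp_class:
  assumes \<Phi>: "induces \<Phi> \<phi>" and \<Psi>: "induces \<Psi> \<psi>"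
  shows "rat_comp HC (rat_class HC \<Phi>) (rat_class HC \<Psi>) = rat_class HC (\<Phi> \<circ> \<Psi>)"
proof -
  have "rat_class HC (\<Phi>' \<circ> \<Psi>') = rat_class HC (\<Phi> \<circ> \<Psi>)"
    if "\<Phi>' \<in> rat_class HC \<Phi>" "\<Psi>' \<in> rat_class HC \<Psi>" for \<Phi>' \<Psi>'
  proof -
    have "induces \<Phi>' \<phi>" "induces \<Psi>' \<psi>"
      using that induces_equiv[OF \<Phi>] induces_equiv[OF \<Psi>] by (auto simp: rat_class_def)
    then have "induces (\<Phi>' \<circ> \<Psi>') (\<phi> \<circ> \<psi>)" by (rule induces_comp)
    then have "(\<Phi> \<circ> \<Psi>, \<Phi>' \<circ> \<Psi>') \<in> rat_equiv HC" using induces_equiv[OF induces_comp[OF \<Phi> \<Psi>]] by blast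
    then show ?thesis unfolding rat_class_def by (rule equiv_class_eq[OF rat_equiv_equiv, symmetric])
  qed
  moreover have "\<Phi> \<in> rat_class HC \<Phi>" "\<Psi> \<in> rat_class HC \<Psi>" "\<Phi> \<circ> \<Psi> \<in> rat_reps HC"
    using \<Phi> \<Psi> induces_comp[OF \<Phi> \<Psi>] rat_class_self by (auto simp: induces_def)
  ultimately show ?thesis unfolding rat_comp_def by blast
qed

section \<open>Birational self-maps of the plane curve\<close>

text \<open>
  A form vanishing on the image of \<open>\<Phi>\<close> would vanish on the curve, because \<open>\<Phi>\<close> has a right inverse.
\<close>
lemma right_inverse_nonvanishing:
  assumes R: "\<Phi> \<in> rat_reps HC" "\<Psi> \<in> rat_reps HC" and inv: "(\<Phi> \<circ> \<Psi>, id) \<in> rat_equiv HC"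
    and Q: "is_form q Q" "\<forall>\<^sub>F e in generic. Q (plane_point e) \<noteq> 0"
  shows "\<forall>\<^sub>F e in generic. Q (\<Phi> (plane_point e)) \<noteq> 0"
proof (rule ccontr)
  assume "\<not> ?thesis"
  then have fr: "\<exists>\<^sub>F e in generic. Q (\<Phi> (plane_point e)) = 0" by (simp add: frequently_def)
  obtain d where d: "\<And>i. is_form d (\<lambda>v. \<Phi> v $ i)" using R(1) by (metis rat_repE)
  have z: "Q (\<Phi> v) = 0" if "v \<in> curve_pts HC" for v
    by (rule form_vanishes[OF is_form_compose[OF Q(1) d] fr that])
  have "\<forall>\<^sub>F e in generic. False"
    using generic_rep[OF R(2)] rat_equivD(1)[OF inv] Q(2)
  proof eventually_elim
    case (elim e)
    then obtain c where "c \<noteq> 0" "plane_point e = c *s \<Phi> (\<Psi> (plane_point e))" by (auto simp: proj_eq_def)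
    then have "Q (plane_point e) = c^q * Q (\<Phi> (\<Psi> (plane_point e)))" using is_form_homogeneous[OF Q(1)] by metis
    then show ?case using z elim by simp
  qed
  then show False using generic_nontrivial by (simp add: trivial_limit_def)
qed

text \<open>
  The two compositions in the definition of an invertible class may involve different representatives of the class
  and of its inverse; the representatives \<open>\<Phi>\<close> and \<open>\<Psi>\<close> of the first one serve for both.
\<close>
lemma carrier_BirD:
  assumes "f \<in> carrier (Bir HC)"
  obtains \<Phi> \<Psi> where "f = rat_class HC \<Phi>" "\<Phi> \<in> rat_reps HC" "\<Psi> \<in> rat_reps HC"
    "(\<Phi> \<circ> \<Psi>, id) \<in> rat_equiv HC" "(\<Psi> \<circ> \<Phi>, id) \<in> rat_equiv HC"
proof -
  obtain g where f: "f \<in> rat_reps HC // rat_equiv HC" and g: "g \<in> rat_reps HC // rat_equiv HC"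
    and fg: "rat_comp HC f g = rat_class HC id" "rat_comp HC g f = rat_class HC id"
    using assms by (auto simp: Bir_def rat_maps_def)
  have "id \<in> rat_class HC id" using induces_id rat_class_self by (simp add: induces_def)
  then have i: "id \<in> rat_comp HC f g" "id \<in> rat_comp HC g f" by (simp_all add: fg)
  obtain \<Phi> \<Psi> where 1: "\<Phi> \<in> f" "\<Psi> \<in> g" "(\<Phi> \<circ> \<Psi>, id) \<in> rat_equiv HC"
    using i(1) by (auto simp: rat_comp_def rat_class_def)
  obtain \<Phi>' \<Psi>' where 2: "\<Phi>' \<in> f" "\<Psi>' \<in> g" "(\<Psi>' \<circ> \<Phi>', id) \<in> rat_equiv HC"
    using i(2) by (auto simp: rat_comp_def rat_class_def)
  have e: "(\<Phi>, \<Phi>') \<in> rat_equiv HC" "(\<Psi>, \<Psi>') \<in> rat_equiv HC"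
    using in_quotient_imp_in_rel[OF rat_equiv_equiv f] in_quotient_imp_in_rel[OF rat_equiv_equiv g] 1 2 by auto
  have R: "\<Phi> \<in> rat_reps HC" "\<Psi> \<in> rat_reps HC" "\<Psi>' \<in> rat_reps HC" using rat_equivD e by blast+
  obtain d where d: "\<And>i. is_form d (\<lambda>v. \<Phi> v $ i)" using R(1) by (metis rat_repE)
  obtain k where k: "\<And>i. is_form k (\<lambda>v. \<Psi> v $ i)" using R(2) by (metis rat_repE)
  obtain k' where k': "\<And>i. is_form k' (\<lambda>v. \<Psi>' v $ i)" using R(3) by (metis rat_repE)
  obtain i where i: "\<forall>\<^sub>F e in generic. \<Psi> (plane_point e) $ i \<noteq> 0" using generic_rep_component[OF R(2)] by blast
  have nz: "\<forall>\<^sub>F e in generic. \<Psi> (\<Phi> (plane_point e)) $ i \<noteq> 0"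
    by (rule right_inverse_nonvanishing[OF R(1,2) 1(3) k i])
  have ev: "\<forall>\<^sub>F e in generic. proj_eq (\<Psi> (\<Phi> (plane_point e))) (plane_point e)"
    using nz generic_rep[OF R(1)] rat_equivD(1)[OF e(1)] rat_equivD(1)[OF 2(3)] generic_curve
  proof eventually_elim
    case (elim x)
    have 3: "proj_eq (\<Psi>' (\<Phi> (plane_point x))) (plane_point x)"
      using elim proj_eq_rep[OF k', of "\<Phi> (plane_point x)" "\<Phi>' (plane_point x)"] by (auto intro: proj_eq_trans)
    then have "\<Psi>' (\<Phi> (plane_point x)) \<noteq> 0" using elim by (auto simp: proj_eq_def curve_pts_def)
    moreover have "\<Psi> (\<Phi> (plane_point x)) \<noteq> 0" using elim by auto
    ultimately have "proj_eq (\<Psi> (\<Phi> (plane_point x))) (\<Psi>' (\<Phi> (plane_point x)))" using e(2) elim by (auto simp: rat_equiv_def)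
    then show ?case using 3 by (rule proj_eq_trans)
  qed
  have "\<forall>\<^sub>F e in generic. (\<Psi> \<circ> \<Phi>) (plane_point e) \<in> curve_pts HC"
    using ev generic_curve by eventually_elim (auto intro: proj_eq_curve proj_eq_sym)
  then have "\<Psi> \<circ> \<Phi> \<in> rat_reps HC" by (rule rat_repI[OF is_form_comp[OF k d]])
  then have "(\<Psi> \<circ> \<Phi>, id) \<in> rat_equiv HC"
    using ev induces_id by (intro rat_equivI eventually_frequently[OF generic_nontrivial]) (auto simp: induces_def)
  moreover have "f = rat_class HC \<Phi>"
  proof -
    obtain \<Phi>0 where \<Phi>0: "f = rat_equiv HC `` {\<Phi>0}" using f by (rule quotientE)
    then have "(\<Phi>0, \<Phi>) \<in> rat_equiv HC" using 1(1) by simp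
    from equiv_class_eq[OF rat_equiv_equiv this] show ?thesis by (simp add: \<Phi>0 rat_class_def)
  qed
  ultimately show thesis using that R 1(3) by blast
qed

lemma is_form_canonical_map:
  "is_form 3 (\<lambda>v. fst (canonical_map v))" "is_form 3 (\<lambda>v. fst (snd (canonical_map v)))"
  "is_form 3 (\<lambda>v. fst (snd (snd (canonical_map v))))" "is_form 3 (\<lambda>v. snd (snd (snd (canonical_map v))))"
proof -
  have "is_form 3 (\<lambda>v. 1 * v $ 1 ^ 2 * v $ 2 ^ 1 * v $ 3 ^ 0 + (-1) * v $ 1 ^ 0 * v $ 2 ^ 2 * v $ 3 ^ 1)"
    "is_form 3 (\<lambda>v. (-1) * v $ 1 ^ 1 * v $ 2 ^ 2 * v $ 3 ^ 0 + 1 * v $ 1 ^ 0 * v $ 2 ^ 0 * v $ 3 ^ 3)"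
    "is_form 3 (\<lambda>v. 1 * v $ 1 ^ 1 * v $ 2 ^ 0 * v $ 3 ^ 2 + (-1) * v $ 1 ^ 0 * v $ 2 ^ 3 * v $ 3 ^ 0)"
    "is_form 3 (\<lambda>v. (-1) * v $ 1 ^ 2 * v $ 2 ^ 0 * v $ 3 ^ 1 + 1 * v $ 1 ^ 0 * v $ 2 ^ 1 * v $ 3 ^ 2)"
    by (intro is_form_add is_form_monomial; simp)+
  then show "is_form 3 (\<lambda>v. fst (canonical_map v))" "is_form 3 (\<lambda>v. fst (snd (canonical_map v)))"
    "is_form 3 (\<lambda>v. fst (snd (snd (canonical_map v))))" "is_form 3 (\<lambda>v. snd (snd (snd (canonical_map v))))"
    unfolding canonical_map_def Let_def fst_conv snd_conv by (simp_all add: algebra_simps power2_eq_square)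
qed

lemma is_form_canonical_factor: "is_form 11 canonical_factor"
proof -
  have "is_form (3 * 2 + 5) (\<lambda>v. (1 * v $ 1 ^ 2 * v $ 2 ^ 0 * v $ 3 ^ 0 + (-1) * v $ 1 ^ 0 * v $ 2 ^ 1 * v $ 3 ^ 1)^3
     * (1 * v $ 1 ^ 0 * v $ 2 ^ 5 * v $ 3 ^ 0 + (-1) * v $ 1 ^ 0 * v $ 2 ^ 0 * v $ 3 ^ 5))"
    by (intro is_form_mult is_form_power is_form_add is_form_monomial; simp)
  then show ?thesis by (simp add: canonical_factor_def[abs_def])
qed

lemma segre_coords_induced:
  assumes R: "\<Phi> \<in> rat_reps HC" "\<Psi> \<in> rat_reps HC" and inv: "(\<Phi> \<circ> \<Psi>, id) \<in> rat_equiv HC"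
  shows "ratfun (\<lambda>e. fst (segre_coords (\<Phi> (plane_point e))))" "ratfun (\<lambda>e. snd (segre_coords (\<Phi> (plane_point e))))"
    "\<forall>\<^sub>F e in generic. segre_coords (\<Phi> (plane_point e)) \<in> bring_curve \<and> proj_eq (plane_point (segre_coords (\<Phi> (plane_point e)))) (\<Phi> (plane_point e))"
proof -
  obtain d where d: "\<And>i. is_form d (\<lambda>v. \<Phi> v $ i)" using R(1) by (metis rat_repE)
  have RFk: "ratfun (\<lambda>e. P (\<Phi> (plane_point e)))" if "is_form k P" for P k
    using is_form_ratfun[OF is_form_compose[OF that d] ratfun_plane_point] .
  have eps_eq: "segre_coords v = (fst (snd (canonical_map v)) / fst (canonical_map v), - fst (snd (snd (canonical_map v))) / fst (canonical_map v))" for v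
    by (simp add: segre_coords_def split: prod.split)
  show "ratfun (\<lambda>e. fst (segre_coords (\<Phi> (plane_point e))))" "ratfun (\<lambda>e. snd (segre_coords (\<Phi> (plane_point e))))"
    unfolding eps_eq fst_conv snd_conv by (intro ratfun_divide ratfun_uminus RFk[OF is_form_canonical_map(1)] RFk[OF is_form_canonical_map(2)] RFk[OF is_form_canonical_map(3)])+
  have "\<forall>\<^sub>F e in generic. canonical_factor (plane_point e) \<noteq> 0" using generic_canonical_map_plane_point generic_bring_curve by eventually_elim (rule segre_coords_plane_point(3))
  then have "\<forall>\<^sub>F e in generic. canonical_factor (\<Phi> (plane_point e)) \<noteq> 0" by (rule right_inverse_nonvanishing[OF R inv is_form_canonical_factor])
  moreover have "\<forall>\<^sub>F e in generic. fst (canonical_map (\<Phi> (plane_point e))) \<noteq> 0"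
    by (rule right_inverse_nonvanishing[OF R inv is_form_canonical_map(1) generic_canonical_map_plane_point])
  ultimately show "\<forall>\<^sub>F e in generic. segre_coords (\<Phi> (plane_point e)) \<in> bring_curve \<and> proj_eq (plane_point (segre_coords (\<Phi> (plane_point e)))) (\<Phi> (plane_point e))"
    using generic_rep[OF R(1)]
  proof eventually_elim
    case (elim e)
    define v where "v = \<Phi> (plane_point e)"
    have v: "HC v = 0" "fst (canonical_map v) \<noteq> 0" "canonical_factor v \<noteq> 0" using elim by (simp_all add: v_def curve_pts_def)
    have "proj_eq v (canonical_factor v *s v)" "proj_eq (plane_point (segre_coords v)) (fst (canonical_map v) ^ 4 *s plane_point (segre_coords v))"
      using v by (simp_all add: proj_eq_smult)
    then have "proj_eq (plane_point (segre_coords v)) v" unfolding plane_point_segre_coords[OF v(1,2)] by (blast intro: proj_eq_sym proj_eq_trans)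
    then show ?case using canonical_map_segre_coords(1)[OF v(1,2)] by (simp add: v_def)
  qed
qed

lemma segre_coords_induced_inverse:
  assumes R: "\<Phi> \<in> rat_reps HC" "\<Psi> \<in> rat_reps HC"
    and inv: "(\<Phi> \<circ> \<Psi>, id) \<in> rat_equiv HC" "(\<Psi> \<circ> \<Phi>, id) \<in> rat_equiv HC"
  shows "\<forall>\<^sub>F e in generic. segre_coords (\<Phi> (plane_point e)) \<in> bring_curve \<and> segre_coords (\<Psi> (plane_point (segre_coords (\<Phi> (plane_point e))))) = e"
  using segre_coords_induced(3)[OF R inv(1)] rat_equivD(1)[OF inv(2)] generic_curve
proof eventually_elim
  case (elim e)
  obtain k where k: "\<And>i. is_form k (\<lambda>v. \<Psi> v $ i)" using R(2) by (metis rat_repE)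
  have "proj_eq (\<Psi> (plane_point (segre_coords (\<Phi> (plane_point e))))) (\<Psi> (\<Phi> (plane_point e)))" using elim proj_eq_rep[OF k] by blast
  then have "proj_eq (\<Psi> (plane_point (segre_coords (\<Phi> (plane_point e))))) (plane_point e)" using elim by (auto intro: proj_eq_trans)
  then show ?case using elim segre_coords_proj_eq by metis
qed

text \<open>
  Every birational self-map of the plane curve is transported to the parametrising curve.
\<close>
lemma carrier_Bir_birational:
  assumes "f \<in> carrier (Bir HC)"
  shows "\<exists>\<Phi> \<phi> \<psi>. f = rat_class HC \<Phi> \<and> induces \<Phi> \<phi> \<and> birational \<phi> \<psi>"
proof -
  obtain \<Phi> \<Psi> where f: "f = rat_class HC \<Phi>" and R: "\<Phi> \<in> rat_reps HC" "\<Psi> \<in> rat_reps HC"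
    and inv: "(\<Phi> \<circ> \<Psi>, id) \<in> rat_equiv HC" "(\<Psi> \<circ> \<Phi>, id) \<in> rat_equiv HC" using carrier_BirD[OF assms] by metis
  define \<phi> \<psi> where "\<phi> = (\<lambda>e. segre_coords (\<Phi> (plane_point e)))" and "\<psi> = (\<lambda>e. segre_coords (\<Psi> (plane_point e)))"
  have b: "birational \<phi> \<psi>"
    unfolding birational_def \<phi>_def \<psi>_def
    using segre_coords_induced[OF R inv(1)] segre_coords_induced[OF R(2,1) inv(2)] segre_coords_induced_inverse[OF R inv]
      segre_coords_induced_inverse[OF R(2,1) inv(2,1)] by blast
  have "\<forall>\<^sub>F e in generic. proj_eq (plane_point (\<phi> e)) (\<Phi> (plane_point e))"
    using segre_coords_induced(3)[OF R inv(1)] unfolding \<phi>_def by eventually_elim blast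
  then have "induces \<Phi> \<phi>" using R birational_filterlim[OF b] by (simp add: induces_def)
  then show ?thesis using f b by blast
qed

section \<open>The action of permutations\<close>

text \<open>
  Newton's identity: on coordinate sum \<open>0\<close> the cubic is the third power sum, up to a factor.
\<close>
lemma bring_coord_cubes: "(\<Sum>i\<in>{1..5}. (bring_coord v i)^3) = 15 * cubic v"
proof -
  have "quadric_bilinear (cubic_product v v) v = 3 * cubic v"
    by (cases v rule: quad_cases) (simp add: algebra_simps power2_eq_square)
  then have "15 * cubic v = (\<Sum>i\<in>{1..5}. bring_coord (cubic_product v v) i * bring_coord v i)" using bring_coord_sum_mult[of "cubic_product v v" v] by simp
  also have "\<dots> = (\<Sum>i\<in>{1..5}. (bring_coord v i)^3 - 2 * quadric v * bring_coord v i)"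
    by (intro sum.cong refl) (simp add: bring_coord_square algebra_simps power2_eq_square power3_eq_cube)
  also have "\<dots> = (\<Sum>i\<in>{1..5}. (bring_coord v i)^3) - 2 * quadric v * (\<Sum>i\<in>{1..5}. bring_coord v i)"
    by (simp only: sum_subtractf sum_distrib_left)
  finally show ?thesis by (simp only: bring_coord_sum) simp
qed

abbreviation pinv :: "(nat \<Rightarrow> nat) \<Rightarrow> nat \<Rightarrow> nat" where "pinv \<equiv> inv_into UNIV"

definition inverse_fourier :: "(nat \<Rightarrow> complex) \<Rightarrow> quad" where
  "inverse_fourier y = ((zeta5^4 * y 1 + zeta5^3 * y 2 + zeta5^2 * y 3 + zeta5 * y 4 + y 5) / 5,
    (zeta5^3 * y 1 + zeta5 * y 2 + zeta5^4 * y 3 + zeta5^2 * y 4 + y 5) / 5,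
    (zeta5^2 * y 1 + zeta5^4 * y 2 + zeta5 * y 3 + zeta5^3 * y 4 + y 5) / 5,
    (zeta5 * y 1 + zeta5^2 * y 2 + zeta5^3 * y 3 + zeta5^4 * y 4 + y 5) / 5)"

lemma inverse_fourier_bring_coord: "inverse_fourier (bring_coord q) = q"
  by (cases q rule: quad_cases) (simp only: inverse_fourier_def bring_coord_inverse, simp)

text \<open>
  The permutation \<open>\<pi>\<close> of the five coordinates \<open>x\<^sub>i\<close>, expressed in the Fourier coordinates.
\<close>
definition perm_quad :: "(nat \<Rightarrow> nat) \<Rightarrow> quad \<Rightarrow> quad" where
  "perm_quad \<pi> q = inverse_fourier (\<lambda>i. bring_coord q (pinv \<pi> i))"

lemma bring_coord_perm_quad:
  assumes \<pi>: "\<pi> permutes {1..5}" and i: "i \<in> {1..5}" shows "bring_coord (perm_quad \<pi> q) i = bring_coord q (pinv \<pi> i)"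
proof -
  have "(\<Sum>i\<in>{1..5}. bring_coord q (pinv \<pi> i)) = (\<Sum>i\<in>{1..5}. bring_coord q i)"
    using sum.permute[OF permutes_inv[OF \<pi>], of "bring_coord q"] by (simp add: comp_def)
  then obtain v where v: "\<forall>i\<in>{1..5}. bring_coord v i = bring_coord q (pinv \<pi> i)" using bring_coord_surj[of "\<lambda>i. bring_coord q (pinv \<pi> i)"] bring_coord_sum by metis
  then have "inverse_fourier (\<lambda>i. bring_coord q (pinv \<pi> i)) = inverse_fourier (bring_coord v)" by (simp add: inverse_fourier_def)
  then show ?thesis using v i by (simp add: perm_quad_def inverse_fourier_bring_coord)
qed

lemma perm_quad_eqI: "\<pi> permutes {1..5} \<Longrightarrow> (\<And>i. i \<in> {1..5} \<Longrightarrow> bring_coord q (pinv \<pi> i) = bring_coord r i) \<Longrightarrow> perm_quad \<pi> q = r"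
  by (rule bring_coord_inj) (simp only: bring_coord_perm_quad)

lemma perm_quad_comp:
  assumes "\<pi> permutes {1..5}" "\<sigma> permutes {1..5}" shows "perm_quad \<pi> (perm_quad \<sigma> q) = perm_quad (\<pi> \<circ> \<sigma>) q"
proof (rule perm_quad_eqI[OF assms(1)])
  fix i :: nat assume i: "i \<in> {1..5}"
  have "pinv \<pi> i \<in> {1..5}" using permutes_in_image[OF permutes_inv[OF assms(1)]] i by blast
  moreover have "pinv (\<pi> \<circ> \<sigma>) = pinv \<sigma> \<circ> pinv \<pi>" by (rule o_inv_distrib) (use assms permutes_bij in auto)
  ultimately show "bring_coord (perm_quad \<sigma> q) (pinv \<pi> i) = bring_coord (perm_quad (\<pi> \<circ> \<sigma>) q) i"
    using bring_coord_perm_quad[OF assms(2)] bring_coord_perm_quad[OF permutes_compose[OF assms(2,1)] i] by simp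
qed

lemma perm_quad_id: "perm_quad id q = q"
  by (simp add: perm_quad_def inverse_fourier_bring_coord)

lemma perm_quad_scale: "perm_quad \<pi> (scale k q) = scale k (perm_quad \<pi> q)"
  by (simp add: perm_quad_def inverse_fourier_def bring_coord_scale algebra_simps add_divide_distrib)

lemma perm_quad_add: "perm_quad \<pi> (q + r) = perm_quad \<pi> q + perm_quad \<pi> r"
  by (simp add: perm_quad_def inverse_fourier_def bring_coord_add algebra_simps add_divide_distrib)

lemma quadric_perm_quad: assumes "\<pi> permutes {1..5}" shows "quadric (perm_quad \<pi> q) = quadric q"
proof -
  have "10 * quadric (perm_quad \<pi> q) = (\<Sum>i\<in>{1..5}. (bring_coord q (pinv \<pi> i))^2)"
    unfolding bring_coord_sum_squares[symmetric] by (intro sum.cong refl) (simp only: bring_coord_perm_quad[OF assms])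
  also have "\<dots> = 10 * quadric q"
    using sum.permute[OF permutes_inv[OF assms], of "\<lambda>i. (bring_coord q i)^2"] bring_coord_sum_squares[of q] by (simp add: comp_def)
  finally show ?thesis by simp
qed

lemma cubic_perm_quad: assumes "\<pi> permutes {1..5}" shows "cubic (perm_quad \<pi> q) = cubic q"
proof -
  have "15 * cubic (perm_quad \<pi> q) = (\<Sum>i\<in>{1..5}. (bring_coord q (pinv \<pi> i))^3)"
    unfolding bring_coord_cubes[symmetric] by (intro sum.cong refl) (simp only: bring_coord_perm_quad[OF assms])
  also have "\<dots> = 15 * cubic q"
    using sum.permute[OF permutes_inv[OF assms], of "\<lambda>i. (bring_coord q i)^3"] bring_coord_cubes[of q] by (simp add: comp_def)
  finally show ?thesis by simp
qed

fun quad_coords :: "quad \<Rightarrow> complex \<times> complex" where "quad_coords (a, b, c, d) = (b / a, - c / a)"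

lemma quad_coords_segre: "quad_coords (segre e) = e"
  by (simp add: segre_def)

lemma quad_coords_scale: "k \<noteq> 0 \<Longrightarrow> quad_coords (scale k q) = quad_coords q"
  by (cases q rule: quad_cases) simp

text \<open>
  A point of the quadric is determined by its coordinates on the two rulings.
\<close>
lemma segre_quad_coords:
  assumes "quadric q = 0" "fst q \<noteq> 0" shows "q = scale (fst q) (segre (quad_coords q))"
proof -
  obtain a b c d where q: "q = (a, b, c, d)" by (rule quad_cases)
  have "a \<noteq> 0" "a * d = - (b * c)" using assms by (auto simp: q eq_neg_iff_add_eq_0)
  then show ?thesis by (simp add: q segre_def field_simps)
qed

lemma quad_coords_bring_curve: assumes "quadric q = 0" "cubic q = 0" "fst q \<noteq> 0" shows "quad_coords q \<in> bring_curve"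
proof -
  have "cubic (segre (quad_coords q)) = 0" using segre_quad_coords[OF assms(1,3)] assms(2,3) cubic_scale[of "fst q" "segre (quad_coords q)"] by simp
  then show ?thesis by (cases "quad_coords q") (simp add: cubic_segre)
qed

definition perm_act :: "(nat \<Rightarrow> nat) \<Rightarrow> complex \<times> complex \<Rightarrow> complex \<times> complex" where "perm_act \<pi> e = quad_coords (perm_quad \<pi> (segre e))"

text \<open>
  The first coordinate is a linear form on space, and the curve lies in no plane by the identity theorem.
\<close>
lemma generic_perm_quad:
  assumes \<pi>: "\<pi> permutes {1..5}" shows "\<forall>\<^sub>F e in generic. fst (perm_quad \<pi> (segre e)) \<noteq> 0"
proof (rule ccontr)
  assume "\<not> ?thesis"
  then have fr: "\<exists>\<^sub>F e in generic. fst (perm_quad \<pi> (segre e)) = 0" by (simp add: frequently_def)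
  define p1 p2 p3 p4 where "p1 = fst (perm_quad \<pi> (1, 0, 0, 0))" and "p2 = fst (perm_quad \<pi> (0, 1, 0, 0))"
    and "p3 = fst (perm_quad \<pi> (0, 0, 1, 0))" and "p4 = fst (perm_quad \<pi> (0, 0, 0, 1))"
  have fsc: "fst (scale k q) = k * fst q" for k q by (cases q rule: quad_cases) simp
  have lin_eq: "fst (perm_quad \<pi> (a, b, c, d)) = a * p1 + b * p2 + c * p3 + d * p4" for a b c d
  proof -
    have "(a, b, c, d) = scale a (1, 0, 0, 0) + scale b (0, 1, 0, 0) + scale c (0, 0, 1, 0) + scale d (0, 0, 0, 1)" by simp
    then show ?thesis by (simp only: perm_quad_add perm_quad_scale fst_add fsc p1_def p2_def p3_def p4_def)
  qed
  have "fst (perm_quad \<pi> (segre e)) = poly [:p1, p2:] (fst e) + poly [:- p3, p4:] (fst e) * snd e + poly 0 (fst e) * (snd e)^2" for e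
    by (simp add: segre_def lin_eq algebra_simps)
  with fr have "\<exists>\<^sub>F e in generic. poly [:p1, p2:] (fst e) + poly [:- p3, p4:] (fst e) * snd e + poly 0 (fst e) * (snd e)^2 = 0" by simp
  from identity_theorem[OF this] have "p1 = 0" "p2 = 0" "p3 = 0" "p4 = 0" by auto
  then have "fst (perm_quad \<pi> q) = 0" for q by (cases q rule: quad_cases) (simp add: lin_eq)
  then have "fst (perm_quad \<pi> (perm_quad (pinv \<pi>) (1, 0, 0, 0))) = 0" .
  then show False using perm_quad_comp[OF \<pi> permutes_inv[OF \<pi>]] permutes_inv_o(1)[OF \<pi>] perm_quad_id by simp
qed

lemma perm_act_comp:
  assumes "\<pi> permutes {1..5}" "\<sigma> permutes {1..5}" "fst (perm_quad \<sigma> (segre e)) \<noteq> 0"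
  shows "perm_act \<pi> (perm_act \<sigma> e) = perm_act (\<pi> \<circ> \<sigma>) e"
proof -
  let ?a = "fst (perm_quad \<sigma> (segre e))"
  have "perm_quad \<sigma> (segre e) = scale ?a (segre (perm_act \<sigma> e))"
    unfolding perm_act_def by (rule segre_quad_coords) (simp_all add: assms(3) quadric_perm_quad[OF assms(2)] quadric_segre)
  then have "perm_quad (\<pi> \<circ> \<sigma>) (segre e) = scale ?a (perm_quad \<pi> (segre (perm_act \<sigma> e)))" by (metis perm_quad_comp[OF assms(1,2)] perm_quad_scale)
  then show ?thesis using quad_coords_scale[OF assms(3)] by (simp add: perm_act_def)
qed

lemma generic_perm_act:
  assumes "\<pi> permutes {1..5}"
  shows "\<forall>\<^sub>F e in generic. perm_act \<pi> e \<in> bring_curve \<and> perm_act (pinv \<pi>) (perm_act \<pi> e) = e"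
  using generic_perm_quad[OF assms] generic_bring_curve
proof eventually_elim
  case (elim e)
  have "cubic (segre e) = 0" using elim by (cases e) (simp add: cubic_segre)
  then have "perm_act \<pi> e \<in> bring_curve" unfolding perm_act_def by (intro quad_coords_bring_curve) (simp_all add: elim(1) \<open>cubic (segre e) = 0\<close> quadric_perm_quad[OF assms] cubic_perm_quad[OF assms] quadric_segre)
  moreover have "perm_act (pinv \<pi>) (perm_act \<pi> e) = e"
    using perm_act_comp[OF permutes_inv[OF assms] assms elim(1)] permutes_inv_o(2)[OF assms] by (simp add: perm_act_def[of id] perm_quad_id quad_coords_segre)
  ultimately show ?case by blast
qed

lemma filterlim_perm_act: "\<pi> permutes {1..5} \<Longrightarrow> filterlim (perm_act \<pi>) generic generic"
  by (rule filterlim_generic[OF generic_perm_act])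

definition perm_rep :: "(nat \<Rightarrow> nat) \<Rightarrow> complex^3 \<Rightarrow> complex^3" where "perm_rep \<pi> v = quartic_map (perm_quad \<pi> (canonical_map v))"

lemma is_form_quartic_map:
  assumes "is_form n A" "is_form n B" "is_form n C" "is_form n D"
  shows "is_form (4 * n) (\<lambda>v. quartic_map (A v, B v, C v, D v) $ i)"
proof -
  have 1: "is_form (n + 3 * n) (\<lambda>v. C v * D v^3 - B v * A v^3)"
    by (intro is_form_diff is_form_mult is_form_power assms)
  have m: "is_form (2 * n + n) (\<lambda>v. A v^2 * C v + D v^2 * B v)"
    by (intro is_form_add is_form_mult is_form_power assms)
  have "is_form (n + (2 * n + n)) (\<lambda>v. - (A v * (A v^2 * C v + D v^2 * B v)))" "is_form (n + (2 * n + n)) (\<lambda>v. D v * (A v^2 * C v + D v^2 * B v))"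
    by (intro is_form_uminus is_form_mult[OF _ m] assms)+
  with 1 show ?thesis using exhaust_3[of i] by (auto simp: mult_ac)
qed

lemma is_form_perm_rep: "is_form 12 (\<lambda>v. perm_rep \<pi> v $ i)"
proof -
  have canonical_map: "canonical_map v = (fst (canonical_map v), fst (snd (canonical_map v)), fst (snd (snd (canonical_map v))), snd (snd (snd (canonical_map v))))" for v by simp
  have x: "is_form 3 (\<lambda>v. bring_coord (canonical_map v) j)" for j
    unfolding bring_coord_def by (subst canonical_map, simp only: bring_form.simps) (intro is_form_add is_form_cmult is_form_canonical_map)
  have s: "is_form 3 (\<lambda>v. (a * bring_coord (canonical_map v) i1 + b * bring_coord (canonical_map v) i2 + c * bring_coord (canonical_map v) i3 + d * bring_coord (canonical_map v) i4 + bring_coord (canonical_map v) i5) / 5)"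
    for a b c d i1 i2 i3 i4 i5
    using is_form_cmult[of 3 "\<lambda>v. a * bring_coord (canonical_map v) i1 + b * bring_coord (canonical_map v) i2 + c * bring_coord (canonical_map v) i3 + d * bring_coord (canonical_map v) i4 + bring_coord (canonical_map v) i5" "1/5"]
    by (simp add: is_form_add is_form_cmult x)
  have "is_form (4 * 3) (\<lambda>v. perm_rep \<pi> v $ i)"
    unfolding perm_rep_def perm_quad_def inverse_fourier_def by (intro is_form_quartic_map s)
  then show ?thesis by simp
qed

lemma induces_perm_rep:
  assumes "\<pi> permutes {1..5}" shows "induces (perm_rep \<pi>) (perm_act \<pi>)"
proof (rule inducesI[OF is_form_perm_rep filterlim_perm_act[OF assms]])
  show "\<forall>\<^sub>F e in generic. proj_eq (plane_point (perm_act \<pi> e)) (perm_rep \<pi> (plane_point e))"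
    using generic_perm_quad[OF assms] generic_canonical_map_plane_point generic_bring_curve
  proof eventually_elim
    case (elim e)
    let ?a = "fst (perm_quad \<pi> (segre e))" and ?m = "fst (canonical_map (plane_point e))"
    have "perm_quad \<pi> (segre e) = scale ?a (segre (perm_act \<pi> e))"
      unfolding perm_act_def by (rule segre_quad_coords) (simp_all add: elim(1) quadric_perm_quad[OF assms] quadric_segre)
    then have "perm_quad \<pi> (canonical_map (plane_point e)) = scale (?m * ?a) (segre (perm_act \<pi> e))"
      using canonical_map_plane_point[OF elim(3)] by (metis perm_quad_scale scale_scale)
    then have "perm_rep \<pi> (plane_point e) = (?m * ?a)^4 *s plane_point (perm_act \<pi> e)" by (simp add: perm_rep_def quartic_map_scale plane_point_def)
    then show ?case using elim by (simp add: proj_eq_smult)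
  qed
qed

definition perm_class :: "(nat \<Rightarrow> nat) \<Rightarrow> (complex^3 \<Rightarrow> complex^3) set" where "perm_class \<pi> = rat_class HC (perm_rep \<pi>)"

lemma perm_class_eqI:
  assumes "\<pi> permutes {1..5}" "induces \<Phi> \<phi>" "\<forall>\<^sub>F e in generic. \<phi> e = perm_act \<pi> e"
  shows "rat_class HC \<Phi> = perm_class \<pi>"
proof -
  have "induces \<Phi> (perm_act \<pi>)" using assms induces_cong by blast
  then have "(perm_rep \<pi>, \<Phi>) \<in> rat_equiv HC" using induces_equiv[OF induces_perm_rep[OF assms(1)]] by blast
  then show ?thesis unfolding perm_class_def rat_class_def by (rule equiv_class_eq[OF rat_equiv_equiv, symmetric])
qed

lemma perm_class_id: "perm_class id = rat_class HC id"
  by (rule perm_class_eqI[OF permutes_id induces_id, symmetric]) (simp add: perm_act_def perm_quad_id quad_coords_segre)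

lemma perm_class_comp:
  assumes "\<pi> permutes {1..5}" "\<sigma> permutes {1..5}"
  shows "rat_comp HC (perm_class \<pi>) (perm_class \<sigma>) = perm_class (\<pi> \<circ> \<sigma>)"
proof -
  have "\<forall>\<^sub>F e in generic. (perm_act \<pi> \<circ> perm_act \<sigma>) e = perm_act (\<pi> \<circ> \<sigma>) e"
    using generic_perm_quad[OF assms(2)] by eventually_elim (simp add: perm_act_comp[OF assms])
  then have "rat_class HC (perm_rep \<pi> \<circ> perm_rep \<sigma>) = perm_class (\<pi> \<circ> \<sigma>)"
    using perm_class_eqI[OF permutes_compose[OF assms(2,1)] induces_comp[OF induces_perm_rep induces_perm_rep]] assms by blast
  then show ?thesis unfolding perm_class_def using rat_comp_class[OF induces_perm_rep induces_perm_rep] assms by simp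
qed

lemma perm_class_carrier:
  assumes "\<pi> permutes {1..5}" shows "perm_class \<pi> \<in> carrier (Bir HC)"
proof -
  have m: "perm_class \<sigma> \<in> rat_maps HC" if "\<sigma> permutes {1..5}" for \<sigma>
    unfolding perm_class_def rat_class_def rat_maps_def using induces_perm_rep[OF that] by (auto simp: induces_def intro: quotientI)
  have "rat_comp HC (perm_class \<pi>) (perm_class (pinv \<pi>)) = rat_class HC id" "rat_comp HC (perm_class (pinv \<pi>)) (perm_class \<pi>) = rat_class HC id"
    using perm_class_comp assms permutes_inv[OF assms] permutes_inv_o[OF assms] perm_class_id by simp_all
  then show ?thesis using m[OF assms] m[OF permutes_inv[OF assms]] by (auto simp: Bir_def)
qed

text \<open>
  This is where the classification of the birational self-maps of the parametrising curve enters.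
\<close>
lemma carrier_Bir_perm_class:
  assumes "f \<in> carrier (Bir HC)" shows "\<exists>\<pi>. \<pi> permutes {1..5} \<and> f = perm_class \<pi>"
proof -
  obtain \<Phi> \<phi> \<psi> where f: "f = rat_class HC \<Phi>" "induces \<Phi> \<phi>" "birational \<phi> \<psi>" using carrier_Bir_birational[OF assms] by blast
  obtain \<pi> where \<pi>: "\<pi> permutes {1..5}"
    and ev: "\<forall>\<^sub>F e in generic. \<exists>k. k \<noteq> 0 \<and> (\<forall>i\<in>{1..5}. bring_coord (segre (\<phi> e)) (\<pi> i) = k * bring_coord (segre e) i)"
    using birational_permutation[OF f(3)] by blast
  have "\<forall>\<^sub>F e in generic. \<phi> e = perm_act \<pi> e" using ev
  proof eventually_elim
    case (elim e)
    then obtain k where k: "k \<noteq> 0" "\<And>i. i \<in> {1..5} \<Longrightarrow> bring_coord (segre (\<phi> e)) (\<pi> i) = k * bring_coord (segre e) i" by blast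
    have "perm_quad \<pi> (scale k (segre e)) = segre (\<phi> e)"
    proof (rule perm_quad_eqI[OF \<pi>])
      fix i :: nat assume i: "i \<in> {1..5}"
      have "pinv \<pi> i \<in> {1..5}" using permutes_in_image[OF permutes_inv[OF \<pi>]] i by blast
      from k(2)[OF this] show "bring_coord (scale k (segre e)) (pinv \<pi> i) = bring_coord (segre (\<phi> e)) i"
        by (simp add: permutes_inverses(1)[OF \<pi>] bring_coord_scale)
    qed
    then have "quad_coords (scale k (perm_quad \<pi> (segre e))) = \<phi> e" by (metis perm_quad_scale quad_coords_segre)
    then show ?case using k(1) by (simp add: quad_coords_scale perm_act_def)
  qed
  then show ?thesis using perm_class_eqI[OF \<pi> f(2)] f(1) \<pi> by blast
qed

section \<open>Faithfulness of the action\<close>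

lemma zeta5_not_1: "zeta5 \<noteq> 1"
  using zeta5_sum by auto

lemma zeta5_power_inj:
  assumes "i \<in> {1..5}" "j \<in> {1..5}" "zeta5^i = zeta5^j" shows "i = j"
proof -
  have *: "False" if "i < j" "i \<in> {1..5}" "j \<in> {1..5}" "zeta5^i = zeta5^j" for i j :: nat
  proof -
    define k where "k = j - i"
    have "zeta5^j = zeta5^i * zeta5^k" unfolding k_def power_add[symmetric] using that(1) by simp
    then have k1: "zeta5^k = 1" using that(4) zeta5_nonzero by simp
    have "k = 1 \<or> k = 2 \<or> k = 3 \<or> k = 4" using that by (auto simp: k_def)
    then have "zeta5 = 1"
    proof (elim disjE)
      assume "k = 2"
      then have "zeta5 ^ 2 = 1" using k1 by simp
      then show ?thesis using zeta5_pow5 by algebra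
    next
      assume "k = 3"
      then have "zeta5 ^ 3 = 1" using k1 by simp
      then show ?thesis using zeta5_pow5 by algebra
    next
      assume "k = 4"
      then have "zeta5 ^ 4 = 1" using k1 by simp
      then show ?thesis using zeta5_pow5 by algebra
    qed (use k1 in simp)
    then show False using zeta5_not_1 by blast
  qed
  show ?thesis using *[of i j] *[of j i] assms by (metis linorder_neqE_nat)
qed

text \<open>
  A quadratic relation on the curve is compared at \<open>t = 0\<close>, where the coordinates \<open>x\<^sub>i\<close> become
  \<open>\<zeta>\<^sup>i (1 + \<zeta>\<^sup>i s)\<close>; evaluation at the zero of the left factor gives the claim.
\<close>
lemma bring_coord_relation:
  assumes i: "p \<in> {1..5}" "q \<in> {1..5}" "r \<in> {1..5}" "u \<in> {1..5}"
    and fr: "\<exists>\<^sub>F e in generic. bring_coord (segre e) p * bring_coord (segre e) q = bring_coord (segre e) r * bring_coord (segre e) u"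
  shows "p = r \<or> p = u"
proof -
  define \<alpha> \<beta> where "\<alpha> = (\<lambda>i. [:zeta5^i, (zeta5^i)^2:])" and "\<beta> = (\<lambda>i. [:- ((zeta5^i)^3), (zeta5^i)^4:])"
  have x: "bring_coord (segre e) i = poly (\<alpha> i) (fst e) + poly (\<beta> i) (fst e) * snd e" for i e
    by (simp add: bring_coord_def segre_def \<alpha>_def \<beta>_def algebra_simps)
  have "bring_coord (segre e) p * bring_coord (segre e) q - bring_coord (segre e) r * bring_coord (segre e) u
    = poly (\<alpha> p * \<alpha> q - \<alpha> r * \<alpha> u) (fst e) + poly (\<alpha> p * \<beta> q + \<beta> p * \<alpha> q - \<alpha> r * \<beta> u - \<beta> r * \<alpha> u) (fst e) * snd e
      + poly (\<beta> p * \<beta> q - \<beta> r * \<beta> u) (fst e) * (snd e)^2" for e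
    unfolding x by (simp add: algebra_simps power2_eq_square del: mult_pCons_left mult_pCons_right)
  then have "\<exists>\<^sub>F e in generic. poly (\<alpha> p * \<alpha> q - \<alpha> r * \<alpha> u) (fst e) + poly (\<alpha> p * \<beta> q + \<beta> p * \<alpha> q - \<alpha> r * \<beta> u - \<beta> r * \<alpha> u) (fst e) * snd e
      + poly (\<beta> p * \<beta> q - \<beta> r * \<beta> u) (fst e) * (snd e)^2 = 0"
    using fr by (elim frequently_elim1) (metis eq_iff_diff_eq_0)
  from identity_theorem[OF this] have "\<alpha> p * \<alpha> q = \<alpha> r * \<alpha> u" by simp
  then have "poly (\<alpha> p * \<alpha> q) (- 1 / zeta5^p) = poly (\<alpha> r * \<alpha> u) (- 1 / zeta5^p)" by simp
  then have "zeta5^r * (1 - zeta5^r / zeta5^p) * (zeta5^u * (1 - zeta5^u / zeta5^p)) = 0"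
    unfolding poly_mult \<alpha>_def using zeta5_nonzero by (simp add: power2_eq_square algebra_simps)
  then have "zeta5^r = zeta5^p \<or> zeta5^u = zeta5^p" using zeta5_nonzero by auto
  then show ?thesis using zeta5_power_inj i by blast
qed

text \<open>
  Two permutations with the same action give proportional coordinate vectors at generic points, hence quadratic
  relations among the \<open>x\<^sub>i\<close>.
\<close>
lemma perm_act_inj:
  assumes \<pi>: "\<pi> permutes {1..5}" and \<sigma>: "\<sigma> permutes {1..5}" and fr: "\<exists>\<^sub>F e in generic. perm_act \<pi> e = perm_act \<sigma> e"
  shows "\<pi> = \<sigma>"
proof -
  have in5: "pinv \<tau> i \<in> {1..5}" if "\<tau> permutes {1..5}" "i \<in> {1..5}" for \<tau> i
    using permutes_in_image[OF permutes_inv[OF that(1)]] that(2) by blast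
  have "pinv \<pi> i = pinv \<sigma> i" if i: "i \<in> {1..5}" for i
  proof -
    have "(if i = 1 then 2 else 1) \<in> {1..5::nat}" "(if i = 1 then 2 else 1) \<noteq> i" by auto
    then obtain j where j: "j \<in> {1..5}" "j \<noteq> i" by blast
    have "\<exists>\<^sub>F e in generic. perm_act \<pi> e = perm_act \<sigma> e \<and> fst (perm_quad \<pi> (segre e)) \<noteq> 0 \<and> fst (perm_quad \<sigma> (segre e)) \<noteq> 0"
      using eventually_frequently_simps(1) frequently_eventually_frequently[OF fr eventually_conj[OF generic_perm_quad[OF \<pi>] generic_perm_quad[OF \<sigma>]]] by simp
    then have "\<exists>\<^sub>F e in generic. bring_coord (segre e) (pinv \<pi> i) * bring_coord (segre e) (pinv \<sigma> j) = bring_coord (segre e) (pinv \<pi> j) * bring_coord (segre e) (pinv \<sigma> i)"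
    proof (rule frequently_elim1)
      fix e assume e: "perm_act \<pi> e = perm_act \<sigma> e \<and> fst (perm_quad \<pi> (segre e)) \<noteq> 0 \<and> fst (perm_quad \<sigma> (segre e)) \<noteq> 0"
      obtain a where a: "perm_quad \<pi> (segre e) = scale a (segre (perm_act \<pi> e))" using segre_quad_coords[of "perm_quad \<pi> (segre e)"] e by (auto simp: perm_act_def quadric_perm_quad[OF \<pi>] quadric_segre)
      obtain b where b: "perm_quad \<sigma> (segre e) = scale b (segre (perm_act \<pi> e))" using segre_quad_coords[of "perm_quad \<sigma> (segre e)"] e by (auto simp: perm_act_def quadric_perm_quad[OF \<sigma>] quadric_segre)
      show "bring_coord (segre e) (pinv \<pi> i) * bring_coord (segre e) (pinv \<sigma> j) = bring_coord (segre e) (pinv \<pi> j) * bring_coord (segre e) (pinv \<sigma> i)"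
        unfolding bring_coord_perm_quad[OF \<pi> i, symmetric] bring_coord_perm_quad[OF \<pi> j(1), symmetric] bring_coord_perm_quad[OF \<sigma> i, symmetric] bring_coord_perm_quad[OF \<sigma> j(1), symmetric] a b bring_coord_scale
        by simp
    qed
    then have "pinv \<pi> i = pinv \<pi> j \<or> pinv \<pi> i = pinv \<sigma> i"
      using bring_coord_relation in5 \<pi> \<sigma> i j(1) by blast
    moreover have "pinv \<pi> i \<noteq> pinv \<pi> j" using j(2) permutes_inj[OF permutes_inv[OF \<pi>]] by (auto dest: injD)
    ultimately show ?thesis by blast
  qed
  moreover have "pinv \<pi> i = pinv \<sigma> i" if "i \<notin> {1..5}" for i
    using that permutes_not_in[OF permutes_inv[OF \<pi>]] permutes_not_in[OF permutes_inv[OF \<sigma>]] by simp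
  ultimately have "pinv \<pi> = pinv \<sigma>" by blast
  then show ?thesis using permutes_inv_inv[OF \<pi>] permutes_inv_inv[OF \<sigma>] by metis
qed

lemma perm_class_inj:
  assumes "\<pi> permutes {1..5}" "\<sigma> permutes {1..5}" "perm_class \<pi> = perm_class \<sigma>" shows "\<pi> = \<sigma>"
proof -
  have "(perm_rep \<pi>, perm_rep \<sigma>) \<in> rat_equiv HC"
    using assms(3) rat_class_eq_iff induces_perm_rep[OF assms(1)] induces_perm_rep[OF assms(2)] by (auto simp: perm_class_def induces_def)
  then have "induces (perm_rep \<sigma>) (perm_act \<pi>)" using induces_equiv[OF induces_perm_rep[OF assms(1)]] by blast
  from induces_unique[OF this induces_perm_rep[OF assms(2)]] show ?thesis
    by (intro perm_act_inj assms eventually_frequently[OF generic_nontrivial])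
qed

theorem perm_class_iso: "perm_class \<in> iso (sym_group 5) (Bir HC)"
proof (rule isoI)
  have c: "carrier (sym_group 5) = {p. p permutes {1..5}}" by (simp add: sym_group_def)
  show "perm_class \<in> hom (sym_group 5) (Bir HC)"
  proof (rule homI)
    fix x y assume "x \<in> carrier (sym_group 5)" "y \<in> carrier (sym_group 5)"
    then show "perm_class (x \<otimes>\<^bsub>sym_group 5\<^esub> y) = perm_class x \<otimes>\<^bsub>Bir HC\<^esub> perm_class y"
      unfolding c using perm_class_comp[of x y] by (simp add: sym_group_def Bir_def)
  qed (use perm_class_carrier in \<open>unfold c, blast\<close>)
  show "bij_betw perm_class (carrier (sym_group 5)) (carrier (Bir HC))"
    unfolding c bij_betw_def inj_on_def using perm_class_inj perm_class_carrier carrier_Bir_perm_class by blast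
qed

theorem group_Bir: "group (Bir HC)"
proof -
  have "group (Bir HC \<lparr>one := perm_class \<one>\<^bsub>sym_group 5\<^esub>\<rparr>)"
    by (rule group.iso_imp_img_group[OF sym_group_is_group perm_class_iso])
  moreover have "perm_class \<one>\<^bsub>sym_group 5\<^esub> = \<one>\<^bsub>Bir HC\<^esub>" by (simp add: sym_group_def Bir_def perm_class_id)
  ultimately show ?thesis by simp
qed

section \<open>The three generators\<close>

text \<open>
  A proportionality of representatives at generic points identifies the class of a rational map.
\<close>
lemma perm_class_eq_class:
  assumes \<pi>: "\<pi> permutes {1..5}" and d: "\<And>i. is_form d (\<lambda>v. \<Phi> v $ i)"
    and ev: "\<forall>\<^sub>F e in generic. \<exists>k l. l \<noteq> 0 \<and> k *s \<Phi> (plane_point e) = l *s perm_rep \<pi> (plane_point e)"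
  shows "\<Phi> \<in> rat_reps HC" "rat_class HC \<Phi> = perm_class \<pi>"
proof -
  have R: "perm_rep \<pi> \<in> rat_reps HC" and a: "\<forall>\<^sub>F e in generic. proj_eq (plane_point (perm_act \<pi> e)) (perm_rep \<pi> (plane_point e))"
    using induces_perm_rep[OF \<pi>] by (auto simp: induces_def)
  have "\<forall>\<^sub>F e in generic. proj_eq (plane_point (perm_act \<pi> e)) (\<Phi> (plane_point e))"
    using ev generic_rep[OF R] a
  proof eventually_elim
    case (elim e)
    then obtain k l where kl: "l \<noteq> 0" "k *s \<Phi> (plane_point e) = l *s perm_rep \<pi> (plane_point e)" by blast
    have "perm_rep \<pi> (plane_point e) \<noteq> 0" using elim by (simp add: curve_pts_def)
    then have "l *s perm_rep \<pi> (plane_point e) \<noteq> 0" using kl(1) by simp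
    then have "k \<noteq> 0" using kl(2) by (metis vector_smult_lzero)
    then have "proj_eq (\<Phi> (plane_point e)) (l *s perm_rep \<pi> (plane_point e))" unfolding kl(2)[symmetric] by (rule proj_eq_smult)
    moreover have "proj_eq (perm_rep \<pi> (plane_point e)) (l *s perm_rep \<pi> (plane_point e))" by (rule proj_eq_smult[OF kl(1)])
    ultimately show ?case using elim(3) by (blast intro: proj_eq_sym proj_eq_trans)
  qed
  then have I: "induces \<Phi> (perm_act \<pi>)" by (rule inducesI[OF d filterlim_perm_act[OF \<pi>]])
  then show "\<Phi> \<in> rat_reps HC" by (simp add: induces_def)
  show "rat_class HC \<Phi> = perm_class \<pi>" by (rule perm_class_eqI[OF \<pi> I]) simp
qed

text \<open>
  A collineation is determined by its effect on the canonical coordinates.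
\<close>
lemma collineation_perm_class:
  assumes \<pi>: "\<pi> permutes {1..5}" and M: "\<And>v. canonical_map (M *v v) = perm_quad \<pi> (canonical_map v)"
  shows "collineation HC M = perm_class \<pi>"
  unfolding collineation_def
proof (rule perm_class_eq_class(2)[OF \<pi>])
  have "is_form 1 (\<lambda>v. \<Sum>j\<in>UNIV. M $ i $ j * v $ j)" for i
    by (intro is_form_sum is_form_cmult is_form_coordinate)
  then show "is_form 1 (\<lambda>v. (M *v v) $ i)" for i by (simp only: matrix_vector_mult_def vec_lambda_beta)
  have "canonical_factor (M *v v) *s (M *v v) = 1 *s perm_rep \<pi> v" for v
    using quartic_map_canonical_map[of "M *v v"] by (simp add: M perm_rep_def)
  then show "\<forall>\<^sub>F e in generic. \<exists>k l. l \<noteq> 0 \<and> k *s (M *v plane_point e) = l *s perm_rep \<pi> (plane_point e)"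
    by (intro always_eventually allI) (metis one_neq_zero)
qed

lemma permutes_inverseI:
  assumes "\<And>i. i \<notin> {1..5} \<Longrightarrow> p i = i" "\<And>i. q (p i) = i" "\<And>i. p (q i) = i"
  shows "p permutes {1..5::nat}" "pinv p = q"
proof -
  have c: "p \<circ> q = id" "q \<circ> p = id" using assms by auto
  show "pinv p = q" by (rule inv_unique_comp[OF c])
  show "p permutes {1..5::nat}" using assms o_bij[OF c(2,1)] by (auto simp: permutes_def bij_iff)
qed

text \<open>
  The permutations of the coordinates \<open>x\<^sub>i\<close> induced by \<open>S\<close>, \<open>U\<close> and \<open>R\<close>, together with the inverses of the first two.
\<close>
definition pS :: "nat \<Rightarrow> nat" where
  "pS i = (if i = 1 then 5 else if i = 2 then 1 else if i = 3 then 2 else if i = 4 then 3 else if i = 5 then 4 else i)"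
definition qS :: "nat \<Rightarrow> nat" where
  "qS i = (if i = 1 then 2 else if i = 2 then 3 else if i = 3 then 4 else if i = 4 then 5 else if i = 5 then 1 else i)"
definition pU :: "nat \<Rightarrow> nat" where
  "pU i = (if i = 1 then 2 else if i = 2 then 4 else if i = 3 then 1 else if i = 4 then 3 else i)"
definition qU :: "nat \<Rightarrow> nat" where
  "qU i = (if i = 1 then 3 else if i = 2 then 1 else if i = 3 then 4 else if i = 4 then 2 else i)"
definition pR :: "nat \<Rightarrow> nat" where
  "pR i = (if i = 1 then 2 else if i = 2 then 1 else if i = 3 then 4 else if i = 4 then 3 else i)"

lemma pS: "pS permutes {1..5}" "pinv pS = qS"
  by (rule permutes_inverseI[of pS qS]; auto simp: pS_def qS_def)+
lemma pU: "pU permutes {1..5}" "pinv pU = qU"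
  by (rule permutes_inverseI[of pU qU]; auto simp: pU_def qU_def)+
lemma pR: "pR permutes {1..5}" "pinv pR = pR"
  by (rule permutes_inverseI[of pR pR]; auto simp: pR_def)+

lemma generator_values:
  "qS 1 = 2" "qS 2 = 3" "qS 3 = 4" "qS 4 = 5" "qS 5 = 1"
  "qU 1 = 3" "qU 2 = 1" "qU 3 = 4" "qU 4 = 2" "qU 5 = 5"
  "pR 1 = 2" "pR 2 = 1" "pR 3 = 4" "pR 4 = 3" "pR 5 = 5"
  by (simp_all add: qS_def qU_def pR_def)

lemma perm_quad_eqI5:
  assumes "\<pi> permutes {1..5}" and "bring_coord q (pinv \<pi> 1) = bring_coord r 1" "bring_coord q (pinv \<pi> 2) = bring_coord r 2"
    "bring_coord q (pinv \<pi> 3) = bring_coord r 3" "bring_coord q (pinv \<pi> 4) = bring_coord r 4" "bring_coord q (pinv \<pi> 5) = bring_coord r 5"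
  shows "perm_quad \<pi> q = r"
proof (rule perm_quad_eqI[OF assms(1)])
  fix i :: nat assume "i \<in> {1..5}"
  then have "i \<in> {1, 2, 3, 4, 5}" unfolding atLeastAtMost5 .
  then show "bring_coord q (pinv \<pi> i) = bring_coord r i" using assms(2-) by auto
qed

lemma perm_quad_pS: "perm_quad pS (a, b, c, d) = (zeta5 * a, zeta5^2 * b, zeta5^3 * c, zeta5^4 * d)"
proof (rule perm_quad_eqI5[OF pS(1)], unfold pS(2) generator_values bring_coord_values, goal_cases)
  case 1 show ?case using zeta5_pow5 by algebra
next
  case 2 show ?case using zeta5_pow5 by algebra
next
  case 3 show ?case using zeta5_pow5 by algebra
next
  case 4 show ?case using zeta5_pow5 by algebra
next
  case 5 show ?case by (rule refl)
qed

lemma perm_quad_pU: "perm_quad pU (a, b, c, d) = (b, d, a, c)"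
  by (rule perm_quad_eqI5[OF pU(1)]; unfold pU(2) generator_values bring_coord_values; algebra)

text \<open>
  The matrix of \<open>R\<close> on the canonical coordinates, with entries in the field generated by \<open>\<surd>5 = 1 + 2 g\<close>.
\<close>
lemma perm_quad_pR:
  fixes a b c d :: complex
  defines "g \<equiv> zeta5 + zeta5^4"
  shows "perm_quad pR (a, b, c, d) =
    (((1 + 2 * g) * a + (2 - g) * b + (3 + g) * c - (1 + 2 * g) * d) / 5,
     ((2 - g) * a - (1 + 2 * g) * b + (1 + 2 * g) * c + (3 + g) * d) / 5,
     ((3 + g) * a + (1 + 2 * g) * b - (1 + 2 * g) * c + (2 - g) * d) / 5,
     (- (1 + 2 * g) * a + (3 + g) * b + (2 - g) * c + (1 + 2 * g) * d) / 5)"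
  unfolding perm_quad_def inverse_fourier_def pR(2) generator_values bring_coord_values g_def prod.inject
  using zeta5_sum by (intro conjI; intro arg_cong[where f = "\<lambda>x. x / 5"]; algebra)

lemma zeta5_inverse: "zeta5 powi (-1) = zeta5^4" "zeta5 powi (-2) = zeta5^3" "zeta5 powi 2 = zeta5^2" "inverse zeta5 = zeta5^4"
proof -
  have "zeta5 * zeta5^4 = 1" "zeta5^2 * zeta5^3 = 1" using zeta5_pow5 by algebra+
  then have i: "inverse zeta5 = zeta5^4" "inverse (zeta5^2) = zeta5^3" by (simp_all add: inverse_unique)
  show "zeta5 powi (-1) = zeta5^4" "inverse zeta5 = zeta5^4" using i(1) by (simp_all add: power_int_def)
  show "zeta5 powi (-2) = zeta5^3" "zeta5 powi 2 = zeta5^2" using i(2) by (simp_all add: power_int_def power_inverse)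
qed

text \<open>
  The right-hand side is the quadratic Gauss sum; its sign is settled by the positivity of \<open>cos (2 * pi / 5)\<close>.
\<close>
lemma sqrt5_zeta5: "of_real (sqrt 5) = 1 + 2 * (zeta5 + zeta5^4)"
proof -
  define x where "x = 2 * cos (2 * pi / 5)"
  have "zeta5^4 = inverse zeta5" using zeta5_inverse(1) by (simp add: power_int_def)
  also have "\<dots> = cis (- (2 * pi / 5))" by (simp add: zeta5_cis)
  finally have g: "zeta5 + zeta5^4 = of_real x" by (simp add: zeta5_cis complex_eq_iff x_def)
  have "(1 + 2 * (zeta5 + zeta5^4))^2 = 5" using zeta5_sum by algebra
  then have "of_real ((1 + 2 * x)^2) = (of_real 5 :: complex)" by (simp add: g)
  then have "(1 + 2 * x)^2 = 5" by (simp only: of_real_eq_iff)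
  moreover have "0 < cos (2 * pi / 5)" by (rule cos_gt_zero) (use pi_gt_zero in auto)
  ultimately have "sqrt 5 = 1 + 2 * x" by (intro real_sqrt_unique) (auto simp: x_def)
  then show ?thesis by (simp add: g)
qed

lemma HC_S_perm_class: "HC_S = perm_class pS"
  unfolding HC_S_def
proof (rule collineation_perm_class[OF pS(1)])
  fix v :: "complex^3"
  define X Y Z where "X = v $ 1" and "Y = v $ 2" and "Z = v $ 3"
  have c: "(HC_S_matrix *v v) $ 1 = X" "(HC_S_matrix *v v) $ 2 = zeta5 * Y" "(HC_S_matrix *v v) $ 3 = zeta5^4 * Z"
    by (simp_all add: HC_S_matrix_def matrix_vector_mult_def sum_3 zeta5_inverse X_def Y_def Z_def)
  show "canonical_map (HC_S_matrix *v v) = perm_quad pS (canonical_map v)"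
    unfolding canonical_map_def Let_def c perm_quad_pS X_def[symmetric] Y_def[symmetric] Z_def[symmetric] prod.inject
    using zeta5_pow5 by (intro conjI; algebra)
qed

lemma HC_R_perm_class: "HC_R = perm_class pR"
  unfolding HC_R_def
proof (rule collineation_perm_class[OF pR(1)])
  fix v :: "complex^3"
  define X Y Z where "X = v $ 1" and "Y = v $ 2" and "Z = v $ 3"
  define g where "g = zeta5 + zeta5^4"
  have g2: "g^2 = 1 - g" unfolding g_def using zeta5_sum by algebra
  have h: "zeta5^2 + zeta5^3 = - 1 - g" unfolding g_def using zeta5_sum by algebra
  define r where "r = (1 + 2 * g) / 5"
  define k where "k = 1 / sqrt 5"
  have "k = sqrt 5 / 5" by (simp add: k_def field_simps)
  then have "complex_of_real k = of_real (sqrt 5) / 5" by (simp only: of_real_divide of_real_numeral)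
  then have s: "complex_of_real k = r" by (simp only: sqrt5_zeta5 r_def g_def)
  have sk: "k *\<^sub>R z = r * z" for z :: complex by (simp only: scaleR_conv_of_real s)
  have r5: "5 * r = 1 + 2 * g" by (simp add: r_def)
  have c: "(HC_R_matrix *v v) $ 1 = r * (X + 2 * Y + 2 * Z)" "(HC_R_matrix *v v) $ 2 = r * (X + (- 1 - g) * Y + g * Z)"
    "(HC_R_matrix *v v) $ 3 = r * (X + g * Y + (- 1 - g) * Z)"
    unfolding HC_R_matrix_def k_def[symmetric] matrix_vector_mult_def
    by (simp_all add: sum_3 vector_scaleR_component sk zeta5_inverse h X_def Y_def Z_def distrib_left mult.assoc flip: g_def)
  have div: "x = y / 5 \<longleftrightarrow> 5 * x = y" for x y :: complex by auto
  show "canonical_map (HC_R_matrix *v v) = perm_quad pR (canonical_map v)"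
    unfolding canonical_map_def Let_def c perm_quad_pR X_def[symmetric] Y_def[symmetric] Z_def[symmetric] prod.inject div
      g_def[symmetric]
    using g2 r5 by (intro conjI; algebra)
qed

text \<open>
  The homogeneous form of \<open>U\<close>, obtained by clearing denominators.
\<close>
definition Umap :: "complex^3 \<Rightarrow> complex^3" where
  "Umap v = (let X = v $ 1; Y = v $ 2; Z = v $ 3 in
     vector [- (Y^5 + X^3 * Y * Z - 3 * X * Y^2 * Z^2 + Z^5), (X * Y^2 - Z^3) * (X^2 - Y * Z), (X * Z^2 - Y^3) * (X^2 - Y * Z)])"

lemma is_form_Umap: "is_form 5 (\<lambda>v. Umap v $ i)"
proof -
  have "is_form 5 (\<lambda>v. (-1) * v $ 1 ^ 0 * v $ 2 ^ 5 * v $ 3 ^ 0 + (-1) * v $ 1 ^ 3 * v $ 2 ^ 1 * v $ 3 ^ 1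
      + 3 * v $ 1 ^ 1 * v $ 2 ^ 2 * v $ 3 ^ 2 + (-1) * v $ 1 ^ 0 * v $ 2 ^ 0 * v $ 3 ^ 5)"
    by (intro is_form_add is_form_monomial; simp)
  moreover have "(\<lambda>v. Umap v $ 1) = (\<lambda>v. (-1) * v $ 1 ^ 0 * v $ 2 ^ 5 * v $ 3 ^ 0 + (-1) * v $ 1 ^ 3 * v $ 2 ^ 1 * v $ 3 ^ 1
      + 3 * v $ 1 ^ 1 * v $ 2 ^ 2 * v $ 3 ^ 2 + (-1) * v $ 1 ^ 0 * v $ 2 ^ 0 * v $ 3 ^ 5)"
    by (intro ext) (simp add: Umap_def Let_def)
  ultimately have 1: "is_form 5 (\<lambda>v. Umap v $ 1)" by simp
  have "is_form (3 + 2) (\<lambda>v. (1 * v $ 1 ^ 1 * v $ 2 ^ 2 * v $ 3 ^ 0 + (-1) * v $ 1 ^ 0 * v $ 2 ^ 0 * v $ 3 ^ 3)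
     * (1 * v $ 1 ^ 2 * v $ 2 ^ 0 * v $ 3 ^ 0 + (-1) * v $ 1 ^ 0 * v $ 2 ^ 1 * v $ 3 ^ 1))"
    by (intro is_form_mult is_form_add is_form_monomial; simp)
  then have 2: "is_form 5 (\<lambda>v. Umap v $ 2)" by (simp add: Umap_def Let_def)
  have "is_form (3 + 2) (\<lambda>v. (1 * v $ 1 ^ 1 * v $ 2 ^ 0 * v $ 3 ^ 2 + (-1) * v $ 1 ^ 0 * v $ 2 ^ 3 * v $ 3 ^ 0)
     * (1 * v $ 1 ^ 2 * v $ 2 ^ 0 * v $ 3 ^ 0 + (-1) * v $ 1 ^ 0 * v $ 2 ^ 1 * v $ 3 ^ 1))"
    by (intro is_form_mult is_form_add is_form_monomial; simp)
  then have 3: "is_form 5 (\<lambda>v. Umap v $ 3)" by (simp add: Umap_def Let_def)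
  show ?thesis using 1 2 3 exhaust_3[of i] by metis
qed

text \<open>
  Both maps are computed from the canonical coordinates, where \<open>U\<close> merely permutes \<open>a, b, c, d\<close>; they differ by the
  factors \<open>a b\<^sup>2 + c\<^sup>2 d\<close> and \<open>X\<^sup>2 - Y Z\<close>.
\<close>
lemma Umap_perm_rep:
  assumes "canonical_map v = (a, b, c, d)"
  shows "(a * b^2 + c^2 * d) *s Umap v = ((v $ 1)^2 - v $ 2 * v $ 3) *s perm_rep pU v"
proof -
  define X Y Z where "X = v $ 1" and "Y = v $ 2" and "Z = v $ 3"
  have abcd: "a = Y * (X^2 - Y * Z)" "b = - (X * Y^2 - Z^3)" "c = X * Z^2 - Y^3" "d = - (Z * (X^2 - Y * Z))"
    using assms by (auto simp: canonical_map_def Let_def X_def Y_def Z_def)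
  have "(- (Y^5 + X^3 * Y * Z - 3 * X * Y^2 * Z^2 + Z^5)) * (Y * b^2 - Z * c^2) = (X^2 - Y * Z) * (Y * c^3 + Z * b^3)"
    unfolding abcd(2,3) by algebra
  then have 1: "(a * b^2 + c^2 * d) * (- (Y^5 + X^3 * Y * Z - 3 * X * Y^2 * Z^2 + Z^5)) = (X^2 - Y * Z) * (a * c^3 - b^3 * d)"
    unfolding abcd(1,4) by algebra
  have 2: "(a * b^2 + c^2 * d) * ((X * Y^2 - Z^3) * (X^2 - Y * Z)) = (X^2 - Y * Z) * (- (b * (b^2 * a + d * c^2)))"
    unfolding abcd(2) by algebra
  have 3: "(a * b^2 + c^2 * d) * ((X * Z^2 - Y^3) * (X^2 - Y * Z)) = (X^2 - Y * Z) * (c * (b^2 * a + d * c^2))"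
    unfolding abcd(3) by algebra
  show ?thesis using 1 2 3
    by (simp only: vec3_eq vector_smult_component perm_rep_def assms perm_quad_pU quartic_map.simps Umap_def Let_def vector_3 X_def Y_def Z_def simp_thms)
qed

lemma Umap_perm_class: "Umap \<in> rat_reps HC" "rat_class HC Umap = perm_class pU"
proof -
  have "\<forall>\<^sub>F e in generic. \<exists>k l. l \<noteq> 0 \<and> k *s Umap (plane_point e) = l *s perm_rep pU (plane_point e)"
    using generic_canonical_map_plane_point
  proof eventually_elim
    case (elim e)
    obtain a b c d where k: "canonical_map (plane_point e) = (a, b, c, d)" by (rule quad_cases)
    have "(plane_point e $ 1)^2 - plane_point e $ 2 * plane_point e $ 3 \<noteq> 0" using elim by (auto simp: canonical_map_def Let_def)
    then show ?case using Umap_perm_rep[OF k] by blast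
  qed
  from perm_class_eq_class[OF pU(1) is_form_Umap this] show "Umap \<in> rat_reps HC" "rat_class HC Umap = perm_class pU" .
qed

lemma Umap_affine:
  assumes q: "(y - x^2) * (y^3 - x) \<noteq> 0"
  shows "Umap (vector [x, y, 1]) = ((y - x^2) * (y^3 - x)) *s
    vector [- ((y^5 + x^3 * y - 3 * x * y^2 + 1) / ((y - x^2) * (y^3 - x))), - ((y^2 * x - 1) / (y^3 - x)), 1]"
proof -
  have "(y - x^2) * (y^3 - x) * (- ((y^2 * x - 1) / (y^3 - x))) = - ((y - x^2) * (y^2 * x - 1))" using q by simp
  moreover have "(x * y^2 - 1) * (x^2 - y) = - ((y - x^2) * (y^2 * x - 1))" by algebra
  ultimately have 2: "(x * y^2 - 1) * (x^2 - y) = (y - x^2) * (y^3 - x) * (- ((y^2 * x - 1) / (y^3 - x)))" by simp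
  have 3: "(x - y^3) * (x^2 - y) = (y - x^2) * (y^3 - x)" by algebra
  show ?thesis using q 2 3 by (simp add: vec3_eq Umap_def Let_def)
qed

text \<open>
  The affine formula agrees with the homogeneous one wherever its denominators do not vanish, so the
  set of representatives described by the formula is one full class.
\<close>
lemma HC_U_perm_class: "HC_U = perm_class pU"
proof -
  define q :: "complex \<Rightarrow> complex \<Rightarrow> complex" where "q x y = (y - x^2) * (y^3 - x)" for x y
  define u :: "complex \<Rightarrow> complex \<Rightarrow> complex^3" where
    "u x y = vector [- ((y^5 + x^3 * y - 3 * x * y^2 + 1) / ((y - x^2) * (y^3 - x))), - ((y^2 * x - 1) / (y^3 - x)), 1]" for x y
  have U: "Umap (vector [x, y, 1]) = q x y *s u x y" if "q x y \<noteq> 0" for x y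
    using Umap_affine that by (simp add: q_def u_def)
  have u0: "u x y \<noteq> 0" for x y by (simp add: vec3_eq u_def)
  have H: "HC_U = {\<Phi> \<in> rat_reps HC. \<forall>x y. vector [x, y, 1] \<in> curve_pts HC \<longrightarrow> q x y \<noteq> 0 \<longrightarrow>
        \<Phi> (vector [x, y, 1]) \<noteq> 0 \<longrightarrow> proj_eq (\<Phi> (vector [x, y, 1])) (u x y)}"
    by (simp add: HC_U_def affine_rat_map_def q_def u_def)
  have "\<Phi> \<in> HC_U \<longleftrightarrow> (Umap, \<Phi>) \<in> rat_equiv HC" for \<Phi>
  proof
    assume \<Phi>: "\<Phi> \<in> HC_U"
    then have R: "\<Phi> \<in> rat_reps HC" by (simp add: H)
    obtain d where d: "\<And>i. is_form d (\<lambda>v. \<Phi> v $ i)" using R by (metis rat_repE)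
    have "\<forall>\<^sub>F e in generic. proj_eq (Umap (plane_point e)) (\<Phi> (plane_point e))"
      using generic_canonical_map_plane_point generic_bring_curve generic_nonzero generic_rep[OF R] generic_curve
    proof eventually_elim
      case (elim e)
      define X Y Z where "X = plane_point e $ 1" and "Y = plane_point e $ 2" and "Z = plane_point e $ 3"
      obtain m where m: "canonical_map (plane_point e) = scale m (segre e)" "m \<noteq> 0" using canonical_map_plane_point elim(1,2) by metis
      have "- (Z * (X^2 - Y * Z)) = m * (fst e * snd e)" "X * Z^2 - Y^3 = - (m * snd e)"
        using m(1) by (auto simp: canonical_map_def Let_def segre_def X_def Y_def Z_def)
      then have nz: "Z \<noteq> 0" "X^2 - Y * Z \<noteq> 0" "X * Z^2 - Y^3 \<noteq> 0" using m(2) elim(3) by auto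
      define x y where "x = X / Z" and "y = Y / Z"
      have XY: "X = Z * x" "Y = Z * y" using nz by (simp_all add: x_def y_def)
      have v: "plane_point e = Z *s vector [x, y, 1]" by (simp add: vec3_eq XY[symmetric]) (simp add: X_def Y_def Z_def)
      have pv: "proj_eq (vector [x, y, 1]) (plane_point e)" unfolding v by (rule proj_eq_smult[OF nz(1)])
      have "X^2 - Y * Z = Z^2 * (x^2 - y)" "X * Z^2 - Y^3 = Z^3 * (x - y^3)" unfolding XY by algebra+
      then have q: "q x y \<noteq> 0" using nz by (auto simp: q_def)
      have c: "vector [x, y, 1] \<in> curve_pts HC" using elim pv proj_eq_sym proj_eq_curve by blast
      have p\<Phi>: "proj_eq (\<Phi> (vector [x, y, 1])) (\<Phi> (plane_point e))" by (rule proj_eq_rep[OF d pv])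
      then have "\<Phi> (vector [x, y, 1]) \<noteq> 0" using elim(4) by (auto simp: proj_eq_def curve_pts_def)
      then have "proj_eq (\<Phi> (vector [x, y, 1])) (u x y)" using \<Phi> c q by (simp add: H)
      moreover have "proj_eq (u x y) (Umap (vector [x, y, 1]))" unfolding U[OF q] by (rule proj_eq_smult[OF q])
      moreover have "proj_eq (Umap (vector [x, y, 1])) (Umap (plane_point e))" by (rule proj_eq_rep[OF is_form_Umap pv])
      ultimately show ?case using p\<Phi> by (blast intro: proj_eq_sym proj_eq_trans)
    qed
    then show "(Umap, \<Phi>) \<in> rat_equiv HC" by (intro rat_equivI Umap_perm_class R eventually_frequently[OF generic_nontrivial])
  next
    assume e: "(Umap, \<Phi>) \<in> rat_equiv HC"
    have "proj_eq (\<Phi> (vector [x, y, 1])) (u x y)"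
      if "vector [x, y, 1] \<in> curve_pts HC" "q x y \<noteq> 0" "\<Phi> (vector [x, y, 1]) \<noteq> 0" for x y
    proof -
      have "Umap (vector [x, y, 1]) \<noteq> 0" using U[OF that(2)] u0 that(2) by simp
      then have "proj_eq (Umap (vector [x, y, 1])) (\<Phi> (vector [x, y, 1]))" using e that by (auto simp: rat_equiv_def)
      moreover have "proj_eq (u x y) (Umap (vector [x, y, 1]))" unfolding U[OF that(2)] by (rule proj_eq_smult[OF that(2)])
      ultimately show ?thesis by (blast intro: proj_eq_sym proj_eq_trans)
    qed
    then show "\<Phi> \<in> HC_U" using rat_equivD(3)[OF e] by (simp add: H)
  qed
  then have "HC_U = rat_class HC Umap" by (auto simp: rat_class_def)
  then show ?thesis by (simp add: Umap_perm_class)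
qed

section \<open>Generation of the automorphism group\<close>

text \<open>
  The product of \<open>U\<close> and \<open>R\<close> is a transposition.  Conjugation by \<open>S\<close> and \<open>U\<close>, which act on the indices modulo \<open>5\<close> as a
  translation and a multiplication of order \<open>4\<close>, yields all ten transpositions.
\<close>
lemma generate_sym_group_5: "generate (sym_group 5) {pU, pR, pS} = carrier (sym_group 5)"
proof -
  interpret G: group "sym_group 5" by (rule sym_group_is_group)
  let ?H = "generate (sym_group 5) {pU, pR, pS}"
  have K: "{pU, pR, pS} \<subseteq> carrier (sym_group 5)" using pU pR pS by (simp add: sym_group_carrier)
  have gens: "pU \<in> ?H" "pR \<in> ?H" "pS \<in> ?H" by (auto intro: generate.incl)
  have mult: "p \<circ> q \<in> ?H" if "p \<in> ?H" "q \<in> ?H" for p q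
    using generate.eng[OF that] by (simp add: sym_group_mult)
  have conj: "Transposition.transpose (p a) (p b) \<in> ?H"
    if p: "p \<in> ?H" and pp: "p permutes {1..5}" and t: "Transposition.transpose a b \<in> ?H" for p a b
  proof -
    have inv: "inv\<^bsub>sym_group 5\<^esub> p \<in> ?H" by (rule G.generate_m_inv_closed[OF K p])
    have "p \<in> carrier (sym_group 5)" using pp by (simp add: sym_group_carrier)
    from G.r_inv[OF this] have i: "p \<circ> inv\<^bsub>sym_group 5\<^esub> p = id" by (simp add: sym_group_mult sym_group_one)
    have "Transposition.transpose (p a) (p b) \<circ> p = p \<circ> Transposition.transpose a b"
      using permutes_inj[OF pp] by (auto simp: fun_eq_iff Transposition.transpose_def inj_eq)
    then have "Transposition.transpose (p a) (p b) \<circ> (p \<circ> inv\<^bsub>sym_group 5\<^esub> p) = p \<circ> Transposition.transpose a b \<circ> inv\<^bsub>sym_group 5\<^esub> p"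
      by (metis comp_assoc)
    then show ?thesis using mult[OF mult[OF p t] inv] by (simp add: i)
  qed
  note S = conj[OF gens(3) pS(1)] and U = conj[OF gens(1) pU(1)]
  have sv: "pS 1 = 5" "pS 2 = 1" "pS 3 = 2" "pS 4 = 3" "pS 5 = 4" "pU 1 = 2" "pU 2 = 4" "pU 3 = 1" "pU 4 = 3" "pU 5 = 5"
    by (simp_all add: pS_def pU_def)
  \<comment> \<open>the transposition from which the others are obtained by conjugation\<close>
  have "pU \<circ> pR = Transposition.transpose 1 4"
    by (rule ext) (auto simp: pU_def pR_def Transposition.transpose_def)
  then have t14: "Transposition.transpose 1 4 \<in> ?H" using mult[OF gens(1,2)] by simp
  note t53 = S[OF t14, unfolded sv] 
  note t42 = S[OF t53, unfolded sv]
  note t31 = S[OF t42, unfolded sv]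
  note t25 = S[OF t31, unfolded sv]
  note t23 = U[OF t14, unfolded sv]
  note t12 = S[OF t23, unfolded sv]
  note t51 = S[OF t12, unfolded sv]
  note t45 = S[OF t51, unfolded sv]
  note t34 = S[OF t45, unfolded sv]
  have tr: "Transposition.transpose a b \<in> ?H" if "a \<in> {1..5}" "b \<in> {1..5}" "a \<noteq> b" for a b :: nat
  proof -
    note ts = t14 t53 t42 t31 t25 t23 t12 t51 t45 t34
    have "a = 1 \<or> a = 2 \<or> a = 3 \<or> a = 4 \<or> a = 5" "b = 1 \<or> b = 2 \<or> b = 3 \<or> b = 4 \<or> b = 5" using that by auto
    then show ?thesis using that(3) ts ts[unfolded Transposition.transpose_commute[of 1 4] Transposition.transpose_commute[of 5 3]
        Transposition.transpose_commute[of 4 2] Transposition.transpose_commute[of 3 1] Transposition.transpose_commute[of 2 5]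
        Transposition.transpose_commute[of 2 3] Transposition.transpose_commute[of 1 2] Transposition.transpose_commute[of 5 1]
        Transposition.transpose_commute[of 4 5] Transposition.transpose_commute[of 3 4]]
      by (elim disjE; hypsubst; blast)
  qed
  have "p \<in> ?H" if p: "p permutes {1..5}" for p
    using p finite_atLeastAtMost[of 1 5]
  proof (induction rule: permutes_induct)
    case id
    show ?case using generate.one[of "sym_group 5" "{pU, pR, pS}"] unfolding sym_group_one id_def .
  next
    case (swap a b p)
    then show ?case by (intro mult tr)
  qed
  then show ?thesis using G.generate_incl[OF K] by (auto simp: sym_group_carrier)
qed

theorem proposition2p15:
  shows "group (Bir HC)
    \<and> HC_U \<in> carrier (Bir HC)
    \<and> HC_R \<in> carrier (Bir HC)
    \<and> HC_S \<in> carrier (Bir HC)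
    \<and> generate (Bir HC) {HC_U, HC_R, HC_S} = carrier (Bir HC)
    \<and> Bir HC \<cong> sym_group 5"
proof -
  interpret G: group "sym_group 5" by (rule sym_group_is_group)
  have h: "perm_class \<in> hom (sym_group 5) (Bir HC)" and b: "bij_betw perm_class (carrier (sym_group 5)) (carrier (Bir HC))"
    using perm_class_iso by (auto simp: iso_def)
  interpret group_hom "sym_group 5" "Bir HC" perm_class
    by (intro group_hom.intro group_hom_axioms.intro sym_group_is_group group_Bir h)
  have "{pU, pR, pS} \<subseteq> carrier (sym_group 5)" using pU pR pS by (simp add: sym_group_carrier)
  then have "generate (Bir HC) (perm_class ` {pU, pR, pS}) = perm_class ` carrier (sym_group 5)"
    by (simp only: generate_img generate_sym_group_5)
  then have "generate (Bir HC) {HC_U, HC_R, HC_S} = carrier (Bir HC)"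
    using b by (simp add: HC_U_perm_class HC_R_perm_class HC_S_perm_class bij_betw_def)
  moreover have "Bir HC \<cong> sym_group 5" using G.iso_set_sym[OF perm_class_iso] by (auto simp: is_iso_def)
  ultimately show ?thesis
    using group_Bir perm_class_carrier[OF pU(1)] perm_class_carrier[OF pR(1)] perm_class_carrier[OF pS(1)]
    by (simp add: HC_U_perm_class HC_R_perm_class HC_S_perm_class)
qed

end
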